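(* Let $d\ge 3$, let $Q$ be a nondegenerate indefinite quadratic form on $\mathbb{R}^{d+1}$ with rational coefficients, let $m\in\mathbb{Q}\setminus\{0\}$, and let $X=\{w\in\mathbb{R}^{d+1}: Q(w)=m\}$. Assume $X(\mathbb{Z}):=X\cap\mathbb{Z}^{d+1}\neq\emptyset$. Let $\psi:(0,\infty)\to(0,\infty)$ be a measurable quasi-conformal function. Then: (i) If $\int_1^\infty t^{d-2}\psi(t)^{d-1}\,dt=\infty$, then $\mu_\infty$-almost every $v\in\partial X$ is $(X,\psi)$-approximable. (ii) If $\int_1^\infty t^{d-2}\psi(t)^{d-1}\,dt<\infty$, then $\mu_\infty$-almost every $v\in\partial X$ is not $(X,\psi)$-approximable.
   Context: $\|\cdot\|$ is the Euclidean norm on $\mathbb{R}^{d+1}$, $S^d$ the unit sphere, and $\pi:\mathbb{R}^{d+1}\setminus\{0\}\to S^d$, $\pi(x)=x/\|x\|$, the radial projection. A function $\psi:(0,\infty)\to(0,\infty)$ is quasi-conformal if there is $c>0$ with $\psi(ht)\le c\,\psi(t)$ for all $h\in[1/2,2]$ and $t>0$. A vector $v\in S^d$ is $(X,\psi)$-approximable if the inequality $\|\pi(x)-v\|<\psi(\|x\|)$ has infinitely many solutions $x\in X(\mathbb{Z})$. The boundary is $\partial X=\{x\in\mathbb{R}^{d+1}:Q(x)=0\}\cap S^d$. The orthogonal group $G=\mathrm{O}(Q)$ acts on $S^d$ by $g\cdot\pi(w)=\pi(gw)$; under this action $\partial X$ is a homogeneous space of $G$ and $\mu_\infty$ denotes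 its unique $G$-semi-invariant probability measure. *)

theory Defs
  imports "HOL-Probability.Probability"
begin

definition rational_quadratic_form :: "(real ^ 'n \<Rightarrow> real) \<Rightarrow> bool" where
  "rational_quadratic_form Q \<longleftrightarrow>
     (\<exists>A :: real ^ 'n ^ 'n. (\<forall>i j. A $ i $ j \<in> \<rat>) \<and>
        (\<forall>x. Q x = (\<Sum>i\<in>UNIV. \<Sum>j\<in>UNIV. A $ i $ j * x $ i * x $ j)))"

definition polar_form :: "(real ^ 'n \<Rightarrow> real) \<Rightarrow> real ^ 'n \<Rightarrow> real ^ 'n \<Rightarrow> real" where
  "polar_form Q x y = Q (x + y) - Q x - Q y"

definition nondegenerate_form :: "(real ^ 'n \<Rightarrow> real) \<Rightarrow> bool" where
  "nondegenerate_form Q \<longleftrightarrow> (\<forall>x. (\<forall>y. polar_form Q x y = 0) \<longrightarrow> x = 0)"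

definition indefinite_form :: "(real ^ 'n \<Rightarrow> real) \<Rightarrow> bool" where
  "indefinite_form Q \<longleftrightarrow> (\<exists>x. Q x > 0) \<and> (\<exists>x. Q x < 0)"

definition quadric :: "(real ^ 'n \<Rightarrow> real) \<Rightarrow> real \<Rightarrow> (real ^ 'n) set" where
  "quadric Q m = {w. Q w = m}"

definition integer_points :: "(real ^ 'n) set \<Rightarrow> (real ^ 'n) set" where
  "integer_points X = {x \<in> X. \<forall>i. x $ i \<in> \<int>}"

text \<open>The library's \<^term>\<open>sgn\<close> on a normed space is \<open>x /\<^sub>R norm x\<close>, with value \<open>0\<close> at \<open>0\<close>.\<close>

abbreviation radial_proj :: "real ^ 'n \<Rightarrow> real ^ 'n" where
  "radial_proj \<equiv> sgn"

definition boundary :: "(real ^ 'n \<Rightarrow> real) \<Rightarrow> (real ^ 'n) set" where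
  "boundary Q = {x. Q x = 0} \<inter> sphere 0 1"

definition quasi_conformal :: "(real \<Rightarrow> real) \<Rightarrow> bool" where
  "quasi_conformal \<psi> \<longleftrightarrow> (\<exists>c>0. \<forall>h\<in>{1/2..2}. \<forall>t>0. \<psi> (h * t) \<le> c * \<psi> t)"

definition approximable :: "(real ^ 'n) set \<Rightarrow> (real \<Rightarrow> real) \<Rightarrow> real ^ 'n \<Rightarrow> bool" where
  "approximable X \<psi> v \<longleftrightarrow>
     infinite {x \<in> integer_points X. norm (radial_proj x - v) < \<psi> (norm x)}"

definition orthogonal_group :: "(real ^ 'n \<Rightarrow> real) \<Rightarrow> (real ^ 'n ^ 'n) set" where
  "orthogonal_group Q = {g. invertible g \<and> (\<forall>x. Q (g *v x) = Q x)}"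

text \<open>For \<open>v\<close> on the unit sphere this is the action \<open>g \<cdot> \<pi> w = \<pi> (g w)\<close>, evaluated at \<open>w = v\<close>.\<close>

definition sphere_action :: "real ^ 'n ^ 'n \<Rightarrow> real ^ 'n \<Rightarrow> real ^ 'n" where
  "sphere_action g v = radial_proj (g *v v)"

text \<open>
  The boundary carries no \<open>G\<close>-invariant probability measure. Semi-invariance means that \<open>g\<close>
  transforms the measure by the multiplier \<open>v \<mapsto> norm (g v)\<close> of its action on
  the sphere, raised to the power \<open>-(d - 1)\<close>, where \<open>d - 1 = CARD('n) - 2\<close> is the dimension of
  the boundary. Equivalently, the measure \<open>r\<^bsup>d-2\<^esup> dr \<otimes> d\<mu>(v)\<close>, in polar coordinates
  \<open>x = r v\<close> on the punctured cone \<open>{Q = 0} - {0}\<close>, is the \<open>G\<close>-invariant measure of that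
  cone; this determines \<open>\<mu>\<close> uniquely.
\<close>

definition semi_invariant_probability ::
    "(real ^ 'n \<Rightarrow> real) \<Rightarrow> (real ^ 'n) measure \<Rightarrow> bool" where
  "semi_invariant_probability Q \<mu> \<longleftrightarrow>
     prob_space \<mu> \<and>
     space \<mu> = boundary Q \<and>
     sets \<mu> = sets (restrict_space borel (boundary Q)) \<and>
     (\<forall>g\<in>orthogonal_group Q. \<forall>E\<in>sets \<mu>.
        emeasure \<mu> (sphere_action g ` E) =
          (\<integral>\<^sup>+v\<in>E. ennreal (1 / norm (g *v v) ^ (CARD('n) - 2)) \<partial>\<mu>))"

end

(*
In suitable coordinates Q is x_a x_b + sum_j beta_j x_j^2, an open part of the boundary is a chart of
isotropic vectors e_w, and approximability of e_w by x in X(Z) at scale T means that w is within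
psi(T) of the point p(x) = (x_j / x_a)_j for some x with x_a of size about T.

Divergence. Let h_T(w) be the flow a_T times the unipotent u(w). The Kleinbock-Margulis argument
along a polynomial curve shows that for at least half of the w in a cube the lattice h_T(w) Z^n has
no short vector, once T is large. It then has independent vectors of bounded size, and since there
are only finitely many possibilities for the arithmetic data of such a family, one of them can be
moved onto a point x of X(Z) with h_T(w) x bounded, that is, |p(x) - w| = O(1 / T) with x_a
comparable to T. So the points p(x) form a ubiquitous system; a second moment estimate for separated
subfamilies together with the Lebesgue density theorem gives the full measure statement.

Convergence. By Borel-Cantelli it suffices to have O(T^(d-1)) points x in X(Z) with x_a of size T
and p(x) bounded. If Q is anisotropic over the rationals, this follows from a packing argument. If
Q is isotropic, the chart can be taken rational and x is determined by l = x_a and a solution z of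
q(z) = M mod l; the number of such z is O(l^(d-2) sum_{e | l} e^(-1/2)).

The null sets of the charts are null for the semi-invariant measure by quasi-invariance under the
unipotent group and Fubini.
*)
theory Submission
imports Defs "HOL-Computational_Algebra.Primes"
begin

text \<open>No equidistribution on a homogeneous space of G enters; everything is said about single
  lattices h_T(w) Z^n. The finite data of a short family Z are its Gram matrix for Q, its
  determinant and its entries modulo the determinant. Two families Z, Z0 with equal data give an
  isometry Z Z0^{-1} that maps X(Z) into itself, so finitely many points serve for all T and w. The
  obstacle in the divergence part is that h_T(w) x may be bounded while x_a is far smaller than T;
  then p(x) says nothing about w. A point with x_a of order T can be picked if X(Z) spans the space,
  and the spanning is itself drawn from nondivergence: otherwise x_a would stay bounded, and
  finitely many x cannot serve for all large T. In the convergence part packing breaks down if Q is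
  isotropic over the rationals, since h_T(w) Z^n may then have arbitrarily short isotropic vectors.
  The congruence count needs a sharp constant 1 + O(1/p) modulo p, hence at least two variables,
  which is where d >= 3 enters. The divisor sum that remains is bounded on average over l, though
  not for each l.\<close>

abbreviation vol :: "'a::euclidean_space set => real" where "vol == measure lborel"

section \<open>Good functions and flags\<close>

definition poly_fun :: "nat => (real => real) => bool" where
"poly_fun N f \<longleftrightarrow> (EX p. degree p<=N & f=poly p)"

text \<open>A recursive form of Lagrange interpolation: division by the last node leaves a quotient
  of lower degree whose values at the other nodes are at most \<open>2 * e / r\<close>.\<close>

lemma poly_bound_separated:
fixes p :: "real poly"
assumes "degree p<=N" and "r > 0" and "e >= 0"
 and "!!i. i<=N ==> x i:{a..b}" and "!!i. i<=N ==> abs (poly p (x i))<=e"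
 and "!!i j. i<=N ==> j<=N ==> i ~= j ==> abs (x i - x j) >= r"
 and "s:{a..b}"
shows "abs (poly p s)<=e * (1 + 2 * ((b - a) / r))^N" using assms
proof (induction N arbitrary: p e)
case 0
then obtain c where "p = [:c:]" by (metis degree_eq_zeroE le_zero_eq)
with 0 show ?case by force
next
case (Suc N)
let ?c = "x (Suc N)" and ?K = "1 + 2 * ((b - a) / r)"
define g where "g=synthetic_div p ?c"
have pg: "poly p t=(t - ?c) * poly g t + poly p ?c" for t
proof -
 have "p + smult ?c g=pCons (poly p ?c) g" unfolding g_def by (rule synthetic_div_correct)
 hence "poly (p + smult ?c g) t=poly (pCons (poly p ?c) g) t" by simp
 thus ?thesis by (simp add: algebra_simps)
qed
have ab: "b - a >= 0" using Suc.prems(7) by auto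
have K1: "?K >= 1" using ab Suc.prems(2) by simp
have "abs (poly g s)<=(2 * e / r) * ?K^N"
proof (rule Suc.IH)
 show "degree g<=N" using Suc.prems(1) by (simp add: g_def degree_synthetic_div)
 show "0<=2 * e / r" using Suc.prems by simp
 show "abs (poly g (x i))<=2 * e / r" if "i<=N" for i
 proof -
 have "abs ((x i - ?c) * poly g (x i))<=2 * e" using pg[of "x i"] Suc.prems(5)[of i] Suc.prems(5)[of "Suc N"] that by auto
 moreover have "r * abs (poly g (x i))<=abs ((x i - ?c) * poly g (x i))"
  unfolding abs_mult by (rule mult_right_mono) (use Suc.prems(6)[of i "Suc N"] that in auto)
 ultimately show ?thesis using Suc.prems(2) by (simp add: field_simps)
 qed
qed (use Suc.prems in auto)
moreover have "abs (s - ?c)<=b - a" using Suc.prems(4)[of "Suc N"] Suc.prems(7) by auto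
ultimately have "abs (s - ?c) * abs (poly g s)<=(b - a) * ((2 * e / r) * ?K^N)" by (intro mult_mono) (use ab in auto)
hence "abs (poly p s)<=(b - a) * ((2 * e / r) * ?K^N) + e"
 using pg[of s] Suc.prems(5)[of "Suc N"] by (simp add: abs_mult[symmetric])
moreover have "e<=e * ?K^N" using K1 Suc.prems(3) by (simp add: mult_le_cancel_left1 one_le_power)
ultimately have "abs (poly p s)<=(b - a) * ((2 * e / r) * ?K^N) + e * ?K^N" by linarith
also have "... = e * ?K^Suc N" by (simp add: field_simps)
finally show ?case .
qed

text \<open>Greedy choice: the intervals of radius \<open>r\<close> around the points already chosen
  have total length \<open>2 * r * m\<close>, so they do not cover \<open>E\<close>.\<close>

lemma separated_points:
fixes E :: "real set" and m :: nat and r :: real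
assumes "E:sets lborel" "emeasure lborel E > ennreal (2 * r * m)" "r > 0"
shows "EX x. (ALL i<m. x i:E) & (ALL i<m. ALL j<m. i ~= j --> abs (x i - x j) >= r)" using assms(2)
proof (induction m)
case 0 thus ?case by simp
next
case (Suc m)
have "ennreal (2 * r * m)<=ennreal (2 * r * Suc m)" using assms(3) by (intro ennreal_leI) (simp add: field_simps)
then obtain x where x: "ALL i<m. x i:E" "ALL i<m. ALL j<m. i ~= j --> abs (x i - x j) >= r" using Suc by (meson le_less_trans)
let ?U = "\<Union>i<m. {x i - r<..<x i + r}"
have "emeasure lborel ?U<=(\<Sum>i<m. emeasure lborel {x i - r<..<x i + r})" by (intro emeasure_subadditive_finite) auto
also have "... = ennreal (2 * r * m)"
 using assms(3) by (simp add: ennreal_of_nat_eq_real_of_nat ennreal_mult[symmetric] mult.commute)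
finally have U: "emeasure lborel ?U<=ennreal (2 * r * m)" .
have "~ E <= ?U"
proof
 assume "E <= ?U"
 hence "emeasure lborel E<=emeasure lborel ?U" by (intro emeasure_mono) auto
 with U Suc.prems \<open>ennreal (2 * r * m)<=_\<close> show False by (meson leD order_trans)
qed
then obtain y where y: "y:E" "!!i. i < m ==> abs (x i - y) >= r" by fastforce
have "(ALL i<Suc m. (x(m := y)) i:E) & (ALL i<Suc m. ALL j<Suc m. i ~= j --> abs ((x(m := y)) i - (x(m := y)) j) >= r)"
 using x y by (auto simp: less_Suc_eq abs_minus_commute)
thus ?case by blast
qed

lemma poly_fun_continuous: "poly_fun N f ==> continuous_on UNIV f" unfolding poly_fun_def by (auto intro: continuous_intros)

text \<open>A sublevel set longer than \<open>dt * (b - a)\<close> contains \<open>N + 1\<close>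
  points at mutual distance \<open>r\<close>, and interpolation from these points would bound the
  value at \<open>s0\<close> by half of itself.\<close>

lemma poly_fun_good:
assumes "dt > 0"
shows "EX ep>0. ALL f a b s0. poly_fun N f --> a < b --> s0:{a..b} -->
 emeasure lborel {s:{a..b}. abs (f s) < ep * abs (f s0)}<=ennreal (dt * (b - a))"
proof -
\<comment> \<open>\<open>rh\<close> is \<open>(b - a) / r\<close> for the spacing \<open>r\<close>
  chosen below, and \<open>ep\<close> is half the inverse of the interpolation factor.\<close>
define rh where "rh=2 * (real N + 1) / dt"
define ep where "ep=1 / (2 * (1 + 2 * rh)^N)"
have rh: "rh > 0" using assms by (simp add: rh_def)
hence ep: "ep > 0" by (simp add: ep_def)
have "emeasure lborel {s:{a..b}. abs (f s) < ep * abs (f s0)}<=ennreal (dt * (b - a))" (is "emeasure lborel ?E<=_")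
 if f: "poly_fun N f" and ab: "a < b" and s0: "s0:{a..b}" for f a b s0
proof (rule ccontr)
 assume contr: "~ ?thesis"
 have [measurable]: "f:borel_measurable borel" using poly_fun_continuous[OF f] by (rule borel_measurable_continuous_onI)
 have E: "?E:sets lborel" by measurable
 define r where "r=dt * (b - a) / (2 * (real N + 1))"
 have r: "r > 0" using assms ab by (simp add: r_def)
 have "2 * r * Suc N=dt * (b - a)" by (simp add: r_def field_simps)
 with contr have "emeasure lborel ?E > ennreal (2 * r * Suc N)" by (simp add: not_le)
 from separated_points[OF E this r] obtain x where x: "ALL i<Suc N. x i : ?E"
 "ALL i<Suc N. ALL j<Suc N. i ~= j --> abs (x i - x j) >= r" by blast
 obtain p where p: "degree p<=N" "f=poly p" using f by (auto simp: poly_fun_def)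
 have pos: "abs (f s0) > 0"
 proof -
 have "x 0 : ?E" using x by blast
 hence "0 < ep * abs (f s0)" by (auto intro: le_less_trans[OF abs_ge_zero])
 thus ?thesis using ep by (simp add: zero_less_mult_iff)
 qed
 have "abs (poly p s0)<=(ep * abs (f s0)) * (1 + 2 * ((b - a) / r))^N"
 by (rule poly_bound_separated[where x=x]) (use p x r ep s0 in \<open>auto simp: less_Suc_eq_le less_imp_le\<close>)
 also have "(b - a) / r=rh" using ab assms by (simp add: r_def rh_def field_simps)
 also have "(ep * abs (f s0)) * (1 + 2 * rh)^N=abs (f s0) / 2" using rh by (simp add: ep_def)
 finally show False using pos p by simp
qed
with ep show ?thesis by blast
qed

text \<open>The (C, alpha)-good functions of Kleinbock and Margulis, with an arbitrary threshold
  function \<open>kp\<close> in place of a power of \<open>dt\<close>.\<close>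

definition good_fun :: "(real => real) => (real => real) => bool" where
"good_fun kp \<psi> \<longleftrightarrow> continuous_on UNIV \<psi> & (ALL dt a b s0. dt > 0 --> a < b --> s0:{a..b} -->
 emeasure lborel {s:{a..b}. \<psi> s < kp dt * \<psi> s0}<=ennreal (dt * (b - a)))"

lemma good_funD:
assumes "good_fun kp \<psi>" "dt > 0" "a < b" "s0:{a..b}"
shows "emeasure lborel {s:{a..b}. \<psi> s < kp dt * \<psi> s0}<=ennreal (dt * (b - a))"
using assms unfolding good_fun_def by blast

text \<open>Relates the index of a dyadic interval to that of its ancestor at a coarser
  level.\<close>

lemma dyadic_floor:
fixes x :: real
assumes "l'<=l"
shows "\<lfloor>x * 2^l'\<rfloor> = \<lfloor>x * 2^l\<rfloor> div 2^(l - l')"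
proof -
have "(2::real)^l=2^l' * 2^(l - l')" using assms by (metis le_add_diff_inverse power_add)
hence "x * 2^l'=x * 2^l / real_of_int (2^(l - l'))" by simp
thus ?thesis by (metis floor_divide_real_eq_div zero_le_numeral zero_le_power)
qed

text \<open>The induction on flags uses only that comparable members have distinct ranks below
  \<open>n\<close>, which bounds the length of a flag. Later the members are rational subspaces,
  \<open>cmp\<close> is inclusion one way or the other and \<open>rk\<close> is the
  dimension.\<close>

locale flag_family =
fixes P :: "'v set" and cmp :: "'v => 'v => bool" and rk :: "'v => nat" and n :: nat
 and kp :: "real => real"
assumes rk: "V:P ==> 0 < rk V & rk V < n"
 and cmp_rk: "V:P ==> W:P ==> cmp V W ==> V ~= W ==> rk V ~= rk W"
 and cmp_sym: "cmp V W ==> cmp W V"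
 and kp: "dt > 0 ==> kp dt > 0"
begin

definition flag :: "'v set => bool" where "flag F \<longleftrightarrow> F<=P & pairwise cmp F"

definition cand :: "'v set => 'v set" where "cand F={V:P. V ~: F & (ALL W:F. cmp V W)}"

text \<open>The invariant of the Kleinbock-Margulis induction: \<open>F\<close> extends to a flag whose new members are
neither too small nor above 1 at \<open>s\<close>, and nothing small can be added to it.\<close>

definition protected :: "('v => real => real) => real => 'v set => real => bool" where
"protected \<psi> ep F s \<longleftrightarrow> (EX F'. F<=F' & flag F' &
 (ALL V:F' - F. ep<=\<psi> V s & \<psi> V s<=1) & (ALL V:cand F'. ep<=\<psi> V s))"

lemma protected_mono: "protected \<psi> ep F s ==> ep'<=ep ==> protected \<psi> ep' F s"
unfolding protected_def by (meson order_trans)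

lemma flag_insert: "flag F ==> V:cand F ==> flag (insert V F)" unfolding flag_def cand_def pairwise_insert using cmp_sym by auto

lemma flag_inj: "flag F ==> inj_on rk F" unfolding flag_def inj_on_def pairwise_def using cmp_rk by blast

lemma flag_card: assumes "flag F" shows "finite F" "card F<=n - 1"
proof -
have sub: "rk ` F<={1..<n}" using assms rk unfolding flag_def by fastforce
thus "finite F" using flag_inj[OF assms] by (meson finite_atLeastLessThan finite_imageD finite_subset)
show "card F<=n - 1" using card_mono[OF _ sub] card_image[OF flag_inj[OF assms]] by simp
qed

text \<open>Induction on the number of members that can still be added to \<open>F\<close>. Where
  some candidate is small, consider the maximal dyadic intervals on which one candidate
  \<open>V\<close> stays below \<open>rh'\<close>, and add \<open>V\<close> to the flag there. By
  maximality no candidate is small on the whole parent interval, and goodness hands this lower bound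
  down to the interval itself, so the induction hypothesis applies with the smaller bound
  \<open>rh1\<close>.\<close>

lemma protected_exists:
assumes "0 < rh" "rh<=1" "0 < dt"
shows "EX ep>0. ALL \<psi> F a b. (ALL V:P. good_fun kp (\<psi> V)) --> flag F --> n - 1<=card F + m --> a < b -->
 (ALL V:cand F. EX s:{a..b}. rh<=\<psi> V s) -->
 (EX B:sets lborel. emeasure lborel B<=ennreal (dt * (b - a)) & (ALL s:{a..<b} - B. protected \<psi> ep F s))"
using assms
proof (induction m arbitrary: rh dt)
case 0
have "protected \<psi> 1 F s" if F: "flag F" and c: "n - 1<=card F" for \<psi> F s
proof -
 have "cand F={}"
 proof (rule ccontr)
 assume "cand F ~= {}"
 then obtain V where V: "V:cand F" by blast
 from flag_card(2)[OF flag_insert[OF F V]] flag_card(1)[OF F] V have "Suc (card F)<=n - 1" by (simp add: cand_def)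
 with c show False by simp
 qed
 thus ?thesis unfolding protected_def using F by blast
qed
thus ?case by (intro exI[of _ 1]) (auto intro!: bexI[of _ "{}"])
next
case (Suc m)
\<comment> \<open>\<open>rh'\<close> lies strictly below \<open>rh\<close>, so the whole interval is
  not low. The proportion 1/3 in \<open>rh1\<close> is smaller than the half of its parent that a
  dyadic interval occupies.\<close>
define rh' where "rh'=rh / 2"
define rh1 where "rh1=min 1 (kp (1/3) * rh')"
have rh': "rh' > 0" "rh' < rh" "rh'<=1" using Suc.prems by (auto simp: rh'_def)
have rh1: "rh1 > 0" "rh1<=1" using rh' kp[of "1/3"] by (auto simp: rh1_def)
obtain ep1 where ep1: "ep1 > 0" and IH: "!!\<psi> F a b. (ALL V:P. good_fun kp (\<psi> V)) ==> flag F ==> n - 1<=card F + m ==> a < b ==>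
 (ALL V:cand F. EX s:{a..b}. rh1<=\<psi> V s) ==>
 (EX B:sets lborel. emeasure lborel B<=ennreal (dt/2 * (b - a)) & (ALL s:{a..<b} - B. protected \<psi> ep1 F s))"
 using Suc.IH[OF rh1, of "dt/2"] Suc.prems(3) by (metis half_gt_zero)
define ep2 where "ep2=kp (dt/2) * rh1"
have ep2: "ep2 > 0" using kp[of "dt/2"] Suc.prems(3) rh1 by (simp add: ep2_def)
define ep where "ep=min ep1 (min ep2 rh')"
have ep: "ep > 0" "ep<=ep1" "ep<=ep2" "ep<=rh'" using ep1 ep2 rh' by (auto simp: ep_def)
have "EX B:sets lborel. emeasure lborel B<=ennreal (dt * (b - a)) & (ALL s:{a..<b} - B. protected \<psi> ep F s)"
 if good: "ALL V:P. good_fun kp (\<psi> V)" and F: "flag F" and card: "n - 1<=card F + Suc m" and ab: "a < b"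
 and sup: "ALL V:cand F. EX s:{a..b}. rh<=\<psi> V s" for \<psi> F a b
proof -
 define lo where "lo=(%(l::nat) (i::int). a + i * ((b - a) / 2^l))"
 define low where "low=(%l i. EX V:cand F. ALL t:{lo l i..lo l (i+1)}. \<psi> V t < rh')"
 \<comment> \<open>The maximal low intervals: low, with no low ancestor.\<close>
 define DD where "DD={(l, i). 0<=i & i < 2^l & low l i & (ALL l'<l. ~ low l' (i div 2^(l - l')))}"
 define D where "D=(%(l, i). {lo l i..<lo l (i+1)})"
 have len: "lo l (i+1) - lo l i=(b - a) / 2^l" for l i
 by (simp add: lo_def distrib_right add_divide_distrib diff_divide_distrib)
 have lolt: "lo l i < lo l (i+1)" for l i using len[of l i] ab by (smt (verit) divide_pos_pos zero_less_power)
 have D_iff: "s:D (l, i) \<longleftrightarrow> \<lfloor>(s - a) / (b - a) * 2^l\<rfloor> = i" for s l i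
 proof -
 have "s:D (l, i) \<longleftrightarrow> of_int i<=(s - a) / (b - a) * 2^l & (s - a) / (b - a) * 2^l < of_int i + 1"
  using ab by (simp add: D_def lo_def field_simps)
 thus ?thesis by (simp add: floor_eq_iff)
 qed
 have "lo 0 0=a" "lo 0 1=b" by (simp_all add: lo_def)
 hence low0: "~ low 0 0" using sup rh' unfolding low_def by force
 have disj: "disjoint_family_on D DD"
 proof -
 have aux: False if "(l, i):DD" "(l', i'):DD" "l' < l" "s:D (l, i)" "s:D (l', i')" for l l' i i' s
 proof -
  have "i'=i div 2^(l - l')" using dyadic_floor[of l' l "(s - a) / (b - a)"] that by (simp add: D_iff)
  thus False using that by (auto simp: DD_def)
 qed
 show ?thesis unfolding disjoint_family_on_def
 proof (intro ballI impI)
  fix p q assume pq: "p:DD" "q:DD" "p ~= q"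
  obtain l i l' i' where e: "p=(l, i)" "q=(l', i')" by force
  show "D p Int D q={}"
  proof (rule ccontr)
  assume "D p Int D q ~= {}"
  then obtain s where s: "s:D (l, i)" "s:D (l', i')" by (auto simp: e)
  consider "l < l'" | "l' < l" | "l=l'" by linarith
  thus False
  proof cases
   case 3 thus False using s pq e by (simp add: D_iff)
  qed (use aux s pq e in blast)+
  qed
 qed
 qed
 have DDsub: "D p<={a..<b}" if p: "p:DD" for p
 proof
 fix s assume s: "s:D p"
 obtain l i where e: "p=(l, i)" by force
 have i: "0<=i" "i < 2^l" using p e by (auto simp: DD_def)
 have "\<lfloor>(s - a) / (b - a) * 2^l\<rfloor> = i" using s by (simp add: e D_iff)
 hence "\<lfloor>(s - a) / (b - a) * 2^0\<rfloor> = i div 2^l" using dyadic_floor[of 0 l "(s - a) / (b - a)"] by simp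
 also have "i div 2^l=0" using i by simp
 finally have "s:D (0, 0)" by (simp add: D_iff)
 thus "s:{a..<b}" by (simp add: D_def lo_def)
 qed
 have cover: "EX p:DD. s:D p" if s: "s:{a..<b}" and V: "V:cand F" "\<psi> V s < rh'" for s V
 proof -
 define x where "x=(s - a) / (b - a)"
 have x: "0<=x" "x < 1" using s ab by (auto simp: x_def field_simps)
 define ix where "ix=(%l. \<lfloor>x * 2^l\<rfloor>)"
 have "continuous_on UNIV (\<psi> V)" using good V by (auto simp: cand_def good_fun_def)
 hence "isCont (\<psi> V) s" by (simp add: continuous_on_eq_continuous_at)
 hence "\<forall>\<^sub>F t in nhds s. \<psi> V t < rh'"
  using V(2) by (simp add: isCont_def order_tendstoD tendsto_at_iff_tendsto_nhds)
 then obtain d where d: "d > 0" "!!t. abs (t - s) < d ==> \<psi> V t < rh'"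
  unfolding eventually_nhds_metric by (auto simp: dist_real_def)
 obtain l where l: "(b - a) / d < 2^l" using real_arch_pow[of 2 "(b - a) / d"] by auto
 have "low l (ix l)"
 proof -
  have "s:D (l, ix l)" by (simp add: D_iff ix_def x_def)
  hence sD: "lo l (ix l)<=s" "s < lo l (ix l + 1)" by (auto simp: D_def)
  have "(b - a) / 2^l < d" using l d(1) by (simp add: field_simps)
  hence "abs (t - s) < d" if "t:{lo l (ix l)..lo l (ix l + 1)}" for t
  using that sD len[of l "ix l"] unfolding atLeastAtMost_iff by linarith
  thus ?thesis unfolding low_def using V d by blast
 qed
 then obtain l0 where l0: "low l0 (ix l0)" "ALL l'<l0. ~ low l' (ix l')" using exists_least_iff[of "%l. low l (ix l)"] by blast
 have "ix l'=ix l0 div 2^(l0 - l')" if "l' < l0" for l' unfolding ix_def using that by (intro dyadic_floor) simp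
 moreover have "0<=ix l0" "ix l0 < 2^l0" using x by (auto simp: ix_def floor_less_iff)
 ultimately have "(l0, ix l0):DD" using l0 by (simp add: DD_def)
 moreover have "s:D (l0, ix l0)" by (simp add: D_iff ix_def x_def)
 ultimately show ?thesis by blast
 qed
 have cell: "EX B:sets lborel. B<=D p & emeasure lborel B<=ennreal dt * emeasure lborel (D p) &
  (ALL s:D p - B. protected \<psi> ep F s)" if p: "p:DD" for p
 proof -
 obtain l i where e: "p=(l, i)" by force
 define u where "u=lo l i"
 define v where "v=lo l (i + 1)"
 have uv: "u < v" using lolt by (simp add: u_def v_def)
 have vu: "v - u=(b - a) / 2^l" by (simp add: u_def v_def len)
 have Duv: "D p={u..<v}" by (simp add: D_def e u_def v_def)
 have lowi: "low l i" and anc: "ALL l'<l. ~ low l' (i div 2^(l - l'))" and i: "0<=i" "i < 2^l" using p e by (auto simp: DD_def)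
 obtain V where V: "V:cand F" "ALL t:{u..v}. \<psi> V t < rh'" using lowi unfolding low_def u_def v_def by blast
 have l: "l > 0" 
 proof (rule ccontr)
  assume "~ l > 0"
  hence "l=0" "i=0" using i by auto
  thus False using lowi low0 by simp
 qed
 have nl: "~ low (l - 1) (i div 2)" using anc[rule_format, of "l - 1"] l by simp
 have pu: "lo (l-1) (i div 2)<=u" "v<=lo (l-1) (i div 2 + 1)"
  and plen: "lo (l-1) (i div 2 + 1) - lo (l-1) (i div 2)=2 * (v - u)"
 proof -
  define h where "h=(b - a) / 2^l"
  have h: "h > 0" using ab by (simp add: h_def)
  have hl: "(b - a) / 2^(l - 1)=2 * h" using l by (cases l) (auto simp: h_def field_simps)
  have L: "lo (l-1) j=a + 2 * real_of_int j * h" for j unfolding lo_def hl by (simp add: algebra_simps)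
  have U: "u=a + real_of_int i * h" "v=a + (real_of_int i + 1) * h" by (simp_all add: u_def v_def lo_def h_def)
  have i2: "2 * real_of_int (i div 2)<=i" "real_of_int i<=2 * real_of_int (i div 2) + 1" by linarith+
  have "2 * real_of_int (i div 2) * h<=i * h" "(real_of_int i + 1) * h<=(2 * real_of_int (i div 2) + 2) * h"
  using i2 h by (auto intro!: mult_right_mono)
  thus "lo (l-1) (i div 2)<=u" "v<=lo (l-1) (i div 2 + 1)" unfolding L U by (auto simp: algebra_simps)
  show "lo (l-1) (i div 2 + 1) - lo (l-1) (i div 2)=2 * (v - u)" unfolding L U by (simp add: algebra_simps)
 qed
 \<comment> \<open>Otherwise the interval, half of its parent, would lie in the set where
   \<open>W\<close> is below \<open>kp (1/3)\<close> times a value attained on the parent, and that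
   set fills at most a third of the parent.\<close>
 have child: "EX s:{u..v}. rh1<=\<psi> W s" if W: "W:cand F" for W
 proof (rule ccontr)
  assume neg: "~ ?thesis"
  let ?p = "lo (l-1) (i div 2)" and ?q = "lo (l-1) (i div 2 + 1)"
  obtain t where t: "t:{?p..?q}" "rh'<=\<psi> W t" using nl W unfolding low_def by force
  have g: "good_fun kp (\<psi> W)" using good W by (simp add: cand_def)
  hence "emeasure lborel {s:{?p..?q}. \<psi> W s < kp (1/3) * \<psi> W t}<=ennreal (1/3 * (?q - ?p))"
  by (rule good_funD[OF _ _ lolt t(1)]) simp
  moreover have "{u..v}<={s:{?p..?q}. \<psi> W s < kp (1/3) * \<psi> W t}"
  proof
  fix s assume s: "s:{u..v}"
  hence "\<psi> W s < rh1" using neg by force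
  also have "rh1<=kp (1/3) * rh'" by (simp add: rh1_def)
  also have "... <= kp (1/3) * \<psi> W t" using t(2) kp[of "1/3"] by (intro mult_left_mono) auto
  finally show "s:{s:{?p..?q}. \<psi> W s < kp (1/3) * \<psi> W t}" using s pu by auto
  qed
  moreover have "{s:{?p..?q}. \<psi> W s < kp (1/3) * \<psi> W t}:sets lborel"
  proof -
  have [measurable]: "\<psi> W:borel_measurable borel" using g
   by (auto simp: good_fun_def intro: borel_measurable_continuous_onI)
  show ?thesis by measurable
  qed
  ultimately have "emeasure lborel {u..v}<=ennreal (1/3 * (?q - ?p))" by (meson emeasure_mono order_trans)
  thus False using uv plen by simp
 qed
 have F': "flag (insert V F)" using flag_insert[OF F V(1)] .
 have c': "n - 1<=card (insert V F) + m" using card flag_card(1)[OF F] V(1) by (simp add: cand_def)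
 have "ALL W:cand (insert V F). EX s:{u..v}. rh1<=\<psi> W s" using child by (auto simp: cand_def)
 from IH[OF good F' c' uv this] obtain B where B: "B:sets lborel"
  "emeasure lborel B<=ennreal (dt/2 * (v - u))" "ALL s:{u..<v} - B. protected \<psi> ep1 (insert V F) s" by blast
 \<comment> \<open>The added member must not be too small either. The allowance \<open>dt\<close> is
   split evenly between this set and the exceptional set of the induction hypothesis.\<close>
 define E where "E={s:{u..v}. \<psi> V s < ep2}"
 have gV: "good_fun kp (\<psi> V)" using good V by (simp add: cand_def)
 have [measurable]: "\<psi> V:borel_measurable borel" using gV
  by (auto simp: good_fun_def intro: borel_measurable_continuous_onI)
 have Em: "E:sets lborel" unfolding E_def by measurable
 obtain t where t: "t:{u..v}" "rh1<=\<psi> V t" using child[OF V(1)] by blast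
 have "E<={s:{u..v}. \<psi> V s < kp (dt/2) * \<psi> V t}"
 proof -
  have "ep2<=kp (dt/2) * \<psi> V t" unfolding ep2_def using t(2) kp[of "dt/2"] Suc.prems(3) by (intro mult_left_mono) auto
  thus ?thesis by (auto simp: E_def)
 qed
 hence "emeasure lborel E<=emeasure lborel {s:{u..v}. \<psi> V s < kp (dt/2) * \<psi> V t}"
  by (intro emeasure_mono) measurable
 also have "... <= ennreal (dt/2 * (v - u))" using good_funD[OF gV half_gt_zero uv t(1)] Suc.prems(3) by blast
 finally have Ele: "emeasure lborel E<=ennreal (dt/2 * (v - u))" .
 show ?thesis
 proof (intro bexI conjI ballI)
  show "(B Un E) Int D p:sets lborel" using B(1) Em by (simp add: Duv)
  show "(B Un E) Int D p<=D p" by blast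
  have "emeasure lborel ((B Un E) Int D p)<=emeasure lborel (B Un E)" using B(1) Em by (intro emeasure_mono) auto
  also have "... <= emeasure lborel B + emeasure lborel E" using B(1) Em by (intro emeasure_subadditive) auto
  also have "... <= ennreal (dt/2 * (v - u)) + ennreal (dt/2 * (v - u))" using B(2) Ele by (rule add_mono)
  also have "... = ennreal (dt * (v - u))" using Suc.prems(3) uv by (subst ennreal_plus[symmetric]) (auto simp: field_simps)
  also have "... = ennreal dt * emeasure lborel (D p)" using Suc.prems(3) uv by (simp add: Duv ennreal_mult)
  finally show "emeasure lborel ((B Un E) Int D p)<=ennreal dt * emeasure lborel (D p)" .
 next
  fix s assume "s:D p - (B Un E) Int D p"
  hence s: "s:{u..<v} - B" "s ~: E" by (auto simp: Duv)
  hence "protected \<psi> ep1 (insert V F) s" using B(3) by blast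
  hence "protected \<psi> ep (insert V F) s" using ep protected_mono by blast
  moreover have "ep<=\<psi> V s" using s ep by (auto simp: E_def)
  moreover have "\<psi> V s < rh'" using V(2) s(1) by auto
  hence "\<psi> V s<=1" using rh' by linarith
  ultimately show "protected \<psi> ep F s" unfolding protected_def by blast
 qed
 qed
 then obtain BB where BB: "!!p. p:DD ==> BB p:sets lborel" "!!p. p:DD ==> BB p<=D p"
 "!!p. p:DD ==> emeasure lborel (BB p)<=ennreal dt * emeasure lborel (D p)"
 "!!p s. p:DD ==> s:D p - BB p ==> protected \<psi> ep F s" by metis
 have cnt: "countable DD" by (rule countableI_type)
 have Dm: "D p:sets lborel" for p by (cases p) (simp add: D_def)
 show ?thesis
 proof (intro bexI conjI ballI)
 show "(UN p:DD. BB p):sets lborel" using cnt BB(1) by (intro sets.countable_UN') auto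
 have "disjoint_family_on BB DD" using disj BB(2) unfolding disjoint_family_on_def by blast
 hence "emeasure lborel (UN p:DD. BB p)=(\<integral>\<^sup>+p. emeasure lborel (BB p) \<partial>count_space DD)"
  using BB(1) cnt by (intro emeasure_UN_countable) auto
 also have "... <= (\<integral>\<^sup>+p. ennreal dt * emeasure lborel (D p) \<partial>count_space DD)"
  using BB(3) by (intro nn_integral_mono) auto
 also have "... = ennreal dt * (\<integral>\<^sup>+p. emeasure lborel (D p) \<partial>count_space DD)"
  by (rule nn_integral_cmult) simp
 also have "(\<integral>\<^sup>+p. emeasure lborel (D p) \<partial>count_space DD)=emeasure lborel (UN p:DD. D p)"
  using disj cnt Dm by (intro emeasure_UN_countable[symmetric]) auto
 also have "... <= emeasure lborel {a..<b}" using DDsub by (intro emeasure_mono) auto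
 also have "... = ennreal (b - a)" using ab by simp
 also have "ennreal dt * ennreal (b - a)=ennreal (dt * (b - a))" using Suc.prems(3) ab by (simp add: ennreal_mult)
 finally show "emeasure lborel (UN p:DD. BB p)<=ennreal (dt * (b - a))" by (simp add: mult_left_mono)
 next
 fix s assume s: "s:{a..<b} - (UN p:DD. BB p)"
 show "protected \<psi> ep F s"
 proof (cases "EX V:cand F. \<psi> V s < rh'")
  case True
  then obtain p where "p:DD" "s:D p" using cover s by blast
  thus ?thesis using BB(4) s by blast
 next
  case False
  thus ?thesis unfolding protected_def using F ep by (intro exI[of _ F]) force
 qed
 qed
qed
with ep(1) show ?case by blast
qed

end

section \<open>Covolumes of integer families\<close>

text \<open>Independence of an indexed family: a repeated vector makes it dependent.\<close>

definition indep_fam :: "'n set => ('n => real^'n) => bool" where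
"indep_fam J X \<longleftrightarrow> (ALL c. (SUM i:J. c i *\<^sub>R X i)=0 --> (ALL i:J. c i=0))"

definition fill :: "'n set => ('n => real^'n) => ('n => 'n) => real^'n^'n" where
"fill J X c=(\<chi> i. if i:J then X i else axis (c i) 1)"

definition minor :: "'n set => ('n => real^'n) => ('n => 'n) => real" where "minor J X c=det (fill J X c)"

text \<open>Up to constants, the volume of the parallelepiped spanned by the \<open>X j\<close>, \<open>j : J\<close>: a
minor completes these rows to a square matrix by the axis vectors selected by \<open>c\<close>.\<close>

definition covol :: "'n set => ('n => real^'n) => real" where "covol J X=(SUM c:UNIV. abs (minor J X c))"

definition intvec :: "real^'n => bool" where "intvec x \<longleftrightarrow> (ALL i. x$i:\<int>)"

lemma covol_nonneg: "0<=covol J X" unfolding covol_def by (simp add: sum_nonneg)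

lemma minor_le_covol: "abs (minor J X c)<=covol J X" unfolding covol_def by (rule member_le_sum) auto

lemma covol_pos_iff: "0 < covol J X \<longleftrightarrow> (EX c. minor J X c ~= 0)"
proof -
have "covol J X=0 \<longleftrightarrow> (ALL c. minor J X c=0)" unfolding covol_def by (subst sum_nonneg_eq_0_iff) auto
thus ?thesis using covol_nonneg[of J X] by (auto simp: less_le)
qed

lemma det_nonzero_rows:
fixes A :: "real^'n^'n"
shows "det A ~= 0 \<longleftrightarrow> indep_fam UNIV (%i. A$i)"
proof -
have "det A ~= 0 \<longleftrightarrow> (EX B. A ** B=mat 1)"
 by (simp add: invertible_det_nz[symmetric] invertible_right_inverse)
thus ?thesis by (simp add: matrix_right_invertible_independent_rows indep_fam_def row_def scalar_mult_eq_scaleR vec_nth_inverse)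
qed

text \<open>Multilinearity: the rows outside \<open>J\<close> are expanded in the axis basis one at
  a time, until only minors of \<open>X\<close> are left.\<close>

lemma det_fill_bound:
fixes X f :: "'n => real^'n"
shows "abs (det (\<chi> i. if i:J then X i else f i))<=(PROD i:-J. SUM k:UNIV. abs (f i$k)) * covol J X"
proof -
have "abs (det (\<chi> i. if i:J then X i else if i:K then f i else axis (c i) 1))
 <= (PROD i:K. SUM k:UNIV. abs (f i$k)) * covol J X" if "finite K" "K <= - J" for K and c :: "'n => 'n" using that
proof (induction K arbitrary: c rule: finite_induct)
 case empty
 thus ?case using minor_le_covol[of J X c] by (simp add: minor_def fill_def cong: if_cong)
next
 case (insert k K)
 have kJ: "k ~: J" using insert by auto
 let ?R = "%i. if i:J then X i else if i:K then f i else axis (c i) 1"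
 have fk: "f k=(SUM m:UNIV. f k$m *s axis m 1)" by (simp add: basis_expansion)
 have "det (\<chi> i. if i:J then X i else if i:insert k K then f i else axis (c i) 1)
  = det (\<chi> i. if i=k then f k else ?R i)"
 by (rule arg_cong[where f=det]) (use kJ in \<open>auto simp: vec_eq_iff\<close>)
 also have "... = det (\<chi> i. if i=k then (SUM m:UNIV. f k$m *s axis m 1) else ?R i)" by (subst fk) (rule refl)
 also have "... = (SUM m:UNIV. det (\<chi> i. if i=k then f k$m *s axis m 1 else ?R i))" by (rule det_linear_row_sum) simp
 also have "... = (SUM m:UNIV. f k$m * det (\<chi> i. if i=k then axis m 1 else ?R i))" by (simp add: det_row_mul)
 finally have "abs (det (\<chi> i. if i:J then X i else if i:insert k K then f i else axis (c i) 1))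
  <= (SUM m:UNIV. abs (f k$m) * abs (det (\<chi> i. if i=k then axis m 1 else ?R i)))"
 by (metis (no_types, lifting) abs_mult sum_abs sum.cong)
 also have "... <= (SUM m:UNIV. abs (f k$m) * ((PROD i:K. SUM k:UNIV. abs (f i$k)) * covol J X))"
 proof (intro sum_mono mult_left_mono)
 fix m
 have "(\<chi> i. if i=k then axis m 1 else ?R i)
  = (\<chi> i. if i:J then X i else if i:K then f i else axis ((c(k := m)) i) (1::real))"
  using kJ insert(2) by (auto simp: vec_eq_iff)
 thus "abs (det (\<chi> i. if i=k then axis m 1 else ?R i))<=(PROD i:K. SUM k:UNIV. abs (f i$k)) * covol J X"
  using insert.IH[of "c(k := m)"] insert.prems by simp
 qed simp
 finally show ?case using insert(1,2) by (simp add: sum_distrib_right mult.assoc)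
qed
from this[of "-J" id] have "abs (det (\<chi> i. if i:J then X i else if i : -J then f i else axis (id i) 1))
 <= (PROD i:-J. SUM k:UNIV. abs (f i$k)) * covol J X" by simp
also have "(\<chi> i. if i:J then X i else if i : -J then f i else axis (id i) (1::real))=(\<chi> i. if i:J then X i else f i)"
 by (auto simp: vec_eq_iff)
finally show ?thesis .
qed

text \<open>A further vector multiplies the covolume by at most a constant times its length. This is
  how small vectors are detected by subspaces.\<close>

lemma covol_insert_le:
fixes X :: "'n => real^'n"
assumes "k ~: J"
shows "covol (insert k J) (X(k := z))<=real (card (UNIV :: ('n => 'n) set)) * (SUM m:UNIV. abs (z$m)) * covol J X"
proof -
have "abs (minor (insert k J) (X(k := z)) c)<=(SUM m:UNIV. abs (z$m)) * covol J X" for c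
proof -
 let ?f = "%i. if i=k then z else axis (c i) 1"
 have "(PROD i:-J. SUM m:UNIV. abs (?f i$m))=(PROD i:-J. if i=k then (SUM m:UNIV. abs (z$m)) else 1)"
 proof (rule prod.cong)
 fix i
 have "(SUM m:UNIV. abs (axis (c i) (1::real)$m))=(SUM m:UNIV. if m=c i then 1 else 0)"
  by (rule sum.cong) (auto simp: axis_def)
 thus "(SUM m:UNIV. abs (?f i$m))=(if i=k then (SUM m:UNIV. abs (z$m)) else 1)" by simp
 qed simp
 also have "... = (SUM m:UNIV. abs (z$m))" using assms by simp
 finally have "(PROD i:-J. SUM m:UNIV. abs (?f i$m))=(SUM m:UNIV. abs (z$m))" .
 moreover have "fill (insert k J) (X(k := z)) c=(\<chi> i. if i:J then X i else ?f i)"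
 using assms by (auto simp: fill_def vec_eq_iff)
 ultimately show ?thesis using det_fill_bound[of J X ?f] by (simp add: minor_def)
qed
hence "covol (insert k J) (X(k := z))<=(SUM c:(UNIV :: ('n => 'n) set). (SUM m:UNIV. abs (z$m)) * covol J X)"
 unfolding covol_def by (intro sum_mono) (simp add: covol_def)
thus ?thesis by (simp add: mult.assoc)
qed

text \<open>The map can be pulled out of all rows if the completing axis vectors are replaced by
  their preimages under \<open>A\<close>; \<open>det_fill_bound\<close> takes care of these.\<close>

lemma covol_linear:
fixes A :: "real^'n^'n"
assumes "invertible A"
shows "EX C>0. ALL J X. covol J (%i. A *v X i)<=C * covol J X"
proof -
obtain B where B: "A ** B=mat 1" using assms by (auto simp: invertible_def)
define s where "s=(%(c :: 'n => 'n) i. SUM k:UNIV. abs ((B *v axis (c i) 1)$k))"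
define C where "C=1 + (SUM J:UNIV. SUM c:UNIV. abs (det A) * (PROD i:-J. s c i))"
have snn: "0<=s c i" for c i by (simp add: s_def sum_nonneg)
have "covol J (%i. A *v X i)<=C * covol J X" for J X
proof -
 have "abs (minor J (%i. A *v X i) c)<=abs (det A) * (PROD i:-J. s c i) * covol J X" for c
 proof -
 let ?M = "\<chi> i. if i:J then X i else B *v axis (c i) 1"
 have row: "(M ** transpose A)$i=A *v (M$i)" for M :: "real^'n^'n" and i
  by (simp add: vec_eq_iff matrix_matrix_mult_def matrix_vector_mult_def transpose_def mult.commute)
 have "fill J (%i. A *v X i) c = ?M ** transpose A" by (subst vec_eq_iff) (auto simp: fill_def row matrix_vector_mul_assoc B)
 hence "minor J (%i. A *v X i) c=det ?M * det A" by (simp add: minor_def det_mul)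
 moreover have "abs (det ?M)<=(PROD i:-J. s c i) * covol J X" unfolding s_def by (rule det_fill_bound)
 ultimately show ?thesis by (simp add: abs_mult mult.commute mult.left_commute mult_left_mono)
 qed
 hence "covol J (%i. A *v X i)<=(SUM c:UNIV. abs (det A) * (PROD i:-J. s c i)) * covol J X"
 unfolding covol_def[of J "%i. A *v X i"] sum_distrib_right by (rule sum_mono)
 also have "... <= C * covol J X"
 proof (rule mult_right_mono[OF _ covol_nonneg])
 have "(SUM c:UNIV. abs (det A) * (PROD i:-J. s c i))<=(SUM J:UNIV. SUM c:UNIV. abs (det A) * (PROD i:-J. s c i))"
  by (rule member_le_sum[of J UNIV "%J. SUM c:UNIV. abs (det A) * (PROD i:-J. s c i)"])
  (auto intro!: sum_nonneg mult_nonneg_nonneg prod_nonneg snn)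
 thus "(SUM c:UNIV. abs (det A) * (PROD i:-J. s c i))<=C" by (simp add: C_def)
 qed
 finally show ?thesis .
qed
moreover have "C > 0"
proof -
 have "0<=(SUM J:UNIV. SUM c:UNIV. abs (det A) * (PROD i:-J. s c i))"
 by (intro sum_nonneg mult_nonneg_nonneg prod_nonneg) (auto intro: snn)
 thus ?thesis by (simp add: C_def)
qed
ultimately show ?thesis by blast
qed

text \<open>The factor \<open>t\<close> between the covolumes of two families, the one in the span
  of the other, is the absolute value of a transition determinant and hence the same for every
  linear map \<open>A\<close>. It stands in for the comparison of decomposable vectors in an
  exterior power.\<close>

lemma covol_change:
fixes Y :: "'n => real^'n"
assumes "!!i. i:J ==> X i=(SUM j:J. C i j *\<^sub>R Y j)"
shows "EX t>=0. ALL A :: real^'n^'n. covol J (%i. A *v X i)=t * covol J (%i. A *v Y i)"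
proof -
define M :: "real^'n^'n" where "M=(\<chi> i j. if i:J then (if j:J then C i j else 0) else if i=j then 1 else 0)"
have "minor J (%i. A *v X i) c=det M * minor J (%i. A *v Y i) c" for A :: "real^'n^'n" and c
proof -
 have "fill J (%i. A *v X i) c$i=(M ** fill J (%i. A *v Y i) c)$i" for i
 proof -
 have r: "(M ** F)$i=(SUM j:UNIV. M$i$j *\<^sub>R F$j)" for F :: "real^'n^'n" by (simp add: vec_eq_iff matrix_matrix_mult_def)
 show ?thesis
 proof (cases "i:J")
  case True
  have "(SUM j:UNIV. M$i$j *\<^sub>R fill J (%i. A *v Y i) c$j)=(SUM j:J. C i j *\<^sub>R (A *v Y j))"
  by (rule sum.mono_neutral_cong_right) (use True in \<open>auto simp: M_def fill_def\<close>)
  also have "... = A *v X i" using assms[OF True] by (simp add: linear_sum[OF matrix_vector_mul_linear] matrix_vector_mult_scaleR)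
  finally show ?thesis using True by (simp add: r fill_def)
 next
  case False
  hence "(SUM j:UNIV. M$i$j *\<^sub>R fill J (%i. A *v Y i) c$j)=(SUM j:UNIV. if j=i then axis (c i) 1 else 0)"
  by (intro sum.cong) (auto simp: M_def fill_def)
  thus ?thesis using False by (simp add: r fill_def)
 qed
 qed
 hence "fill J (%i. A *v X i) c=M ** fill J (%i. A *v Y i) c" by (simp add: vec_eq_iff)
 thus ?thesis by (simp add: minor_def det_mul)
qed
hence "covol J (%i. A *v X i)=abs (det M) * covol J (%i. A *v Y i)" for A :: "real^'n^'n"
 by (simp add: covol_def abs_mult sum_distrib_left)
thus ?thesis by (intro exI[of _ "abs (det M)"]) auto
qed

lemma indep_fam_iff:
fixes X :: "'n::finite => real^'n"
shows "indep_fam J X \<longleftrightarrow> inj_on X J & independent (X ` J)"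
proof
assume I: "indep_fam J X"
have fin: "finite J" by simp
show "inj_on X J & independent (X ` J)"
proof
 show inj: "inj_on X J"
 proof (rule inj_onI, rule ccontr)
 fix i j assume ij: "i:J" "j:J" "X i=X j" "i ~= j"
 let ?c = "%k. if k=i then 1 else if k=j then -1 else (0::real)"
 have "(SUM k:J. ?c k *\<^sub>R X k)=(SUM k:{i,j}. ?c k *\<^sub>R X k)" by (rule sum.mono_neutral_right) (use ij in auto)
 also have "... = 0" using ij by simp
 finally have z: "(SUM k:J. ?c k *\<^sub>R X k)=0" .
 have "ALL k:J. ?c k=0" by (rule mp[OF spec[OF I[unfolded indep_fam_def], of ?c] z])
 from bspec[OF this ij(1)] show False by simp
 qed
 show "independent (X ` J)"
 proof (rule independent_if_scalars_zero)
 fix f x assume s: "(SUM x:X ` J. f x *\<^sub>R x)=0" and x: "x:X ` J"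
 have z: "(SUM j:J. f (X j) *\<^sub>R X j)=0" using s by (simp add: sum.reindex[OF inj])
 have "ALL j:J. f (X j)=0" by (rule mp[OF spec[OF I[unfolded indep_fam_def], of "%j. f (X j)"] z])
 thus "f x=0" using x by blast
 qed simp
qed
next
assume A: "inj_on X J & independent (X ` J)"
show "indep_fam J X" unfolding indep_fam_def
proof (intro allI impI ballI)
 fix c i assume s: "(SUM i:J. c i *\<^sub>R X i)=0" and i: "i:J"
 let ?f = "%x. c (the_inv_into J X x)"
 have "(SUM x:X ` J. ?f x *\<^sub>R x)=(SUM j:J. ?f (X j) *\<^sub>R X j)" using A by (simp add: sum.reindex)
 also have "... = (SUM j:J. c j *\<^sub>R X j)" by (rule sum.cong) (use A in \<open>auto simp: the_inv_into_f_f\<close>)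
 also note s
 finally have z: "(SUM x:X ` J. ?f x *\<^sub>R x)=0" .
 have "?f (X i)=0" by (rule independentD[of "X ` J" "X ` J" ?f "X i"]) (use A i z in auto)
 thus "c i=0" using A i by (simp add: the_inv_into_f_f)
qed
qed

lemma minor_indep:
assumes "minor J X c ~= 0"
shows "indep_fam J X" unfolding indep_fam_def
proof (intro allI impI ballI)
fix d i assume s: "(SUM i:J. d i *\<^sub>R X i)=0" and i: "i:J"
have "indep_fam UNIV (%i. fill J X c$i)" using assms by (simp add: minor_def det_nonzero_rows)
moreover have "(SUM k:UNIV. (if k:J then d k else 0) *\<^sub>R fill J X c$k)=(SUM i:J. d i *\<^sub>R X i)"
 by (rule sum.mono_neutral_cong_right) (auto simp: fill_def)
ultimately have "(if i:J then d i else 0)=0" using s unfolding indep_fam_def by fastforce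
thus "d i=0" using i by simp
qed

text \<open>Steinitz exchange: an independent family is completed to a basis by axis vectors from
  any supply that spans together with it. The control over the supply is used in
  \<open>curve_spread\<close>, where the axis \<open>b\<close> is excluded.\<close>

lemma minor_extend:
fixes X :: "'n::finite => real^'n"
assumes "indep_fam J X" and "span (X ` J Un (%k. axis k 1) ` Ax)=UNIV"
shows "EX c. (ALL i. i ~: J --> c i:Ax) & minor J X c ~= 0"
proof -
let ?ax = "%k. axis k (1::real)"
have inj: "inj_on X J" and ind: "independent (X ` J)" using assms(1) by (auto simp: indep_fam_iff)
obtain B where B: "X ` J<=B" "B<=X ` J Un ?ax ` Ax" "independent B" "X ` J Un ?ax ` Ax<=span B"
 using maximal_independent_subset_extend[of "X ` J" "X ` J Un ?ax ` Ax"] ind by blast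
have finB: "finite B" using B(3) by (rule independent_imp_finite)
have spB: "span B=UNIV" using B(4) assms(2) span_mono[OF B(4)] by (simp add: span_span top.extremum_uniqueI)
have "card B=CARD('n)" using dim_eq_card[of B UNIV] B(3) spB by simp
moreover have "card (B - X ` J)=card B - card (X ` J)" using B(1) finB by (intro card_Diff_subset) (auto intro: finite_subset)
moreover have "card (X ` J)=card J" by (rule card_image[OF inj])
ultimately have "card (B - X ` J)=card (- J)" by (simp add: Compl_eq_Diff_UNIV card_Diff_subset)
then obtain h where h: "bij_betw h (-J) (B - X ` J)" using finite_same_card_bij[of "-J" "B - X ` J"] finB by auto
have "EX k:Ax. h i = ?ax k" if "i ~: J" for i using h that B(2) unfolding bij_betw_def by blast
then obtain c where c: "!!i. i ~: J ==> c i:Ax & h i = ?ax (c i)" by metis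
define R where "R=(%i. if i:J then X i else h i)"
have R: "(%i. fill J X c$i)=R" using c by (auto simp: fill_def R_def)
have "inj_on R UNIV"
proof (rule inj_onI)
 fix i j assume "R i=R j"
 moreover have "h k:B - X ` J" if "k ~: J" for k using h that unfolding bij_betw_def by blast
 moreover have "inj_on h (-J)" using h by (simp add: bij_betw_def)
 ultimately show "i=j" using inj unfolding R_def by (smt (verit) ComplI DiffD2 image_eqI inj_onD)
qed
moreover have "R ` UNIV<=B" using B(1) h unfolding R_def bij_betw_def by auto
hence "independent (R ` UNIV)" using B(3) independent_mono by blast
ultimately have "indep_fam UNIV R" by (simp add: indep_fam_iff)
hence "minor J X c ~= 0" unfolding minor_def det_nonzero_rows R .
with c show ?thesis by blast
qed

lemma covol_pos_iff_indep:
fixes X :: "'n::finite => real^'n"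
shows "0 < covol J X \<longleftrightarrow> indep_fam J X"
proof
show "0 < covol J X ==> indep_fam J X" using minor_indep covol_pos_iff by blast
assume I: "indep_fam J X"
have "span ((%k. axis k (1::real)) ` (UNIV :: 'n set))=UNIV"
proof -
 have "(%k. axis k (1::real)) ` (UNIV :: 'n set)=Basis" by (auto simp: Basis_vec_def)
 thus ?thesis by (simp add: span_Basis)
qed
hence "span (X ` J Un (%k. axis k 1) ` UNIV)=UNIV" by (metis (no_types, lifting) span_mono sup_ge2 top.extremum_uniqueI)
from minor_extend[OF I this] show "0 < covol J X" by (auto simp: covol_pos_iff)
qed

section \<open>Rational subspaces and their covolumes\<close>

lemma det_int:
fixes A :: "real^'n^'n"
assumes "!!i j. A$i$j:\<int>"
shows "det A:\<int>" unfolding det_def by (intro Ints_sum Ints_mult Ints_prod assms) auto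

lemma covol_int:
assumes "!!i. i:J ==> intvec (X i)"
shows "covol J X:\<int>" unfolding covol_def minor_def
by (intro Ints_sum Ints_abs det_int) (use assms in \<open>auto simp: fill_def intvec_def axis_def\<close>)

text \<open>The rational subspaces, described as those spanned by their integer vectors.\<close>

definition int_subspaces :: "(real^'n) set set" where "int_subspaces={V. subspace V & V<=span {x:V. intvec x}}"

text \<open>The index type carries no order; a fixed enumeration gives all subspaces of dimension d
  the same index set \<open>initial d\<close>.\<close>

definition idx :: "nat => 'n::finite" where "idx=(SOME h. bij_betw h {0..<CARD('n)} UNIV)"

definition initial :: "nat => 'n::finite set" where "initial d=idx ` {..<d}"

lemma bij_idx: "bij_betw (idx :: nat => 'n::finite) {0..<CARD('n)} UNIV"
proof -
have ex: "EX h. bij_betw h {0..<CARD('n)} (UNIV :: 'n set)" using ex_bij_betw_nat_finite[of "UNIV :: 'n set"] by simp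
show ?thesis unfolding idx_def by (rule someI_ex[OF ex])
qed

lemma card_initial:
assumes "d<=CARD('n::finite)"
shows "card (initial d :: 'n set)=d"
proof -
have "inj_on (idx :: nat => 'n) {..<d}" by (rule inj_on_subset[OF bij_betw_imp_inj_on[OF bij_idx]]) (use assms in auto)
thus ?thesis by (simp add: initial_def card_image)
qed

lemma initial_Suc: "initial (Suc d)=insert (idx d) (initial d)" by (simp add: initial_def lessThan_Suc)

lemma idx_notin_initial:
assumes "d < CARD('n::finite)"
shows "(idx d :: 'n) ~: initial d"
proof
assume "(idx d :: 'n):initial d"
then obtain k where k: "k < d" "(idx k :: 'n)=idx d" by (auto simp: initial_def)
have "k=d" using inj_onD[OF bij_betw_imp_inj_on[OF bij_idx] k(2)] k(1) assms by auto
with k show False by simp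
qed

lemma initial_full: "(initial CARD('n) :: 'n::finite set)=UNIV"
using bij_betw_imp_surj_on[OF bij_idx] by (simp add: initial_def lessThan_atLeast0)

definition int_family :: "(real^'n::finite) set => ('n => real^'n) => bool" where
"int_family V X \<longleftrightarrow> (ALL i:initial (dim V). X i:V & intvec (X i)) & indep_fam (initial (dim V)) X"

text \<open>Takes the place of a basis of the lattice of integer vectors in \<open>V\<close>. A
  family of least covolume exists because covolumes of integer families are non-negative
  integers.\<close>

definition min_family :: "(real^'n::finite) set => 'n => real^'n" where
"min_family V=(SOME X. int_family V X & (ALL Y. int_family V Y --> covol (initial (dim V)) X<=covol (initial (dim V)) Y))"

definition sub_covol :: "(real^'n::finite) set => real^'n^'n => real" where
"sub_covol V A=covol (initial (dim V)) (%i. A *v min_family V i)"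

lemma dim_le_card: "dim (V :: (real^'n::finite) set)<=CARD('n)" using dim_subset_UNIV[of V] by simp

lemma family_of_basis:
fixes B :: "(real^'n::finite) set"
assumes "independent B" "card B=dim V" "span B=V"
obtains X where "!!i. i:initial (dim V) ==> X i:B" "indep_fam (initial (dim V)) X" "X ` initial (dim V)=B"
proof -
have "finite B" using assms(1) by (rule independent_imp_finite)
have "card (initial (dim V) :: 'n set)=card B" using card_initial[OF dim_le_card[of V]] assms(2) by simp
from finite_same_card_bij[OF _ \<open>finite B\<close> this] obtain X :: "'n => real^'n"
 where X: "bij_betw X (initial (dim V)) B" by auto
have im: "X ` initial (dim V)=B" using X by (simp add: bij_betw_def)
show thesis
proof
 show "X i:B" if "i:initial (dim V)" for i using that im by blast
 show "indep_fam (initial (dim V)) X" using X assms(1) by (simp add: indep_fam_iff bij_betw_def)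
qed (rule im)
qed

lemma int_family_exists:
assumes "V:int_subspaces"
shows "EX X. int_family V X"
proof -
obtain B where B: "B<={x:V. intvec x}" "independent B" "{x:V. intvec x}<=span B" using maximal_independent_subset by blast
have "V<=span B" using assms B(3) unfolding int_subspaces_def by (metis (no_types, lifting) mem_Collect_eq order_trans span_mono span_span)
moreover have "span B<=V"  by (rule span_minimal) (use B(1) assms in \<open>auto simp: int_subspaces_def\<close>)
ultimately have sp: "span B=V" by blast
hence c: "card B=dim V" using sp dim_span_eq_card_independent[OF B(2)] by simp
from family_of_basis[OF B(2) c sp] obtain X where "!!i. i:initial (dim V) ==> X i:B" "indep_fam (initial (dim V)) X" by blast
thus ?thesis using B(1) unfolding int_family_def by blast
qed

lemma int_family_covol_int: "int_family V X ==> covol (initial (dim V)) X:\<int>"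
by (rule covol_int) (auto simp: int_family_def)

lemma min_family:
assumes "V:int_subspaces"
shows "int_family V (min_family V)" "int_family V Y ==> covol (initial (dim V)) (min_family V)<=covol (initial (dim V)) Y"
proof -
let ?m = "%X. nat \<lfloor>covol (initial (dim V)) X\<rfloor>"
obtain X0 where "int_family V X0" using int_family_exists[OF assms] ..
from ex_has_least_nat[of "int_family V" X0 ?m, OF this] obtain X where
 X: "int_family V X" "!!Y. int_family V Y ==> ?m X <= ?m Y" by blast
have "covol (initial (dim V)) X<=covol (initial (dim V)) Y" if "int_family V Y" for Y
proof -
 have "real (?m Z)=covol (initial (dim V)) Z" if "int_family V Z" for Z
 using int_family_covol_int[OF that] covol_nonneg[of _ Z] by (simp add: of_nat_nat Ints_def)
 thus ?thesis using X that by (metis of_nat_mono)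
qed
with X(1) have ex: "EX X. int_family V X & (ALL Y. int_family V Y --> covol (initial (dim V)) X<=covol (initial (dim V)) Y)" by blast
show "int_family V (min_family V)" "int_family V Y ==> covol (initial (dim V)) (min_family V)<=covol (initial (dim V)) Y"
 using someI_ex[OF ex] by (auto simp: min_family_def)
qed

lemma span_family_rep:
fixes X :: "'n::finite => real^'n"
assumes "indep_fam J X" "y:span (X ` J)"
shows "EX c. y=(SUM j:J. c j *\<^sub>R X j)"
proof -
have "inj_on X J" using assms(1) by (simp add: indep_fam_iff)
moreover obtain u where "y=(SUM v:X ` J. u v *\<^sub>R v)" using assms(2) by (auto simp: span_finite)
ultimately have "y=(SUM j:J. u (X j) *\<^sub>R X j)" by (simp add: sum.reindex)
thus ?thesis by (intro exI[of _ "%j. u (X j)"])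
qed

lemma int_family_span:
fixes V :: "(real^'n::finite) set"
assumes "subspace V" "int_family V X"
shows "span (X ` initial (dim V))=V"
proof -
let ?J = "initial (dim V)"
have i: "inj_on X ?J" "independent (X ` ?J)" "X ` ?J<=V" using assms(2) by (auto simp: int_family_def indep_fam_iff)
have "card (X ` ?J)=dim V" using i(1) by (simp add: card_image card_initial[OF dim_le_card])
hence "V<=span (X ` ?J)" using card_ge_dim_independent[of "X ` ?J" V] i by simp
moreover have "span (X ` ?J)<=V" using i(3) assms(1) by (rule span_minimal)
ultimately show ?thesis by blast
qed

text \<open>The ratio of the two covolumes does not depend on \<open>A\<close> by
  \<open>covol_change\<close>, and for the identity it is at least 1 by minimality.\<close>

lemma sub_covol_ratio:
fixes V :: "(real^'n::finite) set"
assumes "V:int_subspaces" "int_family V Y"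
shows "sub_covol V A<=covol (initial (dim V)) (%i. A *v Y i)"
proof -
let ?J = "initial (dim V)" and ?X = "min_family V"
have sV: "subspace V" using assms(1) by (simp add: int_subspaces_def)
have X: "int_family V ?X" using min_family(1)[OF assms(1)] .
have ind: "indep_fam ?J ?X" using X by (simp add: int_family_def)
have "EX c. Y i=(SUM j:?J. c j *\<^sub>R ?X j)" if "i : ?J" for i
 using span_family_rep[OF ind, of "Y i"] int_family_span[OF sV X] assms(2) that by (simp add: int_family_def)
then obtain C where C: "!!i. i : ?J ==> Y i=(SUM j:?J. C i j *\<^sub>R ?X j)" by metis
from covol_change[of ?J Y C ?X, OF C] obtain t where t: "t >= 0"
 "!!A :: real^'n^'n. covol ?J (%i. A *v Y i)=t * covol ?J (%i. A *v ?X i)" by blast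
have "covol ?J ?X<=t * covol ?J ?X" using t(2)[of "mat 1"] min_family(2)[OF assms] by simp
moreover have "covol ?J ?X > 0" using ind by (simp add: covol_pos_iff_indep)
ultimately have "t >= 1" by simp
hence "covol ?J (%i. A *v ?X i)<=t * covol ?J (%i. A *v ?X i)"
 using covol_nonneg[of ?J "%i. A *v ?X i"] by (simp add: mult_le_cancel_right1)
thus ?thesis by (simp add: sub_covol_def t(2))
qed

lemma sub_covol_UNIV:
fixes A :: "real^'n::finite^'n"
assumes "UNIV:(int_subspaces :: (real^'n) set set)"
shows "abs (det A)<=sub_covol UNIV A"
proof -
let ?X = "min_family (UNIV :: (real^'n) set)"
have X: "int_family UNIV ?X" using min_family(1)[OF assms] .
have J: "initial (dim (UNIV :: (real^'n) set))=(UNIV :: 'n set)" by (simp add: initial_full)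
define M :: "real^'n^'n" where "M=(\<chi> i. ?X i)"
have row: "(N ** transpose A)$i=A *v (N$i)" for N :: "real^'n^'n" and i
 by (simp add: vec_eq_iff matrix_matrix_mult_def matrix_vector_mult_def transpose_def mult.commute)
have "det M ~= 0" using X J by (simp add: det_nonzero_rows M_def int_family_def)
moreover have "det M:\<int>" by (rule det_int) (use X J in \<open>auto simp: M_def int_family_def intvec_def\<close>)
ultimately have M1: "abs (det M) >= 1" by (simp add: Ints_nonzero_abs_ge1)
have "fill UNIV (%i. A *v ?X i) id=M ** transpose A" by (subst vec_eq_iff) (simp add: fill_def row M_def)
hence "minor UNIV (%i. A *v ?X i) id=det M * det A" by (simp add: minor_def det_mul)
hence "abs (det M) * abs (det A)<=sub_covol UNIV A"
 using minor_le_covol[of UNIV "%i. A *v ?X i" id] by (simp add: sub_covol_def initial_full abs_mult)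
moreover have "abs (det A)<=abs (det M) * abs (det A)" using M1 by (simp add: mult_le_cancel_right1)
ultimately show ?thesis by linarith
qed

definition proper_int :: "(real^'n::finite) set set" where "proper_int={V:int_subspaces. V ~= {0} & V ~= UNIV}"

definition nested :: "'a set => 'a set => bool" where "nested V W \<longleftrightarrow> V<=W \<or> W<=V"

lemma subspace_eq_dim:
fixes V W :: "(real^'n::finite) set"
assumes "subspace V" "subspace W" "V<=W" "dim W<=dim V"
shows "V=W" using assms by (simp add: subspace_dim_equal)

lemma proper_int_flags:
assumes "!!dt. dt > 0 ==> kp dt > 0"
shows "flag_family (proper_int :: (real^'n::finite) set set) nested dim CARD('n) kp"
proof
fix V W :: "(real^'n) set"
show "0 < dim V & dim V < CARD('n)" if V: "V:proper_int"
proof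
 have s: "subspace V" "V ~= {0}" "V ~= UNIV" using V by (auto simp: proper_int_def int_subspaces_def)
 show "0 < dim V" using s subspace_0[OF s(1)] by (metis dim_eq_0 gr0I subset_singletonD empty_iff)
 show "dim V < CARD('n)"
 proof (rule ccontr)
 assume "~ dim V < CARD('n)"
 hence "V=UNIV" using subspace_eq_dim[OF s(1) subspace_UNIV] by simp
 thus False using s by simp
 qed
qed
show "dim V ~= dim W" if "V:proper_int" "W:proper_int" "nested V W" "V ~= W"
proof
 assume e: "dim V=dim W"
 have "subspace V" "subspace W" using that(1,2) by (auto simp: proper_int_def int_subspaces_def)
 hence "V=W" using subspace_eq_dim[of V W] subspace_eq_dim[of W V] e that(3) unfolding nested_def by auto
 thus False using that(4) by simp
qed
show "nested W V" if "nested V W" using that by (auto simp: nested_def)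
qed (rule assms)

text \<open>Let \<open>W\<close> be the largest member of the flag without \<open>z\<close>, and
  \<open>V\<close> the sum of \<open>W\<close> and the line of \<open>z\<close>. \<open>V\<close> is
  nested with every member of the flag, so it belongs to the flag or could be added to it; either
  way its covolume is at least \<open>ep\<close>. On the other hand that covolume is at most a
  constant times the length of \<open>A s *v z\<close> times the covolume of \<open>W\<close>, which
  is bounded.\<close>

lemma no_short_vectors:
fixes kp :: "real => real" and A :: "real => real^'n::finite^'n"
assumes kp: "!!dt. dt > 0 ==> kp dt > 0"
 and prot: "flag_family.protected (proper_int :: (real^'n) set set) nested (%V s. sub_covol V (A s)) ep {} s"
 and z: "intvec z" "z ~= 0"
shows "min ep \<bar>det (A s)\<bar> <= card (UNIV :: ('n => 'n) set) * (SUM m:UNIV. abs ((A s *v z)$m)) * (1 + covol {} (%_::'n. 0 :: real^'n))"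
proof -
interpret flag_family "proper_int :: (real^'n) set set" nested dim "CARD('n)" kp by (rule proper_int_flags[OF kp])
obtain F where F: "flag F" "!!V. V:F ==> ep<=sub_covol V (A s) & sub_covol V (A s)<=1"
 "!!V. V:cand F ==> ep<=sub_covol V (A s)" using prot unfolding protected_def by auto
have FP: "V:int_subspaces" "subspace V" if "V:F" for V
proof -
 have "F<=proper_int" using F(1) unfolding flag_def by (rule conjunct1)
 thus "V:int_subspaces" using that unfolding proper_int_def by blast
 thus "subspace V" unfolding int_subspaces_def by blast
qed
have z0: "{0}:(int_subspaces :: (real^'n) set set)" by (auto simp: int_subspaces_def span_zero)
\<comment> \<open>The zero subspace serves as \<open>W\<close> if every member of the flag contains
  \<open>z\<close>.\<close>
define WW where "WW={V:insert {0} F. z ~: V}"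
have "finite WW" "WW ~= {}" using flag_card(1)[OF F(1)] z(2) by (auto simp: WW_def)
obtain W where W: "W:WW" "!!U. U:WW ==> dim U<=dim W"
proof -
 have fin: "finite (dim ` WW)" "dim ` WW ~= {}" using \<open>finite WW\<close> \<open>WW ~= {}\<close> by auto
 from Max_in[OF fin] obtain W where "W:WW" "dim W=Max (dim ` WW)" by auto
 thus thesis using that Max_ge[OF fin(1)] by simp
qed
have Wint: "W:int_subspaces" and sW: "subspace W" and zW: "z ~: W" using W(1) FP z0 by (auto simp: WW_def int_subspaces_def)
define d where "d=dim W"
define V where "V=span (insert z W)"
have sV: "subspace V" by (simp add: V_def)
have dV: "dim V=Suc d" using zW sW by (simp add: V_def dim_insert span_eq_iff[THEN iffD2] d_def)
have dn: "d < CARD('n)" using dim_le_card[of V] dV by simp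
have WV: "W<=V" "z:V" by (auto simp: V_def span_base)
have Vint: "V:int_subspaces"
proof -
 have "insert z W<=span {x:V. intvec x}"
 proof -
 have "W<=span {x:W. intvec x}" using Wint by (simp add: int_subspaces_def)
 also have "... <= span {x:V. intvec x}" using WV by (intro span_mono) auto
 finally show ?thesis using WV z by (auto intro: span_base)
 qed
 hence "V<=span {x:V. intvec x}" unfolding V_def by (metis V_def span_minimal subspace_span)
 thus ?thesis using sV by (simp add: int_subspaces_def)
qed
define X where "X=(min_family W)(idx d := z)"
have mW: "int_family W (min_family W)" using min_family(1)[OF Wint] .
have k: "(idx d :: 'n) ~: initial d" using dn by (rule idx_notin_initial)
have XW: "X i=min_family W i" if "i:initial d" for i using that k by (auto simp: X_def)
have Xim: "X ` initial (Suc d)=insert z (min_family W ` initial d)" using XW k by (auto simp: initial_Suc X_def)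
have spW: "span (min_family W ` initial d)=W" using int_family_span[OF sW mW] by (simp add: d_def)
have indX: "indep_fam (initial (Suc d)) X"
proof -
 have "independent (min_family W ` initial d)" "inj_on (min_family W) (initial d)"
 using mW by (auto simp: int_family_def indep_fam_iff d_def)
 moreover have "z ~: min_family W ` initial d"
 proof
 assume "z:min_family W ` initial d"
 hence "z:span (min_family W ` initial d)" by (rule span_base)
 thus False using spW zW by simp
 qed
 moreover have "inj_on X (initial (Suc d))" unfolding initial_Suc inj_on_insert
 proof
 show "inj_on X (initial d)" using \<open>inj_on (min_family W) (initial d)\<close> XW by (simp add: inj_on_def)
 show "X (idx d) ~: X ` (initial d - {idx d})" using \<open>z ~: min_family W ` initial d\<close> XW k by (auto simp: X_def)
 qed
 moreover have "independent (X ` initial (Suc d))" unfolding Xim by (rule independent_insertI) (use zW spW calculation in auto)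
 ultimately show ?thesis unfolding indep_fam_iff by blast
qed
have famX: "int_family V X" unfolding int_family_def dV
proof (intro conjI ballI indX)
 fix i :: 'n assume "i:initial (Suc d)"
 thus "X i:V" "intvec (X i)" using mW WV z XW by (auto simp: initial_Suc int_family_def d_def X_def)
qed
have lower: "min ep \<bar>det (A s)\<bar> <= sub_covol V (A s)"
\<comment> \<open>The full space is not among the proper subspaces that the flag controls; its
  covolume is bounded by the determinant instead, whence the minimum.\<close>
proof (cases "V=UNIV")
 case True
 thus ?thesis using sub_covol_UNIV[of "A s"] Vint by simp
next
 case False
 have VP: "V:proper_int" using False Vint dV by (auto simp: proper_int_def)
 have pw: "pairwise nested F" using F(1) unfolding flag_def by (rule conjunct2)
 have FPr: "F<=proper_int" using F(1) unfolding flag_def by (rule conjunct1)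
 have "nested V U" if U: "U:F" for U
 proof (cases "z:U")
 case True
 have "W<=U"
 proof (cases "W={0}")
  case True
  thus ?thesis using subspace_0[OF FP(2)[OF U]] by simp
 next
  case False
  hence "W:F" using W(1) by (auto simp: WW_def)
  hence "nested U W" using U pw zW True by (metis pairwiseD)
  thus ?thesis using zW True by (auto simp: nested_def)
 qed
 hence "V<=U" unfolding V_def using True FP(2)[OF U] by (intro span_minimal) auto
 thus ?thesis by (simp add: nested_def)
 next
 case zU: False
 hence dU: "dim U<=dim W" using W(2)[of U] U by (simp add: WW_def)
 have "W ~= {0}"
 proof
  assume "W={0}"
  hence "dim U=0" using dU by simp
  moreover have "0 < dim U" using rk FPr U by blast
  ultimately show False by linarith
 qed
 hence "W:F" using W(1) by (auto simp: WW_def)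
 hence "nested U W" using U pw by (cases "U=W") (auto simp: pairwise_def nested_def)
 hence "U<=W" using subspace_eq_dim[of W U] dU sW FP(2)[OF U] by (auto simp: nested_def)
 thus ?thesis using WV by (auto simp: nested_def)
 qed
 hence "V:F \<or> V:cand F" using VP unfolding cand_def by blast
 hence "ep<=sub_covol V (A s)" using F(2,3) by blast
 thus ?thesis by simp
qed
also have "... <= covol (initial (Suc d)) (%i. A s *v X i)" using sub_covol_ratio[OF Vint famX] by (simp add: dV)
also have "... = covol (insert (idx d) (initial d)) ((%i. A s *v min_family W i)(idx d := A s *v z))"
 unfolding initial_Suc X_def by (rule arg_cong[where f = "covol _"]) (auto simp: fun_eq_iff)
also have "... <= card (UNIV :: ('n => 'n) set) * (SUM m:UNIV. abs ((A s *v z)$m)) * covol (initial d) (%i. A s *v min_family W i)"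
 by (rule covol_insert_le[OF k])
also have "... <= card (UNIV :: ('n => 'n) set) * (SUM m:UNIV. abs ((A s *v z)$m)) * (1 + covol {} (%_::'n. 0 :: real^'n))"
proof (rule mult_left_mono)
 show "covol (initial d) (%i. A s *v min_family W i)<=1 + covol {} (%_::'n. 0 :: real^'n)"
 proof (cases "W={0}")
 case True
 hence "initial d=({} :: 'n set)" by (simp add: d_def initial_def)
 thus ?thesis by (simp add: covol_def minor_def fill_def)
 next
 case False
 hence "W:F" using W(1) by (auto simp: WW_def)
 hence "covol (initial d) (%i. A s *v min_family W i)<=1" using F(2) by (auto simp: sub_covol_def d_def)
 thus ?thesis using covol_nonneg[of "{}" "%_::'n. 0 :: real^'n"] by linarith
 qed
qed (simp add: sum_nonneg)
finally show ?thesis .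
qed

section \<open>Quantitative nondivergence\<close>

lemma poly_fun_const: "poly_fun N (%_. c)" unfolding poly_fun_def by (rule exI[of _ "[:c:]"]) auto

lemma poly_fun_mono: "poly_fun N f ==> N<=M ==> poly_fun M f" unfolding poly_fun_def by (metis order_trans)

lemma poly_fun_add: "poly_fun N f ==> poly_fun N g ==> poly_fun N (%s. f s + g s)"
unfolding poly_fun_def by (metis (no_types, lifting) degree_add_le poly_add ext)

lemma poly_fun_mult: "poly_fun N f ==> poly_fun M g ==> poly_fun (N + M) (%s. f s * g s)"
proof -
assume "poly_fun N f" "poly_fun M g"
then obtain p q where "degree p<=N" "f=poly p" "degree q<=M" "g=poly q" by (auto simp: poly_fun_def)
thus ?thesis unfolding poly_fun_def by (intro exI[of _ "p * q"]) (auto intro: order_trans[OF degree_mult_le])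
qed

lemma poly_fun_cmult: "poly_fun N f ==> poly_fun N (%s. c * f s)" using poly_fun_mult[OF poly_fun_const[of 0 c]] by simp

lemma poly_fun_diff: "poly_fun N f ==> poly_fun N g ==> poly_fun N (%s. f s - g s)"
using poly_fun_add[OF _ poly_fun_cmult[of N g "-1"]] by simp

lemma poly_fun_power: "poly_fun N (%s. s^k)" if "k<=N"
proof -
have "(%s::real. s^k)=poly (monom 1 k)" by (simp add: poly_monom fun_eq_iff)
thus ?thesis using that unfolding poly_fun_def by (metis degree_monom_le order_trans)
qed

lemma poly_fun_sum: "(!!i. i:I ==> poly_fun N (f i)) ==> poly_fun N (%s. SUM i:I. f i s)"
by (induction I rule: infinite_finite_induct) (auto intro: poly_fun_const poly_fun_add)

lemma poly_fun_prod: "(!!i. i:I ==> poly_fun N (f i)) ==> poly_fun (card I * N) (%s. PROD i:I. f i s)"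
by (induction I rule: infinite_finite_induct) (auto intro: poly_fun_const poly_fun_mult)

lemma poly_fun_det:
fixes M :: "real => real^'n^'n"
assumes "!!i j. poly_fun N (%s. M s$i$j)"
shows "poly_fun (CARD('n) * N) (%s. det (M s))" unfolding det_def
apply (rule poly_fun_sum)
apply (rule poly_fun_cmult)
apply (rule poly_fun_prod)
apply (rule assms)
done

text \<open>The largest summand at \<open>s0\<close> carries at least the fraction
  \<open>1 / m\<close> of the sum there, so the threshold for a single polynomial, divided by
  \<open>m\<close>, works for the sum.\<close>

lemma good_fun_sum_poly:
"EX kp. (ALL dt>0. kp dt > 0) & (ALL f :: 'c::finite => real => real. (ALL c. poly_fun N (f c)) --> good_fun kp (%s. SUM c:UNIV. abs (f c s)))"
proof -
obtain kp0 where kp0: "!!dt. dt > 0 ==> kp0 dt > 0" "!!dt f a b s0. dt > 0 ==> poly_fun N f ==> a < b ==> s0:{a..b} ==>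
 emeasure lborel {s:{a..b}. abs (f s) < kp0 dt * abs (f s0)}<=ennreal (dt * (b - a))"
proof -
 define P where "P=(%dt ep. ep > 0 & (ALL f a b s0. poly_fun N f --> a < b --> s0:{a..b} -->
 emeasure lborel {s:{a..b}. abs (f s) < ep * abs (f s0)}<=ennreal (dt * (b - a))))"
 have "P dt (SOME ep. P dt ep)" if "dt > 0" for dt
 using someI_ex[of "P dt"] poly_fun_good[OF that, of N] unfolding P_def by blast
 thus thesis by (intro that[of "%dt. SOME ep. P dt ep"]) (simp_all add: P_def)
qed
define m where "m=real CARD('c)"
have m: "m > 0" by (simp add: m_def)
define kp where "kp=(%dt. kp0 dt / m)"
have "good_fun kp (%s. SUM c:UNIV. abs (f c s))" if f: "ALL c. poly_fun N (f c)" for f :: "'c => real => real"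
 unfolding good_fun_def
proof (intro conjI allI impI)
 show "continuous_on UNIV (%s. SUM c:UNIV. abs (f c s))"
 by (intro continuous_on_sum continuous_on_rabs) (rule poly_fun_continuous[OF f[rule_format]])
 fix dt a b s0 :: real assume H: "dt > 0" "a < b" "s0:{a..b}"
 obtain c where c: "!!c'. abs (f c' s0)<=abs (f c s0)"
 proof -
 define g where "g=(%c. abs (f c s0))"
 have fin: "finite (range g)" by simp
 have "Max (range g):range g" by (rule Max_in[OF fin]) simp
 then obtain c where c: "Max (range g)=g c" by (rule imageE)
 have "g c'<=g c" for c' unfolding c[symmetric] by (rule Max_ge[OF fin]) simp
 thus thesis by (intro that) (simp add: g_def)
 qed
 have "(SUM c':UNIV. abs (f c' s0))<=m * abs (f c s0)"
 using sum_bounded_above[of UNIV "%c'. abs (f c' s0)" "abs (f c s0)"] c by (simp add: m_def)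
 hence le: "kp dt * (SUM c':UNIV. abs (f c' s0))<=kp0 dt * abs (f c s0)"
 using m kp0(1)[OF H(1)] by (simp add: kp_def field_simps mult_left_mono)
 have sub: "{s:{a..b}. (SUM c:UNIV. abs (f c s)) < kp dt * (SUM c:UNIV. abs (f c s0))}<={s:{a..b}. abs (f c s) < kp0 dt * abs (f c s0)}"
 proof safe
 fix s assume s: "(SUM c:UNIV. abs (f c s)) < kp dt * (SUM c:UNIV. abs (f c s0))"
 have "abs (f c s)<=(SUM c:UNIV. abs (f c s))" by (rule member_le_sum) auto
 with s le show "abs (f c s) < kp0 dt * abs (f c s0)" by linarith
 qed
 have [measurable]: "f c:borel_measurable borel"
 by (rule borel_measurable_continuous_onI[OF poly_fun_continuous[OF f[rule_format]]])
 have "emeasure lborel {s:{a..b}. (SUM c:UNIV. abs (f c s)) < kp dt * (SUM c:UNIV. abs (f c s0))}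
  <= emeasure lborel {s:{a..b}. abs (f c s) < kp0 dt * abs (f c s0)}" by (rule emeasure_mono[OF sub]) measurable
 also have "... <= ennreal (dt * (b - a))" using kp0(2) H f by blast
 finally show "emeasure lborel {s:{a..b}. (SUM c:UNIV. abs (f c s)) < kp dt * (SUM c:UNIV. abs (f c s0))}<=ennreal (dt * (b - a))" .
qed
moreover have "ALL dt>0. kp dt > 0" using kp0(1) m by (simp add: kp_def)
ultimately show ?thesis by blast
qed

section \<open>Unipotent isometries, flow and curves in a chart\<close>

lemma matrix_apply: "linear f ==> matrix f *v x=f x" for f :: "real^'n => real^'m" by (rule fun_cong[OF matrix_vector_mul(2)])

text \<open>The points of the chart are indexed by all of \<open>real^'n\<close>, with dummy coordinates at \<open>a\<close> and \<open>b\<close>, so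
that Lebesgue measure on \<open>real^'n\<close> can be used.\<close>

locale chart =
fixes a b :: "'n::finite" and \<beta> :: "'n => real" and L :: "real^'n^'n"
assumes ab: "a ~= b" and \<beta>: "!!j. j ~= a ==> j ~= b ==> \<beta> j ~= 0"
 and L: "invertible L" and card3: "3<=CARD('n)"
begin

definition J :: "'n set" where "J = - {a, b}"

definition qj :: "real^'n => real" where "qj x=(SUM j:J. \<beta> j * (x$j)\<^sup>2)"

definition bil :: "real^'n => real^'n => real" where "bil x w=(SUM j:J. \<beta> j * x$j * w$j)"

definition Qc :: "real^'n => real" where "Qc x=x$a * x$b + qj x"

text \<open>The unipotent isometry u(w) of \<open>Qc\<close>; once the coordinates in
  \<open>J\<close> are translated, the coordinate \<open>b\<close> is dictated by the invariance of
  \<open>Qc\<close>.\<close>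

definition shear :: "real^'n => real^'n => real^'n" where
"shear w x=(\<chi> i. if i=a then x$a else if i=b then x$b + 2 * bil x w - x$a * qj w else x$i - x$a * w$i)"

definition flow :: "real => real^'n => real^'n" where
"flow T x=(\<chi> i. if i=a then x$a / T else if i=b then T * x$b else x$i)"

definition ev :: "real^'n => real^'n" where "ev w=(\<chi> i. if i=a then 1 else if i=b then - qj w else w$i)"

definition Linv :: "real^'n^'n" where "Linv=matrix_inv L"

definition hmat :: "real => real^'n => real^'n^'n" where "hmat T w=matrix (flow T) ** matrix (shear w) ** Linv"

text \<open>Odd exponents, because the last coordinate of \<open>ev (curve s)\<close> then has only even ones.\<close>

definition expo :: "'n => nat" where "expo i=2 * the_inv_into {0..<CARD('n)} idx i + 1"

definition curve :: "real => real^'n" where "curve s=(\<chi> i. if i:J then s^expo i else 0)"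

lemma LLinv: "L ** Linv=mat 1" "Linv ** L=mat 1"
proof -
have "EX A'. L ** A'=mat 1 & A' ** L=mat 1" using L by (simp add: invertible_def)
from someI_ex[OF this] show "L ** Linv=mat 1" "Linv ** L=mat 1" by (simp_all add: Linv_def matrix_inv_def)
qed

lemma Linv_L: "Linv *v (L *v x)=x" "L *v (Linv *v x)=x" by (simp_all add: matrix_vector_mul_assoc LLinv)

lemma invertible_Linv: "invertible Linv" using LLinv unfolding invertible_def by blast

lemma J_ab: "a ~: J" "b ~: J" "j:J \<longleftrightarrow> j ~= a & j ~= b" by (auto simp: J_def)

lemma card_J: "card J=CARD('n) - 2" using ab by (simp add: J_def Compl_eq_Diff_UNIV card_Diff_subset)

lemma J_nonempty: "J ~= {}" using card_J card3 by (metis card.empty diff_is_0_eq numeral_3_eq_3 not_less_eq_eq numeral_2_eq_2)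

lemma bil_linear: "bil (x + y) w=bil x w + bil y w" "bil (c *\<^sub>R x) w=c * bil x w"
by (simp_all add: bil_def algebra_simps sum.distrib sum_distrib_left)

lemma bil_minus: "bil x (- w) = - bil x w" "bil (- x) w = - bil x w" by (simp_all add: bil_def sum_negf)
lemma qj_minus: "qj (- w)=qj w" by (simp add: qj_def)
lemma qj_bil: "qj w=bil w w" by (simp add: qj_def bil_def power2_eq_square mult.assoc)

lemma linear_shear: "linear (shear w)" by (rule linearI) (auto simp: shear_def vec_eq_iff bil_linear algebra_simps)

lemma linear_flow: "linear (flow T)" by (rule linearI) (auto simp: flow_def vec_eq_iff algebra_simps add_divide_distrib)

lemma hmat_mult: "hmat T w *v x=flow T (shear w (Linv *v x))"
by (simp add: hmat_def matrix_vector_mul_assoc[symmetric] matrix_apply linear_shear linear_flow)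

lemma bil_shear: "bil (shear w x) v=bil x v - x$a * bil w v"
proof -
have "bil (shear w x) v=(SUM j:J. \<beta> j * x$j * v$j - x$a * (\<beta> j * w$j * v$j))"
 unfolding bil_def by (rule sum.cong) (auto simp: shear_def J_ab algebra_simps)
thus ?thesis by (simp add: sum_subtractf bil_def sum_distrib_left)
qed

lemma shear_nth: "shear w x$a=x$a" "shear w x$b=x$b + 2 * bil x w - x$a * qj w" "j:J ==> shear w x$j=x$j - x$a * w$j"
using ab by (auto simp: shear_def J_ab)

lemma flow_nth: "flow T x$a=x$a / T" "flow T x$b=T * x$b" "j:J ==> flow T x$j=x$j" using ab by (auto simp: flow_def J_ab)

lemma ev_nth: "ev w$a=1" "ev w$b = - qj w" "j:J ==> ev w$j=w$j" using ab by (auto simp: ev_def J_ab)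

lemma vec_eqI: "x$a=y$a ==> x$b=y$b ==> (!!j. j:J ==> x$j=y$j) ==> x=(y :: real^'n)" by (metis vec_eq_iff J_ab(3))

lemma shear_inverse: "shear (- w) (shear w x)=x"
by (rule vec_eqI) (auto simp: shear_nth bil_shear bil_minus qj_minus qj_bil algebra_simps)

lemma shear_ev: "shear w (ev w)=axis a 1"
proof (rule vec_eqI)
have "bil (ev w) w=qj w" unfolding bil_def qj_def by (rule sum.cong) (auto simp: ev_nth power2_eq_square)
thus "shear w (ev w)$b=axis a 1$b" using ab by (simp add: shear_nth ev_nth axis_def)
qed (use ab in \<open>auto simp: shear_nth ev_nth axis_def J_ab\<close>)

lemma Qc_shear: "Qc (shear w x)=Qc x"
proof -
have "qj (shear w x)=(SUM j:J. \<beta> j * (x$j)\<^sup>2 - 2 * x$a * (\<beta> j * x$j * w$j) + (x$a)\<^sup>2 * (\<beta> j * (w$j)\<^sup>2))"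
 unfolding qj_def by (rule sum.cong) (auto simp: shear_nth power2_eq_square algebra_simps)
also have "... = qj x - 2 * x$a * bil x w + (x$a)\<^sup>2 * qj w"
 by (simp add: sum.distrib sum_subtractf qj_def bil_def sum_distrib_left)
finally show ?thesis by (simp add: Qc_def shear_nth power2_eq_square algebra_simps)
qed

lemma Qc_flow: "T ~= 0 ==> Qc (flow T x)=Qc x" by (simp add: Qc_def flow_nth qj_def)

text \<open>The reflection \<open>?r\<close> conjugates \<open>shear w\<close> into its inverse
  \<open>shear (- w)\<close>, so the determinant equals its own inverse.\<close>

lemma det_shear: "abs (det (matrix (shear w)))=1"
proof -
let ?r = "%x :: real^'n. \<chi> i. if i:J then - x$i else x$i"
have lr: "linear ?r" by (rule linearI) (auto simp: vec_eq_iff)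
have comp: "matrix ?r ** matrix (shear w) ** matrix ?r=matrix (shear (- w))"
proof (subst matrix_eq, intro allI)
 fix x
 have "bil (?r x) w = - bil x w" unfolding bil_def sum_negf[symmetric] by (rule sum.cong) auto
 hence "?r (shear w (?r x))=shear (- w) x" by (intro vec_eqI) (auto simp: shear_nth J_ab bil_minus qj_minus)
 thus "matrix ?r ** matrix (shear w) ** matrix ?r *v x=matrix (shear (- w)) *v x"
 by (simp add: matrix_vector_mul_assoc[symmetric] matrix_apply linear_shear lr)
qed
have "matrix ?r ** matrix ?r=(mat 1 :: real^'n^'n)"
proof (subst matrix_eq, intro allI)
 fix x
 have "?r (?r x)=x" by (auto simp: vec_eq_iff)
 thus "matrix ?r ** matrix ?r *v x=mat 1 *v x"
 by (simp only: matrix_vector_mul_assoc[symmetric] matrix_apply[OF lr] matrix_vector_mul_lid)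
qed
from arg_cong[OF this, of det] have rr: "det (matrix ?r) * det (matrix ?r)=1" by (simp only: det_mul det_I)
from arg_cong[OF comp, of det]
have "det (matrix (shear (- w)))=det (matrix ?r) * det (matrix (shear w)) * det (matrix ?r)" by (simp only: det_mul)
also have "... = det (matrix (shear w))" using rr by (simp add: mult.commute mult.left_commute)
finally have e: "det (matrix (shear (- w)))=det (matrix (shear w))" .
have "matrix (shear (- w)) ** matrix (shear w)=(mat 1 :: real^'n^'n)"
 by (subst matrix_eq) (simp add: matrix_vector_mul_assoc[symmetric] matrix_apply linear_shear shear_inverse)
from arg_cong[OF this, of det] have "det (matrix (shear w)) * det (matrix (shear w))=1" by (simp only: det_mul det_I e)
hence "det (matrix (shear w))=1 \<or> det (matrix (shear w)) = - 1" by (simp add: square_eq_1_iff)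
thus ?thesis by auto
qed

lemma matrix_flow_row: "(M ** matrix (flow T))$i=flow T (M$i)"
proof (rule vec_eqI)
have m: "matrix (flow T)$k$j=(if k=j then (if j=a then 1 / T else if j=b then T else 1) else 0)" for k j
 by (auto simp: matrix_def flow_def axis_def)
have "(M ** matrix (flow T))$i$j=M$i$j * (if j=a then 1 / T else if j=b then T else 1)" for j
 by (simp add: matrix_matrix_mult_def m if_distrib[of "%x. _ * x"] cong: if_cong)
thus "(M ** matrix (flow T))$i$a=flow T (M$i)$a" "(M ** matrix (flow T))$i$b=flow T (M$i)$b"
 "!!j. j:J ==> (M ** matrix (flow T))$i$j=flow T (M$i)$j" using ab by (auto simp: flow_nth J_ab)
qed

lemma det_flow: assumes "T ~= 0" shows "det (matrix (flow T))=1"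
proof -
have m: "matrix (flow T)$k$j=(if k=j then (if j=a then 1 / T else if j=b then T else 1) else 0)" for k j
 by (auto simp: matrix_def flow_def axis_def)
have "det (matrix (flow T))=(PROD i:UNIV. if i=a then 1 / T else if i=b then T else 1)"
 by (subst det_diagonal) (auto simp: m)
also have "... = (1 / T) * (PROD i:UNIV - {a}. if i=b then T else 1)" by (subst prod.remove[of UNIV a]) (auto intro!: prod.cong)
also have "(PROD i:UNIV - {a}. if i=b then T else 1)=T" using ab by simp
finally show ?thesis using assms by simp
qed

lemma det_hmat: "T ~= 0 ==> abs (det (hmat T w))=abs (det Linv)" by (simp add: hmat_def det_mul det_flow abs_mult det_shear)

lemma det_Linv: "abs (det Linv) > 0" using invertible_Linv by (simp add: invertible_det_nz)

text \<open>The flow preserves the full determinant, fixes all axes except \<open>a\<close> and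
  \<open>b\<close>, and divides the axis \<open>a\<close> by \<open>T\<close>. With the axis
  \<open>a\<close> among the completing rows and \<open>b\<close> not among them, the rows of the
  family must make up for the factor \<open>1 / T\<close>.\<close>

lemma minor_flow:
assumes T: "T > 0" and i1: "i1 ~: K" "c i1=a" and c: "!!i. i ~: K ==> c i ~= b"
shows "minor K (%i. flow T (x i)) c=T * minor K x c"
proof (cases "EX i2. i2 ~= i1 & i2 ~: K & c i2=a")
case True
then obtain i2 where i2: "i2 ~= i1" "i2 ~: K" "c i2=a" by blast
have "minor K y c=0" for y unfolding minor_def
 by (rule det_identical_rows[of i1 i2]) (use i1 i2 in \<open>auto simp: row_def fill_def vec_eq_iff\<close>)
thus ?thesis by simp
next
case False
let ?F = "fill K (%i. flow T (x i)) c"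
have "fill K x c ** matrix (flow T)=(\<chi> i. if i=i1 then (1 / T) *s ?F$i else ?F$i)"
proof (subst vec_eq_iff, intro allI)
 fix i
 have ax: "flow T (axis k 1)=axis k 1" if "k ~= a" "k ~= b" for k
 using that by (intro vec_eqI) (auto simp: flow_nth axis_def J_ab)
 have axa: "flow T (axis a 1)=(1 / T) *s axis a 1" using ab by (intro vec_eqI) (auto simp: flow_nth axis_def J_ab)
 show "(fill K x c ** matrix (flow T))$i=(\<chi> i. if i=i1 then (1 / T) *s ?F$i else ?F$i)$i"
 using False i1 c[of i] ax[of "c i"] axa by (auto simp: matrix_flow_row fill_def)
qed
hence "det (fill K x c ** matrix (flow T))=(1 / T) * det (\<chi> i. if i=i1 then ?F$i else ?F$i)" by (simp only: det_row_mul)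
hence "det (fill K x c)=(1 / T) * det ?F" using T by (simp add: det_mul det_flow)
thus ?thesis using T by (simp add: minor_def)
qed

lemma expo_inj: "expo i=expo j \<longleftrightarrow> i=j"
using bij_betw_the_inv_into[OF bij_idx, THEN bij_betw_imp_inj_on] by (auto simp: expo_def inj_on_def)

lemma expo_le: "expo i<=2 * CARD('n)"
proof -
have "the_inv_into {0..<CARD('n)} idx i:{0..<CARD('n)}" using bij_betw_the_inv_into[OF bij_idx] by (auto simp: bij_betw_def)
thus ?thesis by (auto simp: expo_def)
qed

lemma expo_pos [simp]: "0 < expo i" "expo i ~= 0" by (simp_all add: expo_def)

lemma expo_parity: "odd (expo i)" by (simp add: expo_def)

text \<open>Along the curve the functions 1, v_j and \<open>qj v\<close> are linearly independent:
  the top terms of \<open>qj\<close> have even exponents \<open>2 * expo j\<close>, all others have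
  odd exponents or are constant, and \<open>expo\<close> is injective.\<close>

lemma curve_generic:
assumes "c0 ~= 0 \<or> (EX j:J. cJ j ~= 0) \<or> c2 ~= 0"
shows "EX p. p ~= 0 & (ALL s. poly p s=c0 + (SUM j:J. cJ j * (w + curve s)$j) + c2 * qj (w + curve s))"
proof -
define W where "W=(%j. [:w$j:] + monom 1 (expo j))"
define W2 where "W2=(%j. [:(w$j)\<^sup>2:] + smult (2 * w$j) (monom 1 (expo j)) + monom 1 (2 * expo j))"
define p where "p = [:c0:] + (SUM j:J. smult (cJ j) (W j)) + smult c2 (SUM j:J. smult (\<beta> j) (W2 j))"
have pW: "poly (W j) s=(w + curve s)$j" if "j:J" for j s using that by (simp add: W_def curve_def poly_monom)
have "poly p s=c0 + (SUM j:J. cJ j * (w + curve s)$j) + c2 * qj (w + curve s)" for s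
proof -
 have "poly (W2 j) s=((w + curve s)$j)\<^sup>2" if "j:J" for j
 using that by (simp add: W2_def curve_def poly_monom power2_sum power_mult mult.commute[of 2])
 thus ?thesis using pW by (simp add: p_def poly_sum qj_def)
qed
moreover have "p ~= 0"
proof
 assume p0: "p=0"
 have cc: "coeff [:c:] k=(if k=0 then c else 0)" for c :: real and k by (cases k) auto
 have cW: "coeff (W j) k=(if k=0 then w$j else 0) + (if k=expo j then 1 else 0)" for j k by (simp add: W_def cc)
 have cWW: "coeff (W2 j) k=(if k=0 then (w$j)\<^sup>2 else 0) + (if k=expo j then 2 * w$j else 0)
  + (if k=2 * expo j then 1 else 0)" for j k by (simp add: W2_def cc)
 have cp: "(if k=0 then c0 else 0) + (SUM j:J. cJ j * coeff (W j) k) + c2 * (SUM j:J. \<beta> j * coeff (W2 j) k)=0" for k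
 proof -
 have "coeff p k=(if k=0 then c0 else 0) + (SUM j:J. cJ j * coeff (W j) k) + c2 * (SUM j:J. \<beta> j * coeff (W2 j) k)"
  by (simp add: p_def coeff_sum cc)
 thus ?thesis using p0 by simp
 qed
 have c2: "c2=0"
 proof -
 obtain j0 where j0: "j0:J" using J_nonempty by blast
 have par: "2 * expo j0 ~= expo j" for j using expo_parity[of j] by (metis dvd_triv_left)
 have "(SUM j:J. \<beta> j * coeff (W2 j) (2 * expo j0))=(SUM j:J. if j=j0 then \<beta> j0 else 0)"
  by (rule sum.cong) (use par in \<open>auto simp: cWW expo_inj\<close>)
 also have "... = \<beta> j0" using j0 by simp
 finally have s1: "(SUM j:J. \<beta> j * coeff (W2 j) (2 * expo j0))=\<beta> j0" .
 have "(SUM j:J. cJ j * coeff (W j) (2 * expo j0))=0" by (rule sum.neutral) (use par in \<open>auto simp: cW\<close>)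
 hence "c2 * \<beta> j0=0" using cp[of "2 * expo j0"] s1 by simp
 thus ?thesis using \<beta> j0 by (auto simp: J_ab)
 qed
 have cJ: "cJ j0=0" if j0: "j0:J" for j0
 proof -
 have "(SUM j:J. cJ j * coeff (W j) (expo j0))=(SUM j:J. if j=j0 then cJ j0 else 0)"
  by (rule sum.cong) (use expo_pos in \<open>auto simp: cW expo_inj\<close>)
 also have "... = cJ j0" using j0 by simp
 finally show ?thesis using cp[of "expo j0"] c2 by simp
 qed
 have "c0=0" using cp[of 0] c2 cJ by simp
 thus False using assms c2 cJ by blast
qed
ultimately show ?thesis by blast
qed

lemma sum_UNIV_J: "(SUM i:UNIV. f i)=f a + f b + (SUM j:J. f j)" for f :: "'n => real"
proof -
have "UNIV=insert a (insert b J)" by (auto simp: J_def)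
moreover have "finite J" by simp
ultimately show ?thesis using ab J_ab(1,2) by (metis (no_types, lifting) add.assoc finite_insert insert_iff sum.insert)
qed

text \<open>Provides a minor to which \<open>minor_flow\<close> applies. The axis \<open>a\<close>
  can be added to the sheared family if a normal vector \<open>h\<close> of its span is not
  orthogonal to the isotropic vector \<open>ev\<close>, and the axis \<open>b\<close> can be avoided
  if some vector of the family has a nonzero coordinate \<open>b\<close>. By
  \<open>curve_generic\<close> both hold off the roots of a nonzero polynomial in
  \<open>s\<close>.\<close>

lemma curve_spread:
assumes I: "indep_fam K X" and K: "K ~= {}" "K ~= UNIV" and sg: "sg > 0"
shows "EX s:{0..sg}. EX c. (EX i1. i1 ~: K & c i1=a) & (ALL i. i ~: K --> c i ~= b) &
 minor K (%i. shear (w + curve s) (X i)) c ~= 0"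
proof -
have inj: "inj_on X K" "independent (X ` K)" using I by (auto simp: indep_fam_iff)
have "card K < CARD('n)" using K(2) by (metis finite psubset_card_mono psubsetI subset_UNIV)
hence "span (X ` K) ~= UNIV"
 using dim_span_eq_card_independent[OF inj(2)] card_image[OF inj(1)] by (metis dim_UNIV DIM_cart DIM_real mult_1_right less_irrefl)
then obtain h where h: "h ~= 0" "!!x. x:span (X ` K) ==> h \<bullet> x=0" using span_not_UNIV_orthogonal[of "X ` K"] by blast
have hev: "h \<bullet> ev v=h$a + (SUM j:J. h$j * v$j) + (- h$b) * qj v" for v by (simp add: inner_vec_def sum_UNIV_J ev_nth)
have "h$a ~= 0 \<or> (EX j:J. h$j ~= 0) \<or> - h$b ~= 0" using h(1) vec_eqI[of h 0] by auto
from curve_generic[OF this] obtain p where p: "p ~= 0" "!!s. poly p s=h \<bullet> ev (w + curve s)" unfolding hev by blast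
obtain i0 where i0: "i0:K" using K(1) by blast
have x0: "X i0 ~= 0" using inj(2) i0 by (metis dependent_zero imageI)
have xb: "shear v (X i0)$b=X i0$b + (SUM j:J. (2 * \<beta> j * X i0$j) * v$j) + (- X i0$a) * qj v" for v
 by (simp add: shear_nth bil_def sum_distrib_left mult.assoc)
have "X i0$b ~= 0 \<or> (EX j:J. 2 * \<beta> j * X i0$j ~= 0) \<or> - X i0$a ~= 0"
 using x0 vec_eqI[of "X i0" 0] \<beta> by (auto simp: J_ab)
from curve_generic[OF this] obtain p' where p': "p' ~= 0" "!!s. poly p' s=shear (w + curve s) (X i0)$b" unfolding xb by blast
have "finite {s. poly (p * p') s=0}" using p p' by (intro poly_roots_finite) simp
moreover have "infinite {0..sg}" using sg by (simp add: infinite_Icc)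
ultimately obtain s where s: "s:{0..sg}" "poly (p * p') s ~= 0"
 by (metis (mono_tags, lifting) finite_subset mem_Collect_eq subsetI)
define v where "v=w + curve s"
have s1: "h \<bullet> ev v ~= 0" and s2: "shear v (X i0)$b ~= 0" using s(2) p p' by (auto simp: v_def)
define Y where "Y=(%i. shear v (X i))"
have injs: "inj (shear v)" by (metis injI shear_inverse)
have Yim: "Y ` K=shear v ` (X ` K)" by (auto simp: Y_def)
have Yind: "independent (Y ` K)"
 unfolding Yim using linear_independent_injective_image[OF linear_shear inj(2)] injs inj_on_subset by blast
have Yinj: "inj_on Y K" using inj(1) injs by (auto simp: Y_def inj_on_def)
have axa: "axis a 1 ~: span (Y ` K)"
proof
 assume "axis a 1:span (Y ` K)"
 hence "axis a 1:shear v ` span (X ` K)" unfolding Yim by (simp add: linear_span_image[OF linear_shear])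
 then obtain x where x: "x:span (X ` K)" "shear v x=axis a 1" by force
 hence "shear v x=shear v (ev v)" by (simp add: shear_ev)
 hence "x=ev v" using injs by (simp add: inj_eq)
 thus False using x(1) h(2) s1 by blast
qed
obtain i1 where i1: "i1 ~: K" using K(2) by blast
define X' where "X'=Y(i1 := axis a 1)"
have X'K: "X' i=Y i" if "i:K" for i using that i1 by (auto simp: X'_def)
have X'im: "X' ` insert i1 K=insert (axis a 1) (Y ` K)" 
proof -
 have "X' ` K=Y ` K" using X'K by (intro image_cong) auto
 moreover have "X' i1=axis a 1" by (simp add: X'_def)
 ultimately show ?thesis by (simp only: image_insert)
qed
have ind': "indep_fam (insert i1 K) X'" unfolding indep_fam_iff
proof
 have "X' i1 ~: X' ` (K - {i1})"
 proof
 assume "X' i1:X' ` (K - {i1})"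
 then obtain k where k: "k:K" "X' i1=X' k" by auto
 moreover have "X' i1=axis a 1" by (simp add: X'_def)
 ultimately have "axis a 1=Y k" using X'K[OF k(1)] by simp
 hence "axis a 1:span (Y ` K)" using k(1) by (simp add: span_base)
 thus False using axa by simp
 qed
 moreover have "inj_on X' K" using Yinj X'K by (simp add: inj_on_def)
 ultimately show "inj_on X' (insert i1 K)" unfolding inj_on_insert by blast
 show "independent (X' ` insert i1 K)" unfolding X'im by (rule independent_insertI[OF axa Yind])
qed
\<comment> \<open>The axis \<open>b\<close> is recovered from \<open>Y i0\<close>, whose coordinate
  \<open>b\<close> is nonzero, and the remaining axes.\<close>
let ?S = "X' ` insert i1 K Un (%k. axis k 1) ` (- {b})"
have "axis k 1:span ?S" for k
proof (cases "k=b")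
 case True
 let ?y = "Y i0"
 have yb: "?y$b ~= 0" using s2 by (simp add: Y_def)
 have ysp: "?y:span ?S" using i0 X'K by (intro span_base) force
 have rest: "(SUM k:-{b}. ?y$k *\<^sub>R axis k 1):span ?S" by (intro span_sum span_scale span_base) auto
 have "?y=(SUM k:UNIV. ?y$k *\<^sub>R axis k 1)" using basis_expansion[of ?y] by (simp add: scalar_mult_eq_scaleR)
 also have "... = ?y$b *\<^sub>R axis b 1 + (SUM k:-{b}. ?y$k *\<^sub>R axis k 1)"
 by (subst sum.remove[of UNIV b]) (auto simp: Compl_eq_Diff_UNIV)
 finally have "?y$b *\<^sub>R axis b 1 = ?y - (SUM k:-{b}. ?y$k *\<^sub>R axis k 1)" by (simp add: algebra_simps)
 hence "?y$b *\<^sub>R axis b 1:span ?S" using span_diff[OF ysp rest] by simp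
 hence "(1 / ?y$b) *\<^sub>R (?y$b *\<^sub>R axis b 1):span ?S" by (rule span_scale)
 thus ?thesis using True yb by simp
qed (auto intro: span_base)
hence "Basis<=span ?S" by (auto simp: Basis_vec_def)
hence "span ?S=UNIV" by (metis span_Basis span_mono span_span top.extremum_uniqueI)
from minor_extend[OF ind' this] obtain c where c: "!!i. i ~: insert i1 K ==> c i ~= b" "minor (insert i1 K) X' c ~= 0" by blast
have "fill K Y (c(i1 := a))=fill (insert i1 K) X' c" using i1 X'K by (auto simp: fill_def vec_eq_iff X'_def)
hence "minor K Y (c(i1 := a)) ~= 0" using c(2) by (simp add: minor_def)
moreover have "ALL i. i ~: K --> (c(i1 := a)) i ~= b" using c(1) ab by auto
ultimately show ?thesis using s(1) i1 unfolding Y_def v_def by (metis fun_upd_same)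
qed

end

lemma covol_bounded: "EX C>0. ALL K (X :: 'n => real^'n). (ALL i:K. norm (X i)<=1) --> covol K X<=C"
proof -
define n where "n=real CARD('n)"
define m where "m=real (card (UNIV :: ('n => 'n) set))"
define e where "e=covol {} (%_::'n. 0 :: real^'n)"
have e0: "0<=e" by (simp add: e_def covol_nonneg)
have n: "n >= 1" by (simp add: n_def Suc_leI)
have "covol K X<=m * (n^CARD('n) * e) + 1" if X: "ALL i:K. norm (X i)<=1" for K and X :: "'n => real^'n"
proof -
 have "abs (minor K X c)<=n^CARD('n) * e" for c
 proof -
 let ?f = "%i. if i:K then X i else axis (c i) 1"
 have f1: "norm (?f i)<=1" for i using X by simp
 have "(SUM k:UNIV. abs (?f i$k))<=n" for i
 proof -
  have "abs (?f i$k)<=1" for k using component_le_norm_cart[of "?f i" k] f1[of i] by linarith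
  hence "(SUM k:UNIV. abs (?f i$k))<=(SUM k:(UNIV::'n set). 1)" by (intro sum_mono) blast
  thus ?thesis by (simp add: n_def)
 qed
 hence p: "(PROD i:UNIV. SUM k:UNIV. abs (?f i$k))<=(PROD i:(UNIV::'n set). n)" by (intro prod_mono) (auto intro: sum_nonneg)
 have "abs (det (\<chi> i. if i:{} then 0 else ?f i))<=(PROD i:-{}. SUM k:UNIV. abs (?f i$k)) * e"
  unfolding e_def by (rule det_fill_bound)
 also have "... <= n^CARD('n) * e" using p e0 by (intro mult_right_mono) auto
 finally show ?thesis by (simp add: minor_def fill_def)
 qed
 hence "covol K X<=(SUM c:(UNIV :: ('n => 'n) set). n^CARD('n) * e)" unfolding covol_def by (rule sum_mono)
 thus ?thesis by (simp add: m_def)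
qed
moreover have "m * (n^CARD('n) * e) + 1 > 0"
proof -
 have "0<=m * (n^CARD('n) * e)" using e0 n by (simp add: m_def)
 thus ?thesis by linarith
qed
ultimately show ?thesis by blast
qed

section \<open>Growth of covolumes along curves, and averaging over a box\<close>

context chart
begin

lemma tendsto_shear:
assumes "(w \<longlongrightarrow> w0) F" "(x \<longlongrightarrow> x0) F"
shows "((%m. shear (w m) (x m)) \<longlongrightarrow> shear w0 x0) F"
proof (rule vec_tendstoI)
fix i
have n: "((%m. w m$j) \<longlongrightarrow> w0$j) F" "((%m. x m$j) \<longlongrightarrow> x0$j) F" for j
 using assms by (auto intro: tendsto_vec_nth)
have bq: "((%m. bil (x m) (w m)) \<longlongrightarrow> bil x0 w0) F" "((%m. qj (w m)) \<longlongrightarrow> qj w0) F"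
 unfolding bil_def qj_def by (intro tendsto_intros n)+
consider "i=a" | "i=b" | "i:J" by (auto simp: J_ab)
thus "((%m. shear (w m) (x m)$i) \<longlongrightarrow> shear w0 x0$i) F"
proof cases
 case 1 thus ?thesis by (simp add: shear_nth n)
next
 case 2 thus ?thesis by (auto simp: shear_nth intro!: tendsto_intros n bq)
next
 case 3 thus ?thesis by (auto simp: shear_nth intro!: tendsto_intros n)
qed
qed

lemma tendsto_flow:
assumes "(x \<longlongrightarrow> x0) F"
shows "((%m. flow T (x m)) \<longlongrightarrow> flow T x0) F"
proof (rule vec_tendstoI)
fix i
have n: "((%m. x m$j) \<longlongrightarrow> x0$j) F" for j using assms by (rule tendsto_vec_nth)
consider "i=a" | "i=b" | "i:J" by (auto simp: J_ab)
thus "((%m. flow T (x m)$i) \<longlongrightarrow> flow T x0$i) F"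
proof cases
 case 1 thus ?thesis by (cases "T=0") (auto simp: flow_nth intro!: tendsto_intros n)
qed (auto simp: flow_nth intro!: tendsto_intros n)
qed

text \<open>Compactness of the orthonormal families turns \<open>curve_spread\<close> into a uniform
  lower bound: a sequence of counterexamples would converge to a family all of whose relevant minors
  vanish.\<close>

lemma spread_uniform:
assumes K0: "compact K0" and sg: "sg > 0" and K: "K ~= {}" "K ~= UNIV"
shows "EX c0>0. ALL w:K0. ALL X. (ALL i:K. ALL j:K. X i \<bullet> X j=(if i=j then 1 else 0)) -->
 (EX s:{0..sg}. EX c. (EX i1. i1 ~: K & c i1=a) & (ALL i. i ~: K --> c i ~= b) &
 c0<=abs (minor K (%i. shear (w + curve s) (X i)) c))"
proof (rule ccontr)
assume neg: "~ ?thesis"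
define bad where "bad=(%e w X. ALL s:{0..sg}. ALL c. (EX i1. i1 ~: K & c i1=a) --> (ALL i. i ~: K --> c i ~= b) -->
 \<bar>minor K (%i. shear (w + curve s) (X i)) c\<bar> < e)"
have nb: "(EX s:{0..sg}. EX c. (EX i1. i1 ~: K & c i1=a) & (ALL i. i ~: K --> c i ~= b) &
 e<=abs (minor K (%i. shear (w + curve s) (X i)) c))=(~ bad e w X)" for e w X unfolding bad_def not_less[symmetric] by blast
have neg': "~ (EX c0>0. ALL w:K0. ALL X. (ALL i:K. ALL j:K. X i \<bullet> X j=(if i=j then 1 else 0)) --> ~ bad c0 w X)"
 using neg unfolding nb .
have "EX w X. w:K0 & (ALL i:K. ALL j:K. X i \<bullet> X j=(if i=j then 1 else 0)) & bad (inverse (real (Suc m))) w X" for m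
proof -
 have "0 < inverse (real (Suc m))" by simp
 with neg' show ?thesis by blast
qed
then obtain w X where wX: "!!m. w m:K0" "!!m i j. i:K ==> j:K ==> X m i \<bullet> X m j=(if i=j then 1 else 0)"
 "!!m. bad (inverse (real (Suc m))) (w m) (X m)" by metis
\<comment> \<open>Rows outside \<open>K\<close> are set to zero, so that the orthonormal families
  indexed by \<open>K\<close> form a compact set of square matrices.\<close>
define ON :: "(real^'n^'n) set" where "ON={M. ALL i j. M$i \<bullet> M$j=(if i=j & i:K then 1 else 0)}"
have "closed ON" unfolding ON_def by (intro closed_Collect_all closed_Collect_eq continuous_intros)
moreover have "bounded ON"
proof (rule boundedI)
 fix M assume M: "M:ON"
 have "norm (M$i)<=1" for i
 proof -
 have "(norm (M$i))\<^sup>2<=1" using M unfolding ON_def by (simp add: power2_norm_eq_inner)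
 thus ?thesis by (simp add: abs_square_le_1)
 qed
 hence "(SUM i:UNIV. norm (M$i))<=(SUM i:(UNIV :: 'n set). 1)" by (intro sum_mono) blast
 thus "norm M<=CARD('n)"  using L2_set_le_sum[of UNIV "%i. norm (M$i)"] unfolding norm_vec_def[of M] by simp
qed
ultimately have "compact ON" using compact_eq_bounded_closed by blast
hence "compact (K0 \<times> ON)" by (rule compact_Times[OF K0])
define M where "M=(%m. (\<chi> i. if i:K then X m i else 0) :: real^'n^'n)"
have "M m:ON" for m using wX(2) by (auto simp: ON_def M_def)
hence "ALL m. (w m, M m):K0 \<times> ON" using wX(1) by blast
obtain l r where l: "l:K0 \<times> ON" and r: "strict_mono r"
 and lim: "((%m. (w m, M m)) \<circ> r) \<longlonglongrightarrow> l"
proof (rule seq_compactE[OF compact_imp_seq_compact[OF \<open>compact (K0 \<times> ON)\<close>], of "%m. (w m, M m)"])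
 show "ALL m. (w m, M m):K0 \<times> ON" by (rule \<open>ALL m. (w m, M m):K0 \<times> ON\<close>)
qed (rule that)
obtain w0 M0 where l0: "l=(w0, M0)" by force
have limw: "(%m. w (r m)) \<longlonglongrightarrow> w0" and limM: "(%m. M (r m)) \<longlonglongrightarrow> M0"
 using tendsto_fst[OF lim] tendsto_snd[OF lim] by (auto simp: l0 o_def)
have M0: "M0:ON" using l l0 by simp
have "indep_fam K (%i. M0$i)" unfolding indep_fam_def
proof (intro allI impI ballI)
 fix c i assume z: "(SUM i:K. c i *\<^sub>R M0$i)=0" and i: "i:K"
 have "(SUM k:K. c k * (M0$k \<bullet> M0$i))=(SUM k:K. if k=i then c i else 0)"
 by (rule sum.cong) (use M0 i in \<open>auto simp: ON_def\<close>)
 moreover have "(SUM k:K. c k * (M0$k \<bullet> M0$i))=(SUM i:K. c i *\<^sub>R M0$i) \<bullet> M0$i"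
 by (simp add: inner_sum_left)
 ultimately show "c i=0" using z i by simp
qed
from curve_spread[OF this K sg, of w0] obtain s c where s: "s:{0..sg}" and c: "EX i1. i1 ~: K & c i1=a" "ALL i. i ~: K --> c i ~= b"
 and nz: "minor K (%i. shear (w0 + curve s) (M0$i)) c ~= 0" by blast
have "(%m. minor K (%i. shear (w (r m) + curve s) (M (r m)$i)) c) \<longlonglongrightarrow> minor K (%i. shear (w0 + curve s) (M0$i)) c"
proof -
 have "(%m. fill K (%i. shear (w (r m) + curve s) (M (r m)$i)) c$i$j) \<longlonglongrightarrow> fill K (%i. shear (w0 + curve s) (M0$i)) c$i$j" for i j
 proof (cases "i:K")
 case True
 have "(%m. shear (w (r m) + curve s) (M (r m)$i)) \<longlonglongrightarrow> shear (w0 + curve s) (M0$i)"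
  by (intro tendsto_shear tendsto_add limw tendsto_const tendsto_vec_nth limM)
 thus ?thesis using True by (simp add: fill_def tendsto_vec_nth)
 qed (simp add: fill_def)
 thus ?thesis unfolding minor_def det_def by (intro tendsto_sum tendsto_mult tendsto_const tendsto_prod)
qed
hence lim1: "(%m. abs (minor K (%i. shear (w (r m) + curve s) (M (r m)$i)) c)) \<longlonglongrightarrow> \<bar>minor K (%i. shear (w0 + curve s) (M0$i)) c\<bar>"
 by (rule tendsto_rabs)
have bound: "abs (minor K (%i. shear (w (r m) + curve s) (M (r m)$i)) c)<=inverse (real (Suc m))" for m
proof -
 have "fill K (%i. shear (w (r m) + curve s) (M (r m)$i)) c=fill K (%i. shear (w (r m) + curve s) (X (r m) i)) c"
 by (auto simp: fill_def M_def vec_eq_iff)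
 hence "abs (minor K (%i. shear (w (r m) + curve s) (M (r m)$i)) c) < inverse (real (Suc (r m)))"
 using wX(3)[of "r m"] s c unfolding bad_def minor_def by simp
 also have "... <= inverse (real (Suc m))" using seq_suble[OF r, of m] by (intro le_imp_inverse_le) auto
 finally show ?thesis by simp
qed
have "abs (minor K (%i. shear (w0 + curve s) (M0$i)) c)<=0"
 by (rule LIMSEQ_le[OF lim1 LIMSEQ_inverse_real_of_nat]) (use bound in blast)
with nz show False by simp
qed

text \<open>A rational subspace is rewritten in an orthonormal basis \<open>Y\<close>. Integrality
  bounds the transition factor \<open>t\<close> from below, \<open>spread_uniform\<close> bounds a
  minor of the sheared \<open>Y\<close> from below, and the flow multiplies this minor by
  \<open>T\<close>. Hence one \<open>T0\<close> serves for all subspaces at once.\<close>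

lemma sup_bound:
assumes K0: "compact K0" and sg: "sg > 0"
shows "EX T0>0. ALL T>=T0. ALL w:K0. ALL V:proper_int. EX s:{0..sg}. 1<=sub_covol V (hmat T (w + curve s))"
proof -
let ?n = "CARD('n)"
define P where "P=(%d c0. ALL w:K0. ALL X. (ALL i:initial d. ALL j:initial d. X i \<bullet> X j=(if i=j then 1 else 0)) -->
 (EX s:{0..sg}. EX c. (EX i1. i1 ~: initial d & c i1=a) & (ALL i. i ~: initial d --> c i ~= b) &
 c0<=abs (minor (initial d) (%i. shear (w + curve s) (X i)) c)))"
have "EX c0. c0 > 0 & (0 < d & d < ?n --> P d c0)" for d
proof (cases "0 < d & d < ?n")
 case True
 hence "initial d ~= ({} :: 'n set)" "initial d ~= (UNIV :: 'n set)" using card_initial[of d, where 'n = 'n] by auto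
 from spread_uniform[OF K0 sg this] show ?thesis unfolding P_def by blast
qed (auto intro: exI[of _ 1])
hence "ALL d. EX c0. c0 > 0 & (0 < d & d < ?n --> P d c0)" by blast
from choice[OF this] obtain c0 where c0': "ALL d. c0 d > 0 & (0 < d & d < ?n --> P d (c0 d))" ..
have c0: "!!d. c0 d > 0" "!!d. 0 < d ==> d < ?n ==> P d (c0 d)" using c0' by blast+
define cm where "cm=Min (c0 ` {..<?n})"
have cm: "cm > 0" "!!d. d < ?n ==> cm<=c0 d" 
proof -
 have ne: "c0 ` {..<?n} ~= {}" "finite (c0 ` {..<?n})" by (auto simp: lessThan_empty_iff)
 have "cm:c0 ` {..<?n}" unfolding cm_def by (rule Min_in[OF ne(2,1)])
 thus "cm > 0" using c0(1) by auto
 show "cm<=c0 d" if "d < ?n" for d unfolding cm_def by (rule Min_le[OF ne(2)]) (use that in auto)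
qed
obtain C1 where C1: "C1 > 0" "!!K (X :: 'n => real^'n). ALL i:K. norm (X i)<=1 ==> covol K X<=C1" using covol_bounded by blast
obtain C2 where C2: "C2 > 0" "!!K X. covol K (%i. L *v X i)<=C2 * covol K X" using covol_linear[OF L] by blast
\<comment> \<open>\<open>C1\<close> bounds the covolume of an orthonormal family, \<open>C2\<close>
  is the cost of the base change \<open>L\<close>, and \<open>cm\<close> is the least minor over the
  finitely many dimensions.\<close>
define T0 where "T0=C1 * C2 / cm"
have T0: "T0 > 0" using C1 C2 cm by (simp add: T0_def)
have "EX s:{0..sg}. 1<=sub_covol V (hmat T (w + curve s))" if T: "T >= T0" and w: "w:K0" and V: "V:proper_int" for T w V
proof -
 define d where "d=dim V"
 have Vi: "V:int_subspaces" and sV: "subspace V" using V by (auto simp: proper_int_def int_subspaces_def)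
 have d: "0 < d" "d < ?n" using flag_family.rk[OF proper_int_flags[of "%_. 1"] V] by (auto simp: d_def)
 let ?K = "initial d :: 'n set"
 let ?X = "min_family V"
 have X: "int_family V ?X" by (rule min_family(1)[OF Vi])
 define V' where "V'=(%x. Linv *v x) ` V"
 have lin: "linear (%x. Linv *v x)" by simp
 have injL: "inj (%x. Linv *v x)" by (metis injI Linv_L(2))
 have sV': "subspace V'" unfolding V'_def using linear_subspace_image[OF lin sV] .
 have dV': "dim V'=d" unfolding V'_def d_def by (rule dim_image_eq[OF lin]) (use injL in \<open>auto intro: inj_on_subset\<close>)
 obtain B where B: "B<=V'" "pairwise orthogonal B" "!!x. x:B ==> norm x=1" "independent B" "card B=dim V'" "span B=V'"
 using orthonormal_basis_subspace[OF sV'] by metis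
 from family_of_basis[OF B(4,5,6)] dV' obtain Y where Y: "!!i. i : ?K ==> Y i:B" "indep_fam ?K Y" "Y ` ?K=B" by metis
 have Yon: "ALL i:?K. ALL j:?K. Y i \<bullet> Y j=(if i=j then 1 else 0)"
 proof (intro ballI)
 fix i j assume ij: "i : ?K" "j : ?K"
 show "Y i \<bullet> Y j=(if i=j then 1 else 0)"
 proof (cases "i=j")
  case True
  thus ?thesis using B(3)[OF Y(1)[OF ij(1)]] by (simp add: norm_eq_1)
 next
  case False
  hence "Y i ~= Y j" using Y(2) ij by (auto simp: indep_fam_iff inj_on_def)
  thus ?thesis using False pairwiseD[OF B(2) Y(1)[OF ij(1)] Y(1)[OF ij(2)]] by (simp add: orthogonal_def)
 qed
 qed
 have "EX c. Linv *v ?X i=(SUM j:?K. c j *\<^sub>R Y j)" if i: "i : ?K" for i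
 proof (rule span_family_rep[OF Y(2)])
 have "?X i:V" using X i by (simp add: int_family_def d_def)
 thus "Linv *v ?X i:span (Y ` ?K)" using Y(3) B(6) by (auto simp: V'_def)
 qed
 then obtain C where C: "!!i. i : ?K ==> Linv *v ?X i=(SUM j:?K. C i j *\<^sub>R Y j)" by metis
 from covol_change[of ?K "%i. Linv *v ?X i" C Y, OF C] obtain t where t: "t >= 0"
 "!!A :: real^'n^'n. covol ?K (%i. A *v (Linv *v ?X i))=t * covol ?K (%i. A *v Y i)" by blast
 have "covol ?K ?X:\<int>" using int_family_covol_int[OF X] by (simp add: d_def)
 moreover have "covol ?K ?X > 0" using X by (simp add: covol_pos_iff_indep int_family_def d_def)
 ultimately have "1<=covol ?K ?X" using Ints_nonzero_abs_ge1[of "covol ?K ?X"] by simp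
 also have "... = covol ?K (%i. L *v (Linv *v ?X i))" by (simp add: Linv_L)
 also have "... <= C2 * covol ?K (%i. Linv *v ?X i)" by (rule C2(2))
 also have "covol ?K (%i. Linv *v ?X i)=t * covol ?K Y" using t(2)[of "mat 1"] by simp
 also have "C2 * (t * covol ?K Y)<=C2 * (t * C1)" using C1(2)[of ?K Y] B(3) Y(1) C2(1) t(1) by (intro mult_left_mono) auto
 finally have t1: "1<=C2 * (t * C1)" .
 obtain s c where s: "s:{0..sg}" "EX i1. i1 ~: ?K & c i1=a" "ALL i. i ~: ?K --> c i ~= b"
 "c0 d<=abs (minor ?K (%i. shear (w + curve s) (Y i)) c)" using c0(2)[OF d] w Yon unfolding P_def by blast
 have Tpos: "T > 0" using T T0 by linarith
 obtain i1 where i1: "i1 ~: ?K" "c i1=a" using s(2) by blast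
 have f1: "minor ?K (%i. flow T (shear (w + curve s) (Y i))) c=T * minor ?K (%i. shear (w + curve s) (Y i)) c"
 by (rule minor_flow[where c=c and ?i1.0=i1, OF Tpos i1]) (use s(3) in blast)
 have f2: "T * c0 d<=T * abs (minor ?K (%i. shear (w + curve s) (Y i)) c)" using s(4) Tpos by (intro mult_left_mono) auto
 have f3: "abs (T * minor ?K (%i. shear (w + curve s) (Y i)) c)<=covol ?K (%i. flow T (shear (w + curve s) (Y i)))"
 unfolding f1[symmetric] by (rule minor_le_covol)
 have "T * c0 d<=covol ?K (%i. flow T (shear (w + curve s) (Y i)))" using f2 f3 Tpos unfolding abs_mult by linarith
 moreover have "T * cm<=T * c0 d" using cm(2)[OF d(2)] Tpos by simp
 moreover have "C1 * C2<=T * cm" using T cm(1) by (simp add: T0_def field_simps)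
 ultimately have low: "C1 * C2<=covol ?K (%i. flow T (shear (w + curve s) (Y i)))" by linarith
 let ?A = "matrix (flow T) ** matrix (shear (w + curve s))"
 have A: "?A *v x=flow T (shear (w + curve s) x)" for x
 by (simp add: matrix_vector_mul_assoc[symmetric] matrix_apply linear_shear linear_flow)
 have "sub_covol V (hmat T (w + curve s))=covol ?K (%i. ?A *v (Linv *v ?X i))"
 by (simp add: sub_covol_def d_def hmat_def matrix_vector_mul_assoc[symmetric])
 also have "... = t * covol ?K (%i. ?A *v Y i)" by (rule t(2))
 also have "... = t * covol ?K (%i. flow T (shear (w + curve s) (Y i)))" by (simp only: A)
 finally have "t * (C1 * C2)<=sub_covol V (hmat T (w + curve s))" using low t(1) by (simp add: mult_left_mono)
 hence "1<=sub_covol V (hmat T (w + curve s))" using t1 by (simp add: mult.commute mult.left_commute)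
 thus ?thesis using s(1) by blast
qed
with T0 show ?thesis by blast
qed

definition good_at :: "real => real => real^'n => bool" where
"good_at et T y \<longleftrightarrow> (ALL z. intvec z --> z ~= 0 --> et<=norm (hmat T y *v z))"

lemma poly_fun_hmat: "poly_fun (4 * CARD('n)) (%s. (hmat T (w + curve s) *v x)$i)"
proof -
let ?n = "CARD('n)"
define v where "v=Linv *v x"
have c: "poly_fun (2 * ?n) (%s. (w + curve s)$j)" for j
 using expo_le[of j] by (cases "j:J") (auto simp: curve_def intro!: poly_fun_add poly_fun_const poly_fun_power)
have c': "poly_fun (4 * ?n) (%s. (w + curve s)$j)" for j by (rule poly_fun_mono[OF c]) simp
have bl: "poly_fun (4 * ?n) (%s. bil v (w + curve s))" unfolding bil_def mult.assoc by (intro poly_fun_sum poly_fun_cmult c')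
have qq: "poly_fun (4 * ?n) (%s. qj (w + curve s))" unfolding qj_def power2_eq_square
proof (intro poly_fun_sum poly_fun_cmult)
 fix j
 have "poly_fun (2 * ?n + 2 * ?n) (%s. (w + curve s)$j * (w + curve s)$j)" by (rule poly_fun_mult[OF c c])
 thus "poly_fun (4 * ?n) (%s. (w + curve s)$j * (w + curve s)$j)" by (rule poly_fun_mono) simp
qed
consider "i=a" | "i=b" | "i:J" by (auto simp: J_ab)
thus ?thesis
proof cases
 case 1
 thus ?thesis by (simp add: hmat_mult flow_nth shear_nth poly_fun_const)
next
 case 2
 have "poly_fun (4 * ?n) (%s. T * (v$b + 2 * bil v (w + curve s) - v$a * qj (w + curve s)))"
 by (intro poly_fun_cmult poly_fun_diff poly_fun_add poly_fun_const bl qq)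
 thus ?thesis using 2 by (simp add: hmat_mult flow_nth shear_nth v_def)
next
 case 3
 have "poly_fun (4 * ?n) (%s. v$i - v$a * (w + curve s)$i)" by (intro poly_fun_diff poly_fun_cmult poly_fun_const c')
 thus ?thesis using 3 by (simp add: hmat_mult flow_nth shear_nth v_def)
qed
qed

text \<open>The order of the quantifiers matters: \<open>et\<close> depends on the degree of the
  polynomials and the proportion 1/4, whereas the compact set and the length of the curve influence
  only \<open>T0\<close>. The same \<open>et\<close> can therefore be used in arbitrarily small
  boxes.\<close>

lemma good_on_curves: "EX et>0. ALL K0 sg. compact K0 --> sg > 0 --> (EX T0>0. ALL T>=T0. ALL w:K0.
 EX B:sets lborel. emeasure lborel B<=ennreal (sg / 4) & (ALL s:{0..<sg} - B. good_at et T (w + curve s)))"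
proof -
let ?N = "CARD('n) * (4 * CARD('n))"
obtain kp where kap: "!!dt. dt > 0 ==> kp dt > 0"
 "!!f :: ('n => 'n) => real => real. (ALL c. poly_fun ?N (f c)) ==> good_fun kp (%s. SUM c:UNIV. abs (f c s))"
 using good_fun_sum_poly[of ?N, where 'c = "'n => 'n"] by blast
interpret flag_family "proper_int :: (real^'n) set set" nested dim "CARD('n)" kp by (rule proper_int_flags[OF kap(1)])
obtain ep where ep: "ep > 0" "!!\<psi> F a b. (ALL V:proper_int. good_fun kp (\<psi> V)) ==> flag F ==> CARD('n) - 1<=card F + (CARD('n) - 1) ==> a < b ==>
 (ALL V:cand F. EX s:{a..b}. 1<=\<psi> V s) ==>
 (EX B:sets lborel. emeasure lborel B<=ennreal (1/4 * (b - a)) & (ALL s:{a..<b} - B. protected \<psi> ep F s))"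
 using protected_exists[of 1 "1/4" "CARD('n) - 1"] by auto
define k where "k=real (card (UNIV :: ('n => 'n) set)) * (1 + covol {} (%_::'n. 0 :: real^'n))"
have k: "k > 0" using covol_nonneg[of "{}" "%_::'n. 0 :: real^'n"] by (auto simp: k_def intro!: mult_pos_pos)
define et where "et=min ep \<bar>det Linv\<bar> / (k * CARD('n))"
have et: "et > 0" using ep(1) det_Linv k by (simp add: et_def)
have "EX T0>0. ALL T>=T0. ALL w:K0. EX B:sets lborel. emeasure lborel B<=ennreal (sg / 4) & (ALL s:{0..<sg} - B. good_at et T (w + curve s))"
 if K0: "compact K0" and sg: "sg > 0" for K0 sg
proof -
 obtain T0 where T0: "T0 > 0" "!!T w V. T >= T0 ==> w:K0 ==> V:proper_int ==> EX s:{0..sg}. 1<=sub_covol V (hmat T (w + curve s))"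
 using sup_bound[OF K0 sg] by blast
 have "EX B:sets lborel. emeasure lborel B<=ennreal (sg / 4) & (ALL s:{0..<sg} - B. good_at et T (w + curve s))"
 if T: "T >= T0" and w: "w:K0" for T w
 proof -
 let ?A = "%s. hmat T (w + curve s)"
 let ?\<psi> = "%V s. sub_covol V (?A s)"
 have gf: "good_fun kp (?\<psi> V)" for V :: "(real^'n) set" unfolding sub_covol_def covol_def
 proof (rule kap(2), intro allI)
  fix c
  show "poly_fun ?N (%s. minor (initial (dim V)) (%i. ?A s *v min_family V i) c)" unfolding minor_def
  proof (rule poly_fun_det)
  fix i j
  show "poly_fun (4 * CARD('n)) (%s. fill (initial (dim V)) (%i. ?A s *v min_family V i) c$i$j)"
   by (cases "i:initial (dim V)") (simp_all add: fill_def poly_fun_hmat poly_fun_const)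
  qed
 qed
 have fl: "flag {}" by (simp add: flag_def)
 have cd: "ALL V:cand {}. EX s:{0..sg}. 1 <= ?\<psi> V s" using T0(2)[OF T w] by (auto simp: cand_def)
 from ep(2)[of ?\<psi> "{}" 0 sg] gf fl cd sg obtain B where B: "B:sets lborel" "emeasure lborel B<=ennreal (1/4 * (sg - 0))"
  "ALL s:{0..<sg} - B. protected ?\<psi> ep {} s" by auto
 have "good_at et T (w + curve s)" if s: "s:{0..<sg} - B" for s unfolding good_at_def
 proof (intro allI impI)
  fix z :: "real^'n" assume z: "intvec z" "z ~= 0"
  have p: "protected ?\<psi> ep {} s" using B(3) s by blast
  have Tn: "T ~= 0" using T T0(1) by linarith
  have "min ep \<bar>det Linv\<bar> <= k * (SUM m:UNIV. abs ((?A s *v z)$m))"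
  using no_short_vectors[where kp=kp, OF kap(1) p z] by (simp add: det_hmat[OF Tn] k_def mult.commute mult.left_commute)
  also have "(SUM m:UNIV. abs ((?A s *v z)$m))<=(SUM m:(UNIV :: 'n set). norm (?A s *v z))"
  by (intro sum_mono component_le_norm_cart)
  finally have "min ep \<bar>det Linv\<bar> <= k * (CARD('n) * norm (?A s *v z))" using k by simp
  thus "et<=norm (?A s *v z)" using k by (simp add: et_def field_simps)
 qed
 thus ?thesis using B(1,2) by auto
 qed
 thus ?thesis using T0(1) by blast
qed
with et show ?thesis by blast
qed

lemma closed_good: "closed {y. good_at et T y}"
proof -
have eq: "{y. good_at et T y}=(INT z:{z. intvec z & z ~= 0}. {y. et<=norm (hmat T y *v z)})"
 by (auto simp: good_at_def)
have cl: "closed {y. et<=norm (hmat T y *v z)}" for z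
proof (rule closed_Collect_le)
 have "((%y. flow T (shear y (Linv *v z))) \<longlongrightarrow> flow T (shear y0 (Linv *v z))) (at y0)" for y0
 by (intro tendsto_flow tendsto_shear tendsto_const tendsto_ident_at)
 thus "continuous_on UNIV (%y. norm (hmat T y *v z))" by (intro continuous_on_norm) (simp add: hmat_mult continuous_on_def)
qed simp
show ?thesis unfolding eq by (rule closed_INT) (use cl in blast)
qed

lemma curve_nth: "curve s$i=(if i:J then s^expo i else 0)" by (simp add: curve_def)

lemma curve_0: "curve 0=0" by (simp add: vec_eq_iff curve_nth)

lemma continuous_curve: "continuous_on UNIV curve"
proof -
have "((%s. curve s) \<longlongrightarrow> curve s0) (at s0)" for s0
 by (rule vec_tendstoI) (auto simp: curve_nth intro!: tendsto_intros)
thus ?thesis by (simp add: continuous_on_def)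
qed

text \<open>Leaves room in the box for a piece of curve that starts in the smaller box. The bound
  \<open>sg<=1\<close> makes every power of \<open>s\<close> at most \<open>s\<close>, and 2/3 is
  chosen because 2/3 times 3/4 is 1/2.\<close>

lemma shrink_measure:
fixes c d :: "real^'n"
assumes cd: "!!i. c$i < d$i"
shows "EX sg>0. sg<=1 & (ALL i. sg<=d$i - c$i) &
 2/3 * vol (cbox c d)<=vol (cbox c (d - (\<chi> i. sg)))"
proof -
define n where "n=real CARD('n)"
define \<theta> where "\<theta> = 1 / (3 * n)"
have n: "n >= 1" by (simp add: n_def Suc_leI)
have \<theta>: "\<theta> > 0" "\<theta> <= 1/3" using n by (auto simp: \<theta>_def field_simps)
define g where "g=Min (range (%i. d$i - c$i))"
have "g:range (%i. d$i - c$i)" unfolding g_def by (rule Min_in) auto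
hence g: "g > 0" using cd by auto
have gle: "g<=d$i - c$i" for i unfolding g_def by (rule Min_le) auto
define sg where "sg=min 1 (\<theta> * g)"
have sg: "sg > 0" "sg<=1" using g \<theta> by (auto simp: sg_def)
have sgi: "sg<=\<theta> * (d$i - c$i)" for i
proof -
 have "sg<=\<theta> * g" by (simp add: sg_def)
 also have "... <= \<theta> * (d$i - c$i)" using gle[of i] \<theta> by (intro mult_left_mono) auto
 finally show ?thesis .
qed
have sgle: "sg<=d$i - c$i" for i
proof -
 have "\<theta> * (d$i - c$i)<=1 * (d$i - c$i)" using \<theta> cd[of i] by (intro mult_right_mono) auto
 thus ?thesis using order_trans[OF sgi[of i]] by simp
qed
have "2/3<=(1 - \<theta>)^CARD('n)"
proof -
 have "1 + real CARD('n) * (- \<theta>)<=(1 + (- \<theta>))^CARD('n)" by (rule Bernoulli_inequality) (use \<theta> in auto)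
 thus ?thesis using n by (simp add: \<theta>_def n_def)
qed
moreover have "0<=(PROD i:UNIV. d$i - c$i)" using cd by (intro prod_nonneg) (auto simp: less_imp_le)
ultimately have "2/3 * (PROD i:UNIV. d$i - c$i)<=(1 - \<theta>)^CARD('n) * (PROD i:UNIV. d$i - c$i)" by (rule mult_right_mono)
also have "... = (PROD i:UNIV. (1 - \<theta>) * (d$i - c$i))" by (simp add: prod.distrib)
also have "... <= (PROD i:UNIV. (d - (\<chi> i. sg))$i - c$i)"
proof (rule prod_mono)
 fix i
 show "0<=(1 - \<theta>) * (d$i - c$i) & (1 - \<theta>) * (d$i - c$i)<=(d - (\<chi> i. sg))$i - c$i"
 using sgi[of i] \<theta> mult_nonneg_nonneg[of "1 - \<theta>" "d$i - c$i"] cd[of i] by (auto simp: algebra_simps)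
qed
finally have "2/3 * (PROD i:UNIV. d$i - c$i)<=(PROD i:UNIV. (d - (\<chi> i. sg))$i - c$i)" .
moreover have "cbox c d ~= {}" using cd by (auto simp: interval_ne_empty_cart less_imp_le)
moreover have "cbox c (d - (\<chi> i. sg)) ~= {}" using sgle by (auto simp: interval_ne_empty_cart algebra_simps)
ultimately show ?thesis using sg sgle by (intro exI[of _ sg]) (simp add: content_cbox_cart)
qed

text \<open>Fubini over pairs of a starting point in the smaller box and a parameter
  \<open>s\<close>. For each starting point at least 3/4 of the parameters are good; for each
  parameter the good starting points are carried by a translation into the good points of the
  box.\<close>

theorem nondivergence: "EX et>0. ALL c d. (ALL i. c$i < d$i) --> (EX T0>0. ALL T>=T0.
 vol (cbox c d) / 2<=vol (cbox c d Int {y. good_at et T y}))"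
proof -
obtain et where et: "et > 0" and gc: "!!K0 sg. compact K0 ==> sg > 0 ==> (EX T0>0. ALL T>=T0. ALL w:K0.
 EX B:sets lborel. emeasure lborel B<=ennreal (sg / 4) & (ALL s:{0..<sg} - B. good_at et T (w + curve s)))"
 using good_on_curves by blast
have "EX T0>0. ALL T>=T0. vol (cbox c d) / 2<=vol (cbox c d Int {y. good_at et T y})"
 if cd: "ALL i. c$i < d$i" for c d
proof -
 obtain sg where sg: "sg > 0" "sg<=1" "!!i. sg<=d$i - c$i"
 "2/3 * vol (cbox c d)<=vol (cbox c (d - (\<chi> i. sg)))" using shrink_measure[of c d] cd by blast
 define Din where "Din=cbox c (d - (\<chi> i. sg))"
 obtain T0 where T0: "T0 > 0" "!!T w. T >= T0 ==> w:cbox c d ==>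
 EX B:sets lborel. emeasure lborel B<=ennreal (sg / 4) & (ALL s:{0..<sg} - B. good_at et T (w + curve s))"
 using gc[OF compact_cbox sg(1), of c d] by blast
 have "vol (cbox c d) / 2<=vol (cbox c d Int {y. good_at et T y})" if T: "T >= T0" for T
 proof -
 define G where "G={y. good_at et T y}"
 have Gb [measurable]: "G:sets borel" using closed_good[of et T] by (simp add: G_def borel_closed)
 have [measurable]: "curve:borel_measurable borel" by (rule borel_measurable_continuous_onI[OF continuous_curve])
 have [measurable]: "Din:sets borel" by (simp add: Din_def)
 define S where "S={p:space (lborel \<Otimes>\<^sub>M lborel). fst p:Din & snd p:{0..<sg} & fst p + curve (snd p):G}"
 have S: "S:sets ((lborel :: (real^'n) measure) \<Otimes>\<^sub>M (lborel :: real measure))" unfolding S_def by measurable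
 have Dsub: "y + curve s:cbox c d" if "y:Din" "s:{0..<sg}" for y s
 proof -
  have "0<=curve s$i & curve s$i<=sg" for i
  proof (cases "i:J")
  case True
  have "s^expo i<=s^1" using that sg(2) by (intro power_decreasing) (auto simp: Suc_leI)
  thus ?thesis using True that by (simp add: curve_nth)
  qed (use sg in \<open>simp add: curve_nth\<close>)
  moreover have "c$i<=y$i & y$i<=d$i - sg" for i using that(1) by (simp add: Din_def mem_box_cart)
  ultimately have "c$i<=y$i + curve s$i & y$i + curve s$i<=d$i" for i by (smt (verit))
  thus ?thesis by (simp add: mem_box_cart)
 qed
 have "ennreal (3/4 * sg) * emeasure lborel Din<=emeasure (lborel \<Otimes>\<^sub>M lborel) S"
 proof -
  have low: "ennreal (3/4 * sg)<=emeasure lborel (Pair y -` S)" if y: "y:Din" for y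
  proof -
  have "y:cbox c d" using Dsub[OF y, of 0] sg(1) by (simp add: curve_0)
  then obtain B where B: "B:sets lborel" "emeasure lborel B<=ennreal (sg / 4)"
   "ALL s:{0..<sg} - B. good_at et T (y + curve s)" using T0(2)[OF T] by blast
  have ps: "Pair y -` S:sets lborel" using sets_Pair1[OF S] by simp
  have "{0..<sg}<=Pair y -` S Un B" using B(3) y by (auto simp: S_def G_def space_pair_measure)
  hence "emeasure lborel {0..<sg}<=emeasure lborel (Pair y -` S Un B)" using ps B(1) by (intro emeasure_mono) auto
  also have "... <= emeasure lborel (Pair y -` S) + emeasure lborel B" using ps B(1) by (intro emeasure_subadditive) auto
  also have "... <= emeasure lborel (Pair y -` S) + ennreal (sg / 4)" using B(2) by (intro add_left_mono)
  finally have "ennreal sg<=emeasure lborel (Pair y -` S) + ennreal (sg / 4)" using sg(1) by simp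
  moreover have "ennreal sg=ennreal (3/4 * sg) + ennreal (sg / 4)"
   using sg(1) by (subst ennreal_plus[symmetric]) auto
  ultimately have "ennreal (sg / 4) + ennreal (3/4 * sg)<=ennreal (sg / 4) + emeasure lborel (Pair y -` S)"
   by (simp only: add.commute)
  thus ?thesis unfolding ennreal_add_left_cancel_le by simp
  qed
  have "(\<integral>\<^sup>+y. ennreal (3/4 * sg) * indicator Din y \<partial>lborel)<=(\<integral>\<^sup>+y. emeasure lborel (Pair y -` S) \<partial>lborel)"
  proof (rule nn_integral_mono)
  fix y
  show "ennreal (3/4 * sg) * indicator Din y<=emeasure lborel (Pair y -` S)" using low[of y] by (cases "y:Din") simp_all
  qed
  also have "... = emeasure (lborel \<Otimes>\<^sub>M lborel) S" by (rule lborel.emeasure_pair_measure_alt[OF S, symmetric])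
  finally show ?thesis by (simp add: nn_integral_cmult_indicator)
 qed
 also have "emeasure (lborel \<Otimes>\<^sub>M lborel) S=(\<integral>\<^sup>+s. emeasure lborel ((%y. (y, s)) -` S) \<partial>lborel)"
  by (rule lborel_pair.emeasure_pair_measure_alt2[OF S])
 also have "... <= (\<integral>\<^sup>+s. emeasure lborel (cbox c d Int G) * indicator {0..<sg} s \<partial>lborel)"
 proof (rule nn_integral_mono)
  fix s
  show "emeasure lborel ((%y. (y, s)) -` S)<=emeasure lborel (cbox c d Int G) * indicator {0..<sg} s"
  proof (cases "s:{0..<sg}")
  case True
  have "(%y. (y, s)) -` S<=(%y. curve s + y) -` (cbox c d Int G)" using Dsub True by (auto simp: S_def add.commute)
  hence "emeasure lborel ((%y. (y, s)) -` S)<=emeasure lborel ((%y. curve s + y) -` (cbox c d Int G) Int space lborel)"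
   by (intro emeasure_mono) (auto simp: measurable_sets_borel)
  also have "... = emeasure (distr lborel borel ((+) (curve s))) (cbox c d Int G)" by (subst emeasure_distr) auto
  finally show ?thesis using True by (simp add: lborel_distr_plus)
  next
  case False
  hence "(%y. (y, s)) -` S={}" by (auto simp: S_def)
  thus ?thesis by simp
  qed
 qed
 also have "... = emeasure lborel (cbox c d Int G) * ennreal sg"
  using sg(1) by (subst nn_integral_cmult_indicator) auto
 finally have main: "ennreal (3/4 * sg) * emeasure lborel Din<=emeasure lborel (cbox c d Int G) * ennreal sg" .
 have fin: "emeasure lborel (cbox c d Int G) ~= \<infinity>"
  using emeasure_mono[of "cbox c d Int G" "cbox c d" lborel] emeasure_lborel_cbox_finite[of c d] by (auto simp: top_unique)
 have e1: "emeasure lborel Din=ennreal (vol Din)" by (rule emeasure_eq_ennreal_measure)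
  (use emeasure_lborel_cbox_finite[of c "d - (\<chi> i. sg)"] in \<open>simp add: Din_def less_top\<close>)
 have e2: "emeasure lborel (cbox c d Int G)=ennreal (vol (cbox c d Int G))"
  by (rule emeasure_eq_ennreal_measure) (use fin in simp)
 have "3/4 * sg * vol Din<=vol (cbox c d Int G) * sg"
  using main sg(1) unfolding e1 e2 by (simp add: ennreal_mult[symmetric] ennreal_le_iff)
 hence "3/4 * vol Din<=vol (cbox c d Int G)" using sg(1) by (simp add: field_simps)
 thus ?thesis using sg(4) by (simp add: Din_def G_def)
 qed
 thus ?thesis using T0(1) by blast
qed
with et show ?thesis by blast
qed

end

section \<open>Short vectors and integer points of the quadric\<close>

lemma finite_bounded_intvec: "finite {z :: real^'n. intvec z & (ALL i. abs (z$i)<=R)}"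
proof (rule finite_subset)
let ?K = "\<lceil>R\<rceil>"
show "{z :: real^'n. intvec z & (ALL i. abs (z$i)<=R)}<=(%f. \<chi> i. real_of_int (f i)) ` (PiE UNIV (%_::'n. {-?K..?K}))"
proof
 fix z :: "real^'n" assume z: "z:{z. intvec z & (ALL i. abs (z$i)<=R)}"
 have fl: "real_of_int \<lfloor>z$i\<rfloor> = z$i" for i
 proof -
 have "z$i:\<int>" using z by (simp add: intvec_def)
 thus ?thesis by (metis Ints_cases floor_of_int)
 qed
 have "\<lfloor>z$i\<rfloor> : {-?K..?K}" for i
 proof -
 have "abs (z$i)<=R" using z by simp
 hence "real_of_int \<lfloor>z$i\<rfloor> <= real_of_int ?K" "- real_of_int ?K<=real_of_int \<lfloor>z$i\<rfloor>"
  using fl[of i] le_of_int_ceiling[of R] by linarith+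
 thus ?thesis unfolding atLeastAtMost_iff by linarith
 qed
 hence "(%i. \<lfloor>z$i\<rfloor>):PiE UNIV (%_. {-?K..?K})" by auto
 moreover have "z=(\<chi> i. real_of_int ((%i. \<lfloor>z$i\<rfloor>) i))" by (simp only: fl vec_lambda_eta)
 ultimately show "z:(%f. \<chi> i. real_of_int (f i)) ` (PiE UNIV (%_::'n. {-?K..?K}))"
 by (intro image_eqI[where x = "%i. \<lfloor>z$i\<rfloor>"]) auto
qed
qed (intro finite_imageI finite_PiE; simp)

lemma finite_bounded_intvec_norm: "finite {z :: real^'n. intvec z & norm z<=R}"
by (rule finite_subset[OF _ finite_bounded_intvec[of R]]) (auto intro: order_trans[OF component_le_norm_cart])

lemma intvec_ops: "intvec x ==> intvec y ==> intvec (x + y)" "intvec x ==> intvec y ==> intvec (x - y)"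
"intvec x ==> intvec (- x)" "intvec 0" by (auto simp: intvec_def)

lemma card_floor_range:
assumes "r > 0" "R >= 0"
shows "real (card {\<lfloor>- R / r\<rfloor>..\<lfloor>R / r\<rfloor>})<=2 * R / r + 2"
proof -
have "\<lfloor>- R / r\<rfloor> <= \<lfloor>R / r\<rfloor>" using assms by (intro floor_mono) (simp add: divide_right_mono)
hence "real (card {\<lfloor>- R / r\<rfloor>..\<lfloor>R / r\<rfloor>})=real_of_int \<lfloor>R / r\<rfloor> - real_of_int \<lfloor>- R / r\<rfloor> + 1" by simp
also have "... <= R / r - (- R / r - 1) + 1" using of_int_floor_le[of "R / r"] floor_correct[of "- R / r"] by linarith
also have "... = 2 * R / r + 2" by (simp add: field_simps)
finally show ?thesis .
qed

lemma packing:
fixes P :: "(real^'n) set" and r R :: real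
assumes r: "r > 0" and R: "R >= 0"
 and b: "!!p i. p:P ==> i:I ==> abs (p$i)<=R"
 and sep: "!!p p'. p:P ==> p':P ==> p ~= p' ==> EX i:I. r<=abs (p$i - p'$i)"
shows "finite P" "real (card P)<=(2 * R / r + 2)^card I"
proof -
define f where "f=(%p :: real^'n. restrict (%i. \<lfloor>p$i / r\<rfloor>) I)"
let ?S = "PiE I (%_. {\<lfloor>- R / r\<rfloor>..\<lfloor>R / r\<rfloor>})"
have inj: "inj_on f P"
proof (rule inj_onI, rule ccontr)
 fix p p' assume pp: "p:P" "p':P" "f p=f p'" "p ~= p'"
 obtain i where i: "i:I" "r<=abs (p$i - p'$i)" using sep[OF pp(1,2,4)] by blast
 have "\<lfloor>p$i / r\<rfloor> = \<lfloor>p'$i / r\<rfloor>" using fun_cong[OF pp(3), of i] i(1) by (simp add: f_def)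
 hence "abs (p$i / r - p'$i / r) < 1" using floor_correct[of "p$i / r"] floor_correct[of "p'$i / r"] by linarith
 hence "abs (p$i - p'$i) < r" using r by (simp add: diff_divide_distrib[symmetric] divide_less_eq)
 with i show False by simp
qed
have im: "f ` P <= ?S"
proof
 fix g assume "g:f ` P"
 then obtain p where p: "p:P" "g=f p" by blast
 have "\<lfloor>p$i / r\<rfloor> : {\<lfloor>- R / r\<rfloor>..\<lfloor>R / r\<rfloor>}" if "i:I" for i
 using b[OF p(1) that] r divide_right_mono[of "- R" "p$i" r] divide_right_mono[of "p$i" R r] by (auto intro!: floor_mono)
 thus "g : ?S" unfolding p(2) f_def by (auto simp: restrict_def)
qed
have fS: "finite ?S" by (rule finite_PiE) auto
show "finite P" using inj im fS by (meson finite_imageD finite_subset)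
have "card P<=card ?S" using card_mono[OF fS im] card_image[OF inj] by simp
also have "card ?S=card {\<lfloor>- R / r\<rfloor>..\<lfloor>R / r\<rfloor>} ^ card I" by (subst card_PiE) auto
finally have "real (card P)<=real (card {\<lfloor>- R / r\<rfloor>..\<lfloor>R / r\<rfloor>})^card I" by (metis of_nat_le_iff of_nat_power)
also have "... <= (2 * R / r + 2)^card I" by (rule power_mono[OF card_floor_range[OF r R]]) simp
finally show "real (card P)<=(2 * R / r + 2)^card I" .
qed

text \<open>The most populated cell of side \<open>r\<close> holds at least the average number of
  points.\<close>

lemma pigeonhole_cells:
fixes P :: "(real^'n) set" and f :: "real^'n => real^'n" and B :: "'n => real" and r :: real
assumes P: "finite P" "P ~= {}" and r: "r > 0" and B: "!!i. B i >= 0"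
 and b: "!!p i. p:P ==> abs (f p$i)<=B i"
shows "EX p0:P. real (card P)<=(PROD i:UNIV. 2 * B i / r + 2) * card {p:P. ALL i. abs (f p$i - f p0$i) < r}"
proof -
define g where "g=(%p i. \<lfloor>f p$i / r\<rfloor>)"
let ?S = "PiE UNIV (%i. {\<lfloor>- B i / r\<rfloor>..\<lfloor>B i / r\<rfloor>})"
have im: "g ` P <= ?S"
proof
 fix h assume "h:g ` P"
 then obtain p where p: "p:P" "h=g p" by blast
 have "\<lfloor>f p$i / r\<rfloor> : {\<lfloor>- B i / r\<rfloor>..\<lfloor>B i / r\<rfloor>}" for i
 using b[OF p(1), of i] r divide_right_mono[of "- B i" "f p$i" r] divide_right_mono[of "f p$i" "B i" r]
 by (auto intro!: floor_mono)
 thus "h : ?S" unfolding p(2) g_def by auto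
qed
have fS: "finite ?S" by (rule finite_PiE) auto
have "card (g ` P)<=card ?S" by (rule card_mono[OF fS im])
also have "card ?S=(PROD i:UNIV. card {\<lfloor>- B i / r\<rfloor>..\<lfloor>B i / r\<rfloor>})" by (rule card_PiE) simp
finally have "real (card (g ` P))<=real (PROD i:UNIV. card {\<lfloor>- B i / r\<rfloor>..\<lfloor>B i / r\<rfloor>})" by (rule of_nat_mono)
hence "real (card (g ` P))<=(PROD i:UNIV. real (card {\<lfloor>- B i / r\<rfloor>..\<lfloor>B i / r\<rfloor>}))"
 by (simp only: of_nat_prod)
also have "... <= (PROD i:UNIV. 2 * B i / r + 2)"
 by (rule prod_mono) (simp only: of_nat_0_le_iff card_floor_range[OF r B] simp_thms)
finally have cg: "real (card (g ` P))<=(PROD i:UNIV. 2 * B i / r + 2)" .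
define m where "m=Max ((%y. card {p:P. g p=y}) ` g ` P)"
have fin: "finite ((%y. card {p:P. g p=y}) ` g ` P)" using P(1) by simp
have "m:(%y. card {p:P. g p=y}) ` g ` P" unfolding m_def by (rule Max_in[OF fin]) (use P in simp)
then obtain p0 where p0: "p0:P" "m=card {p:P. g p=g p0}" by blast
have "card P=(SUM y:g ` P. card {p:P. g p=y})" using sum.image_gen[OF P(1), of "%_. 1::nat" g] by simp
also have "... <= (SUM y:g ` P. m)" by (rule sum_mono) (auto simp: m_def intro!: Max_ge[OF fin])
finally have "card P<=card (g ` P) * m" by simp
hence "real (card P)<=real (card (g ` P)) * real m" by (metis of_nat_le_iff of_nat_mult)
also have "... <= (PROD i:UNIV. 2 * B i / r + 2) * real m" using cg by (rule mult_right_mono) simp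
also have "... <= (PROD i:UNIV. 2 * B i / r + 2) * card {p:P. ALL i. abs (f p$i - f p0$i) < r}"
proof (rule mult_left_mono)
 have "abs (f p$i - f p0$i) < r" if "g p=g p0" for p i
 proof -
 have "\<lfloor>f p$i / r\<rfloor> = \<lfloor>f p0$i / r\<rfloor>" using fun_cong[OF that, of i] by (simp add: g_def)
 hence "abs (f p$i / r - f p0$i / r) < 1" using floor_correct[of "f p$i / r"] floor_correct[of "f p0$i / r"] by linarith
 thus ?thesis using r by (simp add: diff_divide_distrib[symmetric] divide_less_eq)
 qed
 hence "{p:P. g p=g p0}<={p:P. ALL i. abs (f p$i - f p0$i) < r}" by blast
 thus "real m<=real (card {p:P. ALL i. abs (f p$i - f p0$i) < r})" unfolding p0(2) using P(1) by (simp add: card_mono)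
 show "0<=(PROD i:UNIV. 2 * B i / r + 2)" using B r by (intro prod_nonneg) (simp add: add_nonneg_nonneg)
qed
finally show ?thesis using p0(1) by blast
qed

lemma card_int_box: "finite {z :: real^'n. intvec z & (ALL i. 0<=z$i & z$i<=real K)}"
"card {z :: real^'n. intvec z & (ALL i. 0<=z$i & z$i<=real K)}=(K + 1)^CARD('n)"
proof -
let ?F = "%f :: 'n => nat. (\<chi> i. real (f i))"
let ?P = "PiE UNIV (%_::'n. {0..K})"
have eq: "{z :: real^'n. intvec z & (ALL i. 0<=z$i & z$i<=real K)} = ?F ` ?P"
proof
 show "{z :: real^'n. intvec z & (ALL i. 0<=z$i & z$i<=real K)} <= ?F ` ?P"
 proof
 fix z :: "real^'n" assume z: "z:{z. intvec z & (ALL i. 0<=z$i & z$i<=real K)}"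
 have "EX k. z$i=real k & k<=K" for i
 proof -
  have "z$i:\<int>" using z by (simp add: intvec_def)
  then obtain m where m: "z$i = of_int m" by (rule Ints_cases)
  moreover have "0<=z$i" "z$i<=real K" using z by auto
  ultimately show ?thesis by (intro exI[of _ "nat m"]) auto
 qed
 hence "ALL i. EX k. z$i=real k & k<=K" by blast
 from choice[OF this] obtain f where f: "!!i. z$i=real (f i) & f i<=K" by blast
 hence "z = ?F f" by (simp add: vec_eq_iff)
 moreover have "f : ?P" using f by auto
 ultimately show "z : ?F ` ?P" by blast
 qed
qed (auto simp: intvec_def PiE_def Pi_def)
have inj: "inj_on ?F ?P" by (auto simp: inj_on_def vec_eq_iff fun_eq_iff)
show "finite {z :: real^'n. intvec z & (ALL i. 0<=z$i & z$i<=real K)}" unfolding eq by (intro finite_imageI finite_PiE) auto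
show "card {z :: real^'n. intvec z & (ALL i. 0<=z$i & z$i<=real K)}=(K + 1)^CARD('n)"
 unfolding eq card_image[OF inj] by (subst card_PiE) auto
qed

text \<open>On a hyperplane the coordinate with the largest coefficient of \<open>h\<close> changes
  by no more than the sum of the changes of the others. So the points stay separated when it is
  forgotten, and the count loses one power of \<open>R\<close>.\<close>

lemma hyperplane_points:
fixes P :: "(real^'n) set" and et R :: real
assumes h: "h ~= 0" "!!x. x:P ==> h \<bullet> x=0" and et: "et > 0" and R: "R >= et"
 and b: "!!x. x:P ==> norm x<=R"
 and sep: "!!x y. x:P ==> y:P ==> x ~= y ==> et<=norm (x - y)"
shows "finite P" "real (card P)<=(6 * CARD('n) * R / et)^(CARD('n) - 1)"
proof -
define n where "n=real CARD('n)"
have n: "n >= 1" by (simp add: n_def Suc_leI)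
define i0 where "i0=(SOME i. ALL j. abs (h$j)<=abs (h$i))"
have i0: "abs (h$j)<=abs (h$i0)" for j
proof -
 have fin: "finite (range (%i. abs (h$i)))" by simp
 have "Max (range (%i. abs (h$i))):range (%i. abs (h$i))" by (rule Max_in[OF fin]) simp
 then obtain i where "Max (range (%i. abs (h$i)))=abs (h$i)" by (rule imageE)
 hence "EX i. ALL j. abs (h$j)<=abs (h$i)" by (metis Max_ge fin rangeI)
 from someI_ex[OF this] show ?thesis unfolding i0_def by blast
qed
have hi: "abs (h$i0) > 0"
proof (rule ccontr)
 assume "~ ?thesis"
 hence "h$j=0" for j using i0[of j] by linarith
 thus False using h(1) by (simp add: vec_eq_iff)
qed
define r where "r=et / (2 * n)"
have r: "r > 0" using et n by (simp add: r_def)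
have sep': "EX i:-{i0}. r<=abs (x$i - y$i)" if xy: "x:P" "y:P" "x ~= y" for x y
proof (rule ccontr)
 assume "~ ?thesis"
 hence small: "abs (x$i - y$i) < r" if "i ~= i0" for i using that by force
 define v where "v=x - y"
 define s where "s=(SUM i:-{i0}. abs (v$i))"
 have sle: "s<=n * r"
 proof -
 have "s<=(SUM i:-{i0}. r)" unfolding s_def v_def using small by (intro sum_mono) (auto simp: less_imp_le)
 also have "... <= n * r" using r by (simp add: n_def Compl_eq_Diff_UNIV card_Diff_subset mult_right_mono)
 finally show ?thesis .
 qed
 have "h \<bullet> v=0" using h(2) xy by (simp add: v_def inner_diff_right)
 hence "h$i0 * v$i0 + (SUM i:-{i0}. h$i * v$i)=0"
 unfolding inner_vec_def by (simp add: sum.remove[of UNIV i0] Compl_eq_Diff_UNIV)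
 hence "abs (h$i0) * abs (v$i0)=abs (SUM i:-{i0}. h$i * v$i)" by (simp add: abs_mult[symmetric])
 also have "... <= (SUM i:-{i0}. abs (h$i0) * abs (v$i))"
 by (rule order_trans[OF sum_abs]) (auto simp: abs_mult intro!: sum_mono mult_right_mono i0)
 also have "... = abs (h$i0) * s" by (simp add: s_def sum_distrib_left)
 finally have "abs (v$i0)<=s" using hi by simp
 moreover have "norm v<=abs (v$i0) + s"
 using norm_le_l1_cart[of v] by (simp add: s_def sum.remove[of UNIV i0] Compl_eq_Diff_UNIV)
 ultimately have nv: "norm v<=2 * s" by simp
 show False
 proof (cases "v=0")
 case True thus False using xy by (simp add: v_def)
 next
 case False
 have "s < n * r \<or> CARD('n)=1"
 proof (cases "-{i0}=({} :: 'n set)")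
  case True
  hence "s=0" by (simp add: s_def)
  thus ?thesis using n r by simp
 next
  case False
  have "s < (SUM i:-{i0}. r)" unfolding s_def v_def using small False by (intro sum_strict_mono) auto
  also have "... <= n * r" using r by (simp add: n_def Compl_eq_Diff_UNIV card_Diff_subset mult_right_mono)
  finally show ?thesis by simp
 qed
 moreover have "s=0" if "CARD('n)=1"
 proof -
  have "card (-{i0} :: 'n set)=0" using that by (simp add: Compl_eq_Diff_UNIV card_Diff_subset)
  thus ?thesis by (simp add: s_def)
 qed
 ultimately have "s < n * r" using n r by (cases "CARD('n)=1") auto
 hence "norm v < 2 * (n * r)" using nv by simp
 also have "... = et" using n by (simp add: r_def)
 finally show False using sep[OF xy] by (simp add: v_def)
 qed
qed
have b': "abs (p$i)<=R" if "p:P" "i : -{i0}" for p i using b[OF that(1)] component_le_norm_cart[of p i] by linarith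
have R0: "R >= 0" using R et by linarith
show "finite P" by (rule packing(1)[OF r R0 b' sep'])
have "real (card P)<=(2 * R / r + 2)^card (-{i0})" by (rule packing(2)[OF r R0 b' sep'])
also have "card (-{i0})=CARD('n) - 1" by (simp add: Compl_eq_Diff_UNIV card_Diff_subset)
also have "(2 * R / r + 2)^(CARD('n) - 1)<=(6 * CARD('n) * R / et)^(CARD('n) - 1)"
proof (rule power_mono)
 define q where "q=n * R / et"
 have q1: "1<=q" using mult_mono[of 1 n 1 "R / et"] n R et by (simp add: q_def)
 have q2: "2 * R / r=4 * q" using et n by (simp add: r_def q_def)
 have q3: "6 * CARD('n) * R / et=6 * q" by (simp add: n_def q_def)
 show "2 * R / r + 2<=6 * CARD('n) * R / et" unfolding q2 q3 using q1 by simp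
 show "0<=2 * R / r + 2" using R0 r by simp
qed
finally show "real (card P)<=(6 * CARD('n) * R / et)^(CARD('n) - 1)" .
qed

text \<open>Does the work of Minkowski's second theorem, with \<open>R\<close> independent of the
  lattice: a ball of radius \<open>R\<close> contains at least \<open>c * R^n\<close> lattice
  vectors, more than a hyperplane can hold, so these vectors span.\<close>

theorem short_independent_vectors:
fixes et c :: real
assumes et: "et > 0" and c: "c > 0"
shows "EX R>0. ALL A :: real^'n^'n. det A ~= 0 --> (ALL z. intvec z --> z ~= 0 --> et<=norm (A *v z)) -->
 (ALL R>=1. EX F. finite F & c * R^CARD('n)<=card F & (ALL z:F. intvec z & norm (A *v z)<=R)) -->
 (EX Z :: real^'n^'n. det Z ~= 0 & (ALL i j. Z$i$j:\<int>) & (ALL j. norm (A *v column j Z)<=R))"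
proof -
define n where "n=CARD('n)"
have n: "n >= 1" by (simp add: n_def Suc_leI)
\<comment> \<open>Chosen so that \<open>c * R\<close> exceeds the constant
  \<open>(6 * n / et)^(n - 1)\<close> of \<open>hyperplane_points\<close>.\<close>
define R where "R=max 1 et + ((6 * real n / et)^(n - 1) + 1) / c"
have RR: "((6 * real n / et)^(n - 1) + 1) / c >= 0" using et c by (simp add: add_nonneg_nonneg)
have R: "R > 0" "R >= et" "R >= 1" using RR et unfolding R_def by linarith+
have "EX Z :: real^'n^'n. det Z ~= 0 & (ALL i j. Z$i$j:\<int>) & (ALL j. norm (A *v column j Z)<=R)"
 if dA: "det A ~= 0" and short: "ALL z. intvec z --> z ~= 0 --> et<=norm (A *v z)"
 and many: "ALL R>=1. EX F. finite F & c * R^CARD('n)<=card F & (ALL z:F. intvec z & norm (A *v z)<=R)"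
 for A :: "real^'n^'n"
proof -
 define Zs where "Zs={z :: real^'n. intvec z & norm (A *v z)<=R}"
 have "span ((*v) A ` Zs)=UNIV"
 proof (rule ccontr)
 assume "span ((*v) A ` Zs) ~= UNIV"
 then obtain h where h: "h ~= 0" "!!x. x:span ((*v) A ` Zs) ==> h \<bullet> x=0" using span_not_UNIV_orthogonal by blast
 let ?P = "(*v) A ` Zs"
 have injA: "inj ((*v) A)" using dA by (simp add: inj_matrix_vector_mult invertible_det_nz)
 have hp: "h \<bullet> x=0" if "x : ?P" for x using h(2)[OF span_base[OF that]] .
 have bp: "norm x<=R" if "x : ?P" for x using that by (auto simp: Zs_def)
 have sp: "et<=norm (x - y)" if xy: "x : ?P" "y : ?P" "x ~= y" for x y
 proof -
  obtain u v where uv: "x=A *v u" "y=A *v v" "intvec u" "intvec v" using xy by (auto simp: Zs_def)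
  hence "u - v ~= 0" using xy(3) by auto
  thus ?thesis using short uv intvec_ops(2)[of u v] by (simp add: matrix_vector_mult_diff_distrib[symmetric])
 qed
 have fP: "finite ?P" by (rule hyperplane_points(1)[OF h(1) hp et R(2) bp sp])
 have cP: "real (card ?P)<=(6 * CARD('n) * R / et)^(CARD('n) - 1)"
  by (rule hyperplane_points(2)[OF h(1) hp et R(2) bp sp])
 have injZ: "inj_on ((*v) A) Zs" using injA inj_on_subset by blast
 have cZ: "card ?P=card Zs" by (rule card_image[OF injZ])
 have fZ: "finite Zs" using fP injZ by (rule finite_imageD)
 obtain F where F: "finite F" "c * R^n<=card F" "ALL z:F. intvec z & norm (A *v z)<=R"
  using many R(3) unfolding n_def by blast
 have "F<=Zs" using F(3) by (auto simp: Zs_def)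
 hence "card F<=card Zs" by (rule card_mono[OF fZ])
 hence "c * R^n<=real (card ?P)" using F(2) cZ by linarith
 also have "... <= (6 * n * R / et)^(n - 1)" using cP by (simp add: n_def)
 also have "... = (6 * n / et)^(n - 1) * R^(n - 1)" by (simp add: power_mult_distrib power_divide)
 also have "... < (c * R) * R^(n - 1)"
 proof (rule mult_strict_right_mono)
  have "c * (X / c)=X" for X using c by simp
  hence "c * (max 1 et) + ((6 * real n / et)^(n - 1) + 1)=c * R" unfolding R_def distrib_left by (simp only:)
  moreover have "0<=c * max 1 et" using c by simp
  ultimately show "(6 * n / et)^(n - 1) < c * R" by simp
 qed (use R in simp)
 also have "... = c * R^n" using n by (cases n) auto
 finally show False by simp
 qed
 hence spZ: "span ((*v) A ` Zs)=UNIV" .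
 obtain B where B: "B<=(*v) A ` Zs" "independent B" "(*v) A ` Zs<=span B" using maximal_independent_subset by blast
 have spB: "span B=UNIV" using spZ B(3) by (metis span_mono span_span top.extremum_uniqueI)
 have "card B=dim (UNIV :: (real^'n) set)" using dim_span_eq_card_independent[OF B(2)] spB by simp
 from family_of_basis[OF B(2) this spB] obtain X where X: "!!i. i:initial (dim (UNIV :: (real^'n) set)) ==> X i:B"
 "indep_fam (initial (dim (UNIV :: (real^'n) set))) X" by blast
 have ini: "initial (dim (UNIV :: (real^'n) set))=(UNIV :: 'n set)" by (simp add: initial_full)
 have "ALL i. EX z. z:Zs & X i=A *v z" using X(1) B(1) unfolding ini by blast
 from choice[OF this] obtain z where z: "!!i. z i:Zs" "!!i. X i=A *v z i" by blast
 define Z :: "real^'n^'n" where "Z=transpose (\<chi> j. z j)"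
 have col: "column j Z=z j" for j by (simp add: Z_def column_def transpose_def vec_eq_iff)
 have "det Z ~= 0"
 proof -
 have "indep_fam UNIV (%i. (\<chi> j. z j)$i)" unfolding indep_fam_def
 proof (intro allI impI ballI)
  fix f i assume "(SUM i:UNIV. f i *\<^sub>R (\<chi> j. z j)$i)=0"
  hence "A *v (SUM i:UNIV. f i *\<^sub>R z i)=0" by simp
  hence s: "(SUM i:UNIV. f i *\<^sub>R X i)=0"
  by (simp add: z(2) linear_sum[OF matrix_vector_mul_linear] matrix_vector_mult_scaleR)
  show "f i=0" using mp[OF spec[OF X(2)[unfolded ini indep_fam_def], of f] s] by blast
 qed
 thus ?thesis by (simp add: Z_def det_transpose det_nonzero_rows)
 qed
 moreover have "Z$i$j:\<int>" for i j using z(1)[of j] by (simp add: Z_def transpose_def Zs_def intvec_def)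
 moreover have "norm (A *v column j Z)<=R" for j using z(1)[of j] by (simp add: col Zs_def)
 ultimately show ?thesis by blast
qed
with R(1) show ?thesis by blast
qed

context chart
begin

lemma prod_flow_weights:
assumes "T ~= 0"
shows "(PROD i:UNIV. if i=a then 1 / T else if i=b then T else (1 :: real))=1"
proof -
have "(PROD i:UNIV. if i=a then 1 / T else if i=b then T else (1 :: real))=(1 / T) * (PROD i:UNIV - {a}. if i=b then T else 1)"
 by (subst prod.remove[of UNIV a]) (auto intro!: prod.cong)
also have "(PROD i:UNIV - {a}. if i=b then T else 1)=T" using ab by simp
finally show ?thesis using assms by simp
qed

text \<open>Pigeonhole for the images of an integer cube of side about \<open>R * T\<close>. They
  lie in a box whose sides have weights \<open>1 / T\<close>, \<open>T\<close> and 1, with product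
  1, so the number of cells is of order \<open>T^n\<close>; the differences within one cell are the
  short vectors.\<close>

lemma many_lattice_points:
assumes W: "W >= 0"
shows "EX c>0. ALL T w R. 1<=T --> (ALL j. abs (w$j)<=W) --> 1<=R -->
 (EX F. finite F & c * R^CARD('n)<=real (card F) & (ALL z:F. intvec z & norm (hmat T w *v z)<=R))"
proof -
define n where "n=real CARD('n)"
have n: "n >= 1" by (simp add: n_def Suc_leI)
define C0 where "C0=(SUM i:UNIV. SUM j:UNIV. abs (Linv$i$j))"
have C0: "C0 >= 0" by (simp add: C0_def sum_nonneg)
define B0 where "B0=(SUM j:J. abs (\<beta> j))"
have B0: "B0 >= 0" by (simp add: B0_def sum_nonneg)
define C1 where "C1=C0 * (1 + W + 2 * B0 * W + B0 * W\<^sup>2)"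
have C1: "C1 >= 0" using C0 B0 W by (simp add: C1_def)
define C2 where "C2=4 * n * C1 + 2"
have C2: "C2 > 0" using C1 n by (simp add: C2_def add_nonneg_pos)
have "EX F. finite F & (1 / C2^CARD('n)) * R^CARD('n)<=real (card F) & (ALL z:F. intvec z & norm (hmat T w *v z)<=R)"
 if T: "1<=T" and w: "ALL j. abs (w$j)<=W" and R: "1<=R" for T w R
proof -
 \<comment> \<open>The side is of order \<open>R * T\<close> and not \<open>R\<close>, so that even
   in direction \<open>a\<close>, where the flow contracts by \<open>T\<close>, the image extends
   over length \<open>R\<close>. This is what \<open>1<=T * wt i\<close> expresses when the additive
   2 in the number of cells is absorbed.\<close>
 define K where "K=nat \<lceil>R * T\<rceil>"
 have RT: "1<=R * T" using mult_mono[of 1 R 1 T] T R by simp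
 have K: "R * T<=real K" "real K<=2 * (R * T)" using RT by (simp_all add: K_def) linarith+
 define P where "P={z :: real^'n. intvec z & (ALL i. 0<=z$i & z$i<=real K)}"
 have fP: "finite P" and cP: "card P=(K + 1)^CARD('n)" unfolding P_def by (rule card_int_box)+
 have Pne: "P ~= {}" using cP by auto
 define wt where "wt=(%i. if i=a then 1 / T else if i=b then T else (1 :: real))"
 have wt: "wt i > 0" "1<=T * wt i" for i
 proof -
 have "1 * 1<=T * T" using T by (intro mult_mono) auto
 thus "wt i > 0" "1<=T * wt i" using T by (auto simp: wt_def)
 qed
 have pw: "(PROD i:UNIV. wt i)=1" unfolding wt_def by (rule prod_flow_weights) (use T in auto)
 define B where "B=(%i. C1 * K * wt i)"
 have B: "B i >= 0" for i using C1 wt(1)[of i] by (simp add: B_def)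
 have qb: "abs (qj w)<=B0 * W\<^sup>2"
 proof -
 have "abs (qj w)<=(SUM j:J. abs (\<beta> j) * W\<^sup>2)" unfolding qj_def
  by (rule order_trans[OF sum_abs]) (auto simp: abs_mult intro!: sum_mono mult_left_mono power2_le_iff_abs_le[THEN iffD2] W w[rule_format])
 thus ?thesis by (simp add: B0_def sum_distrib_right)
 qed
 have bound: "abs ((hmat T w *v p)$i)<=B i" if p: "p:P" for p i
 proof -
 define y where "y=Linv *v p"
 have yb: "abs (y$k)<=C0 * K" for k
 proof -
  have "abs (y$k)<=(SUM j:UNIV. abs (Linv$k$j) * K)" unfolding y_def matrix_vector_mult_def
  by (simp, rule order_trans[OF sum_abs]) (use p in \<open>auto simp: abs_mult P_def intro!: sum_mono mult_left_mono\<close>)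
  also have "... = (SUM j:UNIV. abs (Linv$k$j)) * K" by (simp add: sum_distrib_right)
  also have "... <= C0 * K" unfolding C0_def
  by (intro mult_right_mono member_le_sum[of k UNIV "%i. SUM j:UNIV. abs (Linv$i$j)"]) (auto intro: sum_nonneg)
  finally show ?thesis .
 qed
 define Y where "Y=C0 * K"
 have Y: "Y >= 0" using C0 by (simp add: Y_def)
 have bb: "abs (bil y w)<=B0 * (Y * W)"
 proof -
  have "abs (bil y w)<=(SUM j:J. abs (\<beta> j) * (Y * W))" unfolding bil_def mult.assoc
  by (rule order_trans[OF sum_abs]) (auto simp: abs_mult Y_def intro!: sum_mono mult_left_mono mult_mono mult_nonneg_nonneg yb w[rule_format] C0)
  thus ?thesis by (simp add: B0_def sum_distrib_right)
 qed
 have BY: "B i=Y * (1 + W + 2 * B0 * W + B0 * W\<^sup>2) * wt i" by (simp add: B_def C1_def Y_def)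
 have p0: "0<=Y * W" "0<=Y * (2 * B0 * W)" "0<=Y * (B0 * W\<^sup>2)" using Y B0 W by auto
 have tot: "Y * (1 + W + 2 * B0 * W + B0 * W\<^sup>2)=Y + Y * W + Y * (2 * B0 * W) + Y * (B0 * W\<^sup>2)" by (simp add: algebra_simps)
 consider "i=a" | "i=b" | "i:J" by (auto simp: J_ab)
 thus ?thesis
 proof cases
  case 1
  have "abs (y$a)<=Y * (1 + W + 2 * B0 * W + B0 * W\<^sup>2)" using yb[of a, folded Y_def] p0 tot by linarith
  thus ?thesis using 1 T unfolding BY by (simp add: hmat_mult flow_nth shear_nth y_def[symmetric] wt_def abs_divide divide_right_mono)
 next
  case 2
  have "abs (y$a * qj w)<=Y * (B0 * W\<^sup>2)" unfolding abs_mult using yb[of a] qb Y by (intro mult_mono) (auto simp: Y_def)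
  moreover have "abs (bil y w)<=Y * (B0 * W)" using bb by (simp add: mult.commute mult.left_commute)
  ultimately have "abs (y$b + 2 * bil y w - y$a * qj w)<=Y + Y * (2 * B0 * W) + Y * (B0 * W\<^sup>2)"
  using yb[of b, folded Y_def] by (simp add: abs_le_iff)
  hence "abs (y$b + 2 * bil y w - y$a * qj w)<=Y * (1 + W + 2 * B0 * W + B0 * W\<^sup>2)" using p0 tot by linarith
  hence "T * abs (y$b + 2 * bil y w - y$a * qj w)<=T * (Y * (1 + W + 2 * B0 * W + B0 * W\<^sup>2))" using T by simp
  thus ?thesis using 2 T ab unfolding BY by (simp add: hmat_mult flow_nth shear_nth y_def[symmetric] wt_def abs_mult mult.commute)
 next
  case 3
  have "abs (y$a * w$i)<=Y * W" unfolding abs_mult using yb[of a] w Y by (intro mult_mono) (auto simp: Y_def)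
  hence "abs (y$i - y$a * w$i)<=Y + Y * W" using yb[of i] unfolding Y_def[symmetric] by linarith
  hence "abs (y$i - y$a * w$i)<=Y * (1 + W + 2 * B0 * W + B0 * W\<^sup>2)" using p0 tot by linarith
  thus ?thesis using 3 unfolding BY by (simp add: hmat_mult flow_nth shear_nth y_def[symmetric] wt_def J_ab)
 qed
 qed
 define r where "r=R / n"
 have r: "r > 0" using R n by (simp add: r_def)
 from pigeonhole_cells[OF fP Pne r, of B "%p. hmat T w *v p", OF B bound]
 obtain p0 where p0: "p0:P" and ph: "real (card P)<=(PROD i:UNIV. 2 * B i / r + 2) * real (card {p:P. ALL i. abs ((hmat T w *v p)$i - (hmat T w *v p0)$i) < r})"
 by blast
 define G where "G={p:P. ALL i. abs ((hmat T w *v p)$i - (hmat T w *v p0)$i) < r}"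
 have cell: "2 * B i / r + 2<=C2 * T * wt i" for i
 proof -
 have "2 * B i / r=2 * C1 * wt i * n * (K / R)" using R n by (simp add: B_def r_def field_simps)
 also have "... <= 2 * C1 * wt i * n * (2 * T)"
 proof (rule mult_left_mono)
  show "real K / R<=2 * T" using K(2) R by (simp add: field_simps)
  show "0<=2 * C1 * wt i * n" using C1 n wt(1)[of i] by simp
 qed
 finally have "2 * B i / r + 2<=(4 * n * C1) * (T * wt i) + 2 * (T * wt i)" using wt(2)[of i] by (simp add: algebra_simps)
 thus ?thesis by (simp add: C2_def algebra_simps)
 qed
 have prodle: "(PROD i:UNIV. 2 * B i / r + 2)<=C2^CARD('n) * T^CARD('n)"
 proof -
 have "(PROD i:UNIV. 2 * B i / r + 2)<=(PROD i:UNIV. C2 * T * wt i)"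
  by (rule prod_mono) (use B r cell in \<open>auto simp: add_nonneg_nonneg\<close>)
 also have "... = C2^CARD('n) * T^CARD('n)" by (simp add: prod.distrib pw power_mult_distrib)
 finally show ?thesis .
 qed
 have "(R * T)^CARD('n)<=real (card P)"
 proof -
 have "(R * T)^CARD('n)<=(real K + 1)^CARD('n)" by (rule power_mono) (use K(1) RT in auto)
 thus ?thesis by (simp add: cP add.commute)
 qed
 also note ph[folded G_def]
 also have "(PROD i:UNIV. 2 * B i / r + 2) * real (card G)<=(C2^CARD('n) * T^CARD('n)) * real (card G)"
 using prodle by (rule mult_right_mono) simp
 finally have "R^CARD('n) * T^CARD('n)<=(C2^CARD('n) * real (card G)) * T^CARD('n)"
 by (simp add: power_mult_distrib mult.commute mult.left_commute)
 hence "R^CARD('n)<=C2^CARD('n) * real (card G)" using T by (simp add: mult_le_cancel_right)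
 hence cG: "(1 / C2^CARD('n)) * R^CARD('n)<=real (card G)" using C2 by (simp add: field_simps)
 have fG: "finite G" using fP by (simp add: G_def)
 show ?thesis
 proof (intro exI[of _ "(%z. z - p0) ` G"] conjI ballI)
 show "finite ((%z. z - p0) ` G)" using fG by simp
 have "card ((%z. z - p0) ` G)=card G" by (rule card_image) (auto simp: inj_on_def)
 thus "(1 / C2^CARD('n)) * R^CARD('n)<=real (card ((%z. z - p0) ` G))" using cG by simp
 fix x assume "x:(%z. z - p0) ` G"
 then obtain z where z: "x=z - p0" "z:G" by blast
 show "intvec x" using z p0 by (simp add: intvec_ops G_def P_def)
 have "norm (hmat T w *v x)<=(SUM i:UNIV. abs ((hmat T w *v x)$i))" by (rule norm_le_l1_cart)
 also have "... <= (SUM i:(UNIV::'n set). r)"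
 proof (rule sum_mono)
  fix i
  have "(hmat T w *v x)$i=(hmat T w *v z)$i - (hmat T w *v p0)$i" by (simp add: z(1) matrix_vector_mult_diff_distrib)
  thus "abs ((hmat T w *v x)$i)<=r" using z(2) by (auto simp: G_def less_imp_le)
 qed
 also have "... = R" using n by (simp add: r_def n_def)
 finally show "norm (hmat T w *v x)<=R" .
 qed
qed
moreover have "1 / C2^CARD('n) > 0" using C2 by simp
ultimately show ?thesis by blast
qed

end

section \<open>Classes of short integer families and points of the quadric\<close>

locale int_chart=chart a b \<beta> L for a b :: "'n::finite" and \<beta> L +
fixes Q :: "real^'n => real" and m :: real
assumes QL: "Q (L *v x)=x$a * x$b + (SUM j:- {a, b}. \<beta> j * (x$j)\<^sup>2)"
 and den: "EX D0::nat. D0 > 0 & (ALL z. intvec z --> real D0 * Q z:\<int>)"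
 and m0: "m ~= 0" and XZne: "EX x. intvec x & Q x=m"
begin

definition XZ :: "(real^'n) set" where "XZ={x. intvec x & Q x=m}"

definition bc :: "real^'n => real^'n => real" where "bc x y=(x$a * y$b + x$b * y$a) / 2 + bil x y"

definition bq :: "real^'n => real^'n => real" where "bq x y=bc (Linv *v x) (Linv *v y)"

lemma Q_Qc: "Q x=Qc (Linv *v x)" using QL[of "Linv *v x"] by (simp add: Linv_L Qc_def qj_def J_def)

lemma Q_hmat: "T ~= 0 ==> Qc (hmat T w *v x)=Q x" by (simp add: hmat_mult Qc_flow Qc_shear Q_Qc)

lemma bq_diag: "bq x x=Q x" by (simp add: bq_def bc_def Q_Qc Qc_def qj_bil)

lemma bil_linear_right: "bil x (y + z)=bil x y + bil x z" "bil x (c *\<^sub>R y)=c * bil x y"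
by (simp_all add: bil_def algebra_simps sum.distrib sum_distrib_left)

lemma bq_linear: "bq (x + y) z=bq x z + bq y z" "bq (c *\<^sub>R x) z=c * bq x z"
"bq z (x + y)=bq z x + bq z y" "bq z (c *\<^sub>R x)=c * bq z x"
by (simp_all add: bq_def bc_def matrix_vector_right_distrib matrix_vector_mult_scaleR bil_linear bil_linear_right algebra_simps add_divide_distrib)

lemma bq_sym: "bq x y=bq y x" by (simp add: bq_def bc_def bil_def algebra_simps)

lemma bq_polar: "bq x y=(Q (x + y) - Q x - Q y) / 2"
proof -
have "Q (x + y)=Q x + 2 * bq x y + Q y" unfolding bq_diag[symmetric] by (simp add: bq_linear bq_sym[of y x])
thus ?thesis by simp
qed

lemma bq_sum: "bq (SUM i:I. f i) z=(SUM i:I. bq (f i) z)" "bq z (SUM i:I. f i)=(SUM i:I. bq z (f i))"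
proof -
have z: "bq 0 z=0" "bq z 0=0" using bq_linear(2)[of 0 0 z] bq_linear(4)[of z 0 0] by auto
show "bq (SUM i:I. f i) z=(SUM i:I. bq (f i) z)" by (induction I rule: infinite_finite_induct) (auto simp: z bq_linear)
show "bq z (SUM i:I. f i)=(SUM i:I. bq z (f i))" by (induction I rule: infinite_finite_induct) (auto simp: z bq_linear)
qed

lemma matrix_mult_columns: "Z *v y=(SUM j:UNIV. y$j *\<^sub>R column j Z)" for Z :: "real^'n^'n"
using matrix_mult_sum[of Z y] by (simp add: scalar_mult_eq_scaleR)

lemma Q_columns:
fixes Z :: "real^'n^'n"
shows "Q (Z *v y)=(SUM j:UNIV. SUM k:UNIV. y$j * y$k * bq (column j Z) (column k Z))"
proof -
have "Q (Z *v y)=bq (SUM j:UNIV. y$j *\<^sub>R column j Z) (SUM j:UNIV. y$j *\<^sub>R column j Z)"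
 unfolding matrix_mult_columns[of Z y, symmetric] bq_diag by (rule refl)
also have "... = (SUM j:UNIV. y$j * (SUM k:UNIV. y$k * bq (column k Z) (column j Z)))" by (simp only: bq_sum bq_linear)
also have "... = (SUM j:UNIV. SUM k:UNIV. y$j * y$k * bq (column j Z) (column k Z))"
 unfolding sum_distrib_left by (intro sum.cong refl) (simp add: bq_sym mult.assoc)
finally show ?thesis .
qed

lemma Q_scale2: "Q (x + x)=4 * Q x"
proof -
have "bq (x + x) (x + x)=bq x x + bq x x + (bq x x + bq x x)" by (simp only: bq_linear)
thus ?thesis by (simp only: bq_diag)
qed

text \<open>Equal columns j = k give four times the diagonal values; polarization then gives the
  rest. Sums of columns are integer vectors, so only values of \<open>Q\<close> at integer vectors
  have to be compared.\<close>

lemma same_gram: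
fixes Z Z' :: "real^'n^'n"
assumes "!!j k. Q (column j Z + column k Z)=Q (column j Z' + column k Z')"
shows "Q (Z *v y)=Q (Z' *v y)"
proof -
have "Q (column j Z)=Q (column j Z')" for j using assms[of j j] unfolding Q_scale2 by simp
hence "bq (column j Z) (column k Z)=bq (column j Z') (column k Z')" for j k unfolding bq_polar using assms by simp
thus ?thesis by (simp add: Q_columns)
qed

lemma Qc_bound: "EX C>0. ALL x. abs (Qc x)<=C * (norm x)\<^sup>2"
proof -
define C where "C=1 + (SUM j:J. abs (\<beta> j))"
have "abs (Qc x)<=C * (norm x)\<^sup>2" for x
proof -
 have c: "abs (x$i)<=norm x" for i by (rule component_le_norm_cart)
 have "abs (x$a * x$b)<=norm x * norm x" unfolding abs_mult by (intro mult_mono c) auto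
 moreover have "abs (qj x)<=(SUM j:J. abs (\<beta> j) * (norm x)\<^sup>2)" unfolding qj_def by (rule order_trans[OF sum_abs])
  (auto simp: abs_mult intro!: sum_mono mult_left_mono power2_le_iff_abs_le[THEN iffD2] c)
 ultimately show ?thesis unfolding Qc_def C_def by (simp add: algebra_simps sum_distrib_left sum_distrib_right power2_eq_square)
qed
moreover have "C > 0" unfolding C_def by (intro add_pos_nonneg sum_nonneg) auto
ultimately show ?thesis by blast
qed

definition admissible :: "real => (real^'n^'n) set" where "admissible R={Z. det Z ~= 0 & (ALL i j. Z$i$j:\<int>) &
 (EX T w. T ~= 0 & (ALL j. norm (hmat T w *v column j Z)<=R))}"

text \<open>The key of \<open>Z\<close> consists of values of \<open>Q\<close> at sums of columns,
  the determinant, and the entries modulo the determinant. These are bounded integers up to the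
  common denominator of \<open>Q\<close>. If \<open>Z\<close> and \<open>Z0\<close> have the same
  key and y is the solution of Z0 y = x, then Q(Z y) = Q(x); and Z y is integral because Z - Z0 is a
  multiple of det Z0 while det Z0 times y is integral by Cramer's rule.\<close>

lemma finite_classes:
"EX \<Z>. finite \<Z> & \<Z> <= admissible R & (ALL Z:admissible R. EX Z0:\<Z>. ALL x:XZ. Z *v (matrix_inv Z0 *v x):XZ)"
proof -
obtain D0 :: nat where D0: "D0 > 0" "!!z. intvec z ==> real D0 * Q z:\<int>" using den by blast
obtain Cq where Cq: "Cq > 0" "!!x. abs (Qc x)<=Cq * (norm x)\<^sup>2" using Qc_bound by blast
obtain Cd where Cd: "Cd > 0" "!!K (X :: 'n => real^'n). (ALL i:K. norm (X i)<=1) ==> covol K X<=Cd"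
 using covol_bounded by blast
define B1 where "B1=real D0 * (Cq * (2 * abs R)\<^sup>2)"
define B2 where "B2=Cd * abs R^CARD('n) / abs (det Linv)"
define kQ where "kQ=(%(Z :: real^'n^'n) p. \<lfloor>real D0 * Q (column (fst p) Z + column (snd p) Z)\<rfloor>)"
define kd where "kd=(%Z :: real^'n^'n. \<lfloor>det Z\<rfloor>)"
define km where "km=(%(Z :: real^'n^'n) p. \<lfloor>Z$fst p$snd p\<rfloor> mod kd Z)"
define key where "key=(%Z. (kQ Z, kd Z, km Z))"
have ci: "intvec (column j Z)" if "Z:admissible R" for Z j using that by (auto simp: admissible_def intvec_def column_def)
have kQ: "real_of_int (kQ Z (j, k))=real D0 * Q (column j Z + column k Z)" if "Z:admissible R" for Z j k
proof -
 have "real D0 * Q (column j Z + column k Z):\<int>" using D0(2) ci[OF that] by (simp add: intvec_ops)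
 thus ?thesis unfolding kQ_def by (metis Ints_cases floor_of_int fst_conv snd_conv)
qed
have kd: "real_of_int (kd Z)=det Z" if "Z:admissible R" for Z
proof -
 have "det Z:\<int>" by (rule det_int) (use that in \<open>auto simp: admissible_def\<close>)
 thus ?thesis unfolding kd_def by (metis Ints_cases floor_of_int)
qed
have kQb: "abs (kQ Z p)<=\<lceil>B1\<rceil>" if Z: "Z:admissible R" for Z p
proof -
 obtain j k where p: "p=(j, k)" by force
 obtain T w where Tw: "T ~= 0" "!!j. norm (hmat T w *v column j Z)<=R" using Z by (auto simp: admissible_def)
 have "norm (hmat T w *v (column j Z + column k Z))<=2 * abs R"
 unfolding matrix_vector_right_distrib using norm_triangle_ineq[of "hmat T w *v column j Z" "hmat T w *v column k Z"] Tw(2)[of j] Tw(2)[of k]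
 by linarith
 hence "(norm (hmat T w *v (column j Z + column k Z)))\<^sup>2<=(2 * abs R)\<^sup>2" by (intro power_mono) auto
 hence "abs (Q (column j Z + column k Z))<=Cq * (2 * abs R)\<^sup>2"
 using Cq(2)[of "hmat T w *v (column j Z + column k Z)"] Cq(1) unfolding Q_hmat[OF Tw(1)]
 by (meson less_imp_le mult_left_mono order_trans)
 hence "abs (real D0 * Q (column j Z + column k Z))<=B1" unfolding B1_def abs_mult by (simp add: mult_left_mono)
 hence "real_of_int \<bar>kQ Z p\<bar> <= B1" using kQ[OF Z, of j k] p by simp
 thus ?thesis by linarith
qed
have kdb: "abs (kd Z)<=\<lceil>B2\<rceil>" if Z: "Z:admissible R" for Z
proof -
 obtain T w where Tw: "T ~= 0" "!!j. norm (hmat T w *v column j Z)<=R" using Z by (auto simp: admissible_def)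
 have R0: "R >= 0" using Tw(2)[of a] norm_ge_zero order_trans by blast
 have "abs (det (hmat T w ** Z))<=Cd * R^CARD('n)"
 proof (cases "R=0")
 case True
 have "column a (hmat T w ** Z)=0"
 proof -
  have "column a (hmat T w ** Z)=hmat T w *v column a Z"
  by (simp add: column_def matrix_matrix_mult_def matrix_vector_mult_def vec_eq_iff)
  thus ?thesis using Tw(2)[of a] True by simp
 qed
 hence "det (hmat T w ** Z)=0" by (rule det_zero_column)
 thus ?thesis using Cd(1) R0 by simp
 next
 case False
 hence Rp: "R > 0" using R0 by simp
 define M where "M=transpose (hmat T w ** Z)"
 have row: "M$j=hmat T w *v column j Z" for j
  by (simp add: M_def transpose_def matrix_matrix_mult_def matrix_vector_mult_def column_def vec_eq_iff)
 define N where "N=(\<chi> j. (1 / R) *s M$j)"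
 have "M=(\<chi> j. R *s N$j)" using Rp by (simp add: N_def vec_eq_iff)
 hence "det M=(PROD j:(UNIV::'n set). R) * det (\<chi> j. N$j)" by (simp only: det_rows_mul)
 hence dM: "det M=R^CARD('n) * det N" by simp
 have "norm (N$j)<=1" for j using Tw(2)[of j] Rp by (simp add: N_def row scalar_mult_eq_scaleR)
 hence "covol UNIV (%j. N$j)<=Cd" by (intro Cd(2)) blast
 hence "abs (det N)<=Cd" using minor_le_covol[of UNIV "%j. N$j" id] by (simp add: minor_def fill_def)
 hence "abs (det M)<=Cd * R^CARD('n)" unfolding dM abs_mult using Rp by (simp add: mult.commute mult_left_mono)
 thus ?thesis by (simp add: M_def det_transpose)
 qed
 hence "abs (det Z)<=B2" using det_Linv R0 by (simp add: det_mul abs_mult det_hmat[OF Tw(1)] B2_def pos_le_divide_eq mult.commute)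
 hence "real_of_int \<bar>kd Z\<bar> <= B2" using kd[OF Z] by simp
 thus ?thesis by linarith
qed
have kmb: "abs (km Z p)<=\<lceil>B2\<rceil>" if Z: "Z:admissible R" for Z p
proof -
 have "kd Z ~= 0" using kd[OF Z] Z by (auto simp: admissible_def)
 hence "abs (km Z p) < abs (kd Z)" unfolding km_def by (rule abs_mod_less)
 thus ?thesis using kdb[OF Z] by linarith
qed
let ?I = "%B. {- \<lceil>B\<rceil>..\<lceil>B :: real\<rceil>}"
have "key ` admissible R<=(PiE UNIV (%_. ?I B1)) \<times> ?I B2 \<times> (PiE UNIV (%_. ?I B2))"
 using kQb kdb kmb unfolding key_def by (auto simp: abs_le_iff) (smt (verit))+
moreover have "finite ((PiE (UNIV :: ('n \<times> 'n) set) (%_. ?I B1)) \<times> ?I B2 \<times> (PiE (UNIV :: ('n \<times> 'n) set) (%_. ?I B2)))"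
 by (intro finite_cartesian_product finite_PiE) auto
ultimately have fk: "finite (key ` admissible R)" by (rule finite_subset)
define rep where "rep=(%k. SOME Z. Z:admissible R & key Z=k)"
have rep: "rep (key Z):admissible R & key (rep (key Z))=key Z" if "Z:admissible R" for Z
 unfolding rep_def by (rule someI[of "%Z'. Z':admissible R & key Z'=key Z" Z]) (use that in simp)
show ?thesis
proof (intro exI conjI ballI)
 show "finite (rep ` key ` admissible R)" using fk by simp
 show "rep ` key ` admissible R<=admissible R" using rep by blast
 fix Z assume Z: "Z:admissible R"
 define Z0 where "Z0=rep (key Z)"
 have Z0: "Z0:admissible R" and kk: "key Z0=key Z" using rep[OF Z] by (auto simp: Z0_def)
 have d0: "det Z0 ~= 0" using Z0 by (simp add: admissible_def)
 have gram: "Q (column j Z + column k Z)=Q (column j Z0 + column k Z0)" for j k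
 proof -
 have "kQ Z (j, k)=kQ Z0 (j, k)" using kk by (simp add: key_def)
 hence "real D0 * Q (column j Z + column k Z)=real D0 * Q (column j Z0 + column k Z0)" using kQ[OF Z] kQ[OF Z0] by metis
 thus ?thesis using D0(1) by simp
 qed
 have "ALL x:XZ. Z *v (matrix_inv Z0 *v x):XZ"
 proof
 fix x assume x: "x:XZ"
 define y where "y=matrix_inv Z0 *v x"
 have "EX A'. Z0 ** A'=mat 1 & A' ** Z0=mat 1" using d0 by (simp add: invertible_det_nz[symmetric] invertible_def)
 from someI_ex[OF this] have inv: "Z0 ** matrix_inv Z0=mat 1" by (simp add: matrix_inv_def)
 have Zy: "Z0 *v y=x" by (simp add: y_def matrix_vector_mul_assoc inv)
 have "Q (Z *v y)=m" using same_gram[of Z Z0 y] gram Zy x by (simp add: XZ_def)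
 moreover have "intvec (Z *v y)"
 proof -
  have dy: "det Z0 * y$k:\<int>" for k
  proof -
  have "y$k=det (\<chi> i j. if j=k then x$i else Z0$i$j) / det Z0"
  proof -
   have ye: "y=(\<chi> k. det (\<chi> i j. if j=k then x$i else Z0$i$j) / det Z0)" using Zy cramer[OF d0, of y x] by blast
   show ?thesis by (subst ye) simp
  qed
  hence "det Z0 * y$k=det (\<chi> i j. if j=k then x$i else Z0$i$j)" using d0 by simp
  moreover have "det (\<chi> i j. if j=k then x$i else Z0$i$j):\<int>"
   by (rule det_int) (use x Z0 in \<open>auto simp: XZ_def intvec_def admissible_def\<close>)
  ultimately show ?thesis by simp
  qed
  have zz: "EX t:\<int>. Z$i$k=Z0$i$k + det Z0 * t" for i k
  proof -
  have kdd: "kd Z=kd Z0" and "km Z (i, k)=km Z0 (i, k)" using kk by (simp_all add: key_def)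
  hence "\<lfloor>Z$i$k\<rfloor> mod kd Z0=\<lfloor>Z0$i$k\<rfloor> mod kd Z0" by (simp add: km_def)
  hence "kd Z0 dvd \<lfloor>Z$i$k\<rfloor> - \<lfloor>Z0$i$k\<rfloor>" by (simp add: mod_eq_dvd_iff)
  then obtain t where t: "\<lfloor>Z$i$k\<rfloor> - \<lfloor>Z0$i$k\<rfloor> = kd Z0 * t" by (rule dvdE)
  have f: "real_of_int \<lfloor>M$i$k\<rfloor> = M$i$k" if "M:admissible R" for M
  proof -
   have "M$i$k:\<int>" using that by (simp add: admissible_def)
   thus ?thesis by (metis Ints_cases floor_of_int)
  qed
  have "Z$i$k - Z0$i$k=real_of_int (\<lfloor>Z$i$k\<rfloor> - \<lfloor>Z0$i$k\<rfloor>)" 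
   by (simp only: of_int_diff f[OF Z] f[OF Z0])
  also have "... = det Z0 * real_of_int t" unfolding t using kd[OF Z0] by simp
  finally show ?thesis by (intro bexI[of _ "real_of_int t"]) (auto simp: algebra_simps)
  qed
  have "(Z *v y)$i:\<int>" for i
  proof -
  have "ALL k. EX t. t:\<int> & Z$i$k=Z0$i$k + det Z0 * t" using zz by blast
  from choice[OF this] obtain t where t: "!!k. t k:\<int>" "!!k. Z$i$k=Z0$i$k + det Z0 * t k" by blast
  have "(Z *v y)$i=(SUM k:UNIV. Z0$i$k * y$k + t k * (det Z0 * y$k))"
   unfolding matrix_vector_mult_def by (simp add: t(2) algebra_simps)
  also have "... = (Z0 *v y)$i + (SUM k:UNIV. t k * (det Z0 * y$k))" by (simp add: sum.distrib matrix_vector_mult_def)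
  finally have e: "(Z *v y)$i=x$i + (SUM k:UNIV. t k * (det Z0 * y$k))" unfolding Zy .
  have "x$i:\<int>" using x by (simp add: XZ_def intvec_def)
  moreover have "(SUM k:UNIV. t k * (det Z0 * y$k)):\<int>" by (intro Ints_sum) (rule Ints_mult[OF t(1) dy])
  ultimately show ?thesis unfolding e by (rule Ints_add)
  qed
  thus ?thesis by (simp add: intvec_def)
 qed
 ultimately show "Z *v (matrix_inv Z0 *v x):XZ" by (simp add: XZ_def y_def)
 qed
 thus "EX Z0:rep ` key ` admissible R. ALL x:XZ. Z *v (matrix_inv Z0 *v x):XZ"
 using Z by (intro bexI[of _ Z0]) (auto simp: Z0_def)
qed
qed

end

lemma cbox_in_open:
fixes S :: "(real^'n) set"
assumes "open S" "w:S"
shows "EX c d. (ALL i. c$i < d$i) & w:box c d & cbox c d<=S"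
proof -
obtain e where e: "e > 0" "ball w e<=S" using assms open_contains_ball by blast
define r where "r=e / (2 * CARD('n))"
have r: "r > 0" using e by (simp add: r_def)
have "cbox (w - (\<chi> i. r)) (w + (\<chi> i. r))<=S"
proof
 fix y assume y: "y:cbox (w - (\<chi> i. r)) (w + (\<chi> i. r))"
 have "abs ((y - w)$i)<=r" for i
 proof -
 have "(w - (\<chi> i. r))$i<=y$i & y$i<=(w + (\<chi> i. r))$i" using y unfolding mem_box_cart by blast
 thus ?thesis by auto
 qed
 hence "(SUM i:UNIV. abs ((y - w)$i))<=(SUM i:(UNIV::'n set). r)" by (intro sum_mono) blast
 hence "norm (y - w)<=CARD('n) * r" using norm_le_l1_cart[of "y - w"] by simp
 also have "... < e" using e by (simp add: r_def)
 finally show "y:S" using e(2) by (auto simp: dist_norm norm_minus_commute)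
qed
thus ?thesis using r by (intro exI[of _ "w - (\<chi> i. r)"] exI[of _ "w + (\<chi> i. r)"]) (auto simp: mem_box_cart)
qed

lemma norm_matrix_comb:
fixes A Z :: "real^'n^'n"
assumes "!!j. norm (A *v column j Z)<=R"
shows "norm (A *v (Z *v y))<=R * (SUM j:UNIV. abs (y$j))"
proof -
have eq: "A *v (Z *v y)=(SUM j:UNIV. y$j *\<^sub>R (A *v column j Z))" unfolding matrix_mult_sum[of Z y] scalar_mult_eq_scaleR
 by (simp add: linear_sum[OF matrix_vector_mul_linear] matrix_vector_mult_scaleR)
have "norm (A *v (Z *v y))<=(SUM j:UNIV. norm (y$j *\<^sub>R (A *v column j Z)))" unfolding eq by (rule norm_sum)
also have "... <= (SUM j:UNIV. abs (y$j) * R)" using assms by (intro sum_mono) (simp add: mult_left_mono)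
finally show ?thesis by (simp add: sum_distrib_left mult.commute)
qed

context chart
begin

lemma shear_axis: "shear (- w) (axis a 1)=ev w" using shear_inverse[of w "ev w"] by (simp add: shear_ev)

lemma shear_bound:
assumes W: "W >= 0"
shows "EX C>0. ALL w x. (ALL j. abs (w$j)<=W) --> norm (shear w x)<=C * norm x"
proof -
define B0 where "B0=(SUM j:J. abs (\<beta> j))"
have B0: "B0 >= 0" by (simp add: B0_def sum_nonneg)
define K where "K=1 + W + 2 * B0 * W + B0 * W\<^sup>2"
have "norm (shear w x)<=(CARD('n) * K) * norm x" if w: "ALL j. abs (w$j)<=W" for w x
proof -
 have c: "abs (x$i)<=norm x" for i by (rule component_le_norm_cart)
 have q: "abs (qj w)<=B0 * W\<^sup>2"
 proof -
 have "abs (qj w)<=(SUM j:J. abs (\<beta> j) * W\<^sup>2)" unfolding qj_def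
  by (rule order_trans[OF sum_abs]) (auto simp: abs_mult intro!: sum_mono mult_left_mono power2_le_iff_abs_le[THEN iffD2] W w[rule_format])
 thus ?thesis by (simp add: B0_def sum_distrib_right)
 qed
 have bb: "abs (bil x w)<=B0 * (norm x * W)"
 proof -
 have "abs (bil x w)<=(SUM j:J. abs (\<beta> j) * (norm x * W))" unfolding bil_def mult.assoc
  by (rule order_trans[OF sum_abs]) (auto simp: abs_mult intro!: sum_mono mult_left_mono mult_mono c w[rule_format])
 thus ?thesis by (simp add: B0_def sum_distrib_right)
 qed
 have p: "0<=norm x * W" "0<=B0 * (norm x * W)" "0<=norm x * (B0 * W\<^sup>2)" using B0 W by auto
 have Kx: "K * norm x=norm x + norm x * W + 2 * (B0 * (norm x * W)) + norm x * (B0 * W\<^sup>2)"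
 by (simp add: K_def algebra_simps)
 have "abs (shear w x$i)<=K * norm x" for i
 proof -
 consider "i=a" | "i=b" | "i:J" by (auto simp: J_ab)
 thus ?thesis
 proof cases
  case 1
  thus ?thesis unfolding Kx using c[of a] p by (simp add: shear_nth)
 next
  case 2
  have "abs (x$a * qj w)<=norm x * (B0 * W\<^sup>2)" unfolding abs_mult using c[of a] q by (intro mult_mono) auto
  hence "abs (x$b + 2 * bil x w - x$a * qj w)<=K * norm x" unfolding Kx using c[of b] bb p by linarith
  thus ?thesis using 2 by (simp add: shear_nth)
 next
  case 3
  have "abs (x$a * w$i)<=norm x * W" unfolding abs_mult using c[of a] w by (intro mult_mono) auto
  hence "abs (x$i - x$a * w$i)<=K * norm x" unfolding Kx using c[of i] p by linarith
  thus ?thesis using 3 by (simp add: shear_nth)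
 qed
 qed
 hence "(SUM i:UNIV. abs (shear w x$i))<=(SUM i:(UNIV::'n set). K * norm x)" by (intro sum_mono) blast
 thus ?thesis using norm_le_l1_cart[of "shear w x"] by simp
qed
moreover have "CARD('n) * K > 0" using W B0 unfolding K_def by (intro mult_pos_pos add_pos_nonneg) auto
ultimately show ?thesis by blast
qed

lemma inner_ev: "h \<bullet> ev v=h$a + (SUM j:J. h$j * v$j) + (- h$b) * qj v" by (simp add: inner_vec_def sum_UNIV_J ev_nth)

lemma inner_ev_generic:
assumes "h ~= 0"
shows "EX p. p ~= 0 & (ALL s. poly p s=h \<bullet> ev (w + curve s))"
proof -
have "h$a ~= 0 \<or> (EX j:J. h$j ~= 0) \<or> - h$b ~= 0" using assms vec_eqI[of h 0] by auto
from curve_generic[OF this] show ?thesis unfolding inner_ev .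
qed

lemma shear_b_generic:
assumes "x ~= 0"
shows "EX p. p ~= 0 & (ALL s. poly p s=shear (w + curve s) x$b)"
proof -
have xb: "shear v x$b=x$b + (SUM j:J. (2 * \<beta> j * x$j) * v$j) + (- x$a) * qj v" for v
 by (simp add: shear_nth bil_def sum_distrib_left mult.assoc)
have "x$b ~= 0 \<or> (EX j:J. 2 * \<beta> j * x$j ~= 0) \<or> - x$a ~= 0" using assms vec_eqI[of x 0] \<beta> by (auto simp: J_ab)
from curve_generic[OF this] show ?thesis unfolding xb .
qed

lemma continuous_shear: "continuous_on UNIV (%w. shear w x)"
proof -
have "((%w. shear w x) \<longlongrightarrow> shear w0 x) (at w0)" for w0 by (intro tendsto_shear tendsto_const tendsto_ident_at)
thus ?thesis by (simp add: continuous_on_def)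
qed

lemma continuous_ev: "continuous_on UNIV ev"
proof -
have "((%w. shear (- w) (axis a 1)) \<longlongrightarrow> shear (- w0) (axis a 1)) (at w0)" for w0
 by (intro tendsto_shear tendsto_const tendsto_ident_at tendsto_minus)
thus ?thesis by (simp add: continuous_on_def shear_axis)
qed

lemma nondivergence_exists: "EX et>0. ALL c d. (ALL i. c$i < d$i) --> (EX T0>0. ALL T>=T0. EX w:cbox c d. good_at et T w)"
proof -
obtain et where et: "et > 0" "!!c d. (ALL i. c$i < d$i) ==> (EX T0>0. ALL T>=T0.
 vol (cbox c d) / 2<=vol (cbox c d Int {y. good_at et T y}))" using nondivergence by blast
have "EX T0>0. ALL T>=T0. EX w:cbox c d. good_at et T w" if cd: "ALL i. c$i < d$i" for c d
proof -
 obtain T0 where T0: "T0 > 0" "!!T. T >= T0 ==> vol (cbox c d) / 2<=vol (cbox c d Int {y. good_at et T y})"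
 using et(2)[OF cd] by blast
 have "cbox c d ~= {}" using cd by (auto simp: interval_ne_empty_cart less_imp_le)
 hence "vol (cbox c d)=(PROD i:UNIV. d$i - c$i)" by (rule content_cbox_cart)
 also have "... > 0" using cd by (intro prod_pos) auto
 finally have "vol (cbox c d) > 0" .
 hence "vol (cbox c d Int {y. good_at et T y}) > 0" if "T >= T0" for T using T0(2)[OF that] by linarith
 hence "cbox c d Int {y. good_at et T y} ~= {}" if "T >= T0" for T using that by (metis less_irrefl measure_empty)
 thus ?thesis using T0(1) by blast
qed
with et(1) show ?thesis by blast
qed

lemma good_matrix:
assumes W: "W >= 0" and et: "et > 0"
shows "EX R>0. ALL T w. 1<=T --> (ALL j. abs (w$j)<=W) --> good_at et T w -->
 (EX Z. det Z ~= 0 & (ALL i j. Z$i$j:\<int>) & (ALL j. norm (hmat T w *v column j Z)<=R))"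
proof -
obtain c where c: "c > 0" "!!T w R. 1<=T ==> (ALL j. abs (w$j)<=W) ==> 1<=R ==>
 (EX F. finite F & c * R^CARD('n)<=real (card F) & (ALL z:F. intvec z & norm (hmat T w *v z)<=R))"
 using many_lattice_points[OF W] by blast
obtain R where R: "R > 0" "!!A :: real^'n^'n. det A ~= 0 ==> (ALL z. intvec z --> z ~= 0 --> et<=norm (A *v z)) ==>
 (ALL R>=1. EX F. finite F & c * R^CARD('n)<=card F & (ALL z:F. intvec z & norm (A *v z)<=R)) ==>
 (EX Z :: real^'n^'n. det Z ~= 0 & (ALL i j. Z$i$j:\<int>) & (ALL j. norm (A *v column j Z)<=R))"
 using short_independent_vectors[OF et c(1)] by blast
have "EX Z. det Z ~= 0 & (ALL i j. Z$i$j:\<int>) & (ALL j. norm (hmat T w *v column j Z)<=R)"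
 if "1<=T" "ALL j. abs (w$j)<=W" "good_at et T w" for T w
proof (rule R(2))
 show "det (hmat T w) ~= 0" using det_hmat[of T w] det_Linv that(1) by auto
 show "ALL z. intvec z --> z ~= 0 --> et<=norm (hmat T w *v z)" using that(3) by (simp add: good_at_def)
 show "ALL R>=1. EX F. finite F & c * R^CARD('n)<=card F & (ALL z:F. intvec z & norm (hmat T w *v z)<=R)"
 using c(2) that by blast
qed
with R(1) show ?thesis by blast
qed

end

context int_chart
begin

text \<open>A single integer point \<open>x0\<close> is enough: with \<open>Z0\<close> from the
  finite list, Z Z0^{-1} x0 is a point of \<open>XZ\<close> of bounded size after
  \<open>hmat\<close>. Its coordinate \<open>a\<close> may still be tiny, which
  \<open>good_point\<close> repairs.\<close>

lemma good_point_weak: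
assumes W: "W >= 0" and et: "et > 0"
shows "EX C>0. ALL T w. 1<=T --> (ALL j. abs (w$j)<=W) --> good_at et T w --> (EX x:XZ. norm (hmat T w *v x)<=C)"
proof -
obtain R where R: "R > 0" "!!T w. 1<=T ==> (ALL j. abs (w$j)<=W) ==> good_at et T w ==>
 (EX Z. det Z ~= 0 & (ALL i j. Z$i$j:\<int>) & (ALL j. norm (hmat T w *v column j Z)<=R))"
 using good_matrix[OF W et] by blast
obtain \<Z> where Zs: "finite \<Z>" "!!Z. Z:admissible R ==> EX Z0:\<Z>. ALL x:XZ. Z *v (matrix_inv Z0 *v x):XZ"
 using finite_classes[of R] by blast
obtain x0 where x0: "x0:XZ" using XZne by (auto simp: XZ_def)
define C where "C=1 + R * (SUM Z0:\<Z>. SUM j:UNIV. abs ((matrix_inv Z0 *v x0)$j))"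
have "EX x:XZ. norm (hmat T w *v x)<=C" if T: "1<=T" and w: "ALL j. abs (w$j)<=W" and g: "good_at et T w" for T w
proof -
 obtain Z where Z: "det Z ~= 0" "ALL i j. Z$i$j:\<int>" "ALL j. norm (hmat T w *v column j Z)<=R" using R(2)[OF T w g] by blast
 have "T ~= 0" using T by simp
 hence "Z:admissible R" using Z unfolding admissible_def by blast
 then obtain Z0 where Z0: "Z0:\<Z>" "Z *v (matrix_inv Z0 *v x0):XZ" using Zs(2) x0 by blast
 have "norm (hmat T w *v (Z *v (matrix_inv Z0 *v x0)))<=R * (SUM j:UNIV. abs ((matrix_inv Z0 *v x0)$j))"
 by (rule norm_matrix_comb) (use Z(3) in blast)
 also have "... <= R * (SUM Z0:\<Z>. SUM j:UNIV. abs ((matrix_inv Z0 *v x0)$j))"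
 proof (rule mult_left_mono)
 show "(SUM j:UNIV. abs ((matrix_inv Z0 *v x0)$j))<=(SUM Z0:\<Z>. SUM j:UNIV. abs ((matrix_inv Z0 *v x0)$j))"
  by (rule member_le_sum[OF Z0(1), of "%Z0. SUM j:UNIV. abs ((matrix_inv Z0 *v x0)$j)"]) (use Zs(1) in \<open>auto intro: sum_nonneg\<close>)
 qed (use R in simp)
 finally have "norm (hmat T w *v (Z *v (matrix_inv Z0 *v x0)))<=C" by (simp add: C_def)
 thus ?thesis using Z0(2) by blast
qed
moreover have "C > 0" unfolding C_def using R(1) by (intro add_pos_nonneg mult_nonneg_nonneg sum_nonneg) auto
ultimately show ?thesis by blast
qed

lemma XZ_nonzero: "x:XZ ==> Linv *v x ~= 0" using m0 by (auto simp: XZ_def Q_Qc Qc_def qj_def)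

text \<open>Suppose that \<open>h\<close> is orthogonal to \<open>XZ\<close>. Where \<open>h\<close>
  does not vanish on the isotropic direction of w, boundedness of \<open>hmat T w *v x\<close>
  together with h . x = 0 bounds x itself, independently of \<open>T\<close>. So the points from
  \<open>good_point_weak\<close> lie in a finite set \<open>F\<close>; but near a generic w every x
  in \<open>F\<close> has a sheared coordinate \<open>b\<close> bounded away from 0, and the flow
  multiplies it by \<open>T\<close>.\<close>

theorem XZ_span: "span XZ=UNIV"
proof (rule ccontr)
assume "span XZ ~= UNIV"
then obtain h where h: "h ~= 0" "!!x. x:span XZ ==> h \<bullet> x=0" using span_not_UNIV_orthogonal by blast
define g where "g=h v* L"
have gL: "g \<bullet> v=h \<bullet> (L *v v)" for v by (simp add: g_def dot_lmul_matrix)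
have g0: "g ~= 0"
proof
 assume "g=0"
 hence "h \<bullet> h=0" using gL[of "Linv *v h"] by (simp add: Linv_L)
 thus False using h(1) by simp
qed
obtain p where p: "p ~= 0" "!!s. poly p s=g \<bullet> ev (0 + curve s)" using inner_ev_generic[OF g0, of 0] by blast
obtain s0 where "poly p s0 ~= 0" using p(1) poly_all_0_iff_0 by blast
define w0 where "w0=curve s0"
define c where "c=abs (g \<bullet> ev w0) / 2"
have c: "c > 0" using \<open>poly p s0 ~= 0\<close> p(2)[of s0] by (simp add: c_def w0_def)
define S1 where "S1={w. c < abs (g \<bullet> ev w)}"
have "open S1" unfolding S1_def
 by (intro open_Collect_less continuous_on_const continuous_on_rabs continuous_on_inner continuous_ev)
moreover have "w0:S1" using c by (simp add: S1_def c_def)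
ultimately obtain c1 d1 where D1: "ALL i. c1$i < d1$i" "w0:box c1 d1" "cbox c1 d1<=S1" using cbox_in_open by blast
obtain W' where W': "!!w. w:cbox c1 d1 ==> norm w<=W'" using bounded_cbox[of c1 d1] by (auto simp: bounded_iff)
define W where "W=abs W'"
have W: "W >= 0" "!!w. w:cbox c1 d1 ==> ALL j. abs (w$j)<=W"
 using W' component_le_norm_cart unfolding W_def by (auto intro: order_trans[OF component_le_norm_cart] order_trans[OF W' abs_ge_self])
obtain et where et: "et > 0" "!!c d. (ALL i. c$i < d$i) ==> (EX T0>0. ALL T>=T0. EX w:cbox c d. good_at et T w)"
 using nondivergence_exists by blast
obtain C where C: "C > 0" "!!T w. 1<=T ==> (ALL j. abs (w$j)<=W) ==> good_at et T w ==> (EX x:XZ. norm (hmat T w *v x)<=C)"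
 using good_point_weak[OF W(1) et(1)] by blast
obtain Cs where Cs: "Cs > 0" "!!w x. (ALL j. abs (w$j)<=W) ==> norm (shear w x)<=Cs * norm x"
 using shear_bound[OF W(1)] by blast
obtain CL where CL: "CL > 0" "!!x. norm (L *v x)<=CL * norm x"
 using linear_bounded_pos[OF matrix_vector_mul_linear[of L]] by (metis mult.commute)
define n where "n=real CARD('n)"
define K1 where "K1=Cs * (n * C)"
define K2 where "K2=norm g * K1 / c"
define K3 where "K3=CL * (K2 * Cs + K1)"
have bnd: "norm x<=K3" if x: "x:XZ" and w: "w:cbox c1 d1" and T: "1<=T" and nx: "norm (hmat T w *v x)<=C" for x w T
proof -
 define y where "y=shear w (Linv *v x)"
 \<comment> \<open>Splits x into its isotropic part \<open>y$a *\<^sub>R ev w\<close>, possibly of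
   length T, and a bounded remainder; orthogonality to \<open>h\<close> controls the former by the
   latter.\<close>
 define v where "v=y - (y$a) *\<^sub>R axis a 1"
 have fl: "abs (flow T y$i)<=C" for i using order_trans[OF component_le_norm_cart nx, of i] by (simp add: hmat_mult y_def)
 have vb: "abs (v$i)<=C" for i
 proof -
 consider "i=a" | "i=b" | "i:J" by (auto simp: J_ab)
 thus ?thesis
 proof cases
  case 1 thus ?thesis using C(1) by (simp add: v_def axis_def)
 next
  case 2
  have "T * abs (y$b)<=C" using fl[of b] T by (simp add: flow_nth abs_mult)
  moreover have "1 * abs (y$b)<=T * abs (y$b)" using T by (intro mult_right_mono) auto
  ultimately show ?thesis using 2 ab by (simp add: v_def axis_def)
 next
  case 3 thus ?thesis using fl[of i] by (simp add: v_def axis_def flow_nth J_ab)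
 qed
 qed
 have "(SUM i:UNIV. abs (v$i))<=(SUM i:(UNIV::'n set). C)" using vb by (intro sum_mono) blast
 hence nv: "norm v<=n * C" using norm_le_l1_cart[of v] by (simp add: n_def)
 have wm: "ALL j. abs ((- w)$j)<=W" using W(2)[OF w] by simp
 have sv: "norm (shear (- w) v)<=K1" using Cs(2)[OF wm, of v] nv Cs(1) unfolding K1_def by (meson less_imp_le mult_left_mono order_trans)
 have ev1: "norm (ev w)<=Cs" using Cs(2)[OF wm, of "axis a 1"] by (simp add: shear_axis)
 have "Linv *v x=shear (- w) y" by (simp add: y_def shear_inverse)
 also have "y=(y$a) *\<^sub>R axis a 1 + v" by (simp add: v_def)
 also have "shear (- w) ((y$a) *\<^sub>R axis a 1 + v)=(y$a) *\<^sub>R ev w + shear (- w) v"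
 by (simp add: linear_add[OF linear_shear] linear_scale[OF linear_shear] shear_axis)
 finally have Lx: "Linv *v x=(y$a) *\<^sub>R ev w + shear (- w) v" .
 have "g \<bullet> (Linv *v x)=0" using gL[of "Linv *v x"] h(2)[of x] x by (simp add: Linv_L span_base)
 hence "(y$a) * (g \<bullet> ev w) = - (g \<bullet> shear (- w) v)" unfolding Lx by (simp add: inner_add_right)
 hence "abs (y$a) * abs (g \<bullet> ev w)=abs (g \<bullet> shear (- w) v)" by (metis abs_minus_cancel abs_mult)
 also have "... <= norm g * norm (shear (- w) v)" by (rule Cauchy_Schwarz_ineq2)
 also have "... <= norm g * K1" using sv by (intro mult_left_mono) auto
 finally have "abs (y$a) * abs (g \<bullet> ev w)<=norm g * K1" .
 moreover have "abs (y$a) * c<=abs (y$a) * abs (g \<bullet> ev w)" using w D1(3) by (intro mult_left_mono) (auto simp: S1_def less_imp_le)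
 ultimately have ya: "abs (y$a)<=K2" using c by (simp add: K2_def pos_le_divide_eq)
 have "norm (Linv *v x)<=abs (y$a) * norm (ev w) + norm (shear (- w) v)"
 unfolding Lx by (rule order_trans[OF norm_triangle_ineq]) simp
 also have "... <= K2 * Cs + K1" using ya ev1 sv by (intro add_mono mult_mono) auto
 finally have "norm (L *v (Linv *v x))<=K3"
 using CL(2)[of "Linv *v x"] CL(1) unfolding K3_def by (meson less_imp_le mult_left_mono order_trans)
 thus ?thesis by (simp add: Linv_L)
qed
define F where "F={x:XZ. norm x<=K3}"
have finF: "finite F" by (rule finite_subset[OF _ finite_bounded_intvec_norm[of K3]]) (auto simp: F_def XZ_def)
have "ALL x. EX p. x:F --> p ~= 0 & (ALL s. poly p s=shear (w0 + curve s) (Linv *v x)$b)"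
 using shear_b_generic XZ_nonzero by (auto simp: F_def)
from choice[OF this] obtain P where P: "!!x. x:F ==> P x ~= 0" "!!x s. x:F ==> poly (P x) s=shear (w0 + curve s) (Linv *v x)$b" by blast
have "continuous_on UNIV (%s. w0 + curve s)" by (intro continuous_intros continuous_curve)
hence "open ((%s. w0 + curve s) -` box c1 d1)" by (intro open_vimage open_box)
moreover have "0:(%s. w0 + curve s) -` box c1 d1" using D1(2) by (simp add: curve_0)
ultimately obtain sg where sg: "sg > 0" "ball 0 sg<=(%s. w0 + curve s) -` box c1 d1" using open_contains_ball by blast
\<comment> \<open>Since \<open>F\<close> is finite, one nonzero polynomial detects the parameters at
  which some x in \<open>F\<close> has sheared coordinate \<open>b\<close> equal to zero. A small
  parameter off its roots remains in the box.\<close>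
have "(PROD x:F. P x) ~= 0" using finF P(1) by (simp add: prod_zero_iff)
hence "finite {s. poly (PROD x:F. P x) s=0}" by (rule poly_roots_finite)
moreover have "infinite {0<..<sg}" using sg(1) by (simp add: infinite_Ioo)
ultimately obtain s where s: "s:{0<..<sg}" "poly (PROD x:F. P x) s ~= 0"
 by (metis (mono_tags, lifting) finite_subset mem_Collect_eq subsetI)
define w1 where "w1=w0 + curve s"
have "s:ball 0 sg" using s(1) by (simp add: dist_real_def)
hence w1: "w1:box c1 d1" using sg(2) unfolding w1_def by blast
have nz: "shear w1 (Linv *v x)$b ~= 0" if "x:F" for x
proof -
 have "poly (P x) s ~= 0" using s(2) that finF by (auto simp: poly_prod prod_zero_iff)
 thus ?thesis using P(2)[OF that] by (simp add: w1_def)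
qed
define cx where "cx=(%x. abs (shear w1 (Linv *v x)$b) / 2)"
define c' where "c'=Min (insert 1 (cx ` F))"
have c': "c' > 0" "!!x. x:F ==> c'<=cx x"
proof -
 have fin: "finite (insert 1 (cx ` F))" using finF by simp
 have "c':insert 1 (cx ` F)" unfolding c'_def by (rule Min_in[OF fin]) simp
 thus "c' > 0" using nz by (auto simp: cx_def)
 show "c'<=cx x" if "x:F" for x unfolding c'_def by (rule Min_le[OF fin]) (use that in simp)
qed
define S2 where "S2=box c1 d1 Int (INT x:F. {w. cx x < abs (shear w (Linv *v x)$b)})"
have "open S2" unfolding S2_def
proof (intro open_Int open_box open_INT finF ballI open_Collect_less continuous_on_const continuous_on_rabs)
 show "continuous_on UNIV (%w. shear w (Linv *v x)$b)" for x by (rule continuous_on_component[OF continuous_shear])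
qed
moreover have "w1:S2" using w1 nz by (auto simp: S2_def cx_def)
ultimately obtain c2 d2 where D2: "ALL i. c2$i < d2$i" "cbox c2 d2<=S2" using cbox_in_open by blast
obtain T0 where T0: "!!T. T >= T0 ==> EX w:cbox c2 d2. good_at et T w" using et(2)[OF D2(1)] by blast
\<comment> \<open>For this \<open>T\<close> the flow makes coordinate \<open>b\<close> of every x in
  \<open>F\<close> larger than \<open>C\<close>.\<close>
define T where "T=max T0 (max 1 ((C + 1) / c'))"
have T: "T >= T0" "T >= 1" "T >= (C + 1) / c'" by (auto simp: T_def)
obtain w where w: "w:cbox c2 d2" "good_at et T w" using T0[OF T(1)] by blast
have wD: "w:cbox c1 d1" using w(1) D2(2) box_subset_cbox[of c1 d1] by (auto simp: S2_def)
obtain x where x: "x:XZ" "norm (hmat T w *v x)<=C" using C(2)[OF T(2) W(2)[OF wD] w(2)] by blast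
have "x:F" using x bnd[OF x(1) wD T(2) x(2)] by (simp add: F_def)
hence "c' < abs (shear w (Linv *v x)$b)" using w(1) D2(2) c'(2) by (force simp: S2_def)
hence "T * c' < T * abs (shear w (Linv *v x)$b)" using T(2) by simp
moreover have "T * abs (shear w (Linv *v x)$b)<=C"
 using order_trans[OF component_le_norm_cart x(2), of b] T(2) by (simp add: hmat_mult flow_nth abs_mult)
moreover have "C + 1<=T * c'" using T(3) c'(1) by (simp add: pos_divide_le_eq)
ultimately show False by linarith
qed

text \<open>Use n independent points of \<open>XZ\<close> instead of one. The row \<open>a\<close>
  of \<open>hmat T w ** Z\<close> is not small, because the determinant is bounded below and the
  other rows are bounded above. The vectors Z0^{-1} X_j span, so this row has a product of definite
  size with at least one of them.\<close>

theorem good_point: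
assumes W: "W >= 0" and et: "et > 0"
shows "EX C>0. EX c>0. ALL T w. 1<=T --> (ALL j. abs (w$j)<=W) --> good_at et T w -->
 (EX x:XZ. norm (hmat T w *v x)<=C & c<=abs ((hmat T w *v x)$a))"
proof -
obtain R where R: "R > 0" "!!T w. 1<=T ==> (ALL j. abs (w$j)<=W) ==> good_at et T w ==>
 (EX Z. det Z ~= 0 & (ALL i j. Z$i$j:\<int>) & (ALL j. norm (hmat T w *v column j Z)<=R))"
 using good_matrix[OF W et] by blast
obtain \<Z> where Zs: "finite \<Z>" "\<Z> <= admissible R" "!!Z. Z:admissible R ==> EX Z0:\<Z>. ALL x:XZ. Z *v (matrix_inv Z0 *v x):XZ"
 using finite_classes[of R] by blast
obtain B where B: "B<=XZ" "independent B" "XZ<=span B" using maximal_independent_subset by blast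
have spB: "span B=UNIV" using XZ_span B(3) by (metis span_mono span_span top.extremum_uniqueI)
have cB: "card B=dim (UNIV :: (real^'n) set)" using dim_span_eq_card_independent[OF B(2)] spB by simp
obtain X :: "'n => real^'n" where X: "!!i. i:initial (dim (UNIV :: (real^'n) set)) ==> X i:B"
 "indep_fam (initial (dim (UNIV :: (real^'n) set))) X" "X ` initial (dim (UNIV :: (real^'n) set))=B"
 by (rule family_of_basis[OF B(2) cB spB], rule that) simp_all
have ini: "initial (dim (UNIV :: (real^'n) set))=(UNIV :: 'n set)" by (simp add: initial_full)
have XX: "X i:XZ" for i using X(1) B(1) unfolding ini by blast
have Xsp: "span (range X)=UNIV" using X(3) spB unfolding ini by simp
define y :: "real^'n^'n => 'n => real^'n" where "y=(%Z0 j. matrix_inv Z0 *v X j)"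
have "EX c>0. ALL r. c * norm r<=norm (\<chi> j. r \<bullet> y Z0 j)" if Z0: "Z0:\<Z>" for Z0
proof -
 have d0: "det Z0 ~= 0" using Z0 Zs(2) by (auto simp: admissible_def)
 have "EX A'. Z0 ** A'=mat 1 & A' ** Z0=mat 1" using d0 by (simp add: invertible_det_nz[symmetric] invertible_def)
 from someI_ex[OF this] have inv: "matrix_inv Z0 ** Z0=mat 1" by (simp add: matrix_inv_def)
 have lin: "linear (%r. \<chi> j. r \<bullet> y Z0 j)" by (rule linearI) (auto simp: vec_eq_iff inner_add_left)
 have "inj (%r. \<chi> j. r \<bullet> y Z0 j)" unfolding linear_injective_0[OF lin]
 proof (intro allI impI)
 fix r assume "(\<chi> j. r \<bullet> y Z0 j)=0"
 hence r: "r \<bullet> (matrix_inv Z0 *v X j)=0" for j by (simp add: vec_eq_iff y_def)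
 define Sp where "Sp={v. r \<bullet> (matrix_inv Z0 *v v)=0}"
 have "subspace Sp" unfolding Sp_def subspace_def
  by (auto simp: matrix_vector_right_distrib matrix_vector_mult_scaleR inner_add_right)
 moreover have "range X<=Sp" using r by (auto simp: Sp_def)
 ultimately have "span (range X)<=Sp" by (intro span_minimal)
 hence "Z0 *v r:Sp" using Xsp by blast
 hence "r \<bullet> r=0" by (simp add: Sp_def matrix_vector_mul_assoc inv)
 thus "r=0" by simp
 qed
 from linear_inj_bounded_below_pos[OF lin this] show ?thesis by (metis mult.commute)
qed
hence "ALL Z0. EX c. Z0:\<Z> --> c > 0 & (ALL r. c * norm r<=norm (\<chi> j. r \<bullet> y Z0 j))" by blast
from choice[OF this] obtain cf where cf: "!!Z0. Z0:\<Z> ==> cf Z0 > 0" "!!Z0 r. Z0:\<Z> ==> cf Z0 * norm r<=norm (\<chi> j. r \<bullet> y Z0 j)" by blast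
define c1 where "c1=Min (insert 1 (cf ` \<Z>))"
have c1: "c1 > 0" "!!Z0. Z0:\<Z> ==> c1<=cf Z0"
proof -
 have fin: "finite (insert 1 (cf ` \<Z>))" using Zs(1) by simp
 have "c1:insert 1 (cf ` \<Z>)" unfolding c1_def by (rule Min_in[OF fin]) simp
 thus "c1 > 0" using cf(1) by auto
 show "c1<=cf Z0" if "Z0:\<Z>" for Z0 unfolding c1_def by (rule Min_le[OF fin]) (use that in simp)
qed
define n where "n=real CARD('n)"
have n: "n >= 1" by (simp add: n_def Suc_leI)
define e0 where "e0=1 + covol {} (%_::'n. 0 :: real^'n)"
have e0: "e0 > 0" using covol_nonneg[of "{}" "%_::'n. 0 :: real^'n"] by (simp add: e0_def)
\<comment> \<open>Lower bound for the row \<open>a\<close>: the determinant is at least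
  \<open>abs (det Linv)\<close>, each of the other n - 1 rows has absolute sum at most
  \<open>n * R\<close>, and \<open>e0\<close> is the constant of
  \<open>det_fill_bound\<close>.\<close>
define rh where "rh=abs (det Linv) / ((n * R)^(CARD('n) - 1) * e0)"
have rh: "rh > 0" using det_Linv n R(1) e0 by (simp add: rh_def)
define c where "c=c1 * (rh / n) / n"
have c: "c > 0" using c1 rh n by (simp add: c_def)
define C where "C=1 + R * (SUM Z0:\<Z>. SUM i:UNIV. SUM j:UNIV. abs (y Z0 i$j))"
have C: "C > 0" unfolding C_def using R(1) by (intro add_pos_nonneg mult_nonneg_nonneg sum_nonneg) auto
have "EX x:XZ. norm (hmat T w *v x)<=C & c<=abs ((hmat T w *v x)$a)"
 if T: "1<=T" and w: "ALL j. abs (w$j)<=W" and g: "good_at et T w" for T w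
proof -
 obtain Z where Z: "det Z ~= 0" "ALL i j. Z$i$j:\<int>" "ALL j. norm (hmat T w *v column j Z)<=R" using R(2)[OF T w g] by blast
 have Tn: "T ~= 0" using T by simp
 hence "Z:admissible R" using Z unfolding admissible_def by blast
 then obtain Z0 where Z0: "Z0:\<Z>" "!!x. x:XZ ==> Z *v (matrix_inv Z0 *v x):XZ" using Zs(3) by blast
 let ?M = "hmat T w ** Z"
 have entry: "abs (?M$i$k)<=R" for i k
 proof -
 have "?M$i$k=(hmat T w *v column k Z)$i" by (simp add: matrix_matrix_mult_def matrix_vector_mult_def column_def)
 thus ?thesis using order_trans[OF component_le_norm_cart Z(3)[rule_format, of k], of i] by simp
 qed
 define r where "r = ?M$a"
 have "abs (det Z) >= 1"
 proof -
 have "det Z:\<int>" by (rule det_int) (use Z(2) in blast)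
 thus ?thesis using Z(1) by (simp add: Ints_nonzero_abs_ge1)
 qed
 hence "abs (det Linv)<=abs (det ?M)" by (simp add: det_mul abs_mult det_hmat[OF Tn] mult_le_cancel_left1)
 also have "abs (det ?M)=abs (det (\<chi> i. if i:{} then 0 else ?M$i))" by simp
 also have "... <= (PROD i:-{}. SUM k:UNIV. abs (?M$i$k)) * covol {} (%_::'n. 0)" by (rule det_fill_bound)
 also have "... <= (PROD i:UNIV. SUM k:UNIV. abs (?M$i$k)) * e0" by (simp add: e0_def mult_left_mono prod_nonneg sum_nonneg)
 also have "(PROD i:UNIV. SUM k:UNIV. abs (?M$i$k))=(SUM k:UNIV. abs (r$k)) * (PROD i:UNIV - {a}. SUM k:UNIV. abs (?M$i$k))"
 by (simp add: r_def prod.remove[of UNIV a])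
 also have "(SUM k:UNIV. abs (r$k)) * (PROD i:UNIV - {a}. SUM k:UNIV. abs (?M$i$k)) * e0<=(SUM k:UNIV. abs (r$k)) * (n * R)^(CARD('n) - 1) * e0"
 proof (intro mult_right_mono mult_left_mono)
 have "(PROD i:UNIV - {a}. SUM k:UNIV. abs (?M$i$k))<=(PROD i:UNIV - {a}. n * R)"
 proof (rule prod_mono)
  fix i :: 'n
  have "(SUM k:UNIV. abs (?M$i$k))<=(SUM k:(UNIV::'n set). R)" using entry by (intro sum_mono) blast
  thus "0<=(SUM k:UNIV. abs (?M$i$k)) & (SUM k:UNIV. abs (?M$i$k))<=n * R" by (simp add: n_def sum_nonneg)
 qed
 thus "(PROD i:UNIV - {a}. SUM k:UNIV. abs (?M$i$k))<=(n * R)^(CARD('n) - 1)" by (simp add: card_Diff_subset)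
 qed (use e0 in \<open>auto intro: sum_nonneg\<close>)
 finally have "rh<=(SUM k:UNIV. abs (r$k))" using n R(1) e0 by (simp add: rh_def pos_divide_le_eq mult.assoc)
 also have "... <= (SUM k:(UNIV::'n set). norm r)" by (intro sum_mono component_le_norm_cart)
 finally have "rh<=n * norm r" by (simp add: n_def)
 hence nr: "rh / n<=norm r" using n by (simp add: pos_divide_le_eq mult.commute)
 have "c1 * (rh / n)<=cf Z0 * norm r" using c1(1) c1(2)[OF Z0(1)] nr rh n by (intro mult_mono) auto
 also have "... <= norm (\<chi> j. r \<bullet> y Z0 j)" by (rule cf(2)[OF Z0(1)])
 also have "... <= (SUM j:UNIV. abs (r \<bullet> y Z0 j))" using norm_le_l1_cart[of "\<chi> j. r \<bullet> y Z0 j"] by simp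
 finally have sumr: "c1 * (rh / n)<=(SUM j:UNIV. abs (r \<bullet> y Z0 j))" .
 obtain j where j: "c<=abs (r \<bullet> y Z0 j)"
 proof (rule ccontr)
 assume nt: "~ thesis"
 have "abs (r \<bullet> y Z0 j) < c" for j
 proof (rule ccontr)
  assume "~ \<bar>r \<bullet> y Z0 j\<bar> < c"
  hence "c<=abs (r \<bullet> y Z0 j)" by simp
  thus False using nt that by blast
 qed
 hence "(SUM j:UNIV. abs (r \<bullet> y Z0 j)) < (SUM j:(UNIV::'n set). c)" by (intro sum_strict_mono) auto
 also have "... = c1 * (rh / n)" using n by (simp add: c_def n_def)
 finally show False using sumr by simp
 qed
 define x where "x=Z *v y Z0 j"
 have "x:XZ" unfolding x_def y_def by (rule Z0(2)[OF XX])
 moreover have "norm (hmat T w *v x)<=C"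
 proof -
 have "norm (hmat T w *v x)<=R * (SUM k:UNIV. abs (y Z0 j$k))" unfolding x_def by (rule norm_matrix_comb) (use Z(3) in blast)
 also have "... <= R * (SUM Z0:\<Z>. SUM i:UNIV. SUM j:UNIV. abs (y Z0 i$j))"
 proof (rule mult_left_mono)
  have "(SUM k:UNIV. abs (y Z0 j$k))<=(SUM i:UNIV. SUM k:UNIV. abs (y Z0 i$k))"
  by (rule member_le_sum[of j UNIV "%i. SUM k:UNIV. abs (y Z0 i$k)"]) (auto intro: sum_nonneg)
  also have "... <= (SUM Z0:\<Z>. SUM i:UNIV. SUM j:UNIV. abs (y Z0 i$j))"
  by (rule member_le_sum[OF Z0(1), of "%Z0. SUM i:UNIV. SUM j:UNIV. abs (y Z0 i$j)"]) (use Zs(1) in \<open>auto intro: sum_nonneg\<close>)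
  finally show "(SUM k:UNIV. abs (y Z0 j$k))<=(SUM Z0:\<Z>. SUM i:UNIV. SUM j:UNIV. abs (y Z0 i$j))" .
 qed (use R in simp)
 finally show ?thesis by (simp add: C_def)
 qed
 moreover have "(hmat T w *v x)$a=r \<bullet> y Z0 j"
 unfolding x_def r_def matrix_vector_mul_assoc by (simp add: matrix_vector_mult_def inner_vec_def)
 ultimately show ?thesis using j by (intro bexI[of _ x]) auto
qed
with C c show ?thesis by blast
qed

end

section \<open>Ubiquitous systems\<close>

lemma fmeasurable_cbox: "cbox c d:fmeasurable lborel" by (rule fmeasurableI) (auto simp: emeasure_lborel_cbox_eq)

text \<open>The Cauchy-Schwarz inequality for the function \<open>f\<close> that counts the sets
  containing a point, in the form that the integral of (t f - 1_U)^2 is non-negative; t = S / X is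
  optimal.\<close>

lemma second_moment:
fixes A :: "'q => 'x set"
assumes I: "finite I" and A: "!!q. q:I ==> A q:fmeasurable M"
shows "(SUM q:I. measure M (A q))\<^sup>2<=measure M (UN q:I. A q) * (SUM q:I. SUM q':I. measure M (A q Int A q'))"
proof -
define U where "U=(UN q:I. A q)"
define S where "S=(SUM q:I. measure M (A q))"
define X where "X=(SUM q:I. SUM q':I. measure M (A q Int A q'))"
have U: "U:fmeasurable M" unfolding U_def using I A by (intro fmeasurable.finite_UN) auto
have AA: "A q Int A q':fmeasurable M" if "q:I" "q':I" for q q' using A that by (intro fmeasurable.Int) auto
have int: "integrable M (indicat_real E)" "integral\<^sup>L M (indicat_real E)=measure M E" if "E:fmeasurable M" for E
 using that by (auto simp: fmeasurable_def Int_absorb2 sets.sets_into_space intro: integrable_real_indicator)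
have key: "0<=t\<^sup>2 * X - 2 * t * S + measure M U" for t
proof -
 define f where "f=(%x. SUM q:I. indicat_real (A q) x)"
 define g where "g=(%x. t\<^sup>2 * (SUM q:I. SUM q':I. indicat_real (A q Int A q') x) - 2 * t * f x + indicat_real U x)"
 have g: "g x=(t * f x - indicat_real U x)\<^sup>2" for x
 proof -
 have "f x * indicat_real U x=f x"
 proof (cases "x:U")
  case False
  hence "f x=0" unfolding f_def U_def by (intro sum.neutral) (auto simp: indicator_def)
  thus ?thesis by simp
 qed simp
 moreover have "(SUM q:I. SUM q':I. indicat_real (A q Int A q') x)=f x * f x"
  by (simp add: f_def sum_product indicator_inter_arith)
 moreover have "indicat_real U x * indicat_real U x=indicat_real U x" by (simp add: indicator_def)
 moreover have "(t * f x - indicat_real U x)\<^sup>2=t\<^sup>2 * (f x * f x) - 2 * t * (f x * indicat_real U x) + indicat_real U x * indicat_real U x"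
  by (simp add: power2_eq_square algebra_simps)
 ultimately show ?thesis unfolding g_def by presburger
 qed
 have "integral\<^sup>L M g=t\<^sup>2 * X - 2 * t * S + measure M U"
 proof -
 have i1: "integrable M (%x. SUM q:I. SUM q':I. indicat_real (A q Int A q') x)" using int(1) AA by (intro Bochner_Integration.integrable_sum) auto
 have i2: "integrable M f" unfolding f_def using int(1) A by (intro Bochner_Integration.integrable_sum) auto
 have e1: "integral\<^sup>L M (%x. SUM q:I. SUM q':I. indicat_real (A q Int A q') x)=X"
  unfolding X_def using int AA by (subst Bochner_Integration.integral_sum, force intro!: Bochner_Integration.integrable_sum) (intro sum.cong refl, subst Bochner_Integration.integral_sum, auto)
 have e2: "integral\<^sup>L M f=S" unfolding S_def f_def using int A by (subst Bochner_Integration.integral_sum) auto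
 show ?thesis unfolding g_def using i1 i2 e1 e2 int[OF U] by simp
 qed
 moreover have "0<=integral\<^sup>L M g" by (rule integral_nonneg_AE) (simp add: g)
 ultimately show ?thesis by simp
qed
have S0: "0<=S" and X0: "0<=X" by (auto simp: S_def X_def intro!: sum_nonneg)
show ?thesis
proof (cases "X=0")
 case True
 have "S=0"
 proof (rule ccontr)
 assume "S ~= 0"
 hence "0 <= - (measure M U + 1) + measure M U" using key[of "(measure M U + 1) / (2 * S)"] True by simp
 thus False by simp
 qed
 thus ?thesis using True by (simp add: S_def X_def)
next
 case False
 hence Xp: "X > 0" using X0 by simp
 have "(S / X)\<^sup>2 * X=S\<^sup>2 / X" "2 * (S / X) * S=2 * (S\<^sup>2 / X)" using Xp by (auto simp: power2_eq_square)
 hence "S\<^sup>2 / X<=measure M U" using key[of "S / X"] by linarith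
 hence "S\<^sup>2<=measure M U * X" using Xp by (simp add: pos_divide_le_eq)
 thus ?thesis by (simp add: S_def X_def U_def)
qed
qed

text \<open>The part of the Lebesgue density theorem that is needed. Cover the complement
  \<open>N\<close> of \<open>A\<close> in the cube by dyadic cubes inside an open \<open>U\<close>
  with \<open>U - N\<close> small. In each of them \<open>A\<close> has proportion at least
  \<open>kp\<close>, yet that part lies in \<open>U - N\<close>, so the cubes have small total
  volume.\<close>

lemma density_full:
fixes A :: "(real^'n) set" and kp W :: real
assumes A: "A:sets borel" and kp: "kp > 0" and W: "W > 0"
 and dens: "!!c r. r > 0 ==> cbox c (c + (\<chi> i. r))<=cbox (\<chi> i. - W) (\<chi> i. W) ==>
 kp * vol (cbox c (c + (\<chi> i. r)))<=vol (cbox c (c + (\<chi> i. r)) Int A)"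
shows "emeasure lborel (cbox (\<chi> i. - W) (\<chi> i. W) - A)=0"
proof -
define B :: "(real^'n) set" where "B=cbox (\<chi> i. - W) (\<chi> i. W)"
define N where "N=B - A"
have N: "N:sets borel" using A by (simp add: N_def B_def)
have Bf: "B:fmeasurable lborel" unfolding B_def by (rule fmeasurableI) (auto simp: emeasure_lborel_cbox_eq)
have Nf: "N:fmeasurable lborel" by (rule fmeasurableI2[OF Bf]) (use N in \<open>auto simp: N_def\<close>)
have step: "kp * vol N<=e" if e: "e > 0" for e :: real
proof -
 obtain U where U: "open U" "N<=U" "emeasure lborel (U - N) < e" using outer_regular_lborel[OF N e] by blast
 have UNf: "U - N:fmeasurable lborel" by (rule fmeasurableI) (use U N in \<open>auto intro: order.strict_trans\<close>)
 have Une: "vol (U - N)<=e" using U(3) UNf e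
 by (metis emeasure_eq_measure2 ennreal_less_iff fmeasurable_def less_imp_le measure_nonneg mem_Collect_eq infinity_ennreal_def)
 \<comment> \<open>The gauge forces every cube of the covering, tagged by a point of
   \<open>N\<close>, into \<open>U\<close>.\<close>
 define g where "g=(%x. if x:U then U else UNIV)"
 have ga: "gauge g" unfolding gauge_def g_def using U(1) by simp
 have Bne: "box (\<chi> i. - W) (\<chi> i. W) ~= ({} :: (real^'n) set)" using W by (simp add: interval_ne_empty_cart)
 have NB: "N<=cbox (\<chi> i. - W) (\<chi> i. W)" by (simp add: N_def B_def)
 obtain \<D> where D: "countable \<D>" "\<Union>\<D> <= cbox (\<chi> i. - W) (\<chi> i. W)"
 "!!K. K:\<D> ==> interior K ~= {} & (EX c d. K=cbox c d)" "pairwise (%A B. interior A Int interior B={}) \<D>"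
 "!!K. K:\<D> ==> EX x:N Int K. K<=g x"
 "!!u v. cbox u v:\<D> ==> EX n. ALL i:Basis. v \<bullet> i - u \<bullet> i=((\<chi> i. W) \<bullet> i - (\<chi> i. - W) \<bullet> i) / 2^n"
 "N<=\<Union>\<D>" using covering_lemma[OF NB Bne ga] by blast
 have DU: "K<=U" if "K:\<D>" for K using D(5)[OF that] U(2) by (auto simp: g_def split: if_splits)
 have Ddens: "kp * vol K<=vol (K Int A)" if K: "K:\<D>" for K
 proof -
 obtain u v where uv: "K=cbox u v" "interior K ~= {}" using D(3)[OF K] by blast
 obtain n where n: "!!i. i:Basis ==> v \<bullet> i - u \<bullet> i=((\<chi> i. W) \<bullet> i - (\<chi> i. - W) \<bullet> i) / 2^n"
  using D(6)[of u v] K uv(1) by blast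
 have "v$i=u$i + 2 * W / 2^n" for i
 proof -
  have "axis i (1::real):Basis" by (simp add: axis_in_Basis_iff)
  from n[OF this] show ?thesis by (simp add: inner_axis)
 qed
 hence "v=u + (\<chi> i. 2 * W / 2^n)" by (simp add: vec_eq_iff)
 hence Ke: "K=cbox u (u + (\<chi> i. 2 * W / 2^n))" using uv(1) by simp
 show ?thesis unfolding Ke by (rule dens) (use W D(2) K Ke in auto)
 qed
 have "vol (\<Union>F)<=(1 / kp) * e" if F: "finite F" "F<=\<D>" for F
 proof -
 have Kf: "K:fmeasurable lborel" if "K:F" for K using D(3)[of K] that F fmeasurable_cbox by blast
 have KA: "K Int A:fmeasurable lborel" if "K:F" for K
  by (rule fmeasurableI2[OF Kf[OF that]]) (use A Kf[OF that] in \<open>auto simp: fmeasurable_def\<close>)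
 have neg: "negligible (K Int K')" if KK: "K:F" "K':F" "K ~= K'" for K K'
 proof -
  obtain c d c' d' where k: "K=cbox c d" "K'=cbox c' d'" using D(3)[of K] D(3)[of K'] F KK by blast
  have "interior K Int interior K'={}" using D(4) KK F by (auto simp: pairwise_def)
  hence "interior (K Int K')={}" by simp
  moreover have "convex (K Int K')" unfolding k by (intro convex_Int convex_box)
  ultimately show ?thesis by (intro negligible_convex_interior[THEN iffD2])
 qed
 have "vol (\<Union>F)<=(SUM K:F. vol K)" using measure_UNION_le[OF F(1), of "%K. K" lborel] Kf by (auto simp: fmeasurable_def)
 also have "... <= (1 / kp) * (SUM K:F. vol (K Int A))"
  unfolding sum_distrib_left using Ddens F(2) kp by (intro sum_mono) (auto simp: field_simps)
 also have "(SUM K:F. vol (K Int A))=measure lebesgue (UN K:F. K Int A)"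
 proof -
  have "measure lebesgue (UN K:F. K Int A)=(SUM K:F. measure lebesgue (K Int A))"
  proof (rule measure_negligible_finite_Union_image[OF F(1)])
  show "K Int A:lmeasurable" if "K:F" for K using KA[OF that] by (simp add: fmeasurable_def)
  show "pairwise (%x y. negligible (x Int A Int (y Int A))) F"
   unfolding pairwise_def by (intro ballI impI negligible_subset[OF neg]) auto
  qed
  also have "... = (SUM K:F. vol (K Int A))" using KA by (intro sum.cong refl) (auto simp: fmeasurable_def)
  finally show ?thesis by simp
 qed
 also have "measure lebesgue (UN K:F. K Int A)<=vol (U - N)"
 proof -
  have s: "(UN K:F. K Int A):sets borel" using KA F(1) by (intro sets.finite_UN) (auto simp: fmeasurable_def)
  have "(UN K:F. K Int A)<=U - N" using DU F(2) by (auto simp: N_def)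
  hence "vol (UN K:F. K Int A)<=vol (U - N)" using s UNf by (intro measure_mono_fmeasurable) auto
  thus ?thesis using s by simp
 qed
 finally show ?thesis using Une kp by (meson order_trans mult_left_mono zero_le_divide_1_iff less_imp_le)
 qed
 note fin=this
 have Dm: "K:fmeasurable lborel" if "K:\<D>" for K using D(3)[OF that] fmeasurable_cbox by blast
 note bnd=fmeasurable_Union_bound[OF D(1) Dm fin] measure_Union_bound[OF D(1) Dm fin]
 have "vol N<=vol (\<Union>\<D>)" by (rule measure_mono_fmeasurable[OF D(7)]) (use N bnd(1) in auto)
 hence "vol N<=(1 / kp) * e" using bnd(2) by linarith
 thus ?thesis using kp by (simp add: field_simps)
qed
have "kp * vol N<=0" by (rule field_le_epsilon) (simp only: add_0 step)
hence "vol N=0" using kp measure_nonneg[of lborel N] by (simp add: mult_le_0_iff)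
hence "emeasure lborel N=0" using emeasure_eq_measure2[OF Nf] by simp
thus ?thesis unfolding N_def B_def .
qed

section \<open>Cylinders over the coordinates in J, grid cells and limsup sets\<close>

definition near :: "'n set => real^'n => real => (real^'n) set" where "near J p r={y. ALL j:J. abs (y$j - p$j)<=r}"

definition cell :: "'n set => real => real^'n => 'n => int" where "cell J t p=restrict (%j. \<lfloor>t * p$j\<rfloor>) J"

lemma closed_near: "closed (near J p r :: (real^'n) set)"
proof -
have "near J p r=(INT j:J. {y. abs (y$j - p$j)<=r})" by (auto simp: near_def)
thus ?thesis by (auto intro!: closed_INT closed_Collect_le continuous_intros)
qed

lemma prod_two_values: "(PROD i:UNIV. if i:J then u else v)=u^card J * v^card (- J)"
for J :: "'n::finite set" and u v :: real by (subst prod.If_cases) (simp_all add: Collect_neg_eq)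

lemma measure_cbox_two:
fixes lo hi :: "real^'n"
assumes "!!i. hi$i - lo$i=(if i:J then u else v)" "0<=u" "0<=v"
shows "vol (cbox lo hi)=u^card J * v^card (- J)"
proof -
have "lo$i<=hi$i" for i using assms(1)[of i] assms(2,3) by (auto split: if_splits)
hence "cbox lo hi ~= {}" by (simp add: interval_ne_empty_cart)
hence "vol (cbox lo hi)=(PROD i:UNIV. hi$i - lo$i)" by (rule content_cbox_cart)
thus ?thesis unfolding assms(1) prod_two_values .
qed

lemma measure_cube_near_le:
fixes c p :: "real^'n" and r rh :: real
assumes "0<=r" "0<=rh"
shows "vol (cbox c (c + (\<chi> i. r)) Int near J p rh)<=(2 * rh)^card J * r^card (- J)"
proof -
define lo :: "real^'n" where "lo=(\<chi> i. if i:J then p$i - rh else c$i)"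
define hi :: "real^'n" where "hi=(\<chi> i. if i:J then p$i + rh else c$i + r)"
have sub: "cbox c (c + (\<chi> i. r)) Int near J p rh<=cbox lo hi"
proof
 fix y assume y: "y:cbox c (c + (\<chi> i. r)) Int near J p rh"
 have "lo$i<=y$i & y$i<=hi$i" for i
 proof (cases "i:J")
 case True
 hence "abs (y$i - p$i)<=rh" using y by (simp add: near_def)
 thus ?thesis using True unfolding lo_def hi_def abs_le_iff by simp
 next
 case False
 have "c$i<=y$i & y$i<=(c + (\<chi> i. r))$i" using y unfolding Int_iff mem_box_cart by blast
 thus ?thesis using False unfolding lo_def hi_def by simp
 qed
 thus "y:cbox lo hi" unfolding mem_box_cart by blast
qed
have "vol (cbox c (c + (\<chi> i. r)) Int near J p rh)<=vol (cbox lo hi)"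
 by (rule measure_mono_fmeasurable[OF sub _ fmeasurable_cbox]) (simp add: closed_near borel_closed sets.Int)
also have "... = (2 * rh)^card J * r^card (- J)"
 by (rule measure_cbox_two) (use assms in \<open>auto simp: lo_def hi_def\<close>)
finally show ?thesis .
qed

lemma measure_cube_near_ge:
fixes c p :: "real^'n" and r rh :: real
assumes "0<=rh" "rh<=r / 2" and p: "!!j. j:J ==> c$j<=p$j & p$j<=c$j + r"
shows "rh ^ card J * r^card (- J)<=vol (cbox c (c + (\<chi> i. r)) Int near J p rh)"
proof -
\<comment> \<open>Of the two intervals of length \<open>rh\<close> with endpoint p_i, one that lies
  inside the cube is taken.\<close>
define s where "s=(%i. if p$i + rh<=c$i + r then p$i else p$i - rh)"
define lo :: "real^'n" where "lo=(\<chi> i. if i:J then s i else c$i)"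
define hi :: "real^'n" where "hi=(\<chi> i. if i:J then s i + rh else c$i + r)"
have sub: "cbox lo hi<=cbox c (c + (\<chi> i. r)) Int near J p rh"
proof
 fix y assume "y:cbox lo hi"
 hence y: "lo$i<=y$i" "y$i<=hi$i" for i unfolding mem_box_cart by auto
 have inJ: "abs (y$i - p$i)<=rh & c$i<=y$i & y$i<=c$i + r" if "i:J" for i
 proof -
 have y1: "s i<=y$i" "y$i<=s i + rh" using y[of i] that by (simp_all add: lo_def hi_def)
 show ?thesis
 proof (cases "p$i + rh<=c$i + r")
  case True
  hence "s i=p$i" by (simp add: s_def)
  thus ?thesis using y1 p[OF that] True assms(1,2) by linarith
 next
  case False
  hence "s i=p$i - rh" by (simp add: s_def)
  thus ?thesis using y1 p[OF that] False assms(1,2) by linarith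
 qed
 qed
 have "c$i<=y$i & y$i<=c$i + r" for i
 proof (cases "i:J")
 case True
 thus ?thesis using inJ by blast
 next
 case False
 thus ?thesis using y[of i] unfolding lo_def hi_def by simp
 qed
 hence "y:cbox c (c + (\<chi> i. r))" by (simp add: mem_box_cart)
 moreover have "y:near J p rh" using inJ by (simp add: near_def)
 ultimately show "y:cbox c (c + (\<chi> i. r)) Int near J p rh" by (rule IntI)
qed
have "rh ^ card J * r^card (- J)=vol (cbox lo hi)"
 by (rule measure_cbox_two[symmetric]) (use assms in \<open>auto simp: lo_def hi_def\<close>)
also have "... <= vol (cbox c (c + (\<chi> i. r)) Int near J p rh)" by (rule measure_mono_fmeasurable[OF sub], simp)
 (rule fmeasurable_Int_fmeasurable[OF fmeasurable_cbox], simp add: closed_near borel_closed)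
finally show ?thesis .
qed

lemma cell_count:
fixes F :: "(real^'n) set" and t s :: real and u :: "'n => real"
assumes t: "t > 0" and s: "s >= 0" and inj: "inj_on (cell J t) F"
 and b: "!!p j. p:F ==> j:J ==> u j<=p$j & p$j<=u j + s"
shows "finite F" "real (card F)<=(t * s + 2)^card J"
proof -
let ?S = "PiE J (%j. {\<lfloor>t * u j\<rfloor>..\<lfloor>t * (u j + s)\<rfloor>})"
have fS: "finite ?S" by (intro finite_PiE) auto
have im: "cell J t ` F <= ?S" using b t unfolding cell_def by (auto intro!: floor_mono mult_left_mono)
show "finite F" by (rule finite_imageD[OF finite_subset[OF im fS] inj])
have c1: "real (card {\<lfloor>t * u j\<rfloor>..\<lfloor>t * (u j + s)\<rfloor>})<=t * s + 2" for j
proof -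
 have "\<lfloor>t * u j\<rfloor> <= \<lfloor>t * (u j + s)\<rfloor>" using t s by (intro floor_mono mult_left_mono) auto
 hence "real (card {\<lfloor>t * u j\<rfloor>..\<lfloor>t * (u j + s)\<rfloor>})=real_of_int \<lfloor>t * (u j + s)\<rfloor> - real_of_int \<lfloor>t * u j\<rfloor> + 1" by simp
 also have "... <= t * (u j + s) - (t * u j - 1) + 1" using floor_correct[of "t * (u j + s)"] floor_correct[of "t * u j"] by linarith
 also have "... = t * s + 2" by (simp add: algebra_simps)
 finally show ?thesis .
qed
have "card F<=card ?S" using card_mono[OF fS im] card_image[OF inj] by simp
also have "card ?S=(PROD j:J. card {\<lfloor>t * u j\<rfloor>..\<lfloor>t * (u j + s)\<rfloor>})" by (rule card_PiE) simp
finally have "real (card F)<=(PROD j:J. real (card {\<lfloor>t * u j\<rfloor>..\<lfloor>t * (u j + s)\<rfloor>}))" by (simp add: of_nat_prod[symmetric] del: of_nat_prod)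
also have "... <= (PROD j:J. t * s + 2)" using c1 by (intro prod_mono) auto
finally show "real (card F)<=(t * s + 2)^card J" by simp
qed

lemma same_cell:
assumes "t > 0" "cell J t p=cell J t p'" "j:J"
shows "abs (p$j - p'$j)<=1 / t"
proof -
have "\<lfloor>t * p$j\<rfloor> = \<lfloor>t * p'$j\<rfloor>" using fun_cong[OF assms(2), of j] assms(3) by (simp add: cell_def)
hence "abs (t * p$j - t * p'$j)<=1" using floor_correct[of "t * p$j"] floor_correct[of "t * p'$j"] by linarith
hence "abs (t * (p$j - p'$j))<=1" by (simp add: algebra_simps)
hence "t * abs (p$j - p'$j)<=1" using assms(1) by (simp add: abs_mult)
thus ?thesis using assms(1) by (simp add: pos_le_divide_eq mult.commute)
qed

lemma sum_Sigma_pairs: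
assumes "finite A" "!!x. x:A ==> finite (B x)"
shows "(SUM q:Sigma A B. f q)=(SUM i:A. SUM p:B i. f (i, p))"
using sum.Sigma[of A B "%i p. f (i, p)"] assms by (simp add: split_def)

lemma sum_pow2_le: "(SUM i<=j. 2^i :: real)<=2 * 2^j" by (induction j) auto

lemma sum_pow2_ratio_le:
assumes "finite I"
shows "(SUM i:I. if i<=j then 2^i / 2^j else (0 :: real))<=2"
proof -
have "(SUM i:I. if i<=j then 2^i / 2^j else (0 :: real))=(SUM i:I Int {..j}. 2^i / 2^j)"
 using assms by (simp add: sum.inter_restrict)
also have "... <= (SUM i<=j. 2^i / 2^j)" by (rule sum_mono2) auto
also have "... = (SUM i<=j. 2^i) / 2^j" by (simp add: sum_divide_distrib)
also have "... <= 2" using sum_pow2_le[of j] by (simp add: pos_divide_le_eq)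
finally show ?thesis .
qed

lemma not_summable_block:
fixes a :: "nat => real"
assumes "!!i. 0<=a i" "~ summable a"
shows "EX M. 1<=(SUM i:{i0..M}. a i)"
proof (rule ccontr)
assume "~ (EX M. 1<=(SUM i:{i0..M}. a i))"
hence lt: "(SUM i:{i0..M}. a i) < 1" for M by (simp add: not_le)
have "sum a {..<n}<=sum a {..<i0} + 1" for n
proof -
 have "sum a {..<n}<=sum a ({..<i0} Un {i0..n})" by (rule sum_mono2) (use assms(1) in auto)
 also have "... = sum a {..<i0} + sum a {i0..n}" by (rule sum.union_disjoint) auto
 also have "... <= sum a {..<i0} + 1" using lt[of n] by simp
 finally show ?thesis .
qed
hence "summable a" using assms(1) by (rule summableI_nonneg_bounded[rotated])
thus False using assms(2) by blast
qed

text \<open>For i <= j a cylinder of level i meets at most a constant times (1 + 2^j dti)^k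
  cylinders of level j, as the latter have at most one centre per cell of side 2^-j. The term 1
  yields a correlation that decays geometrically in j - i, the power yields the product expected of
  independent levels.\<close>

lemma ubiquity_pair_bound:
fixes c :: "real^'n" and Pi Pj :: "(real^'n) set" and i j :: nat and dti dtj r :: real
assumes k: "J ~= {}" and ij: "i<=j" and r: "r > 0" and dt: "0<=dti" "0<=dtj" "2^j * dtj<=1"
 and fPi: "finite Pi" and cPi: "real (card Pi)<=(2 * (2^i * r))^card J"
 and fPj: "finite Pj" and iPj: "inj_on (cell J (2^j)) Pj"
shows "(SUM p:Pi. SUM p':Pj. vol (cbox c (c + (\<chi> i. r)) Int near J p dti Int (cbox c (c + (\<chi> i. r)) Int near J p' dtj)))
 <= 24^card J * (r^card J * r^card (- J)) * ((2^j * dtj)^card J * (2^i / 2^j) + (2^i * dti)^card J * (2^j * dtj)^card J)"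
proof -
define k where "k=card J"
define k' where "k'=card (- J)"
define x where "x=2^j * dti"
have kpos: "k > 0" using k by (simp add: k_def card_gt_0_iff)
have x: "x >= 0" using dt by (simp add: x_def)
let ?D = "cbox c (c + (\<chi> i. r))"
have inner: "(SUM p':Pj. vol (?D Int near J p dti Int (?D Int near J p' dtj)))<=(6^k * (1 + x^k)) * ((2 * dtj)^k * r^k')" for p
proof -
 define F where "F={p':Pj. ?D Int near J p dti Int (?D Int near J p' dtj) ~= {}}"
 have iF: "inj_on (cell J (2^j)) F" by (rule inj_on_subset[OF iPj]) (auto simp: F_def)
 have bF: "(p$l - (dti + dtj))<=p'$l & p'$l<=(p$l - (dti + dtj)) + 2 * (dti + dtj)" if pF: "p':F" "l:J" for p' l
 proof -
 obtain y where "y:near J p dti" "y:near J p' dtj" using pF(1) unfolding F_def by blast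
 hence "abs (y$l - p$l)<=dti" "abs (y$l - p'$l)<=dtj" using pF(2) by (auto simp: near_def)
 thus ?thesis unfolding abs_le_iff by auto
 qed
 have "real (card F)<=(2^j * (2 * (dti + dtj)) + 2)^k"
 unfolding k_def by (rule cell_count(2)[OF _ _ iF bF]) (use dt in auto)
 also have "... <= (2 * x + 4)^k"
 proof (rule power_mono)
 have "2^j * (2 * (dti + dtj))=2 * x + 2 * (2^j * dtj)" by (simp add: x_def algebra_simps)
 thus "2^j * (2 * (dti + dtj)) + 2<=2 * x + 4" using dt(3) by linarith
 qed (use dt in auto)
 also have "... <= 6^k * (1 + x^k)"
 proof (cases "x<=1")
 case True
 hence "(2 * x + 4)^k<=6^k" using x by (intro power_mono) auto
 also have "... <= 6^k * (1 + x^k)" using x by simp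
 finally show ?thesis .
 next
 case False
 hence "(2 * x + 4)^k<=(6 * x)^k" using x by (intro power_mono) auto
 also have "... = 6^k * x^k" by (rule power_mult_distrib)
 also have "... <= 6^k * (1 + x^k)" by (intro mult_left_mono) auto
 finally show ?thesis .
 qed
 finally have cF: "real (card F)<=6^k * (1 + x^k)" .
 have "(SUM p':Pj. vol (?D Int near J p dti Int (?D Int near J p' dtj)))=(SUM p':F. vol (?D Int near J p dti Int (?D Int near J p' dtj)))"
 proof (rule sum.mono_neutral_right[OF fPj])
 show "ALL p':Pj - F. vol (?D Int near J p dti Int (?D Int near J p' dtj))=0"
 proof
  fix p' assume "p':Pj - F"
  hence "?D Int near J p dti Int (?D Int near J p' dtj)={}" unfolding F_def by blast
  thus "vol (?D Int near J p dti Int (?D Int near J p' dtj))=0" by (simp only: measure_empty)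
 qed
 qed (simp add: F_def)
 also have "... <= (SUM p':F. (2 * dtj)^k * r^k')"
 proof (rule sum_mono)
 fix p'
 have "vol (?D Int near J p dti Int (?D Int near J p' dtj))<=vol (?D Int near J p' dtj)"
  by (rule measure_mono_fmeasurable[OF Int_lower2])
  (auto simp: closed_near borel_closed sets.Int fmeasurable_cbox intro!: fmeasurable_Int_fmeasurable)
 also have "... <= (2 * dtj)^k * r^k'" unfolding k_def k'_def by (rule measure_cube_near_le) (use r dt in auto)
 finally show "vol (?D Int near J p dti Int (?D Int near J p' dtj))<=(2 * dtj)^k * r^k'" .
 qed
 also have "... = real (card F) * ((2 * dtj)^k * r^k')" by simp
 also have "... <= (6^k * (1 + x^k)) * ((2 * dtj)^k * r^k')" by (rule mult_right_mono[OF cF]) (use r dt in auto)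
 finally show ?thesis .
qed
have "(SUM p:Pi. SUM p':Pj. vol (?D Int near J p dti Int (?D Int near J p' dtj)))<=(SUM p:Pi. (6^k * (1 + x^k)) * ((2 * dtj)^k * r^k'))"
 by (intro sum_mono inner)
also have "... = real (card Pi) * ((6^k * (1 + x^k)) * ((2 * dtj)^k * r^k'))" by simp
also have "... <= (2 * (2^i * r))^k * ((6^k * (1 + x^k)) * ((2 * dtj)^k * r^k'))"
 by (rule mult_right_mono[OF cPi[folded k_def]]) (use r dt x in auto)
also have "... = (2^k * 6^k * 2^k) * (r^k * r^k') * ((2^i)^k * dtj^k + (2^i)^k * dti^k * ((2^j)^k * dtj^k))"
 unfolding x_def power_mult_distrib by (simp add: algebra_simps)
also have "2^k * 6^k * 2^k=(24^k :: real)" by (simp add: power_mult_distrib[symmetric])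
also have "24^k * (r^k * r^k') * ((2^i)^k * dtj^k + (2^i)^k * dti^k * ((2^j)^k * dtj^k))
 <= 24^k * (r^k * r^k') * ((2^j * dtj)^k * (2^i / 2^j) + (2^i * dti)^k * (2^j * dtj)^k)"
proof (intro mult_left_mono add_mono)
 \<comment> \<open>Since y <= 1 and k >= 1, y^k may be replaced by y, whose sum over i <= j is at
   most 2.\<close>
 define y where "y=(2^i / 2^j :: real)"
 have y: "0<=y" "y<=1" using ij by (auto simp: y_def)
 have "y^k<=y^1" by (rule power_decreasing) (use y kpos in auto)
 hence yk: "y^k<=y" by simp
 have "(2^i)^k * dtj^k=(2^j * dtj)^k * y^k" by (simp add: y_def power_mult_distrib[symmetric] mult.commute)
 also have "... <= (2^j * dtj)^k * y" by (rule mult_left_mono[OF yk]) (use dt in simp)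
 finally show "(2^i)^k * dtj^k<=(2^j * dtj)^k * (2^i / 2^j)" by (simp add: y_def)
 show "(2^i)^k * dti^k * ((2^j)^k * dtj^k)<=(2^i * dti)^k * (2^j * dtj)^k"
 by (simp add: power_mult_distrib)
qed (use r in auto)
finally show ?thesis unfolding k_def k'_def .
qed

text \<open>Keep one centre per grid cell. The cylinders of radius \<open>rh\<close>, enlarged by a
  cell, still cover \<open>G\<close>, half of the inner cube, which forces the number of centres to
  be of the full order (2^i r)^k. The margin r/4 around the inner cube ensures that all centres
  concerned lie in the big cube.\<close>

lemma ubiquity_selection:
fixes c :: "real^'n" and P :: "(real^'n) set" and i :: nat and r C1 :: real
assumes r: "r > 0" and C1: "C1 >= 0" and i: "4<=2^i * r" "C1 / 2^i<=r / 4"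
 and G: "G:sets borel" "G<=cbox (c + (\<chi> i. r / 4)) (c + (\<chi> i. 3 * r / 4))"
 "vol (cbox (c + (\<chi> i. r / 4)) (c + (\<chi> i. 3 * r / 4))) / 2<=vol G" "!!y. y:G ==> EX p:P. y:near J p (C1 / 2^i)"
shows "EX P'<=P. finite P' & inj_on (cell J (2^i)) P' & (ALL p:P'. ALL j:J. c$j<=p$j & p$j<=c$j + r) &
 real (card P')<=(2 * (2^i * r))^card J & (1 / (2 * (4 * (C1 + 1))^card J)) * (2^i * r)^card J<=real (card P')"
proof -
define k where "k=card J"
define k' where "k'=card (- J)"
define S where "S={p:P. ALL j:J. c$j<=p$j & p$j<=c$j + r}"
obtain P' where P': "P'<=S" "inj_on (cell J (2^i)) P'" "cell J (2^i) ` S=cell J (2^i) ` P'"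
 using subset_image_inj[of "cell J (2^i) ` S" "cell J (2^i)" S] by blast
have bP: "c$j<=p$j & p$j<=c$j + r" if "p:P'" "j:J" for p j using P'(1) that by (auto simp: S_def)
have fP: "finite P'" by (rule cell_count(1)[OF _ _ P'(2) bP]) (use r in auto)
have "real (card P')<=(2^i * r + 2)^k" unfolding k_def by (rule cell_count(2)[OF _ _ P'(2) bP]) (use r in auto)
also have "... <= (2 * (2^i * r))^k"
proof (rule power_mono)
 show "2^i * r + 2<=2 * (2^i * r)" using i(1) by linarith
 show "0<=2^i * r + 2" using r by simp
qed
finally have up: "real (card P')<=(2 * (2^i * r))^k" .
define rh where "rh=(C1 + 1) / 2^i"
have rh: "rh >= 0" using C1 by (simp add: rh_def)
let ?c' = "c + (\<chi> i. r / 4)"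
have half: "c + (\<chi> i. 3 * r / 4) = ?c' + (\<chi> i. r / 2)" by (simp add: vec_eq_iff)
let ?D' = "cbox ?c' (?c' + (\<chi> i. r / 2))"
have sub: "G<=(UN p:P'. ?D' Int near J p rh)"
proof
 fix y assume y: "y:G"
 obtain p where p: "p:P" "y:near J p (C1 / 2^i)" using G(4)[OF y] by blast
 have yD: "y:cbox ?c' (?c' + (\<chi> i. r / 2))" using y G(2) half by auto
 hence yc: "c$j + r / 4<=y$j" "y$j<=c$j + r / 4 + r / 2" for j unfolding mem_box_cart by auto
 have py: "abs (y$j - p$j)<=C1 / 2^i" if "j:J" for j using p(2) that by (simp add: near_def)
 have "c$j<=p$j & p$j<=c$j + r" if "j:J" for j using py[OF that] yc[of j] i(2) by linarith
 hence "p:S" using p(1) by (simp add: S_def)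
 then obtain p' where p': "p':P'" "cell J (2^i) p=cell J (2^i) p'" using P'(3) by blast
 have "abs (y$j - p'$j)<=rh" if "j:J" for j
 proof -
 have "abs (p$j - p'$j)<=1 / 2^i" by (rule same_cell[OF _ p'(2) that]) simp
 moreover have "rh=C1 / 2^i + 1 / 2^i" by (simp add: rh_def add_divide_distrib)
 ultimately show ?thesis using py[OF that] by linarith
 qed
 thus "y:(UN p:P'. ?D' Int near J p rh)" using p'(1) yD by (auto simp: near_def)
qed
have fm: "?D' Int near J p rh:fmeasurable lborel" for p
 by (rule fmeasurable_Int_fmeasurable[OF fmeasurable_cbox]) (simp add: closed_near borel_closed)
have "vol ?D'=(r / 2)^k * (r / 2)^k'" unfolding k_def k'_def by (rule measure_cbox_two) (use r in auto)
hence "(r / 2)^k * (r / 2)^k' / 2<=vol G" using G(3) half by simp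
also have "... <= vol (UN p:P'. ?D' Int near J p rh)"
 by (rule measure_mono_fmeasurable[OF sub _ fmeasurable.finite_UN[OF fP fm]]) (use G(1) in auto)
also have "... <= (SUM p:P'. vol (?D' Int near J p rh))"
 by (rule measure_UNION_le[OF fP]) (use fm in \<open>auto simp: fmeasurable_def\<close>)
also have "... <= (SUM p:P'. (2 * rh)^k * (r / 2)^k')"
 unfolding k_def k'_def by (intro sum_mono measure_cube_near_le) (use r rh in auto)
also have "... = (real (card P') * (2 * rh)^k) * (r / 2)^k'" by simp
finally have "((r / 2)^k / 2) * (r / 2)^k'<=(real (card P') * (2 * rh)^k) * (r / 2)^k'" by simp
hence "(r / 2)^k / 2<=real (card P') * (2 * rh)^k" using r by (simp only: mult_le_cancel_right) (simp add: not_less)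
hence "(r / 2)^k / 2 * (2 * 2^i)^k<=real (card P') * (2 * rh)^k * (2 * 2^i)^k" by (intro mult_right_mono) auto
moreover have "(r / 2)^k / 2 * (2 * 2^i)^k=(2^i * r)^k / 2"
proof -
 have "(r / 2)^k * (2 * 2^i)^k=(2^i * r)^k" unfolding power_mult_distrib[symmetric] by (simp add: mult.commute)
 thus ?thesis by simp
qed
moreover have "(2 * rh)^k * (2 * 2^i)^k=(4 * (C1 + 1))^k" unfolding power_mult_distrib[symmetric] by (simp add: rh_def)
ultimately have "(2^i * r)^k / 2<=real (card P') * (4 * (C1 + 1))^k" by (simp only: mult.assoc)
moreover have "(4 * (C1 + 1))^k > 0" using C1 by (intro zero_less_power) auto
ultimately have "(2^i * r)^k / 2 / (4 * (C1 + 1))^k<=real (card P')" by (simp only: pos_divide_le_eq)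
hence low: "(1 / (2 * (4 * (C1 + 1))^k)) * (2^i * r)^k<=real (card P')" by (simp add: divide_divide_eq_left)
show ?thesis using P' fP bP up low unfolding k_def S_def by (intro exI[of _ P'] conjI ballI) auto
qed

text \<open>Take a block of levels whose terms \<open>a i\<close> have sum S >= 1. The first moment
  is at least \<open>kp * S * vD\<close>, the second moment at most
  \<open>24^k * vD * (5 * S\<^sup>2)\<close>, so S cancels and a proportion independent of the cube
  remains.\<close>

lemma ubiquity_cube:
fixes P :: "nat => (real^'n) set" and dt :: "nat => real" and C1 r :: real and c :: "real^'n"
assumes J: "J ~= {}" and C1: "C1 >= 0" and dt: "!!i. 0<=dt i" "!!i. dt i<=1 / 2^i"
 and ns: "~ summable (%i. (2^i * dt i)^card J)" and r: "r > 0"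
 and cov: "EX i0. ALL i>=i0. EX G:sets borel. G<=cbox (c + (\<chi> i. r / 4)) (c + (\<chi> i. 3 * r / 4)) &
 vol (cbox (c + (\<chi> i. r / 4)) (c + (\<chi> i. 3 * r / 4))) / 2<=vol G & (ALL y:G. EX p:P i. y:near J p (C1 / 2^i))"
shows "EX I. finite I & (ALL q:I. i1<=fst q & snd q:P (fst q)) &
 (1 / (2 * (4 * (C1 + 1))^card J))\<^sup>2 / (5 * 24^card J) * vol (cbox c (c + (\<chi> i. r)))
 <= vol (UN q:I. cbox c (c + (\<chi> i. r)) Int near J (snd q) (dt (fst q)))"
proof -
define k where "k=card J"
define k' where "k'=card (- J)"
define kp where "kp=1 / (2 * (4 * (C1 + 1))^k)"
define D where "D=cbox c (c + (\<chi> i. r))"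
define vD where "vD=r^k * r^k'"
have vD: "vD > 0" using r by (simp add: vD_def)
have mD: "vol D=vD" unfolding D_def vD_def k_def k'_def by (rule measure_cbox_two) (use r in auto)
have kp: "kp > 0" using C1 by (simp add: kp_def)
obtain i0 where i0: "ALL i>=i0. EX G:sets borel. G<=cbox (c + (\<chi> i. r / 4)) (c + (\<chi> i. 3 * r / 4)) &
 vol (cbox (c + (\<chi> i. r / 4)) (c + (\<chi> i. 3 * r / 4))) / 2<=vol G & (ALL y:G. EX p:P i. y:near J p (C1 / 2^i))"
 using cov by blast
obtain n0 where n0: "(4 + 4 * C1) / r < 2^n0" using real_arch_pow[of 2 "(4 + 4 * C1) / r"] by auto
define i2 where "i2=max n0 (max i0 i1)"
have big: "4 + 4 * C1<=2^i * r" if "i >= i2" for i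
proof -
 have "(2::real)^n0<=2^i" using that by (intro power_increasing) (auto simp: i2_def)
 hence "(4 + 4 * C1) / r<=2^i" using n0 by linarith
 thus ?thesis using r by (simp add: pos_divide_le_eq)
qed
define sel where "sel=(%i P'. P'<=P i & finite P' & inj_on (cell J (2^i)) P' & (ALL p:P'. ALL j:J. c$j<=p$j & p$j<=c$j + r) &
 real (card P')<=(2 * (2^i * r))^k & kp * (2^i * r)^k<=real (card P'))"
have "EX P'. sel i P'" if i: "i >= i2" for i
proof -
 have ii: "i >= i0" using i by (simp add: i2_def)
 from i0[rule_format, OF ii] obtain G where G0: "G:sets borel" and G1: "G<=cbox (c + (\<chi> i. r / 4)) (c + (\<chi> i. 3 * r / 4)) &
 vol (cbox (c + (\<chi> i. r / 4)) (c + (\<chi> i. 3 * r / 4))) / 2<=vol G & (ALL y:G. EX p:P i. y:near J p (C1 / 2^i))"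
 by (rule bexE)
 have b1: "4<=2^i * r" using big[OF i] C1 by linarith
 have "4 * C1<=2^i * r" using big[OF i] by linarith
 hence b2: "C1 / 2^i<=r / 4" by (simp add: pos_divide_le_eq mult.commute)
 show ?thesis unfolding sel_def kp_def k_def
 by (rule ubiquity_selection[OF r C1 b1 b2 G0 conjunct1[OF G1] conjunct1[OF conjunct2[OF G1]] bspec[OF conjunct2[OF conjunct2[OF G1]]]])
qed
hence "ALL i. EX P'. i >= i2 --> sel i P'" by blast
from choice[OF this] obtain P' where "ALL i. i >= i2 --> sel i (P' i)" by (rule exE)
hence sel: "!!i. i >= i2 ==> sel i (P' i)" by simp
have P': "!!i. i >= i2 ==> P' i<=P i" "!!i. i >= i2 ==> finite (P' i)"
 "!!i. i >= i2 ==> inj_on (cell J (2^i)) (P' i)" "!!i p j. i >= i2 ==> p:P' i ==> j:J ==> c$j<=p$j & p$j<=c$j + r"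
 "!!i. i >= i2 ==> real (card (P' i))<=(2 * (2^i * r))^k" "!!i. i >= i2 ==> kp * (2^i * r)^k<=real (card (P' i))"
 using sel unfolding sel_def by simp_all
define a where "a=(%i. (2^i * dt i)^k)"
have a0: "a i >= 0" for i using dt(1) by (simp add: a_def)
have "~ summable a" using ns by (simp add: a_def k_def)
then obtain M where M: "1<=(SUM i:{i2..M}. a i)" using not_summable_block[of a] a0 by blast
define S where "S=(SUM i:{i2..M}. a i)"
define I where "I=Sigma {i2..M} P'"
define A where "A=(%q. D Int near J (snd q) (dt (fst q)))"
have fI: "finite I" unfolding I_def using P'(2) by (intro finite_SigmaI) auto
have A: "A q:fmeasurable lborel" for q
 unfolding A_def D_def by (rule fmeasurable_Int_fmeasurable[OF fmeasurable_cbox]) (simp add: closed_near borel_closed)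
have low: "kp * S * vD<=(SUM q:I. vol (A q))"
proof -
 have one: "kp * a i * vD<=(SUM p:P' i. vol (A (i, p)))" if i: "i:{i2..M}" for i
 proof -
 have i2: "i >= i2" using i by simp
 have "4<=2^i * r" using big[OF i2] C1 by linarith
 hence "1 / 2^i<=r / 2" by (simp add: field_simps)
 hence dl: "dt i<=r / 2" using dt(2)[of i] by linarith
 have "kp * a i * vD=kp * (2^i * r)^k * (dt i^k * r^k')" by (simp add: a_def vD_def power_mult_distrib)
 also have "... <= real (card (P' i)) * (dt i^k * r^k')" by (rule mult_right_mono[OF P'(6)[OF i2]]) (use dt(1) r in auto)
 also have "... = (SUM p:P' i. dt i^k * r^k')" by simp
 also have "... <= (SUM p:P' i. vol (A (i, p)))" unfolding A_def D_def fst_conv snd_conv k_def k'_def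
  by (intro sum_mono measure_cube_near_ge dt(1) dl) (use P'(4)[OF i2] in auto)
 finally show ?thesis .
 qed
 have "kp * S * vD=(SUM i:{i2..M}. kp * a i * vD)" by (simp add: S_def sum_distrib_left sum_distrib_right)
 also have "... <= (SUM i:{i2..M}. SUM p:P' i. vol (A (i, p)))" by (intro sum_mono one)
 also have "... = (SUM q:I. vol (A q))" unfolding I_def by (rule sum_Sigma_pairs[symmetric]) (use P'(2) in auto)
 finally show ?thesis .
qed
define h where "h=(%i j. if i<=j then a j * (2^i / 2^j) else 0)"
have h0: "h i j >= 0" for i j using a0 by (simp add: h_def)
define Bp where "Bp=(%i j. SUM p:P' i. SUM p':P' j. vol (A (i, p) Int A (j, p')))"
have Bsym: "Bp i j=Bp j i" for i j unfolding Bp_def by (subst sum.swap) (simp add: Int_commute)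
have Ble: "Bp i j<=24^k * vD * (h i j + a i * a j)" if "i >= i2" "i<=j" for i j
proof -
 have j2: "j >= i2" using that by simp
 have dj: "2^j * dt j<=1" using dt(2)[of j] by (simp add: field_simps)
 show ?thesis
 using ubiquity_pair_bound[OF J that(2) r dt(1)[of i] dt(1)[of j] dj P'(2)[OF that(1)] P'(5)[OF that(1), unfolded k_def] P'(2)[OF j2] P'(3)[OF j2], of c] that(2)
 unfolding Bp_def A_def D_def fst_conv snd_conv h_def a_def vD_def k_def k'_def by simp
qed
have Bgen: "Bp i j<=24^k * vD * (h i j + h j i + a i * a j)" if "i:{i2..M}" "j:{i2..M}" for i j
proof (cases "i<=j")
 case True
 hence "Bp i j<=24^k * vD * (h i j + a i * a j)" using Ble that by simp
 also have "... <= 24^k * vD * (h i j + h j i + a i * a j)" using vD h0 by (intro mult_left_mono) auto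
 finally show ?thesis .
next
 case False
 hence "Bp j i<=24^k * vD * (h j i + a j * a i)" using Ble that by simp
 also have "... <= 24^k * vD * (h i j + h j i + a i * a j)" using vD h0 by (intro mult_left_mono) (auto simp: mult.commute)
 finally show ?thesis using Bsym by simp
qed
have hs: "(SUM i:{i2..M}. h i j)<=2 * a j" for j
proof -
 have "(SUM i:{i2..M}. h i j)=a j * (SUM i:{i2..M}. if i<=j then 2^i / 2^j else 0)"
 unfolding sum_distrib_left by (intro sum.cong refl) (simp add: h_def)
 also have "... <= a j * 2" using sum_pow2_ratio_le[of "{i2..M}" j] a0 by (intro mult_left_mono) auto
 finally show ?thesis by simp
qed
have "(SUM q:I. SUM q':I. vol (A q Int A q'))=(SUM i:{i2..M}. SUM p:P' i. SUM q':I. vol (A (i, p) Int A q'))"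
 unfolding I_def by (rule sum_Sigma_pairs) (use P'(2) in auto)
also have "... = (SUM i:{i2..M}. SUM p:P' i. SUM j:{i2..M}. SUM p':P' j. vol (A (i, p) Int A (j, p')))"
proof (intro sum.cong refl)
 fix i p
 show "(SUM q':I. vol (A (i, p) Int A q'))=(SUM j:{i2..M}. SUM p':P' j. vol (A (i, p) Int A (j, p')))"
 unfolding I_def by (rule sum_Sigma_pairs) (use P'(2) in auto)
qed
also have "... = (SUM i:{i2..M}. SUM j:{i2..M}. Bp i j)" unfolding Bp_def by (intro sum.cong refl sum.swap)
also have "... <= (SUM i:{i2..M}. SUM j:{i2..M}. 24^k * vD * (h i j + h j i + a i * a j))" by (intro sum_mono Bgen)
also have "... = 24^k * vD * ((SUM i:{i2..M}. SUM j:{i2..M}. h i j) + (SUM i:{i2..M}. SUM j:{i2..M}. h j i) + S * S)"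
 unfolding S_def sum_product by (simp add: sum_distrib_left[symmetric] sum.distrib)
also have "(SUM i:{i2..M}. SUM j:{i2..M}. h i j)=(SUM i:{i2..M}. SUM j:{i2..M}. h j i)" by (rule sum.swap)
\<comment> \<open>Each of the two off-diagonal sums is at most 2 S, hence at most 2 S^2 because S >=
  1; with the product term this gives 5.\<close>
also have "24^k * vD * ((SUM i:{i2..M}. SUM j:{i2..M}. h j i) + (SUM i:{i2..M}. SUM j:{i2..M}. h j i) + S * S)<=24^k * vD * (5 * S\<^sup>2)"
proof (rule mult_left_mono)
 have "(SUM i:{i2..M}. SUM j:{i2..M}. h j i)<=(SUM i:{i2..M}. 2 * a i)" by (intro sum_mono hs)
 also have "... = 2 * S" by (simp add: S_def sum_distrib_left)
 finally have "(SUM i:{i2..M}. SUM j:{i2..M}. h j i)<=2 * S" .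
 moreover have "S * 1<=S * S" using M S_def by (intro mult_left_mono) auto
 ultimately show "(SUM i:{i2..M}. SUM j:{i2..M}. h j i) + (SUM i:{i2..M}. SUM j:{i2..M}. h j i) + S * S<=5 * S\<^sup>2"
 by (simp add: power2_eq_square)
qed (use vD in simp)
finally have pairs: "(SUM q:I. SUM q':I. vol (A q Int A q'))<=24^k * vD * (5 * S\<^sup>2)" .
define U where "U=(UN q:I. A q)"
have S1: "S >= 1" using M by (simp add: S_def)
have "(kp * S * vD)\<^sup>2<=(SUM q:I. vol (A q))\<^sup>2" by (rule power_mono[OF low]) (use kp S1 vD in auto)
also have "... <= vol U * (SUM q:I. SUM q':I. vol (A q Int A q'))" unfolding U_def by (rule second_moment[OF fI A])
also have "... <= vol U * (24^k * vD * (5 * S\<^sup>2))" by (rule mult_left_mono[OF pairs]) simp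
finally have "(kp\<^sup>2 * vD) * (S\<^sup>2 * vD)<=(vol U * (5 * 24^k)) * (S\<^sup>2 * vD)"
 by (simp add: power2_eq_square mult.assoc mult.commute mult.left_commute)
moreover have "S\<^sup>2 * vD > 0" using S1 vD by (intro mult_pos_pos) auto
ultimately have "kp\<^sup>2 * vD<=vol U * (5 * 24^k)" by (simp only: mult_le_cancel_right_pos)
hence fin: "kp\<^sup>2 / (5 * 24^k) * vol D<=vol U" unfolding mD by (simp add: pos_divide_le_eq)
have "ALL q:I. i1<=fst q & snd q:P (fst q)"
proof
 fix q assume "q:I"
 hence q: "i2<=fst q" "snd q:P' (fst q)" by (auto simp: I_def)
 thus "i1<=fst q & snd q:P (fst q)" using P'(1)[OF q(1)] by (auto simp: i2_def)
qed
thus ?thesis using fI fin unfolding kp_def k_def U_def A_def D_def by blast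
qed

text \<open>The proportion from \<open>ubiquity_cube\<close> is the same for all cubes and all
  starting levels \<open>i1\<close>; continuity from above passes it to the limsup set, and
  \<open>density_full\<close> makes it full.\<close>

theorem ubiquity:
fixes P :: "nat => (real^'n) set" and dt :: "nat => real" and C1 W :: real
assumes J: "J ~= {}" and C1: "C1 >= 0" and dt: "!!i. 0<=dt i" "!!i. dt i<=1 / 2^i"
 and ns: "~ summable (%i. (2^i * dt i)^card J)" and W: "W > 0" and cP: "!!i. countable (P i)"
 and cov: "!!c d. (ALL i. c$i < d$i) ==> cbox c d<=cbox (\<chi> i. - W) (\<chi> i. W) ==>
 EX i0. ALL i>=i0. EX G:sets borel. G<=cbox c d & vol (cbox c d) / 2<=vol G & (ALL y:G. EX p:P i. y:near J p (C1 / 2^i))"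
shows "AE y in lborel. y:cbox (\<chi> i. - W) (\<chi> i. W) --> infinite {i. EX p:P i. y:near J p (dt i)}"
proof -
define kp where "kp=(1 / (2 * (4 * (C1 + 1))^card J))\<^sup>2 / (5 * 24^card J)"
have "1 / (2 * (4 * (C1 + 1))^card J) > 0" using C1 by simp
hence kp: "kp > 0" unfolding kp_def by (intro divide_pos_pos zero_less_power) auto
define V where "V=(%i1. UN i:{i1..}. UN p:P i. near J p (dt i))"
have Vb: "V i1:sets borel" for i1
 unfolding V_def using cP by (intro sets.countable_UN' countableI_type) (auto simp: closed_near borel_closed)
define A where "A=(\<Inter>i1. V i1)"
have Ab: "A:sets borel" unfolding A_def using Vb by (intro sets.countable_INT') auto
have "emeasure lborel (cbox (\<chi> i. - W) (\<chi> i. W) - A)=0"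
proof (rule density_full[OF Ab kp W])
 fix c :: "real^'n" and r :: real
 assume r: "r > 0" and sub: "cbox c (c + (\<chi> i. r))<=cbox (\<chi> i. - W) (\<chi> i. W)"
 let ?D = "cbox c (c + (\<chi> i. r))"
 have sub2: "cbox (c + (\<chi> i. r / 4)) (c + (\<chi> i. 3 * r / 4)) <= ?D"
 proof
 fix y assume "y:cbox (c + (\<chi> i. r / 4)) (c + (\<chi> i. 3 * r / 4))"
 hence y: "c$i + r / 4<=y$i & y$i<=c$i + 3 * r / 4" for i by (auto simp: mem_box_cart)
 have "c$i<=y$i & y$i<=c$i + r" for i using y[of i] r by linarith
 thus "y : ?D" by (simp add: mem_box_cart)
 qed
 have "kp * vol ?D<=vol (?D Int V i1)" for i1
 proof -
 obtain I where I: "finite I" "ALL q:I. i1<=fst q & snd q:P (fst q)"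
  "kp * vol ?D<=vol (UN q:I. ?D Int near J (snd q) (dt (fst q)))"
  using ubiquity_cube[OF J C1 dt ns r cov[OF _ order_trans[OF sub2 sub]], of i1] r unfolding kp_def by auto
 have "(UN q:I. ?D Int near J (snd q) (dt (fst q))) <= ?D Int V i1" using I(2) unfolding V_def by fastforce
 hence "vol (UN q:I. ?D Int near J (snd q) (dt (fst q)))<=vol (?D Int V i1)" by (rule measure_mono_fmeasurable)
  (use I(1) Vb in \<open>auto simp: closed_near borel_closed intro!: sets.finite_UN fmeasurable_Int_fmeasurable fmeasurable_cbox\<close>)
 thus ?thesis using I(3) by linarith
 qed
 moreover have "(%i1. vol (?D Int V i1)) \<longlonglongrightarrow> vol (\<Inter>i1. ?D Int V i1)"
 proof (rule Lim_measure_decseq)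
 show "range (%i1. ?D Int V i1)<=sets lborel" using Vb by auto
 show "decseq (%i1. ?D Int V i1)" unfolding decseq_def V_def by fastforce
 show "emeasure lborel (?D Int V i1) ~= \<infinity>" for i1 unfolding infinity_ennreal_def
  by (rule fmeasurableD2, rule fmeasurable_Int_fmeasurable[OF fmeasurable_cbox]) (use Vb in simp)
 qed
 ultimately have "kp * vol ?D<=vol (\<Inter>i1. ?D Int V i1)" by (intro LIMSEQ_le_const) auto
 thus "kp * vol ?D<=vol (?D Int A)" by (simp add: A_def)
qed
hence "AE y in lborel. y ~: cbox (\<chi> i. - W) (\<chi> i. W) - A" using Ab by (intro AE_not_in) (auto simp: null_sets_def)
thus ?thesis
proof (eventually_elim, intro impI)
 fix y assume "y ~: cbox (\<chi> i. - W) (\<chi> i. W) - A" "y:cbox (\<chi> i. - W) (\<chi> i. W)"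
 hence "y:V i1" for i1 by (auto simp: A_def)
 hence "ALL i1. EX i>=i1. EX p:P i. y:near J p (dt i)" unfolding V_def by blast
 thus "infinite {i. EX p:P i. y:near J p (dt i)}" by (simp add: infinite_nat_iff_unbounded_le)
qed
qed

section \<open>Approximation in a chart\<close>

text \<open>Some 2^n exceeds \<open>K\<close>; each halving or doubling of the argument costs one
  factor \<open>c\<close>.\<close>

lemma quasi_conformal_iterate:
fixes K :: real
assumes qc: "quasi_conformal \<psi>" and pos: "ALL t>0. \<psi> t > 0" and K: "K >= 1"
shows "EX A>0. ALL s t. 0 < t --> t / K<=s --> s<=K * t --> \<psi> s<=A * \<psi> t"
proof -
obtain c where c: "c > 0" "!!h t. h:{1/2..2} ==> t > 0 ==> \<psi> (h * t)<=c * \<psi> t"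
 using qc unfolding quasi_conformal_def by blast
have step: "\<psi> s<=c^n * \<psi> t" if tpos: "0 < t" and b: "t / 2^n<=s" "s<=2^n * t" for n s t using b
proof (induction n arbitrary: s)
 case 0
 hence "s=t" by simp
 thus ?case by simp
next
 case (Suc n)
 have s0: "s > 0" using Suc.prems(1) tpos by (meson divide_pos_pos less_le_trans zero_less_numeral zero_less_power)
 obtain h s' where hs: "h:{1/2..2}" "s=h * s'" "t / 2^n<=s'" "s'<=2^n * t"
 proof -
 have tt: "t / 2^n<=2^n * t"
 proof -
  have "t / 2^n<=t / 1" using tpos by (intro divide_left_mono) auto
  also have "... <= 2^n * t" using tpos by simp
  finally show ?thesis .
 qed
 consider "s > 2^n * t" | "s < t / 2^n" | "t / 2^n<=s" "s<=2^n * t" by linarith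
 thus thesis
 proof cases
  case 1
  have P: "2^n * t > 0" using tpos by simp
  have "s / (2^n * t):{1/2..2}" using 1 P Suc.prems(2) by (simp add: pos_le_divide_eq pos_divide_le_eq)
  thus ?thesis by (rule that[of "s / (2^n * t)" "2^n * t"]) (use P tt in auto)
 next
  case 2
  have P: "t / 2^n > 0" using tpos by simp
  have "(1 / 2) * (t / 2^n)<=s" using Suc.prems(1) by simp
  hence "1 / 2<=s / (t / 2^n)" by (simp only: pos_le_divide_eq[OF P])
  moreover have "s / (t / 2^n)<=2" unfolding pos_divide_le_eq[OF P] using 2 P by linarith
  ultimately have "s / (t / 2^n):{1/2..2}" by simp
  moreover have "s=s / (t / 2^n) * (t / 2^n)" using P by (metis less_irrefl nonzero_eq_divide_eq)
  ultimately show ?thesis using that tt by blast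
 next
  case 3
  show ?thesis by (rule that[of 1 s]) (use 3 in auto)
 qed
 qed
 have "s' > 0" using s0 hs(1,2) by (simp add: zero_less_mult_iff)
 hence "\<psi> s<=c * \<psi> s'" unfolding hs(2) by (rule c(2)[OF hs(1)])
 also have "... <= c * (c^n * \<psi> t)" using Suc.IH[OF hs(3,4)] c(1) by simp
 finally show ?case by (simp add: mult.assoc)
qed
obtain n where n: "K < 2^n" using real_arch_pow[of 2 K] by auto
have "\<psi> s<=c^n * \<psi> t" if st: "0 < t" "t / K<=s" "s<=K * t" for s t
proof (rule step[OF st(1)])
 have "t / 2^n<=t / K" using n K st(1) by (intro divide_left_mono) auto
 thus "t / 2^n<=s" using st(2) by linarith
 have "K * t<=2^n * t" using n st(1) by simp
 thus "s<=2^n * t" using st(3) by linarith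
qed
thus ?thesis using c(1) by (intro exI[of _ "c^n"]) auto
qed

lemma sgn_lipschitz:
fixes u v :: "'v::real_normed_vector"
assumes "v ~= 0"
shows "norm (sgn u - sgn v)<=2 * norm (u - v) / norm v"
proof -
have nv: "norm v > 0" using assms by simp
have e: "sgn u - sgn v=(1 - norm u / norm v) *\<^sub>R sgn u + (1 / norm v) *\<^sub>R (u - v)"
proof -
 have "norm u *\<^sub>R sgn u=u" by (cases "u=0") (auto simp: sgn_div_norm)
 hence "(norm u / norm v) *\<^sub>R sgn u=(1 / norm v) *\<^sub>R u" by (metis divide_inverse_commute inverse_eq_divide scaleR_scaleR)
 moreover have "sgn v=(1 / norm v) *\<^sub>R v" by (simp add: sgn_div_norm inverse_eq_divide)
 ultimately show ?thesis by (simp add: scaleR_diff_left scaleR_diff_right)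
qed
have "norm ((1 - norm u / norm v) *\<^sub>R sgn u)<=norm (u - v) / norm v"
proof -
 have "abs (1 - norm u / norm v)=abs (norm v - norm u) / norm v" 
 proof -
 have "1 - norm u / norm v=(norm v - norm u) / norm v" using nv by (simp add: diff_divide_distrib)
 thus ?thesis by (simp add: abs_divide)
 qed
 also have "... <= norm (u - v) / norm v" using nv norm_triangle_ineq3[of u v] by (intro divide_right_mono) (auto simp: abs_minus_commute)
 finally have b: "abs (1 - norm u / norm v)<=norm (u - v) / norm v" .
 have "norm (sgn u)<=1" by (simp add: norm_sgn)
 hence "abs (1 - norm u / norm v) * norm (sgn u)<=abs (1 - norm u / norm v) * 1" by (intro mult_left_mono) auto
 thus ?thesis using b by simp
qed
moreover have "norm ((1 / norm v) *\<^sub>R (u - v))=norm (u - v) / norm v" using nv by simp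
ultimately show ?thesis unfolding e using norm_triangle_ineq[of "(1 - norm u / norm v) *\<^sub>R sgn u" "(1 / norm v) *\<^sub>R (u - v)"]
 by (simp add: add_divide_distrib)
qed

lemma countable_intvec: "countable {z :: real^'n. intvec z}"
proof (rule countable_subset)
show "{z :: real^'n. intvec z}<=(\<Union>n. {z. intvec z & norm z<=real n})" using real_arch_simple by blast
qed (intro countable_UN countableI_type countable_finite finite_bounded_intvec_norm)

lemma integer_points_intvec: "integer_points X={x:X. intvec x}" by (simp add: integer_points_def intvec_def)

text \<open>Balls contain finitely many integer vectors, so infinitely many solutions means
  solutions of arbitrarily large norm. This presents the approximable vectors as a countable limsup
  of open sets.\<close>

lemma approximable_limsup:
"{v. approximable X \<psi> v}=(\<Inter>n::nat. UN x:{x:integer_points X. norm x > real n}. {v. norm (sgn x - v) < \<psi> (norm x)})"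
proof -
have inf: "infinite A \<longleftrightarrow> (ALL n::nat. EX x:A. norm x > real n)" if A: "A<={z :: real^'a. intvec z}" for A
proof
 assume i: "infinite A"
 show "ALL n::nat. EX x:A. norm x > real n"
 proof (rule ccontr)
 assume "~ (ALL n::nat. EX x:A. norm x > real n)"
 then obtain n :: nat where n: "ALL x:A. ~ norm x > real n" by blast
 have "A<={z. intvec z & norm z<=real n}" using A n by (auto simp: not_less)
 thus False using i finite_subset finite_bounded_intvec_norm by blast
 qed
next
 assume n: "ALL n::nat. EX x:A. norm x > real n"
 show "infinite A"
 proof
 assume "finite A"
 hence "bounded A" by (rule finite_imp_bounded)
 then obtain B where B: "!!x. x:A ==> norm x<=B" by (auto simp: bounded_iff)
 obtain n :: nat where "B<=real n" using real_arch_simple by blast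
 thus False using n B by (meson not_le order_trans)
 qed
qed
have "approximable X \<psi> v \<longleftrightarrow> (ALL n::nat. EX x:{x:integer_points X. norm (sgn x - v) < \<psi> (norm x)}. norm x > real n)" for v
 unfolding approximable_def by (rule inf) (auto simp: integer_points_intvec)
thus ?thesis by auto
qed

lemma borel_approximable: "{v. approximable X \<psi> v}:sets borel"
proof -
have o: "{v. norm (sgn x - v) < \<psi> (norm x)}:sets borel" for x :: "real^'a"
 by (intro borel_open open_Collect_less continuous_intros)
have c: "countable {x:integer_points X. norm x > real n}" for n
 by (rule countable_subset[OF _ countable_intvec]) (auto simp: integer_points_intvec)
have "(UN x:{x:integer_points X. norm x > real n}. {v. norm (sgn x - v) < \<psi> (norm x)}):sets borel" for n
 by (rule sets.countable_UN''[OF c o])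
thus ?thesis unfolding approximable_limsup by (intro sets.countable_INT') auto
qed

lemma approximable_minus:
assumes X: "!!x. x:X ==> - x:X" and v: "approximable X \<psi> v"
shows "approximable X \<psi> (- v)"
proof -
let ?A = "{x:integer_points X. norm (sgn x - v) < \<psi> (norm x)}"
have "infinite (uminus ` ?A)" using v unfolding approximable_def by (simp add: finite_image_iff)
moreover have "uminus ` ?A<={x:integer_points X. norm (sgn x - (- v)) < \<psi> (norm x)}"
proof
 fix y assume "y:uminus ` ?A"
 then obtain x where x: "y = - x" "x : ?A" by blast
 have "sgn y - (- v) = - (sgn x - v)" by (simp add: x(1) sgn_minus)
 hence "norm (sgn y - (- v))=norm (sgn x - v)" by (simp only: norm_minus_cancel)
 thus "y:{x:integer_points X. norm (sgn x - (- v)) < \<psi> (norm x)}"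
 using x X by (auto simp: integer_points_intvec intvec_ops)
qed
ultimately show ?thesis unfolding approximable_def using infinite_super by blast
qed

context int_chart
begin

definition la :: "real^'n => real" where "la x=(Linv *v x)$a"

definition pp :: "real^'n => real^'n" where "pp x=(\<chi> i. (Linv *v x)$i / la x)"

lemma XZ_integer_points: "integer_points (quadric Q m)=XZ" by (auto simp: integer_points_intvec XZ_def quadric_def)

lemma Q_scaleR: "Q (c *\<^sub>R x)=c\<^sup>2 * Q x" by (simp only: bq_diag[symmetric] bq_linear power2_eq_square mult.assoc)

lemma Q_minus: "Q (- x)=Q x" using Q_scaleR[of "-1" x] by simp

lemma countable_XZ: "countable XZ" by (rule countable_subset[OF _ countable_intvec]) (auto simp: XZ_def)

text \<open>At T = 2^i the coordinate j of \<open>hmat T y *v x\<close> is x_a (p_j(x) - y_j). Being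
  bounded, it yields the ubiquity radius C / (c 2^i) after division by x_a; the lower bound of
  \<open>good_point\<close> is used here.\<close>

theorem chart_ubiquity:
assumes W: "W > 0"
shows "EX C>0. EX c>0. ALL dt. (ALL i. 0<=dt i & dt i<=1 / 2^i) --> ~ summable (%i. (2^i * dt i)^card J) -->
 (AE y in lborel. y:cbox (\<chi> i. - W) (\<chi> i. W) -->
 infinite {i. EX x:XZ. c * 2^i<=abs (la x) & abs (la x)<=C * 2^i & y:near J (pp x) (dt i)})"
proof -
obtain et where et: "et > 0" "!!c d. (ALL i. c$i < d$i) ==> (EX T0>0. ALL T>=T0.
 vol (cbox c d) / 2<=vol (cbox c d Int {y. good_at et T y}))" using nondivergence by blast
obtain C c where Cc: "C > 0" "c > 0" "!!T w. 1<=T ==> (ALL j. abs (w$j)<=W) ==> good_at et T w ==>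
 (EX x:XZ. norm (hmat T w *v x)<=C & c<=abs ((hmat T w *v x)$a))" using good_point[OF less_imp_le[OF W] et(1)] by blast
define P where "P=(%i::nat. pp ` {x:XZ. c * 2^i<=abs (la x) & abs (la x)<=C * 2^i})"
have cP: "countable (P i)" for i unfolding P_def by (intro countable_image countable_subset[OF _ countable_XZ]) auto
have cov: "EX i0. ALL i>=i0. EX G:sets borel. G<=cbox e f & vol (cbox e f) / 2<=vol G &
  (ALL y:G. EX p:P i. y:near J p ((C / c) / 2^i))"
 if ef: "ALL i. e$i < f$i" and sub: "cbox e f<=cbox (\<chi> i. - W) (\<chi> i. W)" for e f
proof -
 obtain T0 where T0: "T0 > 0" "!!T. T >= T0 ==> vol (cbox e f) / 2<=vol (cbox e f Int {y. good_at et T y})"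
 using et(2)[OF ef] by blast
 obtain i0 where i0: "T0 < 2^i0" using real_arch_pow[of 2 T0] by auto
 show ?thesis
 proof (intro exI[of _ i0] allI impI)
 fix i assume i: "i0<=i"
 define T :: real where "T=2^i"
 have pw: "(2::real)^i0<=2^i" using i by (intro power_increasing) auto
 have T: "T >= T0" "T >= 1"
 proof -
  show "T >= T0" unfolding T_def using pw i0 by linarith
  show "T >= 1" by (simp add: T_def)
 qed
 have pts: "EX p:P i. y:near J p ((C / c) / 2^i)" if y: "y:cbox e f" "good_at et T y" for y
 proof -
  have "y:cbox (\<chi> i. - W) (\<chi> i. W)" using y(1) sub by blast
  hence "- W<=y$j & y$j<=W" for j by (simp add: mem_box_cart)
  hence "ALL j. abs (y$j)<=W" by (metis abs_le_iff minus_le_iff)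
  then obtain x where x: "x:XZ" "norm (hmat T y *v x)<=C" "c<=abs ((hmat T y *v x)$a)" using Cc(3)[OF T(2) _ y(2)] by blast
  have ha: "(hmat T y *v x)$a=la x / T" by (simp add: hmat_mult flow_nth shear_nth la_def)
  have hj: "(hmat T y *v x)$j=(Linv *v x)$j - la x * y$j" if "j:J" for j
  using that by (simp add: hmat_mult flow_nth shear_nth la_def)
  have "c<=abs (la x / T)" using x(3) ha by simp
  hence "c * T<=abs (la x)" using T(2) by (simp add: abs_divide pos_le_divide_eq)
  hence l1: "c * 2^i<=abs (la x)" by (simp only: T_def)
  have "abs (la x / T)<=C" using order_trans[OF component_le_norm_cart x(2), of a] ha by simp
  hence l2: "abs (la x)<=C * 2^i" using T(2) unfolding T_def by (simp add: abs_divide pos_divide_le_eq)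
  have lpos: "abs (la x) > 0" using l1 Cc(2) by (meson less_le_trans mult_pos_pos zero_less_numeral zero_less_power)
  have "y:near J (pp x) ((C / c) / 2^i)" unfolding near_def mem_Collect_eq
  proof
  fix j assume j: "j:J"
  have "y$j - pp x$j = - ((hmat T y *v x)$j) / la x" using lpos unfolding hj[OF j] pp_def by (simp add: field_simps)
  hence "abs (y$j - pp x$j)=abs ((hmat T y *v x)$j) / abs (la x)" by (simp add: abs_divide)
  also have "... <= C / (c * 2^i)" by (intro frac_le order_trans[OF component_le_norm_cart x(2)] l1) (use Cc in auto)
  finally show "abs (y$j - pp x$j)<=(C / c) / 2^i" by simp
  qed
  thus ?thesis using x(1) l1 l2 unfolding P_def by blast
 qed
 show "EX G:sets borel. G<=cbox e f & vol (cbox e f) / 2<=vol G & (ALL y:G. EX p:P i. y:near J p ((C / c) / 2^i))"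
 proof (intro bexI[of _ "cbox e f Int {y. good_at et T y}"] conjI ballI)
  show "vol (cbox e f) / 2<=vol (cbox e f Int {y. good_at et T y})" by (rule T0(2)[OF T(1)])
  show "cbox e f Int {y. good_at et T y}:sets borel" using closed_good[of et T] by (intro sets.Int) (auto simp: borel_closed)
  show "EX p:P i. y:near J p ((C / c) / 2^i)" if "y:cbox e f Int {y. good_at et T y}" for y using pts that by blast
 qed auto
 qed
qed
have "AE y in lborel. y:cbox (\<chi> i. - W) (\<chi> i. W) -->
 infinite {i. EX x:XZ. c * 2^i<=abs (la x) & abs (la x)<=C * 2^i & y:near J (pp x) (dt i)}"
 if dt: "ALL i. 0<=dt i & dt i<=1 / 2^i" and ns: "~ summable (%i. (2^i * dt i)^card J)" for dt :: "nat => real"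
proof -
 have eq: "{i. EX p:P i. y:near J p (dt i)}={i. EX x:XZ. c * 2^i<=abs (la x) & abs (la x)<=C * 2^i & y:near J (pp x) (dt i)}" for y
 unfolding P_def by blast
 have "C / c >= 0" using Cc by simp
 from ubiquity[OF J_nonempty this _ _ ns W cP cov] dt show ?thesis unfolding eq by blast
qed
thus ?thesis using Cc(1,2) by blast
qed

lemma ev_lipschitz:
assumes W: "W >= 0"
shows "EX K>0. ALL p y rh. (ALL j:J. abs (p$j)<=W & abs (y$j)<=W & abs (y$j - p$j)<=rh) --> norm (ev p - ev y)<=K * rh"
proof -
define B0 where "B0=(SUM j:J. abs (\<beta> j))"
have B0: "B0 >= 0" by (simp add: B0_def sum_nonneg)
define K where "K=1 + 2 * B0 * W"
have K: "K > 0" using B0 W by (simp add: K_def add_pos_nonneg)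
have "norm (ev p - ev y)<=(CARD('n) * K) * rh"
 if py: "ALL j:J. abs (p$j)<=W & abs (y$j)<=W & abs (y$j - p$j)<=rh" for p y rh
proof -
 obtain j0 where "j0:J" using J_nonempty by blast
 hence rh: "rh >= 0" using py abs_ge_zero order_trans by blast
 have q: "abs (qj p - qj y)<=2 * B0 * W * rh"
 proof -
 have t: "abs (\<beta> j * (p$j)\<^sup>2 - \<beta> j * (y$j)\<^sup>2)<=abs (\<beta> j) * (2 * W * rh)" if j: "j:J" for j
 proof -
  have "\<beta> j * (p$j)\<^sup>2 - \<beta> j * (y$j)\<^sup>2=\<beta> j * ((p$j + y$j) * (p$j - y$j))"
  by (simp add: power2_eq_square algebra_simps)
  moreover have "abs ((p$j + y$j) * (p$j - y$j))<=(2 * W) * rh" unfolding abs_mult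
  proof (rule mult_mono)
  show "abs (p$j + y$j)<=2 * W" using py[rule_format, OF j] abs_triangle_ineq[of "p$j" "y$j"] by linarith
  show "abs (p$j - y$j)<=rh" using py[rule_format, OF j] by (simp add: abs_minus_commute)
  qed (use W in auto)
  ultimately show ?thesis by (simp add: abs_mult mult_left_mono)
 qed
 have "qj p - qj y=(SUM j:J. \<beta> j * (p$j)\<^sup>2 - \<beta> j * (y$j)\<^sup>2)" by (simp add: qj_def sum_subtractf)
 also have "abs (...)<=(SUM j:J. abs (\<beta> j) * (2 * W * rh))" by (rule order_trans[OF sum_abs sum_mono[OF t]])
 also have "... = 2 * B0 * W * rh" by (simp add: B0_def sum_distrib_right[symmetric])
 finally show ?thesis .
 qed
 have Kr: "K * rh=rh + 2 * B0 * W * rh" by (simp add: K_def algebra_simps)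
 have n0: "0<=2 * B0 * W * rh" using B0 W rh by simp
 have "abs ((ev p - ev y)$i)<=K * rh" for i
 proof -
 consider "i=a" | "i=b" | "i:J" by (auto simp: J_ab)
 thus ?thesis
 proof cases
  case 1
  thus ?thesis using Kr n0 rh by (simp add: ev_nth)
 next
  case 2
  thus ?thesis using q Kr n0 rh by (simp add: ev_nth)
 next
  case 3
  hence "abs ((ev p - ev y)$i)<=rh" using py[rule_format, OF 3] by (simp add: ev_nth abs_minus_commute)
  thus ?thesis using Kr n0 by linarith
 qed
 qed
 hence "(SUM i:UNIV. abs ((ev p - ev y)$i))<=(SUM i:(UNIV::'n set). K * rh)" by (intro sum_mono) blast
 thus ?thesis using norm_le_l1_cart[of "ev p - ev y"] by simp
qed
moreover have "CARD('n) * K > 0" using K by simp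
ultimately show ?thesis by blast
qed

text \<open>On Q = c the coordinate \<open>b\<close> is a function of the others. The extra term is
  the offset of the quadric from its asymptotic cone; for c = 0 the vector itself is a multiple of
  \<open>ev (pp x)\<close>.\<close>

lemma Linv_point:
assumes x: "Q x=c" and l: "la x ~= 0"
shows "(1 / la x) *\<^sub>R (Linv *v x)=ev (pp x) + (c / (la x)\<^sup>2) *\<^sub>R axis b 1"
proof (rule vec_eqI)
have qp: "qj (pp x)=qj (Linv *v x) / (la x)\<^sup>2" by (simp add: qj_def pp_def power_divide sum_divide_distrib)
have "la x * (Linv *v x)$b + qj (Linv *v x)=c" using x by (simp add: Q_Qc Qc_def la_def)
hence "(Linv *v x)$b=(c - qj (Linv *v x)) / la x" using l by (simp add: field_simps)
thus "((1 / la x) *\<^sub>R (Linv *v x))$b=(ev (pp x) + (c / (la x)\<^sup>2) *\<^sub>R axis b 1)$b"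
 using l by (simp add: ev_nth qp axis_def power2_eq_square diff_divide_distrib)
qed (use l ab in \<open>auto simp: ev_nth axis_def pp_def la_def[symmetric] J_ab\<close>)

lemma L_bounds: obtains B where "B >= 1" "!!u. norm (L *v u)<=B * norm u" "!!u. norm (Linv *v u)<=B * norm u"
proof -
obtain B1 where B1: "B1 > 0" "!!u. norm (L *v u)<=B1 * norm u"
 using linear_bounded_pos[OF matrix_vector_mul_linear[of L]] by blast
obtain B2 where B2: "B2 > 0" "!!u. norm (Linv *v u)<=B2 * norm u"
 using linear_bounded_pos[OF matrix_vector_mul_linear[of Linv]] by blast
show thesis
proof (rule that[of "max 1 (max B1 B2)"])
 show "norm (L *v u)<=max 1 (max B1 B2) * norm u" for u by (rule order_trans[OF B1(2) mult_right_mono]) auto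
 show "norm (Linv *v u)<=max 1 (max B1 B2) * norm u" for u by (rule order_trans[OF B2(2) mult_right_mono]) auto
qed simp
qed

lemma norm_ev_ge: "1<=norm (ev w)" using component_le_norm_cart[of "ev w" a] by (simp add: ev_nth)

lemma L_ev_lower: "EX c>0. ALL w. c<=norm (L *v ev w)"
proof -
obtain B where B: "B >= 1" "!!u. norm (Linv *v u)<=B * norm u" using L_bounds by metis
have "1 / B<=norm (L *v ev w)" for w
 using B(2)[of "L *v ev w"] norm_ev_ge[of w] B(1) by (simp add: Linv_L pos_divide_le_eq mult.commute)
thus ?thesis using B(1) by (intro exI[of _ "1 / B"]) auto
qed

text \<open>The second error term \<open>1 / (la x)\<^sup>2\<close> is caused by the offset between
  the quadric and the cone.\<close>

lemma direction_close:
assumes W: "W >= 0"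
shows "EX K>0. ALL x y rh. x:XZ --> la x ~= 0 --> (ALL j:J. abs (pp x$j)<=W & abs (y$j)<=W) --> y:near J (pp x) rh -->
 norm (sgn ((1 / la x) *\<^sub>R x) - sgn (L *v ev y))<=K * (rh + 1 / (la x)\<^sup>2)"
proof -
obtain K where K: "K > 0" "!!p y rh. (ALL j:J. abs (p$j)<=W & abs (y$j)<=W & abs (y$j - p$j)<=rh) ==> norm (ev p - ev y)<=K * rh"
 using ev_lipschitz[OF W] by blast
obtain B where B: "B >= 1" "!!u. norm (L *v u)<=B * norm u" using L_bounds by metis
obtain c where c: "c > 0" "!!w. c<=norm (L *v ev w)" using L_ev_lower by blast
define K1 where "K1=2 * (B * (K + abs m)) / c"
have K1: "K1 > 0" using K(1) B(1) c(1) by (simp add: K1_def add_pos_nonneg)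
have "norm (sgn ((1 / la x) *\<^sub>R x) - sgn (L *v ev y))<=K1 * (rh + 1 / (la x)\<^sup>2)"
 if x: "x:XZ" "la x ~= 0" and py: "ALL j:J. abs (pp x$j)<=W & abs (y$j)<=W" and ny: "y:near J (pp x) rh" for x y rh
proof -
 obtain j0 where "j0:J" using J_nonempty by blast
 hence rh: "rh >= 0" using ny abs_ge_zero order_trans unfolding near_def by blast
 define q where "q=1 / (la x)\<^sup>2"
 have q: "q >= 0" by (simp add: q_def)
 have Qx: "Q x=m" using x(1) by (simp add: XZ_def)
 have "(1 / la x) *\<^sub>R x=L *v ((1 / la x) *\<^sub>R (Linv *v x))" by (simp add: matrix_vector_mult_scaleR Linv_L)
 also have "... = L *v (ev (pp x) + (m * q) *\<^sub>R axis b 1)" unfolding Linv_point[OF Qx x(2)] by (simp add: q_def)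
 finally have e: "(1 / la x) *\<^sub>R x - L *v ev y=L *v ((ev (pp x) - ev y) + (m * q) *\<^sub>R axis b 1)"
 by (simp add: matrix_vector_right_distrib matrix_vector_mult_diff_distrib)
 have "norm ((ev (pp x) - ev y) + (m * q) *\<^sub>R axis b 1)<=norm (ev (pp x) - ev y) + norm ((m * q) *\<^sub>R axis b (1::real))" by (rule norm_triangle_ineq)
 also have "norm ((m * q) *\<^sub>R axis b (1::real))=abs m * q" using q by (simp add: abs_mult)
 also have "norm (ev (pp x) - ev y)<=K * rh" by (rule K(2)) (use py ny in \<open>auto simp: near_def\<close>)
 finally have n0: "norm ((ev (pp x) - ev y) + (m * q) *\<^sub>R axis b 1)<=K * rh + abs m * q" by simp
 have n1: "norm ((ev (pp x) - ev y) + (m * q) *\<^sub>R axis b 1)<=(K + abs m) * (rh + q)"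
 proof -
 have "K * q >= 0" "abs m * rh >= 0" using K(1) q rh by auto
 moreover have "(K + abs m) * (rh + q)=K * rh + K * q + abs m * rh + abs m * q" by (simp add: algebra_simps)
 ultimately show ?thesis using n0 by linarith
 qed
 have "norm ((1 / la x) *\<^sub>R x - L *v ev y)<=B * ((K + abs m) * (rh + q))"
 unfolding e by (rule order_trans[OF B(2)]) (use n1 B(1) in \<open>simp add: mult_left_mono\<close>)
 hence n2: "2 * norm ((1 / la x) *\<^sub>R x - L *v ev y)<=2 * (B * (K + abs m)) * (rh + q)" by (simp add: mult.assoc)
 have "norm (L *v ev y) > 0" using c(1) c(2)[of y] by linarith
 hence Lne: "L *v ev y ~= 0" by simp
 have "norm (sgn ((1 / la x) *\<^sub>R x) - sgn (L *v ev y))<=2 * norm ((1 / la x) *\<^sub>R x - L *v ev y) / norm (L *v ev y)"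
 by (rule sgn_lipschitz[OF Lne])
 also have "... <= 2 * (B * (K + abs m)) * (rh + q) / c" by (rule frac_le[OF _ n2 c(1) c(2)]) (use B(1) K(1) rh q in auto)
 also have "... = K1 * (rh + 1 / (la x)\<^sup>2)" by (simp add: K1_def q_def)
 finally show ?thesis .
qed
thus ?thesis using K1 by blast
qed

lemma la_le_norm: "EX K>0. ALL x. abs (la x)<=K * norm x"
proof -
obtain B where B: "B >= 1" "!!u. norm (Linv *v u)<=B * norm u" using L_bounds by metis
have "abs (la x)<=B * norm x" for x unfolding la_def by (rule order_trans[OF component_le_norm_cart B(2)])
thus ?thesis using B(1) by (intro exI[of _ B]) auto
qed

lemma norm_le_la:
assumes W: "W >= 0"
shows "EX K>0. ALL x:XZ. 1<=abs (la x) --> (ALL j:J. abs (pp x$j)<=W) --> norm x<=K * abs (la x)"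
proof -
obtain K where K: "K > 0" "!!p y rh. (ALL j:J. abs (p$j)<=W & abs (y$j)<=W & abs (y$j - p$j)<=rh) ==> norm (ev p - ev y)<=K * rh"
 using ev_lipschitz[OF W] by blast
obtain B where B: "B >= 1" "!!u. norm (L *v u)<=B * norm u" using L_bounds by metis
define K1 where "K1=B * (K * W + norm (ev 0) + abs m)"
have K1: "K1 > 0" using B(1) K(1) W norm_ev_ge[of 0] unfolding K1_def by (intro mult_pos_pos add_pos_nonneg add_nonneg_pos) auto
have "norm x<=K1 * abs (la x)" if x: "x:XZ" "1<=abs (la x)" and p: "ALL j:J. abs (pp x$j)<=W" for x
proof -
 have l: "la x ~= 0" using x(2) by auto
 have Qx: "Q x=m" using x(1) by (simp add: XZ_def)
 have "1<=(la x)\<^sup>2" using x(2) by (metis abs_le_square_iff abs_one one_power2)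
 hence q: "abs (m / (la x)\<^sup>2)<=abs m" by (simp add: abs_divide divide_le_eq mult_le_cancel_left1)
 have "norm (ev (pp x))<=norm (ev (pp x) - ev 0) + norm (ev 0)" using norm_triangle_ineq[of "ev (pp x) - ev 0" "ev 0"] by simp
 also have "norm (ev (pp x) - ev 0)<=K * W" by (rule K(2)) (use p W in auto)
 finally have e1: "norm (ev (pp x))<=K * W + norm (ev 0)" by simp
 have "norm ((1 / la x) *\<^sub>R (Linv *v x))<=norm (ev (pp x)) + norm ((m / (la x)\<^sup>2) *\<^sub>R axis b (1::real))"
 unfolding Linv_point[OF Qx l] by (rule norm_triangle_ineq)
 also have "norm ((m / (la x)\<^sup>2) *\<^sub>R axis b (1::real))<=abs m" using q by simp
 finally have e2: "norm ((1 / la x) *\<^sub>R (Linv *v x))<=K * W + norm (ev 0) + abs m" using e1 by linarith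
 have e: "(1 / la x) *\<^sub>R x=L *v ((1 / la x) *\<^sub>R (Linv *v x))" by (simp add: matrix_vector_mult_scaleR Linv_L)
 have "norm ((1 / la x) *\<^sub>R x)<=B * norm ((1 / la x) *\<^sub>R (Linv *v x))" unfolding e by (rule B(2))
 also have "... <= K1" unfolding K1_def using e2 B(1) by (intro mult_left_mono) auto
 finally have "norm x / abs (la x)<=K1" by simp
 thus ?thesis using x(2) by (simp add: pos_divide_le_eq)
qed
thus ?thesis using K1 by blast
qed

text \<open>Allows levels to be switched off in \<open>chart_divergence\<close> by the radius 0:
  degenerate cylinders are null sets, and there are countably many of them.\<close>

lemma AE_not_near_zero: "AE y in lborel. ALL x:XZ. y ~: near J (pp x) 0"
proof (rule AE_ball_countable[THEN iffD2, OF countable_XZ], intro ballI)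
fix x assume "x:XZ"
obtain j where j: "j:J" using J_nonempty by blast
have "negligible {y :: real^'n. axis j 1 \<bullet> y=pp x$j}" by (rule negligible_hyperplane) (simp add: axis_eq_0_iff)
hence "negligible {y :: real^'n. y$j=pp x$j}" by (simp add: inner_axis')
moreover have "near J (pp x) 0<={y. y$j=pp x$j}" using j by (auto simp: near_def)
ultimately have "negligible (near J (pp x) 0)" by (rule negligible_subset)
hence "near J (pp x) 0:null_sets lebesgue" by (simp add: negligible_iff_null_sets)
moreover have b: "near J (pp x) 0:sets borel" by (simp add: closed_near borel_closed)
ultimately have "near J (pp x) 0:null_sets lborel" by (simp add: null_sets_def)
thus "AE y in lborel. y ~: near J (pp x) 0" by (rule AE_not_in)
qed

text \<open>Both x and -x are in \<open>XZ\<close> and have the same \<open>pp\<close>; the one with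
  positive \<open>la\<close> points towards \<open>L *v ev y\<close> and not to its
  antipode.\<close>

lemma positive_representative:
assumes "x:XZ" "la x ~= 0"
shows "EX x':XZ. la x'=abs (la x) & pp x'=pp x & norm x'=norm x & sgn x'=sgn ((1 / la x) *\<^sub>R x)"
proof (cases "la x > 0")
case True
thus ?thesis using assms by (intro bexI[of _ x]) (auto simp: sgn_scaleR)
next
case False
have lm: "la (- x) = - la x" by (simp add: la_def linear_neg[OF matrix_vector_mul_linear])
have "pp (- x)=pp x" by (simp add: pp_def lm linear_neg[OF matrix_vector_mul_linear] vec_eq_iff)
moreover have "- x:XZ" using assms(1) by (simp add: XZ_def Q_minus intvec_ops)
moreover have "sgn (- x)=sgn ((1 / la x) *\<^sub>R x)" using False assms(2) by (simp add: sgn_scaleR sgn_minus)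
ultimately show ?thesis using False by (intro bexI[of _ "- x"]) (auto simp: lm)
qed

text \<open>The offset of order 4^-i between quadric and cone may exceed \<psi>(2^i). Levels where
  it does are switched off; there 2^i \<psi>(2^i) is O(2^-i), so they contribute a convergent series
  and divergence survives on the others.\<close>

theorem chart_divergence:
assumes pos: "ALL t>0. \<psi> t > 0" and qc: "quasi_conformal \<psi>"
 and ns: "~ summable (%i. (2^i * \<psi> (2^i))^card J)"
shows "AE y in lborel. approximable (quadric Q m) \<psi> (sgn (L *v ev y))"
proof -
have main: "AE y in lborel. y:cbox (\<chi> i. - W) (\<chi> i. W) --> approximable (quadric Q m) \<psi> (sgn (L *v ev y))"
 if W: "W > 0" for W :: real
proof -
 define k where "k=card J"
 have k: "k > 0" using J_nonempty by (simp add: k_def card_gt_0_iff)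
 obtain C c where Cc: "C > 0" "c > 0" "!!dt. (ALL i. 0<=dt i & dt i<=1 / 2^i) ==> ~ summable (%i. (2^i * dt i)^card J) ==>
 (AE y in lborel. y:cbox (\<chi> i. - W) (\<chi> i. W) -->
 infinite {i. EX x:XZ. c * 2^i<=abs (la x) & abs (la x)<=C * 2^i & y:near J (pp x) (dt i)})"
 using chart_ubiquity[OF W] by blast
 have W1: "W + 1 >= 0" using W by simp
 obtain K1 where K1: "K1 > 0" "!!x y rh. x:XZ ==> la x ~= 0 ==> (ALL j:J. abs (pp x$j)<=W + 1 & abs (y$j)<=W + 1) ==> y:near J (pp x) rh ==>
 norm (sgn ((1 / la x) *\<^sub>R x) - sgn (L *v ev y))<=K1 * (rh + 1 / (la x)\<^sup>2)"
 using direction_close[OF W1] by blast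
 obtain K2 where K2: "K2 > 0" "!!x. abs (la x)<=K2 * norm x" using la_le_norm by blast
 obtain K3 where K3: "K3 > 0" "!!x. x:XZ ==> 1<=abs (la x) ==> (ALL j:J. abs (pp x$j)<=W + 1) ==> norm x<=K3 * abs (la x)"
 using norm_le_la[OF W1] by blast
 define R where "R=max 1 (max (K3 * C) (K2 / c))"
 have R: "R >= 1" "K3 * C<=R" "K2 / c<=R" by (auto simp: R_def)
 obtain A where A: "A > 0" "!!s t. 0 < t ==> t / R<=s ==> s<=R * t ==> \<psi> s<=A * \<psi> t"
 using quasi_conformal_iterate[OF qc pos R(1)] by blast
 \<comment> \<open>The offset and the distance in the chart may each use
   \<open>\<psi> (2^i) / (4 * A)\<close>. Their sum is strictly below
   \<open>\<psi> (2^i) / A\<close>, which quasi-conformality bounds by \<psi> at the norm of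
   x.\<close>
 define good where "good=(%i::nat. K1 * (1 / (c * 2^i)\<^sup>2)<=\<psi> (2^i) / (4 * A))"
 define dt where "dt=(%i::nat. if good i then min (1 / 2^i) (\<psi> (2^i) / (4 * A * K1)) else 0)"
 have pp2: "\<psi> (2^i) > 0" for i :: nat using pos by simp
 have dt: "ALL i. 0<=dt i & dt i<=1 / 2^i" using pp2 A(1) K1(1) by (auto simp: dt_def less_imp_le)
 have "~ summable (%i. (2^i * dt i)^k)"
 proof
 assume s: "summable (%i. (2^i * dt i)^k)"
 have "(%i. (2^i * dt i)^k) \<longlonglongrightarrow> 0" by (rule summable_LIMSEQ_zero[OF s])
 \<comment> \<open>If the series converged, the cap 1 / 2^i would be attained at finitely many
   levels only, since it makes the term equal to 1. Beyond them \<open>dt\<close> is proportional to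
   \<psi> on good levels.\<close>
 then obtain N where N: "!!i. i >= N ==> norm ((2^i * dt i)^k) < 1" using LIMSEQ_D[of _ 0 1] by fastforce
 define M1 where "M1=(4 * A * K1)^k"
 define D where "D=4 * A * K1 / c\<^sup>2"
 have D: "D > 0" using A(1) K1(1) Cc(2) by (simp add: D_def)
 have M1: "M1 > 0" using A(1) K1(1) by (simp add: M1_def)
 have bound: "norm ((2^i * \<psi> (2^i))^k)<=M1 * (2^i * dt i)^k + D^k * (1 / 2)^i" if i: "i >= N" for i
 proof (cases "good i")
  case True
  have "dt i ~= 1 / 2^i"
  proof
  assume "dt i=1 / 2^i"
  thus False using N[OF i] by simp
  qed
  hence "dt i=\<psi> (2^i) / (4 * A * K1)" using True by (auto simp: dt_def min_def split: if_splits)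
  hence "2^i * \<psi> (2^i)=(4 * A * K1) * (2^i * dt i)" using A(1) K1(1) by simp
  hence "(2^i * \<psi> (2^i))^k=M1 * (2^i * dt i)^k" unfolding M1_def by (simp only: power_mult_distrib)
  moreover have "norm ((2^i * \<psi> (2^i))^k)=(2^i * \<psi> (2^i))^k" using pp2[of i] by simp
  moreover have "0<=D^k * (1 / 2)^i" using D by simp
  ultimately show ?thesis by linarith
 next
  case False
  define t :: real where "t=2^i"
  have t: "t > 0" "t >= 1" by (auto simp: t_def)
  have "\<psi> t < 4 * A * (K1 * (1 / (c * t)\<^sup>2))" using False A(1) unfolding good_def t_def[symmetric] not_le
  by (simp add: pos_divide_less_eq mult.commute)
  also have "... = D / t\<^sup>2" by (simp add: D_def power_mult_distrib)
  finally have "t * \<psi> t<=t * (D / t\<^sup>2)" using t by (intro mult_left_mono) auto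
  also have "... = D / t" using t by (simp add: power2_eq_square)
  finally have "t * \<psi> t<=D / t" .
  hence "(t * \<psi> t)^k<=(D / t)^k" using t pos by (intro power_mono) (auto simp: less_imp_le)
  also have "... = D^k / t^k" by (rule power_divide)
  also have "... <= D^k / t"
  proof (rule divide_left_mono)
  show "t<=t^k" using t k self_le_power by blast
  qed (use D t in auto)
  also have "... = D^k * (1 / 2)^i" by (simp add: t_def power_divide)
  finally have "(2^i * \<psi> (2^i))^k<=D^k * (1 / 2)^i" by (simp add: t_def)
  moreover have "norm ((2^i * \<psi> (2^i))^k)=(2^i * \<psi> (2^i))^k" using pp2[of i] by simp
  moreover have "0<=M1 * (2^i * dt i)^k" using M1 dt by simp
  ultimately show ?thesis by linarith
 qed
 have "summable (%i. M1 * (2^i * dt i)^k + D^k * (1 / 2)^i)" by (intro summable_add summable_mult s summable_geometric) simp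
 from summable_comparison_test'[OF this bound] show False using ns unfolding k_def by blast
 qed
 from Cc(3)[OF dt this[unfolded k_def]] AE_not_near_zero show ?thesis
 proof (eventually_elim, intro impI)
 fix y :: "real^'n"
 let ?I = "{i. EX x:XZ. c * 2^i<=abs (la x) & abs (la x)<=C * 2^i & y:near J (pp x) (dt i)}"
 assume y1: "y:cbox (\<chi> i. - W) (\<chi> i. W) --> infinite ?I"
  and y2: "ALL x:XZ. y ~: near J (pp x) 0" and y3: "y:cbox (\<chi> i. - W) (\<chi> i. W)"
 have inf: "infinite ?I" using y1 y3 by blast
 have yW: "abs (y$j)<=W" for j
 proof -
  have "- W<=y$j & y$j<=W" using y3 by (auto simp: mem_box_cart)
  thus ?thesis by (auto simp: abs_le_iff)
 qed
 define S where "S={x:XZ. norm (sgn x - sgn (L *v ev y)) < \<psi> (norm x)}"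
 have rep: "EX x':S. c * 2^i<=la x'" if i: "i : ?I" and ci: "1<=c * 2^i" for i
 proof -
  obtain x where x: "x:XZ" "c * 2^i<=abs (la x)" "abs (la x)<=C * 2^i" "y:near J (pp x) (dt i)" using i by blast
  have l1: "1<=abs (la x)" using ci x(2) by linarith
  hence l: "la x ~= 0" by auto
  have g: "good i"
  proof (rule ccontr)
  assume "~ good i"
  hence "dt i=0" by (simp add: dt_def)
  thus False using x(1,4) y2 by auto
  qed
  have d1: "dt i<=1"
  proof -
  have "1 / 2^i<=(1::real)" by simp
  thus ?thesis using dt order_trans by blast
  qed
  have pW: "ALL j:J. abs (pp x$j)<=W + 1 & abs (y$j)<=W + 1"
  proof
  fix j assume "j:J"
  hence "abs (y$j - pp x$j)<=dt i" using x(4) by (simp add: near_def)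
  thus "abs (pp x$j)<=W + 1 & abs (y$j)<=W + 1" using yW[of j] d1 by linarith
  qed
  have "norm (sgn ((1 / la x) *\<^sub>R x) - sgn (L *v ev y))<=K1 * (dt i + 1 / (la x)\<^sup>2)" by (rule K1(2)[OF x(1) l pW x(4)])
  also have "... = K1 * dt i + K1 * (1 / (la x)\<^sup>2)" by (simp add: distrib_left)
  also have "K1 * dt i<=\<psi> (2^i) / (4 * A)"
  proof -
  have "dt i<=\<psi> (2^i) / (4 * A * K1)" using g by (simp add: dt_def)
  hence "K1 * dt i<=K1 * (\<psi> (2^i) / (4 * A * K1))" using K1(1) by (intro mult_left_mono) auto
  thus ?thesis using K1(1) by simp
  qed
  also have "K1 * (1 / (la x)\<^sup>2)<=K1 * (1 / (c * 2^i)\<^sup>2)"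
  proof (intro mult_left_mono divide_left_mono)
  have "(c * 2^i)\<^sup>2<=\<bar>la x\<bar>\<^sup>2" by (intro power_mono x(2)) (use Cc(2) in simp)
  thus "(c * 2^i)\<^sup>2<=(la x)\<^sup>2" by simp
  qed (use K1(1) Cc(2) l in auto)
  also have "K1 * (1 / (c * 2^i)\<^sup>2)<=\<psi> (2^i) / (4 * A)" using g by (simp add: good_def)
  finally have n1: "norm (sgn ((1 / la x) *\<^sub>R x) - sgn (L *v ev y))<=\<psi> (2^i) / (4 * A) + \<psi> (2^i) / (4 * A)" by linarith
  have "\<psi> (2^i) / (4 * A) + \<psi> (2^i) / (4 * A) < \<psi> (2^i) / A" using pp2[of i] A(1) by (simp add: field_simps)
  also have "\<psi> (2^i) / A<=\<psi> (norm x)"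
  proof -
  have nx: "norm x > 0" using l by (auto simp: la_def)
  have "norm x<=K3 * abs (la x)" using K3(2)[OF x(1) l1] pW by blast
  also have "... <= K3 * (C * 2^i)" using x(3) K3(1) by simp
  also have "... = (K3 * C) * 2^i" by simp
  also have "... <= R * 2^i" using R(2) by (intro mult_right_mono) auto
  finally have u: "norm x / R<=2^i" using R(1) by (simp add: pos_divide_le_eq mult.commute)
  have "c * 2^i<=K2 * norm x" using x(2) K2(2)[of x] by linarith
  hence "2^i<=(K2 / c) * norm x" using Cc(2) by (simp add: field_simps)
  also have "... <= R * norm x" using R(3) by (intro mult_right_mono) auto
  finally have "\<psi> (2^i)<=A * \<psi> (norm x)" by (rule A(2)[OF nx u])
  thus ?thesis using A(1) by (simp add: pos_divide_le_eq mult.commute)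
  qed
  finally have n2: "norm (sgn ((1 / la x) *\<^sub>R x) - sgn (L *v ev y)) < \<psi> (norm x)" using n1 by linarith
  obtain x' where x': "x':XZ" "la x'=abs (la x)" "norm x'=norm x" "sgn x'=sgn ((1 / la x) *\<^sub>R x)"
  using positive_representative[OF x(1) l] by blast
  show ?thesis using x' n2 x(2) by (intro bexI[of _ x']) (auto simp: S_def)
 qed
 have "infinite S"
 proof
  assume f: "finite S"
  obtain B where B: "!!x. x:S ==> la x<=B"
  proof (rule that[of "Max (insert 0 (la ` S))"])
  show "la x<=Max (insert 0 (la ` S))" if "x:S" for x using f that by (intro Max_ge) auto
  qed
  obtain n where n: "(abs B + 1) / c < 2^n" using real_arch_pow[of 2 "(abs B + 1) / c"] by auto
  obtain i where i: "i >= n" "i : ?I" using inf infinite_nat_iff_unbounded_le by blast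
  have "(2::real)^n<=2^i" using i(1) by (intro power_increasing) auto
  hence "(abs B + 1) / c < 2^i" using n by linarith
  hence ci: "abs B + 1 < c * 2^i" using Cc(2) by (simp add: pos_divide_less_eq mult.commute)
  have "1<=c * 2^i" using ci by linarith
  then obtain x' where "x':S" "c * 2^i<=la x'" using rep[OF i(2)] by blast
  thus False using B[of x'] ci by linarith
 qed
 thus "approximable (quadric Q m) \<psi> (sgn (L *v ev y))" unfolding approximable_def XZ_integer_points S_def .
 qed
qed
have "AE y in lborel. ALL n::nat. y:cbox (\<chi> i. - (real n + 1)) (\<chi> i. real n + 1) --> approximable (quadric Q m) \<psi> (sgn (L *v ev y))"
 unfolding AE_all_countable by (intro allI main) simp
thus ?thesis
proof eventually_elim
 fix y :: "real^'n"
 assume y: "ALL n::nat. y:cbox (\<chi> i. - (real n + 1)) (\<chi> i. real n + 1) --> approximable (quadric Q m) \<psi> (sgn (L *v ev y))"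
 obtain n :: nat where n: "norm y<=real n" using real_arch_simple by blast
 have "abs (y$i)<=real n" for i using component_le_norm_cart[of y i] n by linarith
 hence "- (real n + 1)<=y$i & y$i<=real n + 1" for i by (smt (verit))
 hence "y:cbox (\<chi> i. - (real n + 1)) (\<chi> i. real n + 1)" by (simp add: mem_box_cart)
 thus "approximable (quadric Q m) \<psi> (sgn (L *v ev y))" using y by blast
qed
qed

end

section \<open>Convergence in a chart\<close>

lemma dyadic_scale:
fixes r :: real
assumes "1<=r"
shows "EX i. 2^i<=r & r < 2^Suc i"
proof -
obtain n where n: "r < 2^n" using real_arch_pow[of 2 r] by auto
define l where "l=(LEAST n. r < 2^n)"
have l: "r < 2^l" unfolding l_def by (rule LeastI[of "%n. r < 2^n", OF n])
have "l ~= 0"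
proof
 assume "l=0"
 thus False using l assms by simp
qed
then obtain i where i: "l=Suc i" using not0_implies_Suc by blast
have "~ r < 2^i" unfolding l_def by (rule not_less_Least[of i "%n. r < 2^n"]) (use i l_def in simp)
thus ?thesis using l i by (intro exI[of _ i]) auto
qed

context int_chart
begin

definition shell :: "real => real => (real^'n) set" where
"shell W T={x:XZ. 1<=abs (la x) & abs (la x)<=T & (ALL j:J. abs (pp x$j)<=W)}"

lemma finite_shell:
assumes "W >= 0" shows "finite (shell W T)"
proof -
obtain K where K: "K > 0" "!!x. x:XZ ==> 1<=abs (la x) ==> (ALL j:J. abs (pp x$j)<=W) ==> norm x<=K * abs (la x)"
 using norm_le_la[OF assms] by blast
have "shell W T<={x. intvec x & norm x<=K * T}"
proof
 fix x assume x: "x:shell W T"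
 hence "norm x<=K * abs (la x)" using K(2) by (auto simp: shell_def)
 also have "... <= K * T" using x K(1) by (simp add: shell_def)
 finally show "x:{x. intvec x & norm x<=K * T}" using x by (simp add: shell_def XZ_def)
qed
thus ?thesis by (rule finite_subset) (rule finite_bounded_intvec_norm)
qed

text \<open>Converse to \<open>direction_close\<close>: a direction close to
  \<open>L *v ev y\<close> has a coordinate \<open>a\<close> comparable with the norm and on the
  positive side, and division by that coordinate gives closeness in the chart.\<close>

lemma approximant_near:
assumes W: "W > 0"
shows "EX ep>0. EX K>0. EX c>0. ALL x y t. x ~= 0 --> (ALL j:J. abs (y$j)<=W) --> norm (sgn x - sgn (L *v ev y)) < t --> t<=ep -->
 c * norm x<=la x & (ALL j:J. abs (pp x$j)<=W + 1) & y:near J (pp x) (K * t)"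
proof -
have W0: "W >= 0" using W by simp
obtain K where K: "K > 0" "!!p y rh. (ALL j:J. abs (p$j)<=W & abs (y$j)<=W & abs (y$j - p$j)<=rh) ==> norm (ev p - ev y)<=K * rh"
 using ev_lipschitz[OF W0] by blast
obtain B where B: "B >= 1" "!!u. norm (L *v u)<=B * norm u" "!!u. norm (Linv *v u)<=B * norm u" using L_bounds by metis
define D where "D=B * (K * W + norm (ev 0))"
have D: "D > 0" using B(1) K(1) W norm_ev_ge[of 0] unfolding D_def by (intro mult_pos_pos add_nonneg_pos) auto
define c1 where "c1=1 / D"
have c1: "c1 > 0" using D by (simp add: c1_def)
define K4 where "K4=2 * B * (1 + W) / c1"
have K4: "K4 > 0" using B(1) W c1 by (simp add: K4_def)
define ep where "ep=min (c1 / (2 * B)) (1 / K4)"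
have ep: "ep > 0" using c1 B(1) K4 by (simp add: ep_def)
have "c1 / 2 * norm x<=la x & (ALL j:J. abs (pp x$j)<=W + 1) & y:near J (pp x) (K4 * t)"
 if x: "x ~= 0" and y: "ALL j:J. abs (y$j)<=W" and d: "norm (sgn x - sgn (L *v ev y)) < t" and t: "t<=ep" for x y t
proof -
 have t0: "t > 0" using d by (meson norm_ge_zero le_less_trans)
 define v where "v=sgn (L *v ev y)"
 define N where "N=norm (L *v ev y)"
 obtain c where c: "c > 0" "!!w. c<=norm (L *v ev w)" using L_ev_lower by blast
 have N: "N > 0" unfolding N_def using c(1) c(2)[of y] by linarith
 have "norm (ev y)<=norm (ev 0 - ev y) + norm (ev 0)" using norm_triangle_ineq4[of "ev 0" "ev 0 - ev y"] by simp
 also have "norm (ev 0 - ev y)<=K * W" by (rule K(2)) (use y W in auto)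
 finally have "norm (ev y)<=K * W + norm (ev 0)" by simp
 hence "N<=D" unfolding N_def D_def using B(1) by (intro order_trans[OF B(2)] mult_left_mono) auto
 hence N2: "c1<=1 / N" unfolding c1_def using N by (intro divide_left_mono) auto
 have "v=(1 / N) *\<^sub>R (L *v ev y)" by (simp add: v_def N_def sgn_div_norm inverse_eq_divide)
 hence Lv: "Linv *v v=(1 / N) *\<^sub>R ev y" by (simp add: matrix_vector_mult_scaleR Linv_L)
 define s where "s=Linv *v sgn x"
 have sx: "Linv *v x=norm x *\<^sub>R s" using x by (simp add: s_def matrix_vector_mult_scaleR[symmetric] sgn_div_norm)
 have dif: "abs (s$i - (Linv *v v)$i)<=B * t" for i
 proof -
 have "s$i - (Linv *v v)$i=(Linv *v (sgn x - v))$i" by (simp add: s_def matrix_vector_mult_diff_distrib)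
 also have "abs (...)<=B * norm (sgn x - v)" by (rule order_trans[OF component_le_norm_cart B(3)])
 also have "... <= B * t" using d B(1) by (simp add: v_def)
 finally show ?thesis .
 qed
 have Bt: "B * t<=c1 / 2"
 proof -
 have "t<=c1 / (2 * B)" using t by (simp add: ep_def)
 thus ?thesis using B(1) by (simp add: field_simps)
 qed
 have sa: "c1 / 2<=s$a" using dif[of a] Bt N2 by (simp add: Lv ev_nth)
 have nx: "norm x > 0" using x by simp
 have lax: "la x=norm x * s$a" by (simp add: la_def sx)
 have ppx: "pp x$j=s$j / s$a" for j using nx by (simp add: pp_def lax sx)
 have nr: "abs (y$j - pp x$j)<=K4 * t" if j: "j:J" for j
 proof -
 define A' where "A'=(Linv *v v)$a"
 define Z' where "Z'=(Linv *v v)$j"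
 have Z': "Z'=A' * y$j" using j by (simp add: A'_def Z'_def Lv ev_nth)
 have sap: "s$a > 0" using sa c1 by linarith
 have "y$j - pp x$j=(y$j * s$a - s$j) / s$a" using sap by (simp add: ppx field_simps)
 also have "y$j * s$a - s$j=y$j * (s$a - A') - (s$j - Z')" by (simp add: Z' algebra_simps)
 finally have "abs (y$j - pp x$j)=abs (y$j * (s$a - A') - (s$j - Z')) / s$a" using sap by (simp add: abs_divide)
 also have "... <= (B * (1 + W) * t) / (c1 / 2)"
 proof (rule frac_le)
  have "abs (y$j * (s$a - A'))<=W * (B * t)" unfolding abs_mult
  by (rule mult_mono) (use y j dif[of a] W in \<open>auto simp: A'_def\<close>)
  moreover have "abs (s$j - Z')<=B * t" using dif[of j] by (simp add: Z'_def)
  moreover have "B * (1 + W) * t=W * (B * t) + B * t" by (simp add: algebra_simps)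
  ultimately show "abs (y$j * (s$a - A') - (s$j - Z'))<=B * (1 + W) * t" by linarith
 qed (use sa c1 B(1) W t0 in auto)
 also have "... = K4 * t" by (simp add: K4_def)
 finally show ?thesis .
 qed
 have "t<=1 / K4" using t by (simp add: ep_def)
 hence K4t: "K4 * t<=1" using K4 by (simp add: pos_le_divide_eq mult.commute)
 have "abs (pp x$j)<=W + 1" if j: "j:J" for j using nr[OF j] y[rule_format, OF j] K4t by linarith
 moreover have "c1 / 2 * norm x<=la x" unfolding lax using sa nx by (simp add: mult.commute)
 ultimately show ?thesis using nr by (simp add: near_def)
qed
moreover have "c1 / 2 > 0" using c1 by simp
ultimately show ?thesis using ep K4 by blast
qed

text \<open>Borel-Cantelli over dyadic shells. The count is left as a hypothesis because its proof
  depends on rational isotropy; the restriction to x_a >= c T is harmless here and serves the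
  packing argument.\<close>

theorem chart_convergence:
assumes pos: "ALL t>0. \<psi> t > 0" and qc: "quasi_conformal \<psi>"
 and s: "summable (%i. (2^i * \<psi> (2^i))^card J)"
 and count: "!!W c. W > 0 ==> c > 0 ==> EX C. ALL T>=1. real (card {x:shell W T. c * T<=abs (la x)})<=C * T^card J"
shows "AE y in lborel. ~ approximable (quadric Q m) \<psi> (sgn (L *v ev y))"
proof -
have main: "AE y in lborel. y:cbox (\<chi> i. - W) (\<chi> i. W) --> ~ approximable (quadric Q m) \<psi> (sgn (L *v ev y))"
 if W: "W > 0" for W :: real
proof -
 define k where "k=card J"
 have k: "k > 0" using J_nonempty by (simp add: k_def card_gt_0_iff)
 have W1: "W + 1 > 0" using W by simp
 obtain ep K c where ep: "ep > 0" and K: "K > 0" and c: "c > 0" and app: "!!x y t. x ~= 0 ==> (ALL j:J. abs (y$j)<=W) ==> norm (sgn x - sgn (L *v ev y)) < t ==> t<=ep ==>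
 c * norm x<=la x & (ALL j:J. abs (pp x$j)<=W + 1) & y:near J (pp x) (K * t)" using approximant_near[OF W] by blast
 obtain K20 where K20: "K20 > 0" "!!x. abs (la x)<=K20 * norm x" using la_le_norm by blast
 define K2 where "K2=max 1 K20"
 have K2: "K2 >= 1" "!!x. abs (la x)<=K2 * norm x"
 using order_trans[OF K20(2) mult_right_mono[of K20 K2]] by (auto simp: K2_def)
 obtain A where A: "A > 0" "!!s t. 0 < t ==> t / 2<=s ==> s<=2 * t ==> \<psi> s<=A * \<psi> t"
 using quasi_conformal_iterate[OF qc pos, of 2] by auto
 define c' where "c'=c / (2 * K2)"
 have c': "c' > 0" using c K2(1) by (simp add: c'_def)
 define N where "N=(%T. card {x:shell (W + 1) T. c' * T<=abs (la x)})"
 obtain C0 where C0: "!!T. T >= 1 ==> real (N T)<=C0 * T^k" using count[OF W1 c'] unfolding k_def N_def by blast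
 define C where "C=abs C0"
 have C: "C >= 0" "!!T. T >= 1 ==> real (N T)<=C * T^k"
 proof -
 show "C >= 0" by (simp add: C_def)
 fix T :: real assume T: "T >= 1"
 have "C0 * T^k<=C * T^k" using T by (intro mult_right_mono) (auto simp: C_def)
 thus "real (N T)<=C * T^k" using C0[OF T] by linarith
 qed
 have pp2: "\<psi> (2^i) > 0" for i :: nat using pos by simp
 \<comment> \<open>If 2^i <= norm x < 2^(i+1), then x_a is at most 2 K2 2^i by the choice of
   \<open>K2\<close>, and at least c 2^i, which is c' times that bound.\<close>
 define D where "D=(%i::nat. {x:shell (W + 1) (2 * K2 * 2^i). c' * (2 * K2 * 2^i)<=abs (la x)})"
 have fD: "finite (D i)" for i unfolding D_def using finite_shell[of "W + 1"] W1 by simp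
 let ?box = "cbox (\<chi> i. - W) ((\<chi> i. - W) + (\<chi> i. 2 * W)) :: (real^'n) set"
 define E where "E=(%i::nat. UN x:D i. ?box Int near J (pp x) (K * (A * \<psi> (2^i))))"
 have fm: "?box Int near J p r:fmeasurable lborel" for p r
 by (rule fmeasurable_Int_fmeasurable[OF fmeasurable_cbox]) (simp add: closed_near borel_closed)
 have Ef: "E i:fmeasurable lborel" for i unfolding E_def by (rule fmeasurable.finite_UN[OF fD fm])
 define M where "M=C * (2 * K2)^k * (2 * K * A)^k * (2 * W)^card (- J)"
 have mE: "vol (E i)<=M * (2^i * \<psi> (2^i))^k" for i
 proof -
 have r0: "0<=K * (A * \<psi> (2^i))" using K A pp2[of i] by simp
 have "vol (E i)<=(SUM x:D i. vol (?box Int near J (pp x) (K * (A * \<psi> (2^i)))))"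
  unfolding E_def by (rule measure_UNION_le[OF fD]) (use fm in \<open>auto simp: fmeasurable_def\<close>)
 also have "... <= (SUM x:D i. (2 * (K * (A * \<psi> (2^i))))^k * (2 * W)^card (- J))"
  unfolding k_def by (intro sum_mono measure_cube_near_le) (use W r0 in auto)
 also have "... = real (card (D i)) * ((2 * (K * (A * \<psi> (2^i))))^k * (2 * W)^card (- J))" by simp
 also have "... <= (C * (2 * K2 * 2^i)^k) * ((2 * (K * (A * \<psi> (2^i))))^k * (2 * W)^card (- J))"
 proof (rule mult_right_mono)
  have "1 * 1<=K2 * 2^i" by (rule mult_mono) (use K2(1) in auto)
  hence "1<=2 * K2 * 2^i" by simp
  from C(2)[OF this] show "real (card (D i))<=C * (2 * K2 * 2^i)^k" unfolding D_def N_def .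
 qed (use W r0 in simp)
 also have "... = M * (2^i * \<psi> (2^i))^k" unfolding M_def power_mult_distrib by (simp add: mult.assoc mult.commute mult.left_commute)
 finally show ?thesis .
 qed
 have sE: "summable (%i. vol (E i))"
 by (rule summable_comparison_test'[of "%i. M * (2^i * \<psi> (2^i))^k" 0]) (use mE s[folded k_def] in \<open>auto intro: summable_mult\<close>)
 have BC: "AE y in lborel. eventually (%i. y:space lborel - E i) sequentially"
 proof (rule borel_cantelli_AE1[OF _ _ sE])
 show "E i:sets lborel" for i using Ef[of i] by (simp add: fmeasurable_def)
 show "emeasure lborel (E i) < \<infinity>" for i using Ef[of i] by (simp add: fmeasurable_def)
 qed
 define e0 where "e0=ep / A"
 have e0: "e0 > 0" using ep A(1) by (simp add: e0_def)
 have "(%i. (2^i * \<psi> (2^i))^k) \<longlonglongrightarrow> 0" using s unfolding k_def by (rule summable_LIMSEQ_zero)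
 moreover have "e0^k > 0" using e0 by simp
 ultimately have "eventually (%i. (2^i * \<psi> (2^i))^k < e0^k) sequentially" by (rule order_tendstoD(2))
 then obtain N1 where N1: "!!i. i >= N1 ==> (2^i * \<psi> (2^i))^k < e0^k" by (auto simp: eventually_sequentially)
 have small: "A * \<psi> (2^i)<=ep" if i: "i >= N1" for i
 proof -
 have "2^i * \<psi> (2^i) < e0" using N1[OF i] e0 by (intro power_less_imp_less_base[of _ k e0]) auto
 moreover have "1 * \<psi> (2^i)<=2^i * \<psi> (2^i)" using pp2[of i] by (intro mult_right_mono) auto
 ultimately have "\<psi> (2^i)<=ep / A" unfolding e0_def by linarith
 thus ?thesis using A(1) by (simp add: pos_le_divide_eq mult.commute)
 qed
 from BC show ?thesis
 proof (eventually_elim, intro impI notI)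
 fix y :: "real^'n"
 assume ev: "eventually (%i. y:space lborel - E i) sequentially" and yb: "y:cbox (\<chi> i. - W) (\<chi> i. W)"
  and ap: "approximable (quadric Q m) \<psi> (sgn (L *v ev y))"
 obtain N2 where N2: "!!i. i >= N2 ==> y ~: E i" using ev by (auto simp: eventually_sequentially)
 have yW: "ALL j:J. abs (y$j)<=W"
 proof
  fix j
  have "- W<=y$j & y$j<=W" using yb by (auto simp: mem_box_cart)
  thus "abs (y$j)<=W" by (auto simp: abs_le_iff)
 qed
 have ybox: "y : ?box" using yb by (simp add: mem_box_cart)
 obtain n0 where n0: "1 / c < 2^n0" using real_arch_pow[of 2 "1 / c"] by auto
 define n where "n=max n0 (max N1 N2)"
 obtain n' :: nat where n': "(2::real)^Suc n<=real n'" using real_arch_simple by blast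
 have "sgn (L *v ev y):{v. approximable (quadric Q m) \<psi> v}" using ap by simp
 then obtain x where x: "x:XZ" "norm x > real n'" "norm (sgn x - sgn (L *v ev y)) < \<psi> (norm x)"
  unfolding approximable_limsup XZ_integer_points by blast
 have "1<=(2::real)^Suc n" by (rule one_le_power) simp
 hence x1: "1<=norm x" using x(2) n' by linarith
 then obtain i where i: "2^i<=norm x" "norm x < 2^Suc i" using dyadic_scale by blast
 have "(2::real)^Suc n < 2^Suc i" using i(2) x(2) n' by linarith
 hence "i > n" by (simp add: power_strict_increasing_iff)
 hence iN: "i >= n0" "i >= N1" "i >= N2" by (auto simp: n_def)
 have "\<psi> (norm x)<=A * \<psi> (2^i)" by (rule A(2)) (use i in auto)
 hence d: "norm (sgn x - sgn (L *v ev y)) < A * \<psi> (2^i)" using x(3) by linarith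
 have xne: "x ~= 0" using x1 by auto
 have P: "c * norm x<=la x" "ALL j:J. abs (pp x$j)<=W + 1" "y:near J (pp x) (K * (A * \<psi> (2^i)))"
  using app[OF xne yW d small[OF iN(2)]] by blast+
 have "(2::real)^n0<=2^i" using iN(1) by (intro power_increasing) auto
 hence "1 / c<=norm x" using n0 i(1) by linarith
 hence "1<=c * norm x" using c by (simp add: pos_divide_le_eq mult.commute)
 hence "1<=abs (la x)" using P(1) by linarith
 moreover have "abs (la x)<=2 * K2 * 2^i"
 proof -
  have "K2 * norm x<=K2 * (2 * 2^i)" using i(2) K2(1) by (intro mult_left_mono) auto
  thus ?thesis using K2(2)[of x] by linarith
 qed
 moreover have "c' * (2 * K2 * 2^i)<=abs (la x)"
 proof -
  have "c' * (2 * K2 * 2^i)=c * 2^i" using K2(1) by (simp add: c'_def)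
  also have "... <= c * norm x" using i(1) c by simp
  finally show ?thesis using P(1) by linarith
 qed
 ultimately have "x:D i" using x(1) P(2) by (simp add: D_def shell_def)
 hence "y:E i" unfolding E_def using P(3) ybox by blast
 thus False using N2[OF iN(3)] by blast
 qed
qed
have "AE y in lborel. ALL n::nat. y:cbox (\<chi> i. - (real n + 1)) (\<chi> i. real n + 1) --> ~ approximable (quadric Q m) \<psi> (sgn (L *v ev y))"
 unfolding AE_all_countable by (intro allI main) simp
thus ?thesis
proof eventually_elim
 fix y :: "real^'n"
 assume y: "ALL n::nat. y:cbox (\<chi> i. - (real n + 1)) (\<chi> i. real n + 1) --> ~ approximable (quadric Q m) \<psi> (sgn (L *v ev y))"
 obtain n :: nat where n: "norm y<=real n" using real_arch_simple by blast
 have "abs (y$i)<=real n" for i using component_le_norm_cart[of y i] n by linarith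
 hence "- (real n + 1)<=y$i & y$i<=real n + 1" for i by (smt (verit))
 hence "y:cbox (\<chi> i. - (real n + 1)) (\<chi> i. real n + 1)" by (simp add: mem_box_cart)
 thus "~ approximable (quadric Q m) \<psi> (sgn (L *v ev y))" using y by blast
qed
qed

section \<open>From Lebesgue null sets in a chart to the semi-invariant measure\<close>

definition gmat :: "real^'n => real^'n^'n" where "gmat y=L ** matrix (shear y) ** Linv"

lemma gmat_mult: "gmat y *v u=L *v shear y (Linv *v u)"
by (simp add: gmat_def matrix_vector_mul_assoc[symmetric] matrix_apply linear_shear)

lemma gmat_inverse: "gmat y *v (gmat (- y) *v u)=u" using shear_inverse[of "- y" "Linv *v u"] by (simp add: gmat_mult Linv_L)

lemma gmat_orthogonal: "gmat y:orthogonal_group Q"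
proof -
have "gmat y ** gmat (- y)=mat 1" by (subst matrix_eq) (simp add: matrix_vector_mul_assoc[symmetric] gmat_inverse)
moreover have "gmat (- y) ** gmat y=mat 1"
 using gmat_inverse[of "- y"] by (subst matrix_eq) (simp add: matrix_vector_mul_assoc[symmetric])
ultimately have "invertible (gmat y)" unfolding invertible_def by blast
moreover have "Q (gmat y *v x)=Q x" for x by (simp add: Q_Qc gmat_mult Linv_L Qc_shear)
ultimately show ?thesis by (simp add: orthogonal_group_def)
qed

lemma gmat_nonzero: "u ~= 0 ==> gmat y *v u ~= 0" using gmat_inverse[of "- y" u] by auto

lemma sphere_action_boundary:
assumes "u:boundary Q"
shows "sphere_action (gmat y) u:boundary Q" "sphere_action (gmat y) (sphere_action (gmat (- y)) u)=u"
proof -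
have u: "norm u=1" "Q u=0" "u ~= 0" using assms by (auto simp: boundary_def)
have "Q (gmat y *v u)=0" using gmat_orthogonal[of y] u(2) by (simp add: orthogonal_group_def)
hence "Q (sgn (gmat y *v u))=0" by (simp add: sgn_div_norm Q_scaleR)
moreover have "norm (sgn (gmat y *v u))=1" using gmat_nonzero[OF u(3), of y] by (simp add: norm_sgn)
ultimately show "sphere_action (gmat y) u:boundary Q" by (simp add: boundary_def sphere_action_def)
have n: "norm (gmat (- y) *v u) > 0" using gmat_nonzero[OF u(3), of "- y"] by simp
have "gmat y *v sgn (gmat (- y) *v u)=inverse (norm (gmat (- y) *v u)) *\<^sub>R u"
 by (simp add: sgn_div_norm matrix_vector_mult_scaleR gmat_inverse)
hence "sgn (gmat y *v sgn (gmat (- y) *v u))=sgn u" using n by (simp add: sgn_scaleR)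
also have "sgn u=u" using u(1) by (simp add: sgn_div_norm)
finally show "sphere_action (gmat y) (sphere_action (gmat (- y)) u)=u" by (simp add: sphere_action_def)
qed

text \<open>On the chart the unipotent group acts by translations, which preserve Lebesgue
  measure.\<close>

lemma shear_ev_translate: "shear (- y) (ev w)=ev (w + y)"
proof (rule vec_eqI)
have be: "bil (ev w) y=bil w y" unfolding bil_def by (rule sum.cong) (auto simp: ev_nth)
have "qj (w + y)=qj w + 2 * bil w y + qj y"
 unfolding qj_bil by (simp add: bil_linear bil_linear_right) (simp add: bil_def algebra_simps)
thus "shear (- y) (ev w)$b=ev (w + y)$b" by (simp add: shear_nth ev_nth bil_minus qj_minus be)
qed (simp_all add: shear_nth ev_nth)

lemma boundary_coordinates:
assumes "Q u=0" "la u ~= 0"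
shows "Linv *v u=la u *\<^sub>R ev (pp u)"
proof -
have "la u *\<^sub>R ((1 / la u) *\<^sub>R (Linv *v u))=la u *\<^sub>R ev (pp u)" unfolding Linv_point[OF assms] by simp
thus ?thesis using assms(2) by simp
qed

text \<open>For each fixed boundary point u in the chart, its translates run through the chart, so
  almost all y move u out of the exceptional set \<open>N\<close>. By Fubini some single y does so
  for \<mu>-almost all u, which means that the image of \<open>N\<close> under \<open>gmat y\<close>
  is null. Semi-invariance expresses the measure of that image as the integral over \<open>N\<close>
  of a positive density, hence \<open>N\<close> is null.\<close>

theorem chart_transfer:
assumes \<mu>: "semi_invariant_probability Q \<mu>" and S: "S:sets borel" and sym: "!!v. v:S ==> - v:S"
 and ae: "AE y in lborel. sgn (L *v ev y):S"
shows "AE v in \<mu>. la v ~= 0 --> v:S"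
proof -
have ps: "prob_space \<mu>" and sp: "space \<mu> = boundary Q" and st: "sets \<mu> = sets (restrict_space borel (boundary Q))"
 and qi: "!!g E. g:orthogonal_group Q ==> E:sets \<mu> ==>
 emeasure \<mu> (sphere_action g ` E)=(\<integral>\<^sup>+v\<in>E. ennreal (1 / norm (g *v v)^(CARD('n) - 2)) \<partial>\<mu>)"
 using \<mu> unfolding semi_invariant_probability_def by blast+
interpret prob_space \<mu> by (rule ps)
interpret pair_sigma_finite lborel \<mu> ..
have cl: "continuous_on UNIV la" unfolding la_def
 by (intro continuous_on_component linear_continuous_on matrix_vector_mul_bounded_linear)
define N0 where "N0={v. la v ~= 0} - S"
have N0: "N0:sets borel"
proof -
 have "open {v. la v ~= 0}" by (intro open_Collect_neq cl continuous_on_const)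
 thus ?thesis unfolding N0_def using S by (intro sets.Diff) auto
qed
define N where "N=boundary Q Int N0"
have N: "N:sets \<mu>" unfolding st N_def sets_restrict_space using N0 by blast
have idm: "(%x. x):borel_measurable \<mu>"
proof -
 have "(%x. x):borel_measurable (restrict_space borel (boundary Q))" by (intro measurable_restrict_space1) simp
 thus ?thesis using measurable_cong_sets[OF st refl] by blast
qed
define H where "H=(%z :: (real^'n) \<times> (real^'n). L *v shear (- fst z) (Linv *v snd z))"
have "continuous_on UNIV H"
proof -
 have "((%z. shear (- fst z) (Linv *v snd z)) \<longlongrightarrow> shear (- fst z0) (Linv *v snd z0)) (at z0)" for z0 :: "(real^'n) \<times> (real^'n)"
 by (intro tendsto_shear tendsto_minus tendsto_fst tendsto_snd tendsto_ident_at
  bounded_linear.tendsto[OF matrix_vector_mul_bounded_linear])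
 hence "continuous_on UNIV (%z. shear (- fst z) (Linv *v snd z))" by (simp add: continuous_on_def)
 thus ?thesis unfolding H_def by (rule bounded_linear.continuous_on[OF matrix_vector_mul_bounded_linear])
qed
hence Hm: "H:borel_measurable borel" by (rule borel_measurable_continuous_onI)
have pm: "(%z. (fst z, snd z)):(lborel \<Otimes>\<^sub>M \<mu>) \<rightarrow>\<^sub>M (borel :: ((real^'n) \<times> (real^'n)) measure)"
 unfolding borel_prod[symmetric]
 by (intro measurable_Pair measurable_compose[OF measurable_snd idm]) (auto intro: measurable_compose[OF measurable_fst])
have Hm2: "(%z. H z):borel_measurable (lborel \<Otimes>\<^sub>M \<mu>)" using measurable_compose[OF pm Hm] by simp
define P where "P=(%y u. sgn (H (y, u)) ~: N0)"
have Pm: "{z:space (lborel \<Otimes>\<^sub>M \<mu>). P (fst z) (snd z)}:sets (lborel \<Otimes>\<^sub>M \<mu>)"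
proof -
 have "(%z. inverse (norm (H z)) *\<^sub>R H z):borel_measurable (lborel \<Otimes>\<^sub>M \<mu>)" using Hm2 by measurable
 hence "(%z. sgn (H z)):borel_measurable (lborel \<Otimes>\<^sub>M \<mu>)" by (simp add: sgn_div_norm)
 from measurable_sets[OF this N0] have "(%z. sgn (H z)) -` N0 Int space (lborel \<Otimes>\<^sub>M \<mu>):sets (lborel \<Otimes>\<^sub>M \<mu>)" .
 hence "space (lborel \<Otimes>\<^sub>M \<mu>) - ((%z. sgn (H z)) -` N0 Int space (lborel \<Otimes>\<^sub>M \<mu>)):sets (lborel \<Otimes>\<^sub>M \<mu>)" by (rule sets.compl_sets)
 moreover have "{z:space (lborel \<Otimes>\<^sub>M \<mu>). P (fst z) (snd z)}=space (lborel \<Otimes>\<^sub>M \<mu>) - ((%z. sgn (H z)) -` N0 Int space (lborel \<Otimes>\<^sub>M \<mu>))"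
 by (auto simp: P_def)
 ultimately show ?thesis by simp
qed
have "AE u in \<mu>. AE y in lborel. P y u"
proof (rule AE_I2)
 fix u assume "u:space \<mu>"
 hence u: "Q u=0" "norm u=1" using sp by (auto simp: boundary_def)
 have lasgn: "la (sgn w)=inverse (norm w) * la w" for w by (simp add: la_def sgn_div_norm matrix_vector_mult_scaleR)
 have laH: "la (H (y, u))=la u" for y by (simp add: la_def H_def Linv_L shear_nth)
 show "AE y in lborel. P y u"
 proof (cases "la u=0")
 \<comment> \<open>The complement of the chart is preserved by the unipotent group and does not meet
   \<open>N0\<close>.\<close>
 case True
 hence "P y u" for y by (simp add: P_def N0_def lasgn laH)
 thus ?thesis by simp
 next
 case False
 define w where "w=pp u"
 have Hu: "H (y, u)=la u *\<^sub>R (L *v ev (w + y))" for y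
  unfolding H_def fst_conv snd_conv boundary_coordinates[OF u(1) False]
  by (simp add: w_def linear_scale[OF linear_shear] matrix_vector_mult_scaleR shear_ev_translate)
 define g where "g=(%y. sgn (L *v ev y))"
 have gm: "g:borel_measurable borel"
 proof -
  have "continuous_on UNIV (%y. L *v ev y)" by (rule bounded_linear.continuous_on[OF matrix_vector_mul_bounded_linear continuous_ev])
  hence [measurable]: "(%y. L *v ev y):borel_measurable borel" by (rule borel_measurable_continuous_onI)
  have "(%y. inverse (norm (L *v ev y)) *\<^sub>R (L *v ev y)):borel_measurable borel" by measurable
  thus ?thesis by (simp add: g_def sgn_div_norm)
 qed
 have gS: "{y:space lborel. g y:S}:sets lborel" using measurable_sets[OF gm S] by (simp add: vimage_def)
 have ae2: "AE y in distr lborel borel ((+) w). g y:S" using ae unfolding lborel_distr_plus g_def .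
 have "AE y in lborel. g (w + y):S" using ae2 by (subst (asm) AE_distr_iff) (use gS in auto)
 thus ?thesis
 proof eventually_elim
  fix y assume "g (w + y):S"
  hence gy: "sgn (L *v ev (w + y)):S" by (simp add: g_def)
  have "sgn (H (y, u))=sgn (la u) *\<^sub>R sgn (L *v ev (w + y))" unfolding Hu by (rule sgn_scaleR)
  hence "sgn (H (y, u)):S" using gy sym[OF gy] False by (cases "la u > 0") auto
  thus "P y u" by (simp add: P_def N0_def)
 qed
 qed
qed
hence "AE y in lborel. AE u in \<mu>. P y u" by (rule AE_commute[THEN iffD2, OF Pm])
moreover have "ae_filter (lborel :: (real^'n) measure) ~= bot" by (simp add: ae_filter_eq_bot_iff)
ultimately obtain y where y: "AE u in \<mu>. P y u" using eventually_happens' by blast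
have im: "sphere_action (gmat y) ` N={u:boundary Q. ~ P y u}"
proof -
 have Hg: "sgn (H (y, u))=sphere_action (gmat (- y)) u" for u by (simp add: H_def sphere_action_def gmat_mult)
 show ?thesis
 proof
 show "sphere_action (gmat y) ` N<={u:boundary Q. ~ P y u}"
 proof
  fix u assume "u:sphere_action (gmat y) ` N"
  then obtain v where v: "v:boundary Q" "v:N0" "u=sphere_action (gmat y) v" by (auto simp: N_def)
  have "sphere_action (gmat (- y)) u=v" unfolding v(3) using sphere_action_boundary(2)[OF v(1), of "- y"] by simp
  thus "u:{u:boundary Q. ~ P y u}" using v sphere_action_boundary(1)[OF v(1)] by (simp add: P_def Hg)
 qed
 show "{u:boundary Q. ~ P y u}<=sphere_action (gmat y) ` N"
 proof
  fix u assume "u:{u:boundary Q. ~ P y u}"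
  hence u: "u:boundary Q" "sphere_action (gmat (- y)) u:N0" by (auto simp: P_def Hg)
  have "sphere_action (gmat (- y)) u:N" unfolding N_def using u sphere_action_boundary(1)[OF u(1)] by blast
  thus "u:sphere_action (gmat y) ` N" using sphere_action_boundary(2)[OF u(1), of y] by (metis imageI)
 qed
 qed
qed
have "emeasure \<mu> {u:boundary Q. ~ P y u}=0"
proof -
 have "{u:boundary Q. ~ P y u}:sets \<mu>"
 proof -
 have "(%u. sgn (H (y, u))):borel_measurable \<mu>"
 proof -
  have "(%u. (y, u)):\<mu> \<rightarrow>\<^sub>M (borel :: ((real^'n) \<times> (real^'n)) measure)"
  unfolding borel_prod[symmetric] by (intro measurable_Pair idm) simp
  from measurable_compose[OF this Hm] have [measurable]: "(%u. H (y, u)):borel_measurable \<mu>" .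
  have "(%u. inverse (norm (H (y, u))) *\<^sub>R H (y, u)):borel_measurable \<mu>" by measurable
  thus ?thesis by (simp add: sgn_div_norm)
 qed
 from measurable_sets[OF this N0] have "(%u. sgn (H (y, u))) -` N0 Int space \<mu> : sets \<mu>" .
 moreover have "(%u. sgn (H (y, u))) -` N0 Int space \<mu> = {u:boundary Q. ~ P y u}" by (auto simp: P_def sp)
 ultimately show ?thesis by simp
 qed
 from AE_iff_measurable[OF this, of "P y"] y sp show ?thesis by simp
qed
hence "(\<integral>\<^sup>+v\<in>N. ennreal (1 / norm (gmat y *v v)^(CARD('n) - 2)) \<partial>\<mu>)=0"
 using qi[OF gmat_orthogonal N, of y] im by simp
moreover have fm: "(%v. ennreal (1 / norm (gmat y *v v)^(CARD('n) - 2)) * indicator N v):borel_measurable \<mu>"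
proof -
 have "(%v. gmat y *v v):borel_measurable borel"
 by (rule borel_measurable_continuous_onI, rule linear_continuous_on, rule matrix_vector_mul_bounded_linear)
 from measurable_compose[OF idm this] have [measurable]: "(%v. gmat y *v v):borel_measurable \<mu>" .
 show ?thesis using N by measurable
qed
ultimately have "AE v in \<mu>. ennreal (1 / norm (gmat y *v v)^(CARD('n) - 2)) * indicator N v=0"
 by (simp add: nn_integral_0_iff_AE)
with AE_space show ?thesis
proof eventually_elim
 fix v assume v: "v:space \<mu>" and z: "ennreal (1 / norm (gmat y *v v)^(CARD('n) - 2)) * indicator N v=0"
 have "v:boundary Q" using v sp by simp
 moreover have "v ~= 0" using calculation by (auto simp: boundary_def)
 hence "norm (gmat y *v v) > 0" using gmat_nonzero by simp
 hence "ennreal (1 / norm (gmat y *v v)^(CARD('n) - 2)) ~= 0" by (simp add: ennreal_eq_0_iff not_le)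
 hence "v ~: N" using z by auto
 ultimately show "la v ~= 0 --> v:S" by (auto simp: N_def N0_def)
qed
qed

end

text \<open>\<open>F\<close> plays the field of definition of the charts: the rationals if
  \<open>Q\<close> has a rational isotropic vector, the reals otherwise. One construction covers
  both cases.\<close>

locale form_over =
fixes F :: "real set" and A :: "real^'n::finite^'n" and Q :: "real^'n => real"
assumes F0: "0:F" and F1: "1:F" and Fadd: "!!x y. x:F ==> y:F ==> x + y:F"
 and Fdiff: "!!x y. x:F ==> y:F ==> x - y:F" and Fmult: "!!x y. x:F ==> y:F ==> x * y:F"
 and Fdivide: "!!x y. x:F ==> y:F ==> x / y:F"
 and AF: "!!i j. A$i$j:F" and QA: "!!x. Q x=(SUM i:UNIV. SUM j:UNIV. A$i$j * x$i * x$j)"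
 and nondeg: "nondegenerate_form Q"
begin

section \<open>Diagonalisation and rational charts\<close>

definition bl :: "real^'n => real^'n => real" where "bl x y=(SUM i:UNIV. SUM j:UNIV. ((A$i$j + A$j$i) / 2) * x$i * y$j)"

definition FV :: "real^'n => bool" where "FV x \<longleftrightarrow> (ALL i. x$i:F)"

lemma bl_linear: "bl (x + y) z=bl x z + bl y z" "bl (c *\<^sub>R x) z=c * bl x z"
"bl z (x + y)=bl z x + bl z y" "bl z (c *\<^sub>R x)=c * bl z x"
proof -
show "bl (x + y) z=bl x z + bl y z" "bl z (x + y)=bl z x + bl z y"
 by (simp_all add: bl_def sum.distrib[symmetric] distrib_left distrib_right)
show "bl (c *\<^sub>R x) z=c * bl x z" unfolding bl_def sum_distrib_left by (intro sum.cong refl) (simp add: field_simps)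
show "bl z (c *\<^sub>R x)=c * bl z x" unfolding bl_def sum_distrib_left by (intro sum.cong refl) (simp add: field_simps)
qed

lemma bl_sym: "bl x y=bl y x" unfolding bl_def by (subst sum.swap) (simp add: add.commute mult.commute mult.left_commute)

lemma bl_diag: "bl x x=Q x"
proof -
have "(SUM i:UNIV. SUM j:UNIV. A$j$i * x$i * x$j)=(SUM i:UNIV. SUM j:UNIV. A$i$j * x$i * x$j)"
 by (subst sum.swap) (simp add: mult.commute mult.left_commute)
moreover have "2 * bl x x=(SUM i:UNIV. SUM j:UNIV. A$i$j * x$i * x$j) + (SUM i:UNIV. SUM j:UNIV. A$j$i * x$i * x$j)"
 unfolding bl_def sum.distrib[symmetric] sum_distrib_left by (intro sum.cong refl) (simp add: field_simps)
ultimately show ?thesis by (simp add: QA)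
qed

lemma bl_zero: "bl 0 z=0" "bl z 0=0" by (simp_all add: bl_def)

lemma bl_diff: "bl (x - y) z=bl x z - bl y z" "bl z (x - y)=bl z x - bl z y"
using bl_linear(1)[of "x - y" y z] bl_linear(3)[of z "x - y" y] by simp_all

lemma bl_sum: "bl (SUM i:I. f i) z=(SUM i:I. bl (f i) z)" "bl z (SUM i:I. f i)=(SUM i:I. bl z (f i))"
by (induction I rule: infinite_finite_induct) (auto simp: bl_zero bl_linear)

lemma Q_add: "Q (x + y)=Q x + 2 * bl x y + Q y" unfolding bl_diag[symmetric] by (simp add: bl_linear bl_sym[of y x])

lemma Q_scale: "Q (c *\<^sub>R x)=c\<^sup>2 * Q x"
unfolding bl_diag[symmetric] by (simp only: bl_linear power2_eq_square mult.assoc)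

lemma bl_nondeg:
assumes "x ~= 0" shows "EX i. bl x (axis i 1) ~= 0"
proof (rule ccontr)
assume n: "~ (EX i. bl x (axis i 1) ~= 0)"
have "bl x y=0" for y
proof -
 have "y=(SUM i:UNIV. y$i *\<^sub>R axis i 1)" by (simp add: vec_eq_iff axis_def if_distrib[of "%t. _ * t"] cong: if_cong)
 hence "bl x y=bl x (SUM i:UNIV. y$i *\<^sub>R axis i 1)" by (rule arg_cong)
 also have "... = (SUM i:UNIV. y$i * bl x (axis i 1))" by (simp only: bl_sum bl_linear)
 finally have "bl x y=(SUM i:UNIV. y$i * bl x (axis i 1))" .
 thus ?thesis using n by simp
qed
hence "polar_form Q x y=0" for y unfolding polar_form_def Q_add by simp
thus False using nondeg assms unfolding nondegenerate_form_def by blast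
qed

lemma Fsum: "(!!i. i:I ==> f i:F) ==> (SUM i:I. f i):F" by (induction I rule: infinite_finite_induct) (auto intro: F0 Fadd)

lemma F2: "2:F" using Fadd[OF F1 F1] by simp

lemma bl_F: "FV x ==> FV y ==> bl x y:F" unfolding bl_def FV_def by (intro Fsum Fmult Fdivide Fadd AF F2) auto

lemma FV_ops: "FV x ==> FV y ==> FV (x + y)" "FV x ==> FV y ==> FV (x - y)" "c:F ==> FV x ==> FV (c *\<^sub>R x)" "FV (axis i 1)"
by (auto simp: FV_def axis_def intro: Fadd Fdiff Fmult F0 F1)

lemma FV_sum: "(!!i. i:I ==> FV (f i)) ==> FV (SUM i:I. f i)" by (auto simp: FV_def intro!: Fsum)

text \<open>A vector \<open>h\<close> pairing to 1/2 with \<open>f\<close> is made isotropic by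
  subtracting a multiple of \<open>f\<close>. The value 1/2 makes the plane contribute exactly x_a
  x_b to the form.\<close>

lemma hyperbolic_partner:
assumes f: "f ~= 0" "Q f=0" "FV f"
shows "EX e. FV e & Q e=0 & bl e f=1 / 2"
proof -
obtain i where i: "bl f (axis i 1) ~= 0" using bl_nondeg[OF f(1)] by blast
define h where "h=(1 / (2 * bl f (axis i 1))) *\<^sub>R axis i (1::real)"
have h: "FV h" unfolding h_def by (intro FV_ops Fdivide F1 Fmult F2 bl_F f(3))
have hf: "bl h f=1 / 2" unfolding h_def bl_linear using i bl_sym[of f "axis i 1"] by simp
define e where "e=h - Q h *\<^sub>R f"
have e: "FV e" unfolding e_def by (intro FV_ops h f(3)) (use bl_F[OF h h] bl_diag in simp)
have "Q e=0"
 unfolding bl_diag[symmetric] e_def bl_diff bl_linear using hf bl_sym[of h f] bl_diag[of h] bl_diag[of f] f(2) by simp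
moreover have "bl e f=1 / 2" unfolding e_def bl_diff bl_linear bl_diag f(2) using hf by simp
ultimately show ?thesis using e by blast
qed

definition orth :: "real^'n => real^'n => 'n set => ('n => real^'n) => bool" where
"orth e f K w \<longleftrightarrow> (ALL i:K. FV (w i) & Q (w i) ~= 0 & bl (w i) e=0 & bl (w i) f=0 & (ALL j:K. i ~= j --> bl (w i) (w j)=0))"

text \<open>Nondegeneracy gives two vectors u and t in the orthogonal complement with nonzero
  pairing; if both are isotropic, then u + t is not.\<close>

lemma orth_extend:
assumes ef: "FV e" "FV f" "Q e=0" "Q f=0" "bl e f=1 / 2" and w: "orth e f K w" and K: "card K + 2 < CARD('n)"
shows "EX t. FV t & Q t ~= 0 & bl t e=0 & bl t f=0 & (ALL j:K. bl t (w j)=0)"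
proof -
\<comment> \<open>The orthogonal projection onto the complement of \<open>e\<close>,
  \<open>f\<close> and the \<open>w i\<close>; the factors 2 come from
  \<open>bl e f=1 / 2\<close>.\<close>
define pr where "pr=(%u. u - (2 * bl u f) *\<^sub>R e - (2 * bl u e) *\<^sub>R f - (SUM i:K. (bl u (w i) / Q (w i)) *\<^sub>R w i))"
have fe: "bl f e=1 / 2" using ef(5) bl_sym by simp
have ww: "FV (w i)" "Q (w i) ~= 0" "bl (w i) e=0" "bl (w i) f=0" if "i:K" for i using w that by (auto simp: orth_def)
have wij: "bl (w i) (w j)=(if i=j then Q (w i) else 0)" if "i:K" "j:K" for i j
 using w that by (auto simp: orth_def bl_diag)
have FVpr: "FV (pr u)" if "FV u" for u
 unfolding pr_def bl_diag[symmetric] using that ww(1) ef(1,2) by (intro FV_ops FV_sum Fmult Fdivide bl_F F2) auto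
have pe: "bl (pr u) e=0" for u
proof -
 have "(SUM i:K. bl ((bl u (w i) / Q (w i)) *\<^sub>R w i) e)=0" by (rule sum.neutral) (use ww(3) in \<open>auto simp: bl_linear\<close>)
 thus ?thesis by (simp add: pr_def bl_diff bl_sum bl_linear(2) bl_diag ef(3) fe)
qed
have pf: "bl (pr u) f=0" for u
proof -
 have "(SUM i:K. bl ((bl u (w i) / Q (w i)) *\<^sub>R w i) f)=0" by (rule sum.neutral) (use ww(4) in \<open>auto simp: bl_linear\<close>)
 thus ?thesis by (simp add: pr_def bl_diff bl_sum bl_linear(2) bl_diag ef(4,5))
qed
have pw: "bl (pr u) (w j)=0" if j: "j:K" for u j
proof -
 have "(SUM i:K. bl ((bl u (w i) / Q (w i)) *\<^sub>R w i) (w j))=(SUM i:K. if i=j then bl u (w j) else 0)"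
 by (rule sum.cong) (use wij j ww(2) in \<open>auto simp: bl_linear\<close>)
 also have "... = bl u (w j)" using j by simp
 finally have s: "(SUM i:K. bl ((bl u (w i) / Q (w i)) *\<^sub>R w i) (w j))=bl u (w j)" .
 have "bl e (w j)=0" "bl f (w j)=0" using ww(3,4)[OF j] bl_sym by simp_all
 thus ?thesis unfolding pr_def bl_diff bl_sum s by (simp add: bl_linear(2))
qed
have self: "bl (pr u) y=bl u y" if "bl e y=0" "bl f y=0" "!!j. j:K ==> bl (w j) y=0" for u y
proof -
 have "(SUM i:K. bl ((bl u (w i) / Q (w i)) *\<^sub>R w i) y)=0" by (rule sum.neutral) (use that(3) in \<open>auto simp: bl_linear\<close>)
 thus ?thesis using that(1,2) by (simp add: pr_def bl_diff bl_sum bl_linear(2))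
qed
have "EX i. pr (axis i 1) ~= 0"
proof (rule ccontr)
 assume n: "~ (EX i. pr (axis i 1) ~= 0)"
 define S where "S={e, f} Un w ` K"
 have "axis i (1::real):span S" for i
 proof -
 have "axis i 1=(2 * bl (axis i 1) f) *\<^sub>R e + (2 * bl (axis i 1) e) *\<^sub>R f + (SUM j:K. (bl (axis i 1) (w j) / Q (w j)) *\<^sub>R w j)"
  using n unfolding pr_def by (simp add: algebra_simps)
 also have "... : span S" by (intro span_add span_scale span_sum span_base) (auto simp: S_def)
 finally show ?thesis .
 qed
 hence "(Basis :: (real^'n) set)<=span S" by (auto simp: Basis_vec_def)
 hence "(UNIV :: (real^'n) set)<=span S" by (metis span_Basis span_mono span_span)
 moreover have "finite S" by (simp add: S_def)
 ultimately have "dim (UNIV :: (real^'n) set)<=card S" by (rule span_card_ge_dim[OF subset_UNIV])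
 also have "card S<=card {e, f} + card (w ` K)" unfolding S_def by (rule card_Un_le)
 also have "... <= 2 + card K" by (intro add_mono card_image_le) (auto simp: card_insert_if)
 finally show False using K by simp
qed
then obtain i where i: "pr (axis i 1) ~= 0" by blast
define u where "u=pr (axis i 1)"
obtain l where l: "bl u (axis l 1) ~= 0" using bl_nondeg i unfolding u_def by blast
define t where "t=pr (axis l 1)"
have ut: "bl u t ~= 0"
proof -
 have "bl t u=bl (axis l 1) u" unfolding t_def
 by (rule self) (use pe[of "axis i 1"] pf[of "axis i 1"] pw[of _ "axis i 1"] bl_sym in \<open>auto simp: u_def\<close>)
 thus ?thesis using l bl_sym by metis
qed
define good where "good=(%t. FV t & bl t e=0 & bl t f=0 & (ALL j:K. bl t (w j)=0))"
have g: "good u" "good t" using FVpr FV_ops(4) pe pf pw by (auto simp: good_def u_def t_def)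
have "good (u + t)" using g by (auto simp: good_def bl_linear FV_ops)
moreover have "Q t ~= 0 \<or> Q u ~= 0 \<or> Q (u + t) ~= 0" using ut by (auto simp: Q_add)
ultimately show ?thesis using g unfolding good_def by blast
qed

lemma orth_family:
fixes a b :: 'n
assumes ef: "FV e" "FV f" "Q e=0" "Q f=0" "bl e f=1 / 2" and ab: "a ~= b"
shows "EX w. orth e f (- {a, b}) w"
proof -
have claim: "finite K ==> K <= - {a, b} ==> EX w. orth e f K w" for K
proof (induction K rule: finite_induct)
 case empty
 show ?case by (simp add: orth_def)
next
 case (insert j K)
 then obtain w where w: "orth e f K w" by blast
 have "card (insert j K)<=card (- {a, b})" using insert.prems by (intro card_mono) auto
 moreover have "card (- {a, b})=CARD('n) - 2" using ab by (simp add: Compl_eq_Diff_UNIV card_Diff_subset)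
 moreover have "card (insert j K)=Suc (card K)" using insert.hyps by simp
 ultimately have "card K + 2 < CARD('n)" by linarith
 then obtain t where t: "FV t" "Q t ~= 0" "bl t e=0" "bl t f=0" "!!j. j:K ==> bl t (w j)=0"
 using orth_extend[OF ef w] by blast
 have t': "!!j. j:K ==> bl (w j) t=0" using t(5) bl_sym by simp
 have "orth e f (insert j K) (w(j := t))" unfolding orth_def
 proof (intro ballI conjI impI)
 fix i assume i: "i:insert j K"
 show "FV ((w(j := t)) i)" "Q ((w(j := t)) i) ~= 0" "bl ((w(j := t)) i) e=0" "bl ((w(j := t)) i) f=0"
  using i w t insert.hyps by (auto simp: orth_def)
 fix l assume "l:insert j K" "i ~= l"
 thus "bl ((w(j := t)) i) ((w(j := t)) l)=0" using i w t(5) t' by (auto simp: orth_def)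
 qed
 thus ?case by blast
qed
show ?thesis by (rule claim) auto
qed

text \<open>Hyperbolic plane plus diagonalised complement. The last clause tells which vectors the
  chart misses: those orthogonal to \<open>f\<close>.\<close>

lemma chart_exists:
fixes a b :: 'n
assumes f: "f ~= 0" "Q f=0" "FV f" and ab: "a ~= b"
shows "EX \<beta> L. (ALL j. \<beta> j:F) & (ALL i j. L$i$j:F) & invertible L & (ALL j. j ~= a --> j ~= b --> \<beta> j ~= 0) &
 (ALL x. Q (L *v x)=x$a * x$b + (SUM j:- {a, b}. \<beta> j * (x$j)\<^sup>2)) & (ALL x. bl (L *v x) f=x$a / 2)"
proof -
obtain e where e: "FV e" "Q e=0" "bl e f=1 / 2" using hyperbolic_partner[OF f] by blast
have fe: "bl f e=1 / 2" using e(3) bl_sym by simp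
obtain w where w: "orth e f (- {a, b}) w" using orth_family[OF e(1) f(3) e(2) f(2) e(3) ab] by blast
let ?J = "- {a, b}"
have ww: "FV (w i)" "Q (w i) ~= 0" "bl (w i) e=0" "bl (w i) f=0" if "i : ?J" for i using w that by (auto simp: orth_def)
have ww': "bl e (w i)=0" "bl f (w i)=0" if "i : ?J" for i using ww(3,4)[OF that] bl_sym by simp_all
have wij: "bl (w i) (w j)=(if i=j then Q (w i) else 0)" if "i : ?J" "j : ?J" for i j
 using w that unfolding orth_def by (auto simp: bl_diag)
define c where "c=(%k. if k=a then e else if k=b then f else w k)"
define L :: "real^'n^'n" where "L=(\<chi> i k. c k$i)"
define \<beta> where "\<beta> = (%j. if j : ?J then Q (w j) else 0)"
have FVc: "FV (c k)" for k using e(1) f(3) ww(1) by (auto simp: c_def)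
have LF: "L$i$j:F" for i j using FVc[of j] by (simp add: L_def FV_def)
have \<beta>F: "\<beta> j:F" for j using ww(1)[of j] bl_F[of "w j" "w j"] F0 by (auto simp: \<beta>_def bl_diag)
define s where "s=(%x :: real^'n. SUM j:?J. x$j *\<^sub>R w j)"
have Lx: "L *v x=x$a *\<^sub>R e + x$b *\<^sub>R f + s x" for x
proof -
 have "column k L=c k" for k by (simp add: column_def L_def)
 hence "L *v x=(SUM k:UNIV. x$k *\<^sub>R c k)" using matrix_mult_sum[of L x] by (simp add: scalar_mult_eq_scaleR)
 also have "... = (SUM k:{a, b} Un ?J. x$k *\<^sub>R c k)" by (simp add: Un_commute)
 also have "... = (SUM k:{a, b}. x$k *\<^sub>R c k) + (SUM k:?J. x$k *\<^sub>R c k)" by (rule sum.union_disjoint) auto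
 also have "(SUM k:?J. x$k *\<^sub>R c k)=s x" unfolding s_def by (rule sum.cong) (auto simp: c_def)
 also have "(SUM k:{a, b}. x$k *\<^sub>R c k)=x$a *\<^sub>R e + x$b *\<^sub>R f" using ab by (simp add: c_def)
 finally show ?thesis .
qed
have sef: "bl (s x) e=0" "bl (s x) f=0" "bl e (s x)=0" "bl f (s x)=0" for x
 unfolding s_def bl_sum by (auto intro!: sum.neutral simp: bl_linear ww ww')
have sw: "bl (s x) (w j)=x$j * Q (w j)" if j: "j : ?J" for x j
proof -
 have "bl (s x) (w j)=(SUM i:?J. if i=j then x$j * Q (w j) else 0)"
 unfolding s_def bl_sum by (rule sum.cong) (use wij j in \<open>auto simp: bl_linear\<close>)
 also have "... = x$j * Q (w j)" using j by simp
 finally show ?thesis .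
qed
have ss: "Q (s x)=(SUM j:?J. \<beta> j * (x$j)\<^sup>2)" for x
proof -
 have "Q (s x)=(SUM j:?J. bl (s x) (x$j *\<^sub>R w j))" unfolding bl_diag[symmetric] by (subst (2) s_def) (rule bl_sum(2))
 also have "... = (SUM j:?J. \<beta> j * (x$j)\<^sup>2)" by (rule sum.cong) (auto simp: bl_linear sw \<beta>_def power2_eq_square)
 finally show ?thesis .
qed
have QL: "Q (L *v x)=x$a * x$b + (SUM j:?J. \<beta> j * (x$j)\<^sup>2)" for x
 unfolding Lx Q_add Q_scale bl_linear ss sef e f(2) by simp
have blf: "bl (L *v x) f=x$a / 2" for x unfolding Lx bl_linear sef bl_diag f(2) e(3) by simp
have ble: "bl (L *v x) e=x$b / 2" for x unfolding Lx bl_linear sef bl_diag e(2) fe by simp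
have blw: "bl (L *v x) (w j)=x$j * Q (w j)" if "j : ?J" for x j unfolding Lx bl_linear using that by (simp add: sw ww')
have "ALL x. L *v x=0 --> x=0"
proof (intro allI impI)
 fix x assume z: "L *v x=0"
 have "x$i=0" for i
 proof -
 consider "i=a" | "i=b" | "i : ?J" by auto
 thus ?thesis
 proof cases
  case 1
  thus ?thesis using blf[of x] z by (simp add: bl_zero)
 next
  case 2
  thus ?thesis using ble[of x] z by (simp add: bl_zero)
 next
  case 3
  thus ?thesis using blw[OF 3, of x] z ww(2)[OF 3] by (simp add: bl_zero)
 qed
 qed
 thus "x=0" by (simp add: vec_eq_iff)
qed
hence "EX B. B ** L=mat 1" by (simp add: matrix_left_invertible_ker)
hence "invertible L" by (simp add: invertible_left_inverse)
moreover have "ALL j. j ~= a --> j ~= b --> \<beta> j ~= 0" using ww(2) by (auto simp: \<beta>_def)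
ultimately show ?thesis using LF \<beta>F QL blf by blast
qed

text \<open>A vector h with bl h e0 nonzero becomes isotropic when a multiple of e0 is subtracted;
  so orthogonality to e0 and to the result implies orthogonality to h. Basis vectors orthogonal to
  e0 are shifted by \<open>h0\<close> beforehand.\<close>

lemma isotropic_spanning:
assumes e0: "e0 ~= 0" "Q e0=0" "FV e0"
shows "EX S. finite S & (ALL f:S. f ~= 0 & Q f=0 & FV f) & (ALL v. (ALL f:S. bl v f=0) --> v=0)"
proof -
define \<phi> where "\<phi> = (%h. h - (Q h / (2 * bl h e0)) *\<^sub>R e0)"
have \<phi>: "\<phi> h ~= 0 & Q (\<phi> h)=0 & FV (\<phi> h)" if h: "bl h e0 ~= 0" "FV h" for h
proof (intro conjI)
 have "bl (\<phi> h) e0=bl h e0" unfolding \<phi>_def bl_diff bl_linear bl_diag e0(2) by simp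
 thus "\<phi> h ~= 0" using h(1) by (auto simp: bl_zero)
 show "Q (\<phi> h)=0"
 unfolding bl_diag[symmetric] \<phi>_def bl_diff bl_linear using h(1) bl_sym[of h e0] bl_diag[of h] bl_diag[of e0] e0(2) by simp
 have "Q h:F" using bl_F[OF h(2) h(2)] by (simp add: bl_diag)
 thus "FV (\<phi> h)" unfolding \<phi>_def by (intro FV_ops h(2) e0(3) Fdivide Fmult F2 bl_F)
qed
obtain i0 where i0: "bl e0 (axis i0 1) ~= 0" using bl_nondeg[OF e0(1)] by blast
define h0 where "h0=axis i0 (1::real)"
have h0: "bl h0 e0 ~= 0" "FV h0" using i0 bl_sym FV_ops(4) by (auto simp: h0_def)
define h where "h=(%i. if bl (axis i 1) e0 ~= 0 then axis i (1::real) else axis i 1 + h0)"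
have h: "bl (h i) e0 ~= 0" "FV (h i)" for i using h0 by (auto simp: h_def bl_linear FV_ops)
define S where "S={e0, \<phi> h0} Un range (%i. \<phi> (h i))"
have "v=0" if v: "ALL f:S. bl v f=0" for v
proof (rule ccontr)
 assume "v ~= 0"
 then obtain i where i: "bl v (axis i 1) ~= 0" using bl_nondeg by blast
 have ve: "bl v e0=0" using v by (simp add: S_def)
 have vh: "bl v k=0" if "bl v (\<phi> k)=0" for k using that ve unfolding \<phi>_def bl_diff bl_linear by simp
 have "\<phi> (h i):S" "\<phi> h0:S" by (auto simp: S_def)
 hence "bl v (h i)=0" "bl v h0=0" using v vh by blast+
 thus False using i by (auto simp: h_def bl_linear split: if_splits)
qed
moreover have "finite S" by (simp add: S_def)
moreover have "ALL f:S. f ~= 0 & Q f=0 & FV f" using \<phi> h h0 e0 by (auto simp: S_def)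
ultimately show ?thesis by blast
qed

text \<open>One chart for each vector of \<open>isotropic_spanning\<close>: a nonzero v is not
  orthogonal to all of them, so some chart sees it with nonzero coordinate \<open>a\<close>.\<close>

theorem chart_atlas:
fixes a b :: 'n
assumes e0: "e0 ~= 0" "Q e0=0" "FV e0" and ab: "a ~= b"
shows "EX \<C>. finite \<C> & (ALL (\<beta>, L):\<C>. (ALL j. \<beta> j:F) & (ALL i j. L$i$j:F) & invertible L & (ALL j. j ~= a --> j ~= b --> \<beta> j ~= 0) &
 (ALL x. Q (L *v x)=x$a * x$b + (SUM j:- {a, b}. \<beta> j * (x$j)\<^sup>2))) &
 (ALL v. v ~= 0 --> (EX (\<beta>, L):\<C>. (matrix_inv L *v v)$a ~= 0))"
proof -
obtain S where S: "finite S" "!!f. f:S ==> f ~= 0 & Q f=0 & FV f" "!!v. (ALL f:S. bl v f=0) ==> v=0"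
 using isotropic_spanning[OF e0] by blast
define P where "P=(%f (\<beta> :: 'n => real, L :: real^'n^'n). (ALL j. \<beta> j:F) & (ALL i j. L$i$j:F) & invertible L & (ALL j. j ~= a --> j ~= b --> \<beta> j ~= 0) &
 (ALL x. Q (L *v x)=x$a * x$b + (SUM j:- {a, b}. \<beta> j * (x$j)\<^sup>2)) & (ALL x. bl (L *v x) f=x$a / 2))"
have "ALL f. EX c. f:S --> P f c"
proof (intro allI)
 fix f
 show "EX c. f:S --> P f c"
 proof (cases "f:S")
 case True
 have f: "f ~= 0" "Q f=0" "FV f" using S(2)[OF True] by auto
 have "EX \<beta> L. P f (\<beta>, L)" using chart_exists[OF f ab] by (simp only: P_def prod.case)
 thus ?thesis by blast
 qed simp
qed
from choice[OF this] obtain c where c: "!!f. f:S ==> P f (c f)" by blast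
show ?thesis
proof (intro exI[of _ "c ` S"] conjI allI impI)
 show "finite (c ` S)" using S(1) by simp
 show "ALL (\<beta>, L):c ` S. (ALL j. \<beta> j:F) & (ALL i j. L$i$j:F) & invertible L & (ALL j. j ~= a --> j ~= b --> \<beta> j ~= 0) &
 (ALL x. Q (L *v x)=x$a * x$b + (SUM j:- {a, b}. \<beta> j * (x$j)\<^sup>2))"
 proof
 fix q assume "q:c ` S"
 then obtain f where "f:S" "q=c f" by blast
 thus "case q of (\<beta>, L) => (ALL j. \<beta> j:F) & (ALL i j. L$i$j:F) & invertible L & (ALL j. j ~= a --> j ~= b --> \<beta> j ~= 0) &
  (ALL x. Q (L *v x)=x$a * x$b + (SUM j:- {a, b}. \<beta> j * (x$j)\<^sup>2))"
  using c[of f] unfolding P_def by (cases "c f") simp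
 qed
 fix v :: "real^'n" assume "v ~= 0"
 then obtain f where f: "f:S" "bl v f ~= 0" using S(3) by blast
 obtain \<beta> L where cL: "c f=(\<beta>, L)" by force
 have PL: "P f (\<beta>, L)" using c[OF f(1)] cL by simp
 hence "invertible L" by (simp add: P_def)
 hence "EX A'. L ** A'=mat 1 & A' ** L=mat 1" by (simp add: invertible_def)
 from someI_ex[OF this] have inv: "L ** matrix_inv L=mat 1" by (simp add: matrix_inv_def)
 have "bl (L *v (matrix_inv L *v v)) f=(matrix_inv L *v v)$a / 2" using PL by (simp add: P_def)
 hence "(matrix_inv L *v v)$a ~= 0" using f(2) by (simp add: matrix_vector_mul_assoc inv)
 thus "EX (\<beta>, L):c ` S. (matrix_inv L *v v)$a ~= 0" using cL f(1) by (intro bexI[of _ "(\<beta>, L)"]) (auto intro: image_eqI[of _ _ f])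
qed
qed

end

lemma indefinite_isotropic:
assumes Q: "!!x y. Q (x + y)=Q x + 2 * B x y + Q y" and Bs: "!!c x y. B (c *\<^sub>R x) y=c * B x y" "!!c x y. B x (c *\<^sub>R y)=c * B x y"
 and sc: "!!c x. Q (c *\<^sub>R x)=c\<^sup>2 * Q x" and ind: "indefinite_form Q"
shows "EX x. x ~= 0 & Q x=0"
proof -
obtain x y where xy: "Q x > 0" "Q y < 0" using ind by (auto simp: indefinite_form_def)
define \<phi> where "\<phi> = (%t::real. Q (x + t *\<^sub>R y))"
have e: "\<phi> t=Q x + 2 * (t * B x y) + t\<^sup>2 * Q y" for t by (simp add: \<phi>_def Q Bs sc)
define s where "s=1 + (Q x + 2 * abs (B x y)) / (- Q y)"
have s1: "s >= 1" using xy by (simp add: s_def divide_nonneg_neg)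
have "\<phi> s<=0"
proof -
 have "(s - 1) * (- Q y)=Q x + 2 * abs (B x y)" using xy by (simp add: s_def)
 hence q: "s * (- Q y) >= Q x + 2 * abs (B x y)" using xy by (simp add: algebra_simps)
 have "s * (Q x + 2 * abs (B x y))<=s * (s * (- Q y))" using q s1 by (intro mult_left_mono) auto
 moreover have "Q x<=s * Q x" using s1 xy by (simp add: mult_le_cancel_right1)
 moreover have "s * B x y<=s * abs (B x y)" using s1 by (intro mult_left_mono) auto
 ultimately show ?thesis unfolding e by (simp add: power2_eq_square algebra_simps)
qed
moreover have "\<phi> 0 >= 0" using xy by (simp add: \<phi>_def)
moreover have "continuous_on {0..s} \<phi>" unfolding e[abs_def] by (intro continuous_intros)
ultimately obtain t where t: "t >= 0" "\<phi> t=0" using IVT2'[of \<phi> s 0 0] s1 by auto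
have "x + t *\<^sub>R y ~= 0"
proof
 assume "x + t *\<^sub>R y=0"
 hence "x=(- t) *\<^sub>R y" by (simp add: eq_neg_iff_add_eq_0)
 hence "Q x=t\<^sup>2 * Q y" using sc[of "- t" y] by simp
 moreover have "t\<^sup>2 * Q y<=0" by (rule mult_nonneg_nonpos) (use xy in auto)
 ultimately show False using xy by linarith
qed
moreover have "Q (x + t *\<^sub>R y)=0" using t(2) by (simp only: \<phi>_def)
ultimately show ?thesis by blast
qed

section \<open>Quadratic congruences\<close>

definition sols :: "'j set => ('j => int) => int => nat => ('j => int) set" where
"sols J b M n={z:PiE J (%_. {0..<int n}). int n dvd (SUM j:J. b j * (z j)\<^sup>2) - M}"

lemma finite_sols: "finite J ==> finite (sols J b M n)"
unfolding sols_def by (rule finite_subset[of _ "PiE J (%_. {0..<int n})"]) (auto intro!: finite_PiE)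

lemma residue_eq:
fixes x y n :: int
assumes "n dvd x - y" "0<=x" "x < n" "0<=y" "y < n"
shows "x=y"
proof -
have "x mod n=y mod n" using assms(1) by (simp add: mod_eq_dvd_iff)
moreover have "x mod n=x" "y mod n=y" using assms(2-) by (auto intro: mod_pos_pos_trivial)
ultimately show ?thesis by simp
qed

lemma odd_prime_not_dvd_2:
assumes "prime p" "odd p" shows "~ int p dvd 2"
proof
assume "int p dvd 2"
hence "int p dvd int 2" by simp
hence "p dvd 2" by (simp only: int_dvd_int_iff)
hence "p=2" by (rule primes_dvd_imp_eq[OF assms(1) two_is_prime_nat])
thus False using assms(2) by simp
qed

lemma sols_le_all:
assumes "finite J" shows "card (sols J b M n)<=n^card J"
proof -
have "card (sols J b M n)<=card (PiE J (%_. {0..<int n}))"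
 unfolding sols_def by (intro card_mono finite_PiE) (use assms in auto)
thus ?thesis using assms by (simp add: card_PiE)
qed

lemma quad_mod:
fixes z :: "'j => int"
assumes "finite J" "!!j. j:J ==> n dvd z j - z' j"
shows "n dvd (SUM j:J. b j * (z j)\<^sup>2) - (SUM j:J. b j * (z' j)\<^sup>2)"
proof -
have "(SUM j:J. b j * (z j)\<^sup>2) - (SUM j:J. b j * (z' j)\<^sup>2)=(SUM j:J. b j * ((z j - z' j) * (z j + z' j)))"
 by (simp add: sum_subtractf[symmetric] power2_eq_square algebra_simps)
also have "n dvd ..." using assms(2) by (intro dvd_sum dvd_mult[OF dvd_mult2]) simp
finally show ?thesis .
qed

lemma sols_reduce:
assumes J: "finite J" and z: "z:sols J b M n" and d: "d dvd n" and d0: "d > 0"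
shows "restrict (%j. z j mod int d) J:sols J b M d"
proof -
let ?w = "restrict (%j. z j mod int d) J"
have "int d dvd (SUM j:J. b j * (?w j)\<^sup>2) - (SUM j:J. b j * (z j)\<^sup>2)"
proof (rule quad_mod[OF J])
 fix j assume "j:J"
 hence "?w j - z j = - (int d * (z j div int d))" using mult_div_mod_eq[of "int d" "z j"] by (simp add: algebra_simps)
 thus "int d dvd ?w j - z j" by simp
qed
moreover have "int d dvd (SUM j:J. b j * (z j)\<^sup>2) - M"
 using z d by (auto simp: sols_def intro: dvd_trans[of "int d" "int n"])
ultimately have "int d dvd ((SUM j:J. b j * (?w j)\<^sup>2) - (SUM j:J. b j * (z j)\<^sup>2)) + ((SUM j:J. b j * (z j)\<^sup>2) - M)" by (rule dvd_add)
thus ?thesis using d0 by (auto simp: sols_def)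
qed

text \<open>Only the injectivity half of the Chinese remainder theorem is called for, as an upper
  bound suffices.\<close>

lemma sols_mult_coprime:
assumes J: "finite J" and mn: "coprime m n" "m > 0" "n > 0"
shows "card (sols J b M (m * n))<=card (sols J b M m) * card (sols J b M n)"
proof -
let ?f = "%z. (restrict (%j. z j mod int m) J, restrict (%j. z j mod int n) J)"
have "inj_on ?f (sols J b M (m * n))"
proof (rule inj_onI)
 fix z z' assume z: "z:sols J b M (m * n)" "z':sols J b M (m * n)" and e: "?f z = ?f z'"
 have "z j=z' j" for j
 proof (cases "j:J")
 case True
 have "restrict (%j. z j mod int m) J j=restrict (%j. z' j mod int m) J j"
  "restrict (%j. z j mod int n) J j=restrict (%j. z' j mod int n) J j" using e by (metis fst_conv, metis snd_conv)
 hence "int m dvd z j - z' j" "int n dvd z j - z' j" using True by (simp_all add: mod_eq_dvd_iff)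
 moreover have "coprime (int m) (int n)" using mn(1) by simp
 ultimately have "int m * int n dvd z j - z' j" by (rule divides_mult)
 hence "int (m * n) dvd z j - z' j" by simp
 thus ?thesis by (rule residue_eq) (use z True in \<open>auto simp: sols_def PiE_iff\<close>)
 next
 case False
 thus ?thesis using z by (auto simp: sols_def PiE_iff extensional_def)
 qed
 thus "z=z'" by blast
qed
moreover have "?f ` sols J b M (m * n)<=sols J b M m \<times> sols J b M n"
 using sols_reduce[OF J _ dvd_triv_left mn(2)] sols_reduce[OF J _ dvd_triv_right mn(3)] by auto
ultimately have "card (sols J b M (m * n))<=card (sols J b M m \<times> sols J b M n)"
 by (intro card_inj_on_le) (auto simp: finite_sols J)
thus ?thesis by (simp add: card_cartesian_product)
qed

lemma card_fibres_le:
assumes "finite S" "g ` S<=T" "finite T" "!!t. t:T ==> card {x:S. g x=t}<=m"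
shows "card S<=m * card T"
proof -
have "S=(UN t:T. {x:S. g x=t})" using assms(2) by blast
hence "card S<=(SUM t:T. card {x:S. g x=t})" using card_UN_le[OF assms(3), of "%t. {x:S. g x=t}"] by simp
also have "... <= (SUM t:T. m)" using assms(4) by (intro sum_mono)
finally show ?thesis by (simp add: mult.commute)
qed

lemma finite_residues: "finite {x:{0..<n :: int}. P x}" by (rule finite_subset[of _ "{0..<n}"]) auto

lemma int_div_less:
fixes x q r :: int
assumes "0 < q" "x < r * q" shows "x div q < r"
proof (rule ccontr)
assume "~ x div q < r"
hence "r * q<=x div q * q" using assms(1) by (intro mult_right_mono) auto
also have "... <= x" using div_mult_mod_eq[of x q] assms(1) pos_mod_sign[of q x] by linarith
finally show False using assms(2) by simp
qed

lemma card_square_roots: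
assumes p: "prime p" and b: "~ int p dvd b"
shows "card {x:{0..<int p}. int p dvd b * x\<^sup>2 - c}<=2"
proof -
let ?S = "{x:{0..<int p}. int p dvd b * x\<^sup>2 - c}"
have pp: "prime (int p)" using p by simp
show ?thesis
proof (cases "?S={}")
 case True
 thus ?thesis by (simp only: card.empty)
next
 case False
 then obtain x0 where x0: "x0 : ?S" by blast
 have "?S<={x0, (- x0) mod int p}"
 proof
 fix x assume x: "x : ?S"
 have "int p dvd (b * x\<^sup>2 - c) - (b * x0\<^sup>2 - c)" by (rule dvd_diff) (use x x0 in auto)
 hence "int p dvd b * ((x - x0) * (x + x0))" by (simp add: power2_eq_square algebra_simps)
 hence "int p dvd x - x0 \<or> int p dvd x + x0" using pp b by (simp add: prime_dvd_mult_iff)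
 thus "x:{x0, (- x0) mod int p}"
 proof
  assume "int p dvd x - x0"
  hence "x=x0" by (rule residue_eq) (use x x0 in auto)
  thus ?thesis by simp
 next
  assume "int p dvd x + x0"
  hence "x mod int p=(- x0) mod int p" by (simp add: mod_eq_dvd_iff)
  thus ?thesis using x by simp
 qed
 qed
 hence "card ?S<=card {x0, (- x0) mod int p}" by (intro card_mono) auto
 also have "... <= 2" by (simp add: card_insert_if)
 finally show ?thesis .
qed
qed

lemma card_conic_degenerate:
assumes p: "prime p" and b: "~ int p dvd b1"
shows "card {(x, y). x:{0..<int p} & y:{0..<int p} & int p dvd b1 * x\<^sup>2 + b2 * y\<^sup>2 - c}<=2 * p"
proof -
let ?S = "{(x, y). x:{0..<int p} & y:{0..<int p} & int p dvd b1 * x\<^sup>2 + b2 * y\<^sup>2 - c}"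
have fin: "finite ?S" by (rule finite_subset[of _ "{0..<int p} \<times> {0..<int p}"]) auto
have "card {q : ?S. snd q=y}<=2" for y
proof -
 have "{q : ?S. snd q=y}<=(%x. (x, y)) ` {x:{0..<int p}. int p dvd b1 * x\<^sup>2 - (c - b2 * y\<^sup>2)}"
 by (auto simp: algebra_simps)
 hence "card {q : ?S. snd q=y}<=card ((%x. (x, y)) ` {x:{0..<int p}. int p dvd b1 * x\<^sup>2 - (c - b2 * y\<^sup>2)})"
 by (rule card_mono[OF finite_imageI[OF finite_residues]])
 also have "... <= card {x:{0..<int p}. int p dvd b1 * x\<^sup>2 - (c - b2 * y\<^sup>2)}" by (rule card_image_le[OF finite_residues])
 also have "... <= 2" by (rule card_square_roots[OF p b])
 finally show ?thesis .
qed
hence "card ?S<=2 * card {0..<int p}" by (intro card_fibres_le[OF fin, of snd]) auto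
thus ?thesis by simp
qed

text \<open>The constant must be p + O(1), as the ratios to p are multiplied over all primes
  dividing l; the easy bound 2p would be too large. Points are counted by the slope of the line to a
  given point: each slope gives at most one further point, and the vertical line through the given
  point holds at most two points in all.\<close>

lemma card_conic:
assumes p: "prime p" "odd p" and b: "~ int p dvd b1" "~ int p dvd b2" and c: "~ int p dvd c"
shows "card {(x, y). x:{0..<int p} & y:{0..<int p} & int p dvd b1 * x\<^sup>2 + b2 * y\<^sup>2 - c}<=p + 2"
proof -
let ?S = "{(x, y). x:{0..<int p} & y:{0..<int p} & int p dvd b1 * x\<^sup>2 + b2 * y\<^sup>2 - c}"
let ?p = "int p"
have pp: "prime ?p" using p by simp
have p2: "~ ?p dvd 2" by (rule odd_prime_not_dvd_2[OF p])
have fin: "finite ?S" by (rule finite_subset[of _ "{0..<int p} \<times> {0..<int p}"]) auto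
show ?thesis
proof (cases "?S={}")
 case True
 thus ?thesis by (simp only: card.empty)
next
 case False
 then obtain x0 y0 where o: "(x0, y0) : ?S" by auto
 define V where "V={q : ?S. fst q=x0}"
 define R where "R={q : ?S. fst q ~= x0}"
 have "V<=(%y. (x0, y)) ` {y:{0..<int p}. ?p dvd b2 * y\<^sup>2 - (c - b1 * x0\<^sup>2)}" by (auto simp: V_def algebra_simps)
 hence "card V<=card ((%y. (x0, y)) ` {y:{0..<int p}. ?p dvd b2 * y\<^sup>2 - (c - b1 * x0\<^sup>2)})" by (rule card_mono[OF finite_imageI[OF finite_residues]])
 also have "... <= card {y:{0..<int p}. ?p dvd b2 * y\<^sup>2 - (c - b1 * x0\<^sup>2)}" by (rule card_image_le[OF finite_residues])
 also have "... <= 2" by (rule card_square_roots[OF p(1) b(2)])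
 finally have cV: "card V<=2" .
 have slope: "EX t:{0..<int p}. ?p dvd (snd q - y0) - t * (fst q - x0)" if q: "q:R" for q
 proof -
 have "~ ?p dvd fst q - x0"
 proof
  assume "?p dvd fst q - x0"
  hence "fst q=x0" by (rule residue_eq) (use q o in \<open>auto simp: R_def\<close>)
  thus False using q by (simp add: R_def)
 qed
 hence "coprime ?p (fst q - x0)" using pp prime_imp_coprime by blast
 then obtain u v where uv: "u * ?p + v * (fst q - x0)=1" using bezout_int[of ?p "fst q - x0"] by (auto simp: coprime_iff_gcd_eq_1)
 define t where "t=(v * (snd q - y0)) mod ?p"
 have "(snd q - y0) - (v * (snd q - y0)) * (fst q - x0)=(snd q - y0) * (u * ?p)"
 proof -
  have "(snd q - y0) * (u * ?p)=(snd q - y0) * (1 - v * (fst q - x0))" using uv by (simp add: eq_diff_eq)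
  thus ?thesis by (simp add: algebra_simps)
 qed
 moreover define D where "D=v * (snd q - y0) div ?p"
 have te: "t=v * (snd q - y0) - ?p * D" unfolding t_def D_def by (simp add: minus_mult_div_eq_mod)
 have "(snd q - y0) - t * (fst q - x0)=((snd q - y0) - (v * (snd q - y0)) * (fst q - x0)) + ?p * D * (fst q - x0)"
  unfolding te by (simp add: algebra_simps)
 ultimately have "(snd q - y0) - t * (fst q - x0)=(snd q - y0) * (u * ?p) + ?p * D * (fst q - x0)" by simp
 hence "(snd q - y0) - t * (fst q - x0) = ?p * ((snd q - y0) * u + D * (fst q - x0))" by (simp add: algebra_simps)
 hence "?p dvd (snd q - y0) - t * (fst q - x0)" by simp
 moreover have "t:{0..<int p}" using p(1) by (simp add: t_def prime_gt_0_nat)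
 ultimately show ?thesis by blast
 qed
 hence "ALL q. EX t. q:R --> t:{0..<int p} & ?p dvd (snd q - y0) - t * (fst q - x0)" by blast
 from choice[OF this] obtain t where t: "!!q. q:R ==> t q:{0..<int p}" "!!q. q:R ==> ?p dvd (snd q - y0) - t q * (fst q - x0)" by blast
 have "inj_on t R"
 proof (rule inj_onI)
 fix q r assume q: "q:R" and r: "r:R" and tt: "t q=t r"
 \<comment> \<open>On the line of slope \<open>T\<close> the equation for s = x - x0 becomes s (s G
   + 2 H) = 0 modulo p.\<close>
 define T where "T=t q"
 define G where "G=b1 + b2 * T\<^sup>2"
 define H where "H=b1 * x0 + b2 * y0 * T"
 have key: "?p dvd (fst q - x0) * G + 2 * H & ~ ?p dvd fst q - x0" if q: "q:R" "t q=T" for q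
 proof -
  define s where "s=fst q - x0"
  define w where "w=(snd q - y0) - T * s"
  have w: "?p dvd w" using t(2)[OF q(1)] q(2) by (simp add: w_def s_def)
  have ns: "~ ?p dvd s"
  proof
  assume "?p dvd s"
  hence "fst q=x0" unfolding s_def by (rule residue_eq) (use q o in \<open>auto simp: R_def\<close>)
  thus False using q by (simp add: R_def)
  qed
  have "?p dvd (b1 * (fst q)\<^sup>2 + b2 * (snd q)\<^sup>2 - c) - (b1 * x0\<^sup>2 + b2 * y0\<^sup>2 - c)"
  by (rule dvd_diff) (use q(1) o in \<open>auto simp: R_def\<close>)
  moreover have "fst q=x0 + s" "snd q=y0 + T * s + w" by (simp_all add: s_def w_def)
  hence "(b1 * (fst q)\<^sup>2 + b2 * (snd q)\<^sup>2 - c) - (b1 * x0\<^sup>2 + b2 * y0\<^sup>2 - c)=s * (s * G + 2 * H) + w * (b2 * (2 * y0 + 2 * T * s + w))"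
  by (simp add: G_def H_def power2_eq_square algebra_simps)
  ultimately have "?p dvd s * (s * G + 2 * H) + w * (b2 * (2 * y0 + 2 * T * s + w))" by simp
  hence "?p dvd s * (s * G + 2 * H)" using w by (simp add: dvd_add_left_iff)
  thus ?thesis using ns pp by (simp add: prime_dvd_mult_iff s_def)
 qed
 have kq: "?p dvd (fst q - x0) * G + 2 * H" "~ ?p dvd fst q - x0" using key[OF q] by (auto simp: T_def)
 have kr: "?p dvd (fst r - x0) * G + 2 * H" using key[OF r] tt by (auto simp: T_def)
 \<comment> \<open>If \<open>G\<close> vanished modulo p, then so would \<open>H\<close>, and the
   line would run through the origin in an isotropic direction, which forces p to divide
   \<open>c\<close>.\<close>
 have nG: "~ ?p dvd G"
 proof
  assume g: "?p dvd G"
  hence "?p dvd 2 * H" using kq(1) by (simp add: dvd_add_right_iff)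
  hence h: "?p dvd H" using p2 pp by (simp add: prime_dvd_mult_iff)
  have "?p dvd x0 * G - H" by (rule dvd_diff) (use g h in auto)
  moreover have "x0 * G - H=b2 * (T * (T * x0 - y0))" by (simp add: G_def H_def power2_eq_square algebra_simps)
  ultimately have "?p dvd b2 * (T * (T * x0 - y0))" by simp
  hence "?p dvd T \<or> ?p dvd T * x0 - y0" using b(2) pp by (simp add: prime_dvd_mult_iff)
  thus False
  proof
  assume "?p dvd T"
  hence "?p dvd b2 * T\<^sup>2" by (simp add: power2_eq_square)
  hence "?p dvd b1" using g by (simp add: G_def dvd_add_left_iff)
  thus False using b(1) by blast
  next
  assume d: "?p dvd T * x0 - y0"
  have "b1 * x0\<^sup>2 + b2 * y0\<^sup>2 - c=x0\<^sup>2 * G - b2 * ((T * x0 - y0) * (T * x0 + y0)) - c"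
   by (simp add: G_def power2_eq_square algebra_simps)
  moreover have "?p dvd b1 * x0\<^sup>2 + b2 * y0\<^sup>2 - c" using o by auto
  moreover have "?p dvd x0\<^sup>2 * G - b2 * ((T * x0 - y0) * (T * x0 + y0))" by (rule dvd_diff) (use g d in auto)
  ultimately have "?p dvd (x0\<^sup>2 * G - b2 * ((T * x0 - y0) * (T * x0 + y0))) - (b1 * x0\<^sup>2 + b2 * y0\<^sup>2 - c)" by (intro dvd_diff[of ?p "x0\<^sup>2 * G - b2 * ((T * x0 - y0) * (T * x0 + y0))"])
  hence "?p dvd c" using \<open>b1 * x0\<^sup>2 + b2 * y0\<^sup>2 - c=x0\<^sup>2 * G - b2 * ((T * x0 - y0) * (T * x0 + y0)) - c\<close> by simp
  thus False using c by blast
  qed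
 qed
 have "?p dvd ((fst q - x0) * G + 2 * H) - ((fst r - x0) * G + 2 * H)" using kq(1) kr by (rule dvd_diff)
 hence "?p dvd (fst q - fst r) * G" by (simp add: algebra_simps)
 hence "?p dvd fst q - fst r" using nG pp by (simp add: prime_dvd_mult_iff)
 hence f: "fst q=fst r" by (rule residue_eq) (use q r in \<open>auto simp: R_def\<close>)
 have "?p dvd ((snd q - y0) - t q * (fst q - x0)) - ((snd r - y0) - t r * (fst r - x0))" using t(2)[OF q] t(2)[OF r] by (rule dvd_diff)
 hence "?p dvd snd q - snd r" using f tt by simp
 hence "snd q=snd r" by (rule residue_eq) (use q r in \<open>auto simp: R_def\<close>)
 thus "q=r" using f by (simp add: prod_eq_iff)
 qed
 hence "card R<=card {0..<int p}" by (rule card_inj_on_le) (use t(1) in auto)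
 moreover have "?S=V Un R" by (auto simp: V_def R_def)
 hence "card ?S<=card V + card R" by (metis card_Un_le)
 ultimately show ?thesis using cV by simp
qed
qed

lemma sum_restrict_split:
fixes f :: "'j => int"
assumes "finite J" "j:J"
shows "(SUM i:J. f i)=f j + (SUM i:J - {j}. f i)" using assms by (simp add: sum.remove)

text \<open>Fixing all but two coordinates leaves a conic. It has at most p + 2 points unless its
  constant term vanishes modulo p; this happens for few choices of the fixed coordinates, for which
  the crude bound 2p is affordable.\<close>

lemma sols_prime:
assumes J: "finite J" "2<=card J" and p: "prime p" "odd p" and b: "!!j. j:J ==> ~ int p dvd b j" and M: "~ int p dvd M"
shows "card (sols J b M p)<=p^(card J - 2) * (p + 6)"
proof -
let ?p = "int p"
obtain j1 where j1: "j1:J" using J by fastforce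
have "card (J - {j1}) >= 1" using J j1 by simp
then obtain j2 where j2: "j2:J" "j2 ~= j1" by (metis DiffE card.empty ex_in_conv not_one_le_zero singletonI)
define J' where "J'=J - {j1, j2}"
have J': "finite J'" "card J'=card J - 2" using J j1 j2 by (simp_all add: J'_def card_Diff_subset)
define c where "c=(%z :: 'a => int. M - (SUM j:J'. b j * (z j)\<^sup>2))"
define g where "g=(%z :: 'a => int. restrict z J')"
define T where "T=PiE J' (%_. {0..<int p})"
define T0 where "T0={z:T. ?p dvd c z}"
let ?S = "sols J b M p"
have fT: "finite T" using J' by (simp add: T_def finite_PiE)
have cT: "card T=p^(card J - 2)" using J' by (simp add: T_def card_PiE)
have fS: "finite ?S" using J by (simp add: finite_sols)
have fibre: "card {z : ?S. g z=u}<=card {(x, y). x:{0..<int p} & y:{0..<int p} & ?p dvd b j1 * x\<^sup>2 + b j2 * y\<^sup>2 - c u}" for u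
proof (rule card_inj_on_le)
 show "inj_on (%z. (z j1, z j2)) {z : ?S. g z=u}"
 proof (rule inj_onI)
 fix z z' assume z: "z:{z : ?S. g z=u}" "z':{z : ?S. g z=u}" and e: "(z j1, z j2)=(z' j1, z' j2)"
 have "z j=z' j" for j
 proof -
  consider "j=j1" | "j=j2" | "j:J'" | "j ~: J" by (auto simp: J'_def)
  thus ?thesis
  proof cases
  case 3
  have "g z j=g z' j" using z by simp
  thus ?thesis using 3 by (simp add: g_def)
  next
  case 4
  thus ?thesis using z by (auto simp: sols_def PiE_iff extensional_def)
  qed (use e in auto)
 qed
 thus "z=z'" by blast
 qed
 show "(%z. (z j1, z j2)) ` {z : ?S. g z=u}<={(x, y). x:{0..<int p} & y:{0..<int p} & ?p dvd b j1 * x\<^sup>2 + b j2 * y\<^sup>2 - c u}"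
 proof
 fix q assume "q:(%z. (z j1, z j2)) ` {z : ?S. g z=u}"
 then obtain z where z: "z : ?S" "g z=u" "q=(z j1, z j2)" by blast
 have "J - {j1} - {j2}=J'" by (auto simp: J'_def)
 hence "(SUM j:J. b j * (z j)\<^sup>2)=b j1 * (z j1)\<^sup>2 + (b j2 * (z j2)\<^sup>2 + (SUM j:J'. b j * (z j)\<^sup>2))"
  using sum_restrict_split[OF J(1) j1, of "%j. b j * (z j)\<^sup>2"] sum_restrict_split[of "J - {j1}" j2 "%j. b j * (z j)\<^sup>2"] J(1) j2 by simp
 moreover have "(SUM j:J'. b j * (z j)\<^sup>2)=M - c u" using z(2) by (auto simp: c_def g_def)
 moreover have "?p dvd (SUM j:J. b j * (z j)\<^sup>2) - M" using z(1) by (simp add: sols_def)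
 moreover have "A - M=x + y - cu" if "A=x + (y + R)" "R=M - cu" for A x y R cu :: int using that by simp
 ultimately have "?p dvd b j1 * (z j1)\<^sup>2 + b j2 * (z j2)\<^sup>2 - c u" by metis
 moreover have "z j1:{0..<int p}" "z j2:{0..<int p}" using z(1) j1 j2 by (auto simp: sols_def PiE_iff)
 ultimately show "q:{(x, y). x:{0..<int p} & y:{0..<int p} & ?p dvd b j1 * x\<^sup>2 + b j2 * y\<^sup>2 - c u}" using z(3) by simp
 qed
 show "finite {(x, y). x:{0..<int p} & y:{0..<int p} & ?p dvd b j1 * x\<^sup>2 + b j2 * y\<^sup>2 - c u}"
 by (rule finite_subset[of _ "{0..<int p} \<times> {0..<int p}"]) auto
qed
have gT: "g ` ?S<=T"
proof
 fix u assume "u:g ` ?S"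
 then obtain z where z: "z : ?S" "u=g z" by blast
 thus "u:T" unfolding T_def g_def by (auto simp: sols_def PiE_iff J'_def)
qed
have part1: "card {z : ?S. g z:T - T0}<=(p + 2) * card (T - T0)"
proof (rule card_fibres_le[of _ g])
 fix u assume u: "u:T - T0"
 have "card {z:{z : ?S. g z:T - T0}. g z=u}<=card {z : ?S. g z=u}" by (intro card_mono) (use fS in auto)
 also have "... <= p + 2" by (rule order_trans[OF fibre card_conic[OF p]]) (use b j1 j2 u in \<open>auto simp: T0_def\<close>)
 finally show "card {z:{z : ?S. g z:T - T0}. g z=u}<=p + 2" .
qed (use fS fT in auto)
have part2: "card {z : ?S. g z:T0}<=(2 * p) * card T0"
proof (rule card_fibres_le[of _ g])
 fix u
 have "card {z:{z : ?S. g z:T0}. g z=u}<=card {z : ?S. g z=u}" by (intro card_mono) (use fS in auto)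
 also have "... <= 2 * p" by (rule order_trans[OF fibre card_conic_degenerate[OF p(1)]]) (use b j1 in auto)
 finally show "card {z:{z : ?S. g z:T0}. g z=u}<=2 * p" .
qed (use fS fT in \<open>auto simp: T0_def\<close>)
\<comment> \<open>Multiplied by p to avoid the exponent card J - 3. For card J = 2 the constant term
  is \<open>M\<close> itself, prime to p, and \<open>T0\<close> is empty.\<close>
have T0c: "p * card T0<=2 * p^(card J - 2)"
proof (cases "J'={}")
 case True
 hence "T0={}" using M by (auto simp: T0_def c_def)
 thus ?thesis by simp
next
 case False
 then obtain j3 where j3: "j3:J'" by blast
 define T' where "T'=PiE (J' - {j3}) (%_. {0..<int p})"
 have fT': "finite T'" using J' by (simp add: T'_def finite_PiE)
 have "card T'=p^(card J' - 1)" using J' j3 by (simp add: T'_def card_PiE)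
 moreover have "card T0<=2 * card T'"
 proof (rule card_fibres_le[of _ "%z. restrict z (J' - {j3})"])
 show "finite T0" using fT by (simp add: T0_def)
 show "(%z. restrict z (J' - {j3})) ` T0<=T'"
  unfolding image_subset_iff T'_def restrict_PiE_iff by (auto simp: T0_def T_def PiE_iff)
 show "finite T'" by (rule fT')
 fix u
 define d where "d=M - (SUM j:J' - {j3}. b j * (u j)\<^sup>2)"
 have "card {z:T0. restrict z (J' - {j3})=u}<=card {x:{0..<int p}. ?p dvd b j3 * x\<^sup>2 - d}"
 proof (rule card_inj_on_le)
  show "inj_on (%z. z j3) {z:T0. restrict z (J' - {j3})=u}"
  proof (rule inj_onI)
  fix z z' assume z: "z:{z:T0. restrict z (J' - {j3})=u}" "z':{z:T0. restrict z (J' - {j3})=u}" and e: "z j3=z' j3"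
  have "z j=z' j" for j
  proof -
   consider "j=j3" | "j:J' - {j3}" | "j ~: J'" by blast
   thus ?thesis
   proof cases
   case 2
   have "restrict z (J' - {j3}) j=restrict z' (J' - {j3}) j" using z by simp
   thus ?thesis using 2 by simp
   next
   case 3
   thus ?thesis using z by (auto simp: T0_def T_def PiE_iff extensional_def)
   qed (use e in simp)
  qed
  thus "z=z'" by blast
  qed
  show "(%z. z j3) ` {z:T0. restrict z (J' - {j3})=u}<={x:{0..<int p}. ?p dvd b j3 * x\<^sup>2 - d}"
  proof
  fix x assume "x:(%z. z j3) ` {z:T0. restrict z (J' - {j3})=u}"
  then obtain z where z: "z:T0" "restrict z (J' - {j3})=u" "x=z j3" by blast
  have "(SUM j:J' - {j3}. b j * (z j)\<^sup>2)=(SUM j:J' - {j3}. b j * (u j)\<^sup>2)" by (rule sum.cong) (use z(2) in auto)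
  hence "c z=d - b j3 * x\<^sup>2"
   unfolding c_def d_def using sum_restrict_split[OF J'(1) j3, of "%j. b j * (z j)\<^sup>2"] z(3) by simp
  hence "?p dvd d - b j3 * x\<^sup>2" using z(1) by (simp add: T0_def)
  hence "?p dvd b j3 * x\<^sup>2 - d" by (subst dvd_diff_commute)
  moreover have "x:{0..<int p}" using z(1,3) j3 by (auto simp: T0_def T_def PiE_iff)
  ultimately show "x:{x:{0..<int p}. ?p dvd b j3 * x\<^sup>2 - d}" by simp
  qed
 qed (rule finite_residues)
 also have "... <= 2" by (rule card_square_roots[OF p(1)]) (use b j3 in \<open>auto simp: J'_def\<close>)
 finally show "card {z:T0. restrict z (J' - {j3})=u}<=2" .
 qed
 moreover have "card J'=Suc (card J' - 1)" using False J'(1) by (simp add: card_gt_0_iff)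
 ultimately show ?thesis using J'(2) by (metis mult.left_commute mult_le_mono2 power_Suc)
qed
have "?S={z : ?S. g z:T - T0} Un {z : ?S. g z:T0}" using gT by blast
hence "card ?S<=card {z : ?S. g z:T - T0} + card {z : ?S. g z:T0}" by (metis (lifting) card_Un_le)
also have "... <= (p + 2) * card (T - T0) + (2 * p) * card T0" using part1 part2 by (rule add_mono)
also have "... <= (p + 2) * p^(card J - 2) + 2 * (2 * p^(card J - 2))"
proof (rule add_mono)
 have "card (T - T0)<=card T" using fT by (intro card_mono) auto
 thus "(p + 2) * card (T - T0)<=(p + 2) * p^(card J - 2)" unfolding cT by (rule mult_le_mono2)
 show "(2 * p) * card T0<=2 * (2 * p^(card J - 2))" using T0c by simp
qed
also have "... = p^(card J - 2) * (p + 6)" by (simp add: algebra_simps)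
finally show ?thesis .
qed

text \<open>As p does not divide \<open>M\<close>, some coordinate \<open>u j0\<close> is prime to
  p. Two lifts that agree in the other coordinates have a sum of j0-coordinates prime to p, so
  p^(i+1) divides their difference; each of the other coordinates has at most p lifts.\<close>

lemma sols_hensel:
assumes J: "finite J" and p: "prime p" "odd p" and b: "!!j. j:J ==> ~ int p dvd b j" and M: "~ int p dvd M" and i: "i >= 1"
shows "card (sols J b M (p^Suc i))<=p^(card J - 1) * card (sols J b M (p^i))"
proof (rule card_fibres_le[of _ "%z. restrict (%j. z j mod int (p^i)) J"])
let ?p = "int p"
have pp: "prime ?p" using p by simp
have p2: "~ ?p dvd 2" by (rule odd_prime_not_dvd_2[OF p])
have p0: "p > 0" using p(1) by (simp add: prime_gt_0_nat)
show "finite (sols J b M (p^Suc i))" "finite (sols J b M (p^i))" using J by (simp_all add: finite_sols)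
show "(%z. restrict (%j. z j mod int (p^i)) J) ` sols J b M (p^Suc i)<=sols J b M (p^i)"
 using sols_reduce[OF J, of _ b M "p^Suc i" "p^i"] p0 by auto
fix u assume u: "u:sols J b M (p^i)"
obtain j0 where j0: "j0:J" "~ ?p dvd u j0"
proof (rule ccontr)
 assume nt: "~ thesis"
 note ob=that
 have "?p dvd u j" if "j:J" for j using nt ob \<open>j:J\<close> by blast
 hence "?p dvd (SUM j:J. b j * (u j)\<^sup>2)" by (intro dvd_sum) (simp add: power2_eq_square)
 moreover have "?p dvd (SUM j:J. b j * (u j)\<^sup>2) - M"
 using u i by (auto simp: sols_def intro: dvd_trans[of ?p "?p^i"] dvd_power)
 ultimately have "?p dvd M" using dvd_diff_right_iff by blast
 thus False using M by blast
qed
define A where "A=(%j. {x:{0..<int (p^Suc i)}. x mod int (p^i)=u j})"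
have cA: "finite (A j) & card (A j)<=p" for j
proof -
 have "A j<=(%t. u j + int (p^i) * t) ` {0..<int p}"
 proof
 fix x assume x: "x:A j"
 hence x: "0<=x" "x < int (p^Suc i)" "x mod int (p^i)=u j" by (auto simp: A_def)
 have "x=u j + int (p^i) * (x div int (p^i))" using x(3) mult_div_mod_eq[of "int (p^i)" x] by simp
 moreover have "x div int (p^i) >= 0" using x(1) by (simp add: pos_imp_zdiv_nonneg_iff p0)
 moreover have "x div int (p^i) < int p"
 proof -
  have "x < int p * int (p^i)" using x(2) by simp
  thus ?thesis using p0 by (intro int_div_less) auto
 qed
 ultimately show "x:(%t. u j + int (p^i) * t) ` {0..<int p}" by (intro image_eqI[of _ _ "x div int (p^i)"]) auto
 qed
 thus ?thesis using surj_card_le[of "{0..<int p}" "A j" "%t. u j + int (p^i) * t"] finite_subset by auto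
qed
let ?F = "{z:sols J b M (p^Suc i). restrict (%j. z j mod int (p^i)) J=u}"
have zA: "z j:A j" if "z : ?F" "j:J" for z j
proof -
 have "restrict (%j. z j mod int (p^i)) J j=u j" using that(1) by simp
 thus ?thesis using that by (auto simp: A_def sols_def PiE_iff)
qed
have "card ?F<=card (PiE (J - {j0}) A)"
proof (rule card_inj_on_le[of "%z. restrict z (J - {j0})"])
 show "inj_on (%z. restrict z (J - {j0})) ?F"
 proof (rule inj_onI)
 fix z z' assume z: "z : ?F" and z': "z' : ?F" and e: "restrict z (J - {j0})=restrict z' (J - {j0})"
 have eq: "z j=z' j" if "j:J - {j0}" for j using fun_cong[OF e, of j] that by simp
 have "?p^Suc i dvd ((SUM j:J. b j * (z j)\<^sup>2) - M) - ((SUM j:J. b j * (z' j)\<^sup>2) - M)"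
  by (rule dvd_diff) (use z z' in \<open>auto simp: sols_def\<close>)
 moreover have "(SUM j:J - {j0}. b j * (z j)\<^sup>2)=(SUM j:J - {j0}. b j * (z' j)\<^sup>2)" by (rule sum.cong) (use eq in auto)
 hence "((SUM j:J. b j * (z j)\<^sup>2) - M) - ((SUM j:J. b j * (z' j)\<^sup>2) - M)=b j0 * (z j0 + z' j0) * (z j0 - z' j0)"
  using sum_restrict_split[OF J j0(1), of "%j. b j * (z j)\<^sup>2"] sum_restrict_split[OF J j0(1), of "%j. b j * (z' j)\<^sup>2"]
  by (simp add: power2_eq_square algebra_simps)
 ultimately have d: "?p^Suc i dvd (b j0 * (z j0 + z' j0)) * (z j0 - z' j0)" by simp
 have "~ ?p dvd b j0 * (z j0 + z' j0)"
 proof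
  assume "?p dvd b j0 * (z j0 + z' j0)"
  hence d1: "?p dvd z j0 + z' j0" using b[OF j0(1)] pp by (simp add: prime_dvd_mult_iff)
  have m: "?p dvd y j0 - u j0" if "y : ?F" for y
  proof -
  have "y j0 mod int (p^i)=u j0" using zA[OF that j0(1)] by (simp add: A_def)
  hence "y j0 - u j0=int (p^i) * (y j0 div int (p^i))" using mult_div_mod_eq[of "int (p^i)" "y j0"] by simp
  moreover have "?p dvd int (p^i)" using i by (simp add: dvd_power)
  ultimately show ?thesis by (metis dvd_mult2)
  qed
  have "?p dvd (z j0 + z' j0) - (z j0 - u j0) - (z' j0 - u j0)" by (rule dvd_diff[OF dvd_diff[OF d1 m[OF z]] m[OF z']])
  hence "?p dvd 2 * u j0" by (simp add: algebra_simps)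
  thus False using p2 j0(2) pp by (simp add: prime_dvd_mult_iff)
 qed
 hence "coprime ?p (b j0 * (z j0 + z' j0))" using prime_imp_coprime[OF pp] by blast
 hence "coprime (?p^Suc i) (b j0 * (z j0 + z' j0))" by simp
 hence "?p^Suc i dvd z j0 - z' j0" using d coprime_dvd_mult_right_iff by blast
 hence "int (p^Suc i) dvd z j0 - z' j0" by simp
 hence e0: "z j0=z' j0" by (rule residue_eq) (use z z' j0 in \<open>auto simp: sols_def PiE_iff\<close>)
 have "z j=z' j" for j
 proof (cases "j:J")
  case True
  thus ?thesis using eq e0 by (cases "j=j0") auto
 next
  case False
  thus ?thesis using z z' by (auto simp: sols_def PiE_iff extensional_def)
 qed
 thus "z=z'" by blast
 qed
 show "(%z. restrict z (J - {j0})) ` ?F<=PiE (J - {j0}) A" unfolding image_subset_iff restrict_PiE_iff using zA by blast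
 show "finite (PiE (J - {j0}) A)" using J cA by (intro finite_PiE) auto
qed
also have "... = (PROD j:J - {j0}. card (A j))" using J by (intro card_PiE) simp
also have "... <= (PROD j:J - {j0}. p)" using cA by (intro prod_mono) auto
also have "... = p^(card J - 1)" using J j0 by simp
finally show "card ?F<=p^(card J - 1)" .
qed

lemma sols_good:
assumes J: "finite J" "2<=card J" and p: "prime p" "odd p" and b: "!!j. j:J ==> ~ int p dvd b j" and M: "~ int p dvd M" and i: "i >= 1"
shows "real (card (sols J b M (p^i)))<=(1 + 6 / real p) * real (p^i)^(card J - 1)" using i
proof (induction i rule: dec_induct)
case base
have p0: "p > 0" using p(1) by (simp add: prime_gt_0_nat)
have "card J - 1=Suc (card J - 2)" using J(2) by simp
hence E: "(1 + 6 / real p) * real p^(card J - 1)=real (p^(card J - 2) * (p + 6))" using p0 by (simp add: field_simps)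
show ?case unfolding power_one_right E using sols_prime[OF J p b M] by (simp only: of_nat_le_iff)
next
case (step i)
have "real (card (sols J b M (p^Suc i)))<=real (p^(card J - 1) * card (sols J b M (p^i)))"
 using sols_hensel[OF J(1) p b M step.hyps(1)] by (simp only: of_nat_le_iff)
also have "... = real p^(card J - 1) * real (card (sols J b M (p^i)))" by simp
also have "... <= real p^(card J - 1) * ((1 + 6 / real p) * real (p^i)^(card J - 1))" by (rule mult_left_mono[OF step.IH]) simp
also have "... = (1 + 6 / real p) * real (p^Suc i)^(card J - 1)" by (simp add: power_mult_distrib)
finally show ?case .
qed

section \<open>Congruences modulo powers of an arbitrary prime\<close>

lemma prime_power_dvd_product:
fixes p u v :: int
assumes p: "prime p" and d: "p^(h + r) dvd u * v"
shows "p^h dvd u \<or> p^r dvd v"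
proof (rule ccontr)
assume n: "~ (p^h dvd u \<or> p^r dvd v)"
hence nz: "u ~= 0" "v ~= 0" by auto
have pu: "~ is_unit p" using p not_prime_unit by blast
have "multiplicity p u < h" "multiplicity p v < r" using n nz pu by (meson multiplicity_dvd' not_le)+
moreover have "h + r<=multiplicity p (u * v)" using d nz pu by (intro multiplicity_geI) auto
moreover have "multiplicity p (u * v)=multiplicity p u + multiplicity p v"
 using p nz by (intro prime_elem_multiplicity_mult_distrib) auto
ultimately show False by simp
qed

lemma card_cong_class:
assumes "p > 0" "r<=i"
shows "card {x:{0..<int (p^i)}. int (p^(i - r)) dvd x - y}<=p^r"
proof -
let ?q = "int (p^(i - r))"
have q: "?q > 0" using assms by simp
have pi: "int (p^i)=int (p^r) * ?q" using assms by (simp add: power_add[symmetric])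
have "{x:{0..<int (p^i)}. ?q dvd x - y}<=(%t. y mod ?q + ?q * t) ` {0..<int (p^r)}"
proof
 fix x assume x: "x:{x:{0..<int (p^i)}. ?q dvd x - y}"
 have "x mod ?q=y mod ?q" using x by (simp add: mod_eq_dvd_iff)
 hence e: "x=y mod ?q + ?q * (x div ?q)" using mult_div_mod_eq[of ?q x] by simp
 have "x div ?q >= 0" using x q by (simp add: pos_imp_zdiv_nonneg_iff)
 moreover have "x div ?q < int (p^r)" by (rule int_div_less[OF q]) (use x pi in simp)
 ultimately show "x:(%t. y mod ?q + ?q * t) ` {0..<int (p^r)}" using e by (intro image_eqI[of _ _ "x div ?q"]) auto
qed
hence "card {x:{0..<int (p^i)}. ?q dvd x - y}<=card {0..<int (p^r)}" by (intro surj_card_le) auto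
also have "... = p^r" by (simp only: card_atLeastLessThan_int diff_zero nat_int)
finally show ?thesis .
qed

text \<open>For two roots x and y the product b (x - y) (x + y) is divisible by p^i. The coefficient
  absorbs fewer than g factors p, and x - y and x + y cannot both be divisible by p^(e+1) since p^e
  does not divide x. So x is close to y or to -y in the p-adic sense.\<close>

lemma card_square_roots_power:
fixes p :: nat
assumes p: "prime p" and b: "~ int (p^g) dvd b"
shows "card {x:{0..<int (p^i)}. ~ int (p^e) dvd x & int (p^i) dvd b * x\<^sup>2 - c}<=2 * p^(g + Suc e)"
proof (cases "g + Suc e<=i")
case False
have p0: "p > 0" using p by (simp add: prime_gt_0_nat)
have "card {x:{0..<int (p^i)}. ~ int (p^e) dvd x & int (p^i) dvd b * x\<^sup>2 - c}<=card {0..<int (p^i)}" by (intro card_mono) auto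
also have "... = p^i" by (simp only: card_atLeastLessThan_int diff_zero nat_int)
also have "... <= p^(g + Suc e)" using False p0 by (intro power_increasing) auto
finally show ?thesis by simp
next
case True
let ?S = "{x:{0..<int (p^i)}. ~ int (p^e) dvd x & int (p^i) dvd b * x\<^sup>2 - c}"
have pp: "prime (int p)" using p by simp
have p0: "p > 0" using p by (simp add: prime_gt_0_nat)
show ?thesis
proof (cases "?S={}")
 case True
 thus ?thesis by (simp only: card.empty)
next
 case False
 then obtain y where y: "y : ?S" by blast
 \<comment> \<open>The additional factor p accounts for the 2 in 2x when p = 2.\<close>
 define h where "h=Suc e"
 define r where "r=i - (g + h)"
 have ir: "i=g + (h + r)" using True by (simp add: r_def h_def)
 let ?C = "%y. {x:{0..<int (p^i)}. int (p^(i - (g + h))) dvd x - y}"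
 have "?S <= ?C y Un ?C (- y)"
 proof
 fix x assume x: "x : ?S"
 have "int (p^i) dvd (b * x\<^sup>2 - c) - (b * y\<^sup>2 - c)" by (rule dvd_diff) (use x y in auto)
 hence "int p^(g + (h + r)) dvd b * ((x - y) * (x + y))" using ir by (simp add: power2_eq_square algebra_simps)
 hence "int p^(h + r) dvd (x - y) * (x + y)" using prime_power_dvd_product[OF pp, of g "h + r" b] b by auto
 hence d1: "int p^h dvd x - y \<or> int p^r dvd x + y" "int p^h dvd x + y \<or> int p^r dvd x - y"
  using prime_power_dvd_product[OF pp, of h r "x - y" "x + y"] prime_power_dvd_product[OF pp, of h r "x + y" "x - y"]
  by (auto simp: mult.commute)
 have "~ (int p^h dvd x - y & int p^h dvd x + y)"
 proof
  assume a: "int p^h dvd x - y & int p^h dvd x + y"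
  have "int p^h dvd (x - y) + (x + y)" by (rule dvd_add) (use a in auto)
  hence "int p^(1 + e) dvd 2 * x" by (simp add: h_def)
  moreover have "~ int p^e dvd x" using x by simp
  ultimately have d2: "int p^(e + 1) dvd x * 2" by (simp add: mult.commute add.commute)
  have "int p^1 dvd 2" using prime_power_dvd_product[OF pp d2] \<open>~ int p^e dvd x\<close> by blast
  hence "int p dvd int 2" by simp
  hence "p dvd 2" by (simp only: int_dvd_int_iff)
  hence "p=2" using p by (metis primes_dvd_imp_eq two_is_prime_nat)
  hence "2 * int p^e dvd 2 * x" using \<open>int p^(1 + e) dvd 2 * x\<close> by simp
  thus False using \<open>~ int p^e dvd x\<close> by simp
 qed
 hence "int p^r dvd x - y \<or> int p^r dvd x + y" using d1 by blast
 moreover have "int (p^(i - (g + h)))=int p^r" by (simp add: r_def)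
 ultimately show "x : ?C y Un ?C (- y)" using x by auto
 qed
 hence "card ?S<=card (?C y Un ?C (- y))" by (rule card_mono[OF finite_UnI[OF finite_residues finite_residues]])
 also have "... <= card (?C y) + card (?C (- y))" by (rule card_Un_le)
 also have "... <= p^(g + h) + p^(g + h)" by (intro add_mono card_cong_class p0) (use True in \<open>simp_all add: h_def\<close>)
 finally show ?thesis by (simp add: h_def)
qed
qed

lemma prime_power_not_dvd:
fixes p :: nat and x :: int
assumes "prime p" "x ~= 0" shows "EX e. ~ int (p^e) dvd x"
proof -
have "prime (int p)" using assms(1) by simp
hence "~ is_unit (int p)" using not_prime_unit by blast
hence "finite {n. int p^n dvd x}" using assms(2) by (rule finite_divisor_powers[rotated])
then obtain e where "~ int p^e dvd x" using infinite_UNIV_nat by (metis (mono_tags, lifting) UNIV_I finite_subset mem_Collect_eq subsetI)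
thus ?thesis by auto
qed

text \<open>For the finitely many bad primes any constant will do. Since p^e does not divide
  \<open>M\<close>, some coordinate is not divisible by p^e, and given the others it takes boundedly
  many values.\<close>

lemma sols_prime_power:
assumes J: "finite J" "J ~= {}" and p: "prime p" and b: "!!j. j:J ==> b j ~= 0" and M: "M ~= 0"
shows "EX C>=1. ALL i. real (card (sols J b M (p^i)))<=C * real (p^i)^(card J - 1)"
proof -
have p0: "p > 0" using p by (simp add: prime_gt_0_nat)
obtain e where e: "~ int (p^e) dvd M" using prime_power_not_dvd[OF p M] by blast
have "ALL j. EX g. j:J --> ~ int (p^g) dvd b j" using prime_power_not_dvd[OF p] b by blast
from choice[OF this] obtain g where g: "!!j. j:J ==> ~ int (p^g j) dvd b j" by blast
define C where "C=(SUM j:J. 2 * p^(g j + Suc e)) + p^e"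
have "1<=p^e" using p0 by simp
hence C1: "C >= 1" unfolding C_def by linarith
have "card (sols J b M (p^i))<=C * (p^i)^(card J - 1)" for i
proof (cases "e<=i")
 case False
 have k: "card J=Suc (card J - 1)" using J by (simp add: card_gt_0_iff)
 have "card (sols J b M (p^i))<=(p^i)^card J" by (rule sols_le_all[OF J(1)])
 also have "... = p^i * (p^i)^(card J - 1)" using k by (metis power_Suc)
 also have "... <= p^e * (p^i)^(card J - 1)" using False p0 by (intro mult_le_mono1 power_increasing) auto
 also have "... <= C * (p^i)^(card J - 1)" by (intro mult_le_mono1) (simp add: C_def)
 finally show ?thesis .
next
 case True
 define S where "S=(%j. {z:sols J b M (p^i). ~ int (p^e) dvd z j})"
 have sub: "sols J b M (p^i)<=(UN j:J. S j)"
 proof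
 fix z assume z: "z:sols J b M (p^i)"
 have "EX j:J. ~ int (p^e) dvd z j"
 proof (rule ccontr)
  assume n: "~ (EX j:J. ~ int (p^e) dvd z j)"
  have "int (p^e) dvd (SUM j:J. b j * (z j)\<^sup>2)" using n by (intro dvd_sum) (auto simp: power2_eq_square)
  moreover have "int (p^e) dvd (SUM j:J. b j * (z j)\<^sup>2) - M"
  using z True by (auto simp: sols_def intro: dvd_trans[of "int p^e" "int p^i"] le_imp_power_dvd)
  ultimately have "int (p^e) dvd M" using dvd_diff_right_iff by blast
  thus False using e by blast
 qed
 thus "z:(UN j:J. S j)" using z by (auto simp: S_def)
 qed
 have fS: "finite (S j)" for j using finite_sols[OF J(1)] by (simp add: S_def)
 have cS: "card (S j)<=2 * p^(g j + Suc e) * (p^i)^(card J - 1)" if j: "j:J" for j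
 proof -
 define T where "T=PiE (J - {j}) (%_. {0..<int (p^i)})"
 have "card (S j)<=2 * p^(g j + Suc e) * card T"
 proof (rule card_fibres_le[OF fS, of "%z. restrict z (J - {j})"])
  show "(%z. restrict z (J - {j})) ` S j<=T"
  unfolding image_subset_iff T_def restrict_PiE_iff by (auto simp: S_def sols_def PiE_iff)
  show "finite T" using J by (simp add: T_def finite_PiE)
  fix u
  define c where "c=M - (SUM l:J - {j}. b l * (u l)\<^sup>2)"
  have "card {z:S j. restrict z (J - {j})=u}<=card {x:{0..<int (p^i)}. ~ int (p^e) dvd x & int (p^i) dvd b j * x\<^sup>2 - c}"
  proof (rule card_inj_on_le[of "%z. z j"])
  show "inj_on (%z. z j) {z:S j. restrict z (J - {j})=u}"
  proof (rule inj_onI)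
   fix z z' assume z: "z:{z:S j. restrict z (J - {j})=u}" "z':{z:S j. restrict z (J - {j})=u}" and e: "z j=z' j"
   have "z l=z' l" for l
   proof -
   consider "l=j" | "l:J - {j}" | "l ~: J" by blast
   thus ?thesis
   proof cases
    case 2
    have "restrict z (J - {j}) l=restrict z' (J - {j}) l" using z by simp
    thus ?thesis using 2 by simp
   next
    case 3
    thus ?thesis using z by (auto simp: S_def sols_def PiE_iff extensional_def)
   qed (use e in simp)
   qed
   thus "z=z'" by blast
  qed
  show "(%z. z j) ` {z:S j. restrict z (J - {j})=u}<={x:{0..<int (p^i)}. ~ int (p^e) dvd x & int (p^i) dvd b j * x\<^sup>2 - c}"
  proof
   fix x assume "x:(%z. z j) ` {z:S j. restrict z (J - {j})=u}"
   then obtain z where z: "z:S j" "restrict z (J - {j})=u" "x=z j" by blast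
   have "(SUM l:J - {j}. b l * (z l)\<^sup>2)=(SUM l:J - {j}. b l * (u l)\<^sup>2)" by (rule sum.cong) (use z(2) in auto)
   hence "(SUM l:J. b l * (z l)\<^sup>2) - M=b j * x\<^sup>2 - c"
   unfolding c_def using sum_restrict_split[OF J(1) j, of "%l. b l * (z l)\<^sup>2"] z(3) by simp
   thus "x:{x:{0..<int (p^i)}. ~ int (p^e) dvd x & int (p^i) dvd b j * x\<^sup>2 - c}"
   using z j by (auto simp: S_def sols_def PiE_iff)
  qed
  qed (rule finite_residues)
  also have "... <= 2 * p^(g j + Suc e)" by (rule card_square_roots_power[OF p g[OF j]])
  finally show "card {z:S j. restrict z (J - {j})=u}<=2 * p^(g j + Suc e)" .
 qed
 moreover have "card T=(p^i)^(card J - 1)" using J j by (simp add: T_def card_PiE nat_power_eq)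
 ultimately show ?thesis by simp
 qed
 have "card (sols J b M (p^i))<=card (UN j:J. S j)" using sub fS J(1) by (intro card_mono) auto
 also have "... <= (SUM j:J. card (S j))" by (rule card_UN_le[OF J(1)])
 also have "... <= (SUM j:J. 2 * p^(g j + Suc e) * (p^i)^(card J - 1))" by (intro sum_mono cS)
 also have "... = (SUM j:J. 2 * p^(g j + Suc e)) * (p^i)^(card J - 1)" by (simp add: sum_distrib_right)
 also have "... <= C * (p^i)^(card J - 1)" by (intro mult_le_mono1) (simp add: C_def)
 finally show ?thesis .
qed
hence "real (card (sols J b M (p^i)))<=real C * real (p^i)^(card J - 1)" for i by (metis of_nat_le_iff of_nat_mult of_nat_power)
thus ?thesis using C1 by (intro exI[of _ "real C"]) auto
qed

section \<open>Averaging over the modulus\<close>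

definition dsum :: "nat => real" where "dsum l=(\<Sum>d | d dvd l. real d powr (- 1 / 2))"

text \<open>\<open>dsum\<close> is the divisor function sigma_{-1/2}, which dominates the product of
  1 + p^{-1/2} over the primes dividing l: the divisors d of r and their multiples p d are distinct
  divisors of p^i r.\<close>

lemma dsum_extend:
assumes p: "prime p" and r: "~ p dvd r" "r > 0" and i: "i >= 1"
shows "(1 + real p powr (- 1 / 2)) * dsum r<=dsum (p^i * r)"
proof -
have p0: "p > 0" using p by (simp add: prime_gt_0_nat)
have fin: "finite {d. d dvd p^i * r}" using p0 r by simp
let ?A = "{d. d dvd r}" and ?B = "(*) p ` {d. d dvd r}"
have fA: "finite ?A" using r by simp
have disj: "?A Int ?B={}" using r(1) by (auto dest: dvd_mult_left)
have sub: "?A Un ?B<={d. d dvd p^i * r}" using i by (auto intro!: mult_dvd_mono dvd_power)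
have "(1 + real p powr (- 1 / 2)) * dsum r=dsum r + (\<Sum>d | d dvd r. real (p * d) powr (- 1 / 2))"
 by (simp add: dsum_def distrib_right sum_distrib_left powr_mult sum.distrib)
also have "(\<Sum>d | d dvd r. real (p * d) powr (- 1 / 2))=(SUM d:?B. real d powr (- 1 / 2))"
 using p0 by (subst sum.reindex) (auto simp: inj_on_def)
also have "dsum r + (SUM d:?B. real d powr (- 1 / 2))=(SUM d:?A Un ?B. real d powr (- 1 / 2))"
 unfolding dsum_def using fA disj by (intro sum.union_disjoint[symmetric]) auto
also have "... <= dsum (p^i * r)" unfolding dsum_def by (rule sum_mono2[OF fin sub]) auto
finally show ?thesis .
qed

lemma six_over_prime:
fixes p :: nat
assumes "p >= 36" shows "6 / real p<=real p powr (- 1 / 2)"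
proof -
have p: "real p > 0" using assms by simp
have "6<=sqrt (real p)" by (rule real_le_rsqrt) (use assms in simp)
hence "6 * sqrt (real p)<=sqrt (real p) * sqrt (real p)" by (intro mult_right_mono) auto
hence "6 * sqrt (real p)<=real p" by simp
hence "6 / real p<=1 / sqrt (real p)" using p by (simp add: field_simps)
also have "... = real p powr (- 1 / 2)" using p by (simp add: powr_minus_divide powr_half_sqrt)
finally show ?thesis .
qed

text \<open>Prime powers are split off one at a time. A good prime costs the factor 1 + 6/p, at most
  1 + p^{-1/2}, which \<open>dsum\<close> absorbs; the constants of the bad primes are collected in
  \<open>P l\<close> and bounded by their product over all of \<open>Bad\<close>.\<close>

lemma sols_bound:
assumes J: "finite J" "2<=card J" and b: "!!j. j:J ==> b j ~= 0" and M: "M ~= 0"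
shows "EX K>0. ALL l>0. real (card (sols J b M l))<=K * real l^(card J - 1) * dsum l"
proof -
have Jne: "J ~= {}" using J by auto
\<comment> \<open>From 36 on, 6/p is at most p^{-1/2}, and the prime 2 is excluded as well.\<close>
define Bad where "Bad={p. prime p & (p < 36 \<or> int p dvd M \<or> (EX j:J. int p dvd b j))}"
have finB: "finite Bad"
proof -
 have fd: "finite {p :: nat. int p dvd x}" if "x ~= 0" for x :: int
 proof (rule finite_subset)
 show "{p. int p dvd x}<={..nat \<bar>x\<bar>}" using that by (auto dest!: dvd_imp_le_int)
 qed simp
 have "Bad<={..<36} Un {p. int p dvd M} Un (UN j:J. {p. int p dvd b j})" by (auto simp: Bad_def)
 thus ?thesis by (rule finite_subset) (use fd M b J(1) in auto)
qed
have "ALL p. EX C. prime p --> C >= 1 & (ALL i. real (card (sols J b M (p^i)))<=C * real (p^i)^(card J - 1))"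
proof
 fix p
 show "EX C. prime p --> C >= 1 & (ALL i. real (card (sols J b M (p^i)))<=C * real (p^i)^(card J - 1))"
 proof (cases "prime p")
 case True
 show ?thesis using sols_prime_power[of J p b M, OF J(1) Jne True b M] by blast
 qed simp
qed
from choice[OF this] obtain Cp where Cp: "!!p. prime p ==> Cp p >= 1"
 "!!p i. prime p ==> real (card (sols J b M (p^i)))<=Cp p * real (p^i)^(card J - 1)" by blast
define Kf where "Kf=(%p. if p:Bad then Cp p else 1)"
have Kf1: "Kf p >= 1" for p using Cp(1) by (auto simp: Kf_def Bad_def)
have pw: "real (card (sols J b M (p^i)))<=Kf p * (1 + real p powr (- 1 / 2)) * real (p^i)^(card J - 1)"
 if p: "prime p" and i: "i >= 1" for p i
proof (cases "p:Bad")
 case True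
 have "real (card (sols J b M (p^i)))<=Kf p * real (p^i)^(card J - 1)" using Cp(2)[OF p] True by (simp add: Kf_def)
 also have "... <= Kf p * (1 + real p powr (- 1 / 2)) * real (p^i)^(card J - 1)"
 using Kf1[of p] by (intro mult_right_mono) (auto simp: mult_le_cancel_left1)
 finally show ?thesis .
next
 case False
 hence g: "p >= 36" "~ int p dvd M" "!!j. j:J ==> ~ int p dvd b j" using p by (auto simp: Bad_def)
 have "odd p" using prime_odd_nat[OF p] g(1) by simp
 from sols_good[OF J p this g(3) g(2) i]
 have "real (card (sols J b M (p^i)))<=(1 + 6 / real p) * real (p^i)^(card J - 1)" .
 also have "... <= (1 + real p powr (- 1 / 2)) * real (p^i)^(card J - 1)"
 using six_over_prime[OF g(1)] by (intro mult_right_mono) auto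
 finally show ?thesis using False by (simp add: Kf_def)
qed
define P where "P=(%l. PROD p:{p:Bad. p dvd l}. Kf p)"
have claim: "l > 0 --> real (card (sols J b M l))<=P l * real l^(card J - 1) * dsum l" for l
proof (induction l rule: less_induct)
 case (less l)
 show ?case
 proof
 assume l: "l > 0"
 show "real (card (sols J b M l))<=P l * real l^(card J - 1) * dsum l"
 proof (cases "l=1")
  case True
  have "{p:Bad. p dvd 1}={}" by (auto simp: Bad_def)
  hence "P 1=1" unfolding P_def by (simp only: prod.empty)
  moreover have "dsum 1=1" by (simp add: dsum_def)
  moreover have "card (sols J b M 1)<=1" using sols_le_all[OF J(1), of b M 1] by simp
  ultimately show ?thesis using True by simp
 next
  case False
  then obtain p where p: "prime p" "p dvd l" using prime_factor_nat[of l] by blast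
  have pu: "~ is_unit p" using p(1) not_prime_unit by blast
  define i where "i=multiplicity p l"
  obtain r where r: "l=p^i * r" "~ p dvd r" using multiplicity_decompose'[of l p] l pu unfolding i_def by auto
  have i1: "i >= 1" using p(2) r by (cases i) auto
  have r0: "r > 0" using l r(1) by (cases r) auto
  have p1: "p > 1" using p(1) by (rule prime_gt_1_nat)
  have "1 < p^i" by (rule one_less_power[OF p1]) (use i1 in simp)
  hence rl: "r < l" using r(1) r0 by simp
  have cop: "coprime (p^i) r" using p(1) r(2) by (simp add: prime_imp_coprime)
  have IH: "real (card (sols J b M r))<=P r * real r^(card J - 1) * dsum r" using less.IH[OF rl] r0 by blast
  have P0: "P r >= 0" unfolding P_def using Kf1 by (intro prod_nonneg) (meson order_trans zero_le_one)
  have d0: "dsum r >= 0" unfolding dsum_def by (intro sum_nonneg) simp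
  have Pl: "Kf p * P r<=P l"
  proof (cases "p:Bad")
  case True
  have eq: "{q:Bad. q dvd l}=insert p {q:Bad. q dvd r}"
  proof
   show "{q:Bad. q dvd l}<=insert p {q:Bad. q dvd r}"
   proof
   fix q assume q: "q:{q:Bad. q dvd l}"
   hence qp: "prime q" by (simp add: Bad_def)
   hence "q dvd p^i \<or> q dvd r" using q r(1) by (simp add: prime_dvd_mult_iff)
   hence "q=p \<or> q dvd r" using qp p(1) prime_dvd_power primes_dvd_imp_eq by blast
   thus "q:insert p {q:Bad. q dvd r}" using q by blast
   qed
   show "insert p {q:Bad. q dvd r}<={q:Bad. q dvd l}" using True p(2) r(1) by auto
  qed
  have nin: "p ~: {q:Bad. q dvd r}" using r(2) by simp
  have fr: "finite {q:Bad. q dvd r}" using finB by simp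
  have "P l=Kf p * P r" unfolding P_def eq by (rule prod.insert[OF fr nin])
  thus ?thesis by simp
  next
  case False
  have "P r<=P l" unfolding P_def
  proof (rule prod_mono2)
   show "finite {q:Bad. q dvd l}" using finB by simp
   show "{q:Bad. q dvd r}<={q:Bad. q dvd l}" using r(1) by auto
   show "1<=Kf q" for q by (rule Kf1)
   show "0<=Kf q" for q using Kf1[of q] by linarith
  qed
  thus ?thesis using False by (simp add: Kf_def)
  qed
  have "real (card (sols J b M l))<=real (card (sols J b M (p^i)) * card (sols J b M r))"
  unfolding r(1) using sols_mult_coprime[OF J(1) cop _ r0] p1 by (simp only: of_nat_le_iff) simp
  also have "... = real (card (sols J b M (p^i))) * real (card (sols J b M r))" by simp
  also have "... <= (Kf p * (1 + real p powr (- 1 / 2)) * real (p^i)^(card J - 1)) * (P r * real r^(card J - 1) * dsum r)"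
  by (rule mult_mono[OF pw[OF p(1) i1] IH]) (use Kf1[of p] in auto)
  also have "... = (Kf p * P r) * (real (p^i)^(card J - 1) * real r^(card J - 1)) * ((1 + real p powr (- 1 / 2)) * dsum r)"
  by (simp only: mult.assoc mult.commute mult.left_commute)
  also have "real (p^i)^(card J - 1) * real r^(card J - 1)=real l^(card J - 1)" unfolding r(1) by (simp add: power_mult_distrib)
  also have "(Kf p * P r) * real l^(card J - 1) * ((1 + real p powr (- 1 / 2)) * dsum r)<=P l * real l^(card J - 1) * dsum l"
  proof (rule mult_mono)
  show "Kf p * P r * real l^(card J - 1)<=P l * real l^(card J - 1)" by (rule mult_right_mono[OF Pl]) simp
  show "(1 + real p powr (- 1 / 2)) * dsum r<=dsum l" unfolding r(1) by (rule dsum_extend[OF p(1) r(2) r0 i1])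
  have "0<=Kf p * P r" using Kf1[of p] P0 by simp
  thus "0<=P l * real l^(card J - 1)" using Pl by (intro mult_nonneg_nonneg) auto
  qed (use d0 in simp)
  finally show ?thesis .
 qed
 qed
qed
define K where "K=(PROD p:Bad. Kf p)"
have K: "K > 0" unfolding K_def using Kf1 by (intro prod_pos) (meson less_le_trans zero_less_one)
have "real (card (sols J b M l))<=K * real l^(card J - 1) * dsum l" if l: "l > 0" for l
proof -
 have "P l<=K" unfolding P_def K_def
 proof (rule prod_mono2[OF finB])
 show "1<=Kf q" for q by (rule Kf1)
 show "0<=Kf q" for q using Kf1[of q] by linarith
 qed auto
 moreover have "dsum l >= 0" unfolding dsum_def by (intro sum_nonneg) simp
 ultimately have "P l * real l^(card J - 1) * dsum l<=K * real l^(card J - 1) * dsum l" by (intro mult_right_mono) auto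
 thus ?thesis using claim[of l] l by linarith
qed
thus ?thesis using K by blast
qed

text \<open>Exchange of summation: at most N / d of the moduli up to N are multiples of d, so the
  sum of \<open>dsum\<close> is at most N times the convergent series of d^{-3/2}.\<close>

theorem sum_sols_bound:
assumes J: "finite J" "2<=card J" and b: "!!j. j:J ==> b j ~= 0" and M: "M ~= 0"
shows "EX C>0. ALL N. real (\<Sum>l=1..N. card (sols J b M l))<=C * real N^card J"
proof -
obtain K where K: "K > 0" "!!l. l > 0 ==> real (card (sols J b M l))<=K * real l^(card J - 1) * dsum l"
 using sols_bound[of J b M, OF J b M] by blast
have sm: "summable (%n. real n powr (- 3 / 2))" by (subst summable_real_powr_iff) simp
define Z where "Z=(\<Sum>n. real n powr (- 3 / 2))"
have Z0: "Z >= 0" unfolding Z_def by (rule suminf_nonneg[OF sm]) simp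
have "real (\<Sum>l=1..N. card (sols J b M l))<=(K * (Z + 1)) * real N^card J" for N
proof -
 have k: "card J=Suc (card J - 1)" using J(2) by simp
 have ds: "(\<Sum>l=1..N. dsum l)<=real N * Z"
 proof -
 have "(\<Sum>l=1..N. dsum l)=(\<Sum>l=1..N. SUM d:{d:{1..N}. d dvd l}. real d powr (- 1 / 2))"
 proof (rule sum.cong[OF refl])
  fix l assume l: "l:{1..N}"
  have "{d. d dvd l}={d:{1..N}. d dvd l}" using l by (auto dest: dvd_imp_le intro: Suc_leI dvd_pos_nat)
  thus "dsum l=(SUM d:{d:{1..N}. d dvd l}. real d powr (- 1 / 2))" by (simp add: dsum_def)
 qed
 also have "... = (\<Sum>d=1..N. SUM l:{l:{1..N}. d dvd l}. real d powr (- 1 / 2))" by (rule sum.swap_restrict) auto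
 also have "... <= (\<Sum>d=1..N. real N * real d powr (- 3 / 2))"
 proof (rule sum_mono)
  fix d assume d: "d:{1..N}"
  have "card {l:{1..N}. d dvd l}<=card ((*) d ` {1..N div d})"
  proof (rule card_mono)
  show "{l:{1..N}. d dvd l}<=(*) d ` {1..N div d}"
  proof
   fix l assume "l:{l:{1..N}. d dvd l}"
   then obtain q where q: "l=d * q" "1<=l" "l<=N" by auto
   hence "1<=q" by (cases q) auto
   moreover have "q<=N div d" using q d by (metis atLeastAtMost_iff div_le_mono nonzero_mult_div_cancel_left not_one_le_zero)
   ultimately show "l:(*) d ` {1..N div d}" using q(1) by auto
  qed
  qed simp
  also have "... <= N div d" using card_image_le[of "{1..N div d}" "(*) d"] by simp
  finally have cn: "card {l:{1..N}. d dvd l}<=N div d" .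
  have dp: "real d > 0" using d by simp
  have "card {l:{1..N}. d dvd l} * d<=N" by (rule order_trans[OF mult_le_mono1[OF cn] div_times_less_eq_dividend])
  hence "real (card {l:{1..N}. d dvd l}) * real d<=real N" by (simp only: of_nat_mult[symmetric] of_nat_le_iff)
  hence c: "real (card {l:{1..N}. d dvd l})<=real N / real d" by (simp only: pos_le_divide_eq[OF dp])
  have "(SUM l:{l:{1..N}. d dvd l}. real d powr (- 1 / 2))=real (card {l:{1..N}. d dvd l}) * real d powr (- 1 / 2)" by simp
  also have "... <= (real N / real d) * real d powr (- 1 / 2)" by (rule mult_right_mono[OF c]) simp
  also have "... = real N * (real d powr (- 1) * real d powr (- 1 / 2))" using dp by (simp add: powr_minus_divide)
  also have "real d powr (- 1) * real d powr (- 1 / 2)=real d powr (- 3 / 2)"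
  using powr_add[of "real d" "- 1" "- 1 / 2"] by simp
  finally show "(SUM l:{l:{1..N}. d dvd l}. real d powr (- 1 / 2))<=real N * real d powr (- 3 / 2)" .
 qed
 also have "... = real N * (\<Sum>d=1..N. real d powr (- 3 / 2))" by (simp add: sum_distrib_left)
 also have "... <= real N * Z" unfolding Z_def by (intro mult_left_mono sum_le_suminf sm) auto
 finally show ?thesis .
 qed
 have "real (\<Sum>l=1..N. card (sols J b M l))=(\<Sum>l=1..N. real (card (sols J b M l)))" by simp
 also have "... <= (\<Sum>l=1..N. K * real N^(card J - 1) * dsum l)"
 proof (rule sum_mono)
 fix l assume l: "l:{1..N}"
 have d0: "dsum l >= 0" unfolding dsum_def by (intro sum_nonneg) simp
 have "real (card (sols J b M l))<=K * real l^(card J - 1) * dsum l" using K(2) l by simp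
 also have "... <= K * real N^(card J - 1) * dsum l" using l K(1) d0 by (intro mult_right_mono mult_left_mono power_mono) auto
 finally show "real (card (sols J b M l))<=K * real N^(card J - 1) * dsum l" .
 qed
 also have "... = K * real N^(card J - 1) * (\<Sum>l=1..N. dsum l)" by (simp add: sum_distrib_left)
 also have "... <= K * real N^(card J - 1) * (real N * (Z + 1))"
 proof (rule mult_left_mono)
 have "real N * Z<=real N * (Z + 1)" by (intro mult_left_mono) auto
 thus "(\<Sum>l=1..N. dsum l)<=real N * (Z + 1)" using ds by linarith
 qed (use K(1) in simp)
 also have "... = (K * (Z + 1)) * (real N * real N^(card J - 1))" by (simp only: mult.assoc mult.commute mult.left_commute)
 also have "real N * real N^(card J - 1)=real N^card J" using k by (metis power_Suc)
 finally show ?thesis .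
qed
moreover have "K * (Z + 1) > 0" using K(1) Z0 by simp
ultimately show ?thesis by blast
qed

section \<open>Counting integer points and conclusion\<close>

lemma common_denominator:
assumes "finite I" "!!i. i:I ==> f i:\<rat>"
shows "EX N::nat. N > 0 & (ALL i:I. real N * f i:\<int>)" using assms
proof (induction I rule: finite_induct)
case empty
show ?case by (intro exI[of _ 1]) simp
next
case (insert i I)
then obtain N :: nat where N: "N > 0" "!!j. j:I ==> real N * f j:\<int>" by auto
have "f i:\<rat>" using insert.prems by simp
then obtain p q where pq: "q > 0" "f i = of_int p / of_int q" by (rule Rats_cases')
define M where "M=N * nat q"
have Mq: "real M=real N * of_int q" using pq(1) by (simp add: M_def)
have "real M * f j:\<int>" if "j:insert i I" for j
proof (cases "j=i")
 case True
 have "real M * f i=real N * of_int p" using pq by (simp add: Mq)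
 also have "... : \<int>" by simp
 finally show ?thesis using True by simp
next
 case False
 have "real M * f j = of_int q * (real N * f j)" by (simp add: Mq)
 also have "... : \<int>" by (rule Ints_mult[OF Ints_of_int N(2)]) (use that False in simp)
 finally show ?thesis .
qed
moreover have "M > 0" using N(1) pq(1) by (simp add: M_def)
ultimately show ?case by blast
qed

lemma Rats_sum_closed: "(!!i. i:I ==> f i:\<rat>) ==> (SUM i:I. f i :: real):\<rat>"
by (induction I rule: infinite_finite_induct) auto

lemma Rats_prod_closed: "(!!i. i:I ==> f i:\<rat>) ==> (PROD i:I. f i :: real):\<rat>"
by (induction I rule: infinite_finite_induct) auto

lemma det_Rats:
fixes M :: "real^'n^'n"
assumes "!!i j. M$i$j:\<rat>" shows "det M:\<rat>"
unfolding det_def by (intro Rats_sum_closed Rats_mult Rats_prod_closed assms) simp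

lemma matrix_inv_Rats:
fixes M :: "real^'n^'n"
assumes M: "!!i j. M$i$j:\<rat>" and inv: "invertible M"
shows "matrix_inv M$i$j:\<rat>"
proof -
have d: "det M ~= 0" using inv by (simp add: invertible_det_nz)
have "EX A'. M ** A'=mat 1 & A' ** M=mat 1" using inv by (simp add: invertible_def)
from someI_ex[OF this] have inv': "M ** matrix_inv M=mat 1" by (simp add: matrix_inv_def)
define y where "y=matrix_inv M *v axis j 1"
have My: "M *v y=axis j 1" by (simp add: y_def matrix_vector_mul_assoc inv')
have ye: "y=(\<chi> k. det (\<chi> i l. if l=k then axis j 1$i else M$i$l) / det M)"
 using My cramer[OF d, of y "axis j 1"] by blast
have "y$i:\<rat>" by (subst ye) (auto intro!: Rats_divide det_Rats M simp: axis_def)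
moreover have "y$i=matrix_inv M$i$j"
 by (simp add: y_def matrix_vector_mult_def axis_def if_distrib[of "%t. _ * t"] cong: if_cong)
ultimately show ?thesis by simp
qed

section \<open>Integer points in a shell: anisotropic and rational isotropic case\<close>

context int_chart
begin

text \<open>Nonzero values of \<open>Q\<close> at integer vectors have absolute value at least 1 /
  D0, \<open>hmat\<close> is an isometry onto \<open>Qc\<close>, and \<open>Qc\<close> is small at
  short vectors. So all the lattices have no short vectors, uniformly in T and w.\<close>

lemma anisotropic_separation:
assumes aniso: "!!z. intvec z ==> z ~= 0 ==> Q z ~= 0"
shows "EX et>0. ALL T w z. T ~= 0 --> intvec z --> z ~= 0 --> et<=norm (hmat T w *v z)"
proof -
obtain D0 :: nat where D0: "D0 > 0" "!!z. intvec z ==> real D0 * Q z:\<int>" using den by blast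
obtain C where C: "C > 0" "!!x. abs (Qc x)<=C * (norm x)\<^sup>2" using Qc_bound by blast
define et where "et=sqrt (1 / (real D0 * C))"
have et: "et > 0" using D0(1) C(1) by (simp add: et_def)
have "et<=norm (hmat T w *v z)" if T: "T ~= 0" and z: "intvec z" "z ~= 0" for T w z
proof -
 have "1<=abs (real D0 * Q z)" using D0 z aniso[OF z] by (intro Ints_nonzero_abs_ge1) auto
 also have "abs (real D0 * Q z)=real D0 * abs (Qc (hmat T w *v z))" using T by (simp add: abs_mult Q_hmat)
 also have "... <= real D0 * (C * (norm (hmat T w *v z))\<^sup>2)" by (rule mult_left_mono[OF C(2)]) simp
 finally have "1 / (real D0 * C)<=(norm (hmat T w *v z))\<^sup>2" using D0(1) C(1) by (simp add: pos_divide_le_eq mult.commute mult.left_commute)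
 thus ?thesis unfolding et_def by (intro real_le_lsqrt) auto
qed
thus ?thesis using et by blast
qed

text \<open>Points x whose p(x) share a cell of side 1/T are mapped by one common
  \<open>hmat T w\<close> into a fixed box, where they are separated. Hence each cell contains
  boundedly many, and there are O(T^k) cells.\<close>

theorem count_anisotropic:
assumes aniso: "!!z. intvec z ==> z ~= 0 ==> Q z ~= 0" and W: "W > 0" and c: "c > 0"
shows "EX C. ALL T>=1. real (card {x:shell W T. c * T<=abs (la x)})<=C * T^card J"
proof -
obtain et where et: "et > 0" "!!T w z. T ~= 0 ==> intvec z ==> z ~= 0 ==> et<=norm (hmat T w *v z)"
 using anisotropic_separation[OF aniso] by blast
define n where "n=real CARD('n)"
have n: "n >= 1" by (simp add: n_def Suc_leI)
define r where "r=et / n"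
have r: "r > 0" using et(1) n by (simp add: r_def)
define B0 where "B0=(SUM j:J. abs (\<beta> j))"
have B0: "B0 >= 0" by (simp add: B0_def sum_nonneg)
define R where "R=1 + (abs m + B0) / c"
have R: "R >= 1" using B0 c by (simp add: R_def)
define Mx where "Mx=(2 * R / r + 2)^CARD('n)"
have Mx: "Mx >= 0" using R r by (simp add: Mx_def)
have "real (card {x:shell W T. c * T<=abs (la x)})<=(Mx * (2 * W + 2)^card J) * T^card J" if T: "T >= 1" for T
proof -
 define S where "S={x:shell W T. c * T<=abs (la x)}"
 have fS: "finite S" using finite_shell[of W T] W by (simp add: S_def)
 have Tp: "T > 0" "T ~= 0" using T by auto
 define g where "g=(%x. cell J T (pp x))"
 have fib: "card {x:S. g x=t}<=nat \<lfloor>Mx\<rfloor>" if t: "t:g ` S" for t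
 proof -
 obtain x0 where x0: "x0:S" "t=g x0" using t by blast
 define w where "w=pp x0"
 define f where "f=(%x. hmat T w *v x)"
 define F where "F={x:S. g x=t}"
 have comp: "abs (f x$i)<=R" if x: "x:F" for x i
 proof -
  have xs: "x:XZ" "1<=abs (la x)" "abs (la x)<=T" "c * T<=abs (la x)" using x by (auto simp: F_def S_def shell_def)
  have l: "la x ~= 0" using xs(2) by auto
  have near: "abs (pp x$j - w$j)<=1 / T" if "j:J" for j
  by (rule same_cell[OF Tp(1) _ that]) (use x x0(2) in \<open>simp add: F_def g_def w_def\<close>)
  have fa: "f x$a=la x / T" by (simp add: f_def hmat_mult flow_nth shear_nth la_def)
  have fa1: "abs (f x$a)<=1" using xs(3) Tp by (simp add: fa abs_divide)
  have fac: "c<=abs (f x$a)" using xs(4) Tp by (simp add: fa abs_divide pos_le_divide_eq)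
  have fj: "abs (f x$j)<=1" if j: "j:J" for j
  proof -
  have "f x$j=(Linv *v x)$j - la x * w$j" using j by (simp add: f_def hmat_mult flow_nth shear_nth la_def)
  also have "... = la x * (pp x$j - w$j)" using l by (simp add: pp_def algebra_simps)
  finally have "abs (f x$j)=abs (la x) * abs (pp x$j - w$j)" by (simp add: abs_mult)
  also have "... <= T * (1 / T)" by (rule mult_mono[OF xs(3) near[OF j]]) (use Tp in auto)
  finally show ?thesis using Tp by simp
  qed
  \<comment> \<open>The coordinate \<open>b\<close> is bounded through the equation of the quadric,
    which requires the lower bound \<open>c\<close> for coordinate \<open>a\<close>.\<close>
  have "Qc (f x)=m" using xs(1) by (simp add: f_def Q_hmat[OF Tp(2)] XZ_def)
  hence "f x$a * f x$b=m - qj (f x)" by (simp add: Qc_def)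
  hence "abs (f x$a) * abs (f x$b)=abs (m - qj (f x))" by (simp add: abs_mult[symmetric])
  also have "... <= abs m + B0"
  proof -
  have "abs (qj (f x))<=(SUM j:J. abs (\<beta> j) * 1\<^sup>2)" unfolding qj_def by (rule order_trans[OF sum_abs])
   (auto simp: abs_mult abs_square_le_1 intro!: sum_mono mult_left_le fj)
  thus ?thesis by (simp add: B0_def)
  qed
  finally have ab: "abs (f x$a) * abs (f x$b)<=abs m + B0" .
  have "c * abs (f x$b)<=abs (f x$a) * abs (f x$b)" using fac by (intro mult_right_mono) auto
  hence "abs (f x$b)<=(abs m + B0) / c" using ab c by (simp add: pos_le_divide_eq mult.commute)
  hence fb: "abs (f x$b)<=R" by (simp add: R_def)
  consider "i=a" | "i=b" | "i:J" by (auto simp: J_ab)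
  thus ?thesis using fa1 fb fj R by cases (auto intro: order_trans)
 qed
 have sep: "EX i:UNIV. r<=abs (f x$i - f x'$i)" if x: "x:F" "x':F" "x ~= x'" for x x'
 proof (rule ccontr)
  assume nn: "~ (EX i:UNIV. r<=abs (f x$i - f x'$i))"
  have iv: "intvec (x - x')" using x by (simp add: F_def S_def shell_def XZ_def intvec_ops)
  have "et<=norm (hmat T w *v (x - x'))" using et(2)[OF Tp(2) iv] x(3) by simp
  also have "... <= (SUM i:UNIV. abs ((hmat T w *v (x - x'))$i))" by (rule norm_le_l1_cart)
  also have "... = (SUM i:UNIV. abs (f x$i - f x'$i))" by (simp add: f_def matrix_vector_mult_diff_distrib)
  also have "... < (SUM i:(UNIV::'n set). r)" by (rule sum_strict_mono) (use nn in \<open>auto simp: not_le\<close>)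
  also have "... = et" using n by (simp add: r_def n_def)
  finally show False by simp
 qed
 have injf: "inj_on f F"
 proof (rule inj_onI, rule ccontr)
  fix x x' assume x: "x:F" "x':F" "f x=f x'" "x ~= x'"
  obtain i where "r<=abs (f x$i - f x'$i)" using sep[OF x(1,2,4)] by blast
  thus False using x(3) r by simp
 qed
 have "real (card (f ` F))<=(2 * R / r + 2)^card (UNIV :: 'n set)"
 proof (rule packing(2)[OF r])
  show "0<=R" using R by simp
  show "abs (p$i)<=R" if "p:f ` F" for p i using comp that by auto
  show "EX i:UNIV. r<=abs (p$i - p'$i)" if p: "p:f ` F" "p':f ` F" "p ~= p'" for p p'
  proof -
  obtain x x' where "x:F" "x':F" "p=f x" "p'=f x'" using p by blast
  thus ?thesis using sep[of x x'] p(3) by blast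
  qed
 qed
 hence "real (card F)<=Mx" unfolding Mx_def card_image[OF injf] .
 thus ?thesis unfolding F_def by linarith
 qed
 have "card S<=nat \<lfloor>Mx\<rfloor> * card (g ` S)" by (rule card_fibres_le[OF fS]) (use fS fib in auto)
 hence "real (card S)<=real (nat \<lfloor>Mx\<rfloor>) * real (card (g ` S))" by (simp only: of_nat_mult[symmetric] of_nat_le_iff)
 also have "... <= Mx * real (card (g ` S))" using Mx by (intro mult_right_mono) (auto simp: of_nat_floor)
 also have "... <= Mx * ((2 * W + 2)^card J * T^card J)"
 proof (rule mult_left_mono[OF _ Mx])
 obtain F' where F': "F'<=pp ` S" "inj_on (cell J T) F'" "cell J T ` (pp ` S)=cell J T ` F'"
  using subset_image_inj[of "cell J T ` (pp ` S)" "cell J T" "pp ` S"] by blast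
 have "g ` S=cell J T ` F'" using F'(3) by (simp add: g_def image_image)
 hence "card (g ` S)=card F'" using card_image[OF F'(2)] by simp
 also have "real (card F')<=(T * (2 * W) + 2)^card J"
 proof (rule cell_count(2)[OF Tp(1) _ F'(2)])
  show "- W<=p$j & p$j <= - W + 2 * W" if "p:F'" "j:J" for p j
  proof -
  obtain x where "x:S" "p=pp x" using F'(1) \<open>p:F'\<close> by blast
  hence "abs (p$j)<=W" using \<open>j:J\<close> by (simp add: S_def shell_def)
  thus ?thesis by (auto simp: abs_le_iff)
  qed
 qed (use W in simp)
 also have "... <= ((2 * W + 2) * T)^card J" by (rule power_mono) (use T W in \<open>auto simp: algebra_simps\<close>)
 finally show "real (card (g ` S))<=(2 * W + 2)^card J * T^card J" by (simp add: power_mult_distrib)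
 qed
 finally show ?thesis unfolding S_def by (simp add: mult.assoc)
qed
thus ?thesis by blast
qed

text \<open>With denominators cleared, D y_a y_b + sum_j b_j y_j^2 = M. So the y_j solve a
  congruence modulo l = |y_a|, and the bound on p(x) leaves boundedly many quotients y_j div l. The
  sign of y_a, the residues and the quotients determine y_a and all y_j, and the equation then
  determines y_b. Summing over l up to N T is \<open>sum_sols_bound\<close>.\<close>

theorem count_rational:
assumes LR: "!!i j. L$i$j:\<rat>" and \<beta>R: "!!j. \<beta> j:\<rat>" and c4: "4<=CARD('n)" and W: "W > 0"
shows "EX C. ALL T>=1. real (card (shell W T))<=C * T^card J"
proof -
have LiR: "Linv$i$j:\<rat>" for i j unfolding Linv_def by (rule matrix_inv_Rats[OF LR L])
obtain N :: nat where N: "N > 0" "!!i j. real N * Linv$i$j:\<int>"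
 using common_denominator[of "UNIV :: ('n \<times> 'n) set" "%(i, j). Linv$i$j"] LiR by auto
obtain D :: nat where D: "D > 0" "!!j. real D * \<beta> j:\<int>"
 using common_denominator[of "UNIV :: 'n set" \<beta>] \<beta>R by auto
define y where "y=(%x. real N *\<^sub>R (Linv *v x))"
have yi: "y x$i:\<int>" if x: "x:XZ" for x i
proof -
 have "y x$i=(SUM j:UNIV. (real N * Linv$i$j) * x$j)" by (simp add: y_def matrix_vector_mult_def sum_distrib_left mult.assoc)
 also have "... : \<int>" by (intro Ints_sum Ints_mult[OF N(2)]) (use x in \<open>auto simp: XZ_def intvec_def\<close>)
 finally show ?thesis .
qed
define ly where "ly=(%x i. \<lfloor>y x$i\<rfloor>)"
have ly: "of_int (ly x i)=y x$i" if "x:XZ" for x i using yi[OF that, of i] unfolding ly_def by (metis Ints_cases floor_of_int)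
define bi where "bi=(%j. \<lfloor>real D * \<beta> j\<rfloor>)"
have bi: "of_int (bi j)=real D * \<beta> j" for j using D(2)[of j] unfolding bi_def by (metis Ints_cases floor_of_int)
\<comment> \<open>The floor is exact: by \<open>eqi\<close> and the existence of a point of
  \<open>XZ\<close> the number is an integer.\<close>
define M :: int where "M=\<lfloor>real D * (real N)\<^sup>2 * m\<rfloor>"
have eqr: "real D * (y x$a * y x$b) + (SUM j:J. real D * \<beta> j * (y x$j)\<^sup>2)=real D * (real N)\<^sup>2 * m" if x: "x:XZ" for x
proof -
 have "Qc (Linv *v x)=m" using x by (simp add: XZ_def Q_Qc)
 hence "real D * (real N)\<^sup>2 * m=real D * (real N)\<^sup>2 * ((Linv *v x)$a * (Linv *v x)$b + (SUM j:J. \<beta> j * ((Linv *v x)$j)\<^sup>2))"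
 by (simp add: Qc_def qj_def)
 also have "... = real D * (y x$a * y x$b) + (SUM j:J. real D * \<beta> j * (y x$j)\<^sup>2)"
 unfolding y_def by (simp add: distrib_left sum_distrib_left power_mult_distrib) (simp add: power2_eq_square mult.assoc mult.commute mult.left_commute)
 finally show ?thesis by simp
qed
have eqi: "int D * (ly x a * ly x b) + (SUM j:J. bi j * (ly x j)\<^sup>2)=M" if x: "x:XZ" for x
proof -
 have "of_int (int D * (ly x a * ly x b) + (SUM j:J. bi j * (ly x j)\<^sup>2))=real D * (real N)\<^sup>2 * m"
 using eqr[OF x] by (simp add: ly[OF x] bi)
 thus ?thesis unfolding M_def by (metis floor_of_int)
qed
obtain x0 where "x0:XZ" using XZne by (auto simp: XZ_def)
have "M ~= 0"
proof -
 have "of_int M=real D * (real N)\<^sup>2 * m"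
 using eqr[OF \<open>x0:XZ\<close>] eqi[OF \<open>x0:XZ\<close>, symmetric] by (simp add: ly[OF \<open>x0:XZ\<close>] bi)
 also have "... ~= 0" using D(1) N(1) m0 by simp
 finally show ?thesis by auto
qed
moreover have "bi j ~= 0" if "j:J" for j
proof -
 have "of_int (bi j) ~= (0::real)" unfolding bi using D(1) \<beta> that by (auto simp: J_ab)
 thus ?thesis by auto
qed
moreover have "finite J" "2<=card J" using c4 by (auto simp: card_J)
ultimately obtain C where C: "C > 0" "!!K. real (\<Sum>l=1..K. card (sols J bi M l))<=C * real K^card J"
 using sum_sols_bound[of J bi M] by blast
define wi where "wi=\<lceil>W\<rceil>"
\<comment> \<open>Two signs of y_a, and quotients between -wi and wi for each j.\<close>
define V where "V=2 * nat (2 * wi + 1)^card J"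
have "real (card (shell W T))<=(real V * C * real N^card J) * T^card J" if T: "T >= 1" for T
proof -
 have fS: "finite (shell W T)" using finite_shell[of W T] W by simp
 have XS: "x:XZ" "1<=abs (la x)" "abs (la x)<=T" "!!j. j:J ==> abs (pp x$j)<=W" if "x:shell W T" for x
 using that by (auto simp: shell_def)
 have ya: "y x$a=real N * la x" for x by (simp add: y_def la_def)
 have yj: "y x$j=pp x$j * y x$a" if "la x ~= 0" for x j using that by (simp add: y_def pp_def la_def)
 define Nb where "Nb=nat \<lfloor>real N * T\<rfloor>"
 have lrange: "nat \<bar>ly x a\<bar> : {1..Nb}" if x: "x:shell W T" for x
 proof -
 have e: "of_int \<bar>ly x a\<bar> = real N * abs (la x)" using ly[OF XS(1)[OF x], of a] by (simp add: ya abs_mult)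
 have "1 * 1<=real N * abs (la x)" using N(1) XS(2)[OF x] by (intro mult_mono) auto
 hence "1<=abs (ly x a)" using e by linarith
 moreover have "real_of_int \<bar>ly x a\<bar> <= real N * T" unfolding e using XS(3)[OF x] by (intro mult_left_mono) auto
 hence "abs (ly x a)<=\<lfloor>real N * T\<rfloor>" by linarith
 ultimately show ?thesis by (auto simp: Nb_def)
 qed
 define Sl where "Sl=(%l. {x:shell W T. nat \<bar>ly x a\<bar> = l})"
 have cSl: "card (Sl l)<=V * card (sols J bi M l)" if l: "l:{1..Nb}" for l
 proof (rule card_fibres_le[of _ "%x. restrict (%j. ly x j mod int l) J"])
 have l0: "l > 0" using l by simp
 show "finite (Sl l)" using fS by (simp add: Sl_def)
 show "finite (sols J bi M l)" by (simp add: finite_sols)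
 show "(%x. restrict (%j. ly x j mod int l) J) ` Sl l<=sols J bi M l"
 proof
  fix t assume "t:(%x. restrict (%j. ly x j mod int l) J) ` Sl l"
  then obtain x where x: "x:Sl l" "t=restrict (%j. ly x j mod int l) J" by blast
  have xs: "x:XZ" using x(1) XS(1) by (simp add: Sl_def)
  have la: "int l=abs (ly x a)" using x(1) by (auto simp: Sl_def)
  have "(SUM j:J. bi j * (ly x j)\<^sup>2) - M=ly x a * (- (int D * ly x b))" using eqi[OF xs] by (simp add: algebra_simps)
  hence "int l dvd (SUM j:J. bi j * (ly x j)\<^sup>2) - M" unfolding la by simp
  moreover have "int l dvd (SUM j:J. bi j * (t j)\<^sup>2) - (SUM j:J. bi j * (ly x j)\<^sup>2)"
  proof (rule quad_mod)
  fix j assume "j:J"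
  hence "t j - ly x j = - (int l * (ly x j div int l))" using mult_div_mod_eq[of "int l" "ly x j"] by (simp add: x(2) algebra_simps)
  thus "int l dvd t j - ly x j" by simp
  qed simp
  ultimately have "int l dvd ((SUM j:J. bi j * (t j)\<^sup>2) - (SUM j:J. bi j * (ly x j)\<^sup>2)) + ((SUM j:J. bi j * (ly x j)\<^sup>2) - M)"
  by (intro dvd_add)
  hence "int l dvd (SUM j:J. bi j * (t j)\<^sup>2) - M" by simp
  moreover have "t:PiE J (%_. {0..<int l})" using l0 by (simp add: x(2))
  ultimately show "t:sols J bi M l" by (simp add: sols_def)
 qed
 fix t
 define F where "F={x:Sl l. restrict (%j. ly x j mod int l) J=t}"
 let ?h = "%x. (ly x a, restrict (%j. ly x j div int l) J)"
 let ?T = "{int l, - int l} \<times> PiE J (%_. {- wi..wi})"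
 have "card F<=card ?T"
 proof (rule card_inj_on_le[of ?h])
  show "inj_on ?h F"
  proof (rule inj_onI)
  fix x x' assume x: "x:F" and x': "x':F" and e: "?h x = ?h x'"
  have xs: "x:XZ" "x':XZ" "x:shell W T" using x x' XS(1) by (auto simp: F_def Sl_def)
  have ea: "ly x a=ly x' a" using e by simp
  have ej: "ly x j=ly x' j" if j: "j:J" for j
  proof -
   have "restrict (%j. ly x j div int l) J j=restrict (%j. ly x' j div int l) J j" using e by simp
   moreover have "restrict (%j. ly x j mod int l) J j=restrict (%j. ly x' j mod int l) J j" using x x' by (simp add: F_def)
   ultimately have "ly x j div int l=ly x' j div int l" "ly x j mod int l=ly x' j mod int l" using j by simp_all
   thus ?thesis by (metis mult_div_mod_eq)
  qed
  have "(SUM j:J. bi j * (ly x j)\<^sup>2)=(SUM j:J. bi j * (ly x' j)\<^sup>2)" by (rule sum.cong) (auto simp: ej)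
  hence "int D * (ly x a * ly x b)=int D * (ly x' a * ly x' b)" using eqi[OF xs(1)] eqi[OF xs(2)] by linarith
  moreover have "ly x a ~= 0" using lrange[OF xs(3)] by auto
  ultimately have eb: "ly x b=ly x' b" using D(1) ea by simp
  have "y x=y x'"
  proof (rule vec_eqI)
   show "y x$a=y x'$a" using ea ly[OF xs(1), of a] ly[OF xs(2), of a] by simp
   show "y x$b=y x'$b" using eb ly[OF xs(1), of b] ly[OF xs(2), of b] by simp
   show "y x$j=y x'$j" if "j:J" for j using ej[OF that] ly[OF xs(1), of j] ly[OF xs(2), of j] by simp
  qed
  hence "Linv *v x=Linv *v x'" using N(1) by (simp add: y_def)
  thus "x=x'" by (metis Linv_L(2))
  qed
  show "?h ` F <= ?T"
  proof
  fix q assume "q : ?h ` F"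
  then obtain x where x: "x:F" "q = ?h x" by blast
  have xs: "x:shell W T" "x:XZ" "nat \<bar>ly x a\<bar> = l" using x(1) XS(1) by (auto simp: F_def Sl_def)
  have la0: "la x ~= 0" using XS(2)[OF xs(1)] by auto
  have lal: "int l=abs (ly x a)" using xs(3) by auto
  have "ly x a:{int l, - int l}" using lal by auto
  moreover have "ly x j div int l:{- wi..wi}" if j: "j:J" for j
  proof -
   have "real_of_int \<bar>ly x j\<bar> = abs (pp x$j) * abs (y x$a)" using ly[OF xs(2), of j] yj[OF la0, of j] by (simp add: abs_mult)
   also have "... = abs (pp x$j) * real l" using lal ly[OF xs(2), of a] by (metis of_int_abs of_int_of_nat_eq)
   also have "... <= of_int wi * real l"
   using XS(4)[OF xs(1) j] by (intro mult_right_mono) (auto simp: wi_def intro: order_trans[OF _ le_of_int_ceiling])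
   finally have "real_of_int \<bar>ly x j\<bar> <= real_of_int (wi * int l)" by simp
   hence b: "abs (ly x j)<=wi * int l" by (simp only: of_int_le_iff)
   have "ly x j div int l<=(wi * int l) div int l" using b l0 by (intro zdiv_mono1) auto
   moreover have "(- wi * int l) div int l<=ly x j div int l" using b l0 by (intro zdiv_mono1) auto
   moreover have "(wi * int l) div int l=wi" by (rule nonzero_mult_div_cancel_right) (use l0 in simp)
   moreover have "(- wi * int l) div int l = - wi" by (rule nonzero_mult_div_cancel_right) (use l0 in simp)
   ultimately show ?thesis by simp
  qed
  ultimately show "q : ?T" unfolding x(2) by simp
  qed
  show "finite ?T" by (intro finite_cartesian_product finite_PiE) auto
 qed
 also have "card ?T=card {int l, - int l} * card (PiE J (%_. {- wi..wi}))" by (rule card_cartesian_product)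
 also have "... <= 2 * nat (2 * wi + 1)^card J"
 proof (rule mult_le_mono)
  show "card {int l, - int l}<=2" by (simp add: card_insert_if)
  show "card (PiE J (%_. {- wi..wi}))<=nat (2 * wi + 1)^card J" by (simp add: card_PiE add.commute)
 qed
 finally show "card {x:Sl l. restrict (%j. ly x j mod int l) J=t}<=V" by (simp add: F_def V_def)
 qed
 have "shell W T=(UN l:{1..Nb}. Sl l)" using lrange by (auto simp: Sl_def)
 hence "card (shell W T)<=(\<Sum>l=1..Nb. card (Sl l))" using card_UN_le[of "{1..Nb}" Sl] by simp
 also have "... <= (\<Sum>l=1..Nb. V * card (sols J bi M l))" by (intro sum_mono cSl)
 also have "... = V * (\<Sum>l=1..Nb. card (sols J bi M l))" by (simp add: sum_distrib_left)
 finally have "real (card (shell W T))<=real V * real (\<Sum>l=1..Nb. card (sols J bi M l))" by (simp only: of_nat_mult[symmetric] of_nat_le_iff)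
 also have "... <= real V * (C * real Nb^card J)" by (intro mult_left_mono C(2)) simp
 also have "... <= real V * (C * (real N * T)^card J)"
 proof (intro mult_left_mono power_mono)
 show "real Nb<=real N * T" using T by (simp add: Nb_def of_nat_floor)
 qed (use C(1) in auto)
 finally show ?thesis by (simp add: power_mult_distrib mult.assoc)
qed
thus ?thesis by blast
qed

section \<open>Integral test and assembly of the charts\<close>

lemma quadric_minus: "x:quadric Q m ==> - x:quadric Q m" by (simp add: quadric_def Q_minus)

lemma AE_approximable:
assumes \<mu>: "semi_invariant_probability Q \<mu>" and pos: "ALL t>0. \<psi> t > 0" and qc: "quasi_conformal \<psi>"
 and ns: "~ summable (%i. (2^i * \<psi> (2^i))^card J)"
shows "AE v in \<mu>. (matrix_inv L *v v)$a ~= 0 --> approximable (quadric Q m) \<psi> v"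
proof -
have "AE v in \<mu>. la v ~= 0 --> v:{v. approximable (quadric Q m) \<psi> v}"
 by (rule chart_transfer[OF \<mu> borel_approximable])
 (use approximable_minus[OF quadric_minus] chart_divergence[OF pos qc ns] in auto)
thus ?thesis by (simp add: la_def Linv_def)
qed

lemma AE_not_approximable:
assumes \<mu>: "semi_invariant_probability Q \<mu>" and pos: "ALL t>0. \<psi> t > 0" and qc: "quasi_conformal \<psi>"
 and s: "summable (%i. (2^i * \<psi> (2^i))^card J)"
 and count: "!!W c. W > 0 ==> c > 0 ==> EX C. ALL T>=1. real (card {x:shell W T. c * T<=abs (la x)})<=C * T^card J"
shows "AE v in \<mu>. (matrix_inv L *v v)$a ~= 0 --> ~ approximable (quadric Q m) \<psi> v"
proof -
have "AE v in \<mu>. la v ~= 0 --> v : - {v. approximable (quadric Q m) \<psi> v}"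
proof (rule chart_transfer[OF \<mu>])
 show "- {v. approximable (quadric Q m) \<psi> v}:sets borel"
 using borel_approximable[of "quadric Q m" \<psi>] by (simp only: borel_comp)
 show "- v : - {v. approximable (quadric Q m) \<psi> v}" if "v : - {v. approximable (quadric Q m) \<psi> v}" for v
 using that approximable_minus[OF quadric_minus, of \<psi> "- v"] by auto
 show "AE y in lborel. sgn (L *v ev y) : - {v. approximable (quadric Q m) \<psi> v}"
 using chart_convergence[OF pos qc s count] by simp
qed
thus ?thesis by (simp add: la_def Linv_def)
qed

end

text \<open>On a dyadic block quasi-conformality makes the integrand comparable with its value at
  the left end, hence with the step function \<open>s\<close>, which is measurable by construction
  and integrates to the series.\<close>

lemma integral_dyadic:
fixes \<psi> :: "real => real"
assumes pos: "ALL t>0. \<psi> t > 0" and qc: "quasi_conformal \<psi>" and k: "k >= 1"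
shows "(\<integral>\<^sup>+t\<in>{1..}. ennreal (t^(k - 1) * \<psi> t^k) \<partial>lebesgue) < \<infinity> \<longleftrightarrow> summable (%i. (2^i * \<psi> (2^i))^k)"
proof -
obtain A where A: "A > 0" "!!s t. 0 < t ==> t / 2<=s ==> s<=2 * t ==> \<psi> s<=A * \<psi> t"
 using quasi_conformal_iterate[OF qc pos, of 2] by auto
define B where "B=(%i::nat. {2^i..<2^Suc i :: real})"
define c where "c=(%i::nat. (2^i)^(k - 1) * \<psi> (2^i)^k)"
define s where "s=(%t. \<Sum>i. ennreal (c i) * indicator (B i) t)"
have c0: "c i >= 0" for i using pos by (simp add: c_def less_imp_le)
have disj: "disjoint_family B" unfolding disjoint_family_on_def
proof (intro ballI impI)
 fix i j :: nat assume "i ~= j"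
 have d: "B i Int B j={}" if "i < j" for i j
 proof -
 have "(2::real)^Suc i<=2^j" using that by (intro power_increasing) auto
 thus ?thesis by (auto simp: B_def)
 qed
 show "B i Int B j={}" using d[of i j] d[of j i] \<open>i ~= j\<close> by (metis Int_commute linorder_neqE_nat)
qed
have sB: "s t=ennreal (c i)" if "t:B i" for t i unfolding s_def by (rule suminf_cmult_indicator[OF disj that])
have s0: "s t=0" if "t < 1" for t
proof -
 have "t ~: B i" for i
 proof -
 have "(1::real)<=2^i" by (rule one_le_power) simp
 thus ?thesis using that unfolding B_def by (metis atLeastLessThan_iff leD le_less_trans)
 qed
 thus ?thesis by (simp add: s_def)
qed
have Bm [measurable]: "B i:sets lebesgue" for i by (rule sets_completionI_sets) (simp add: B_def)
have sm: "s:borel_measurable lebesgue" unfolding s_def by measurable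
have ints: "(\<integral>\<^sup>+t. s t \<partial>lebesgue)=(\<Sum>i. ennreal ((2^i * \<psi> (2^i))^k))"
proof -
 have "(\<integral>\<^sup>+t. s t \<partial>lebesgue)=(\<Sum>i. \<integral>\<^sup>+t. ennreal (c i) * indicator (B i) t \<partial>lebesgue)"
 unfolding s_def by (rule nn_integral_suminf) measurable
 also have "... = (\<Sum>i. ennreal ((2^i * \<psi> (2^i))^k))"
 proof (rule suminf_cong)
 fix i
 have "(\<integral>\<^sup>+t. ennreal (c i) * indicator (B i) t \<partial>lebesgue)=ennreal (c i) * emeasure lebesgue (B i)"
  by (rule nn_integral_cmult_indicator) (rule Bm)
 also have "emeasure lebesgue (B i)=ennreal (2^i)" by (simp add: B_def)
 also have "ennreal (c i) * ennreal (2^i)=ennreal (c i * 2^i)" using c0 by (simp add: ennreal_mult)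
 also have "c i * 2^i=(2^i * \<psi> (2^i))^k"
 proof -
  have "(2^i)^(k - 1) * 2^i=((2::real)^i)^k" using k by (metis Suc_diff_1 power_Suc2 less_le_trans zero_less_one)
  thus ?thesis by (simp add: c_def power_mult_distrib mult.commute mult.left_commute)
 qed
 finally show "(\<integral>\<^sup>+t. ennreal (c i) * indicator (B i) t \<partial>lebesgue)=ennreal ((2^i * \<psi> (2^i))^k)" .
 qed
 finally show ?thesis .
qed
define f where "f=(%t. ennreal (t^(k - 1) * \<psi> t^k) * indicator {1..} t)"
have block: "t^(k - 1) * \<psi> t^k<=(2^(k - 1) * A^k) * c i & c i<=A^k * (t^(k - 1) * \<psi> t^k)" if t: "t:B i" for t i
proof -
 define T :: real where "T=2^i"
 have T: "T > 0" "T<=t" "t<=2 * T" using t by (auto simp: B_def T_def)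
 have p: "\<psi> t > 0" "\<psi> T > 0" using pos T by auto
 have "\<psi> t<=A * \<psi> T" by (rule A(2)) (use T in auto)
 hence u: "\<psi> t^k<=A^k * \<psi> T^k" unfolding power_mult_distrib[symmetric] using p by (intro power_mono) auto
 have "\<psi> T<=A * \<psi> t" by (rule A(2)) (use T in auto)
 hence l: "\<psi> T^k<=A^k * \<psi> t^k" unfolding power_mult_distrib[symmetric] using p by (intro power_mono) auto
 have "t^(k - 1)<=2^(k - 1) * T^(k - 1)" unfolding power_mult_distrib[symmetric] using T by (intro power_mono) auto
 hence "t^(k - 1) * \<psi> t^k<=(2^(k - 1) * T^(k - 1)) * (A^k * \<psi> T^k)" using u p T A(1) by (intro mult_mono) auto
 moreover have "T^(k - 1) * \<psi> T^k<=t^(k - 1) * (A^k * \<psi> t^k)" using l p T by (intro mult_mono power_mono) auto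
 ultimately show ?thesis unfolding c_def T_def[symmetric] by (simp add: mult.assoc mult.commute mult.left_commute)
qed
have cover: "EX i. t:B i" if "t >= 1" for t using dyadic_scale[OF that] by (auto simp: B_def)
have up: "f t<=ennreal (2^(k - 1) * A^k) * s t" for t
proof (cases "t >= 1")
 case True
 then obtain i where i: "t:B i" using cover by blast
 have "f t=ennreal (t^(k - 1) * \<psi> t^k)" using True by (simp add: f_def)
 also have "... <= ennreal ((2^(k - 1) * A^k) * c i)" using block[OF i] by (intro ennreal_leI) simp
 also have "... = ennreal (2^(k - 1) * A^k) * s t" unfolding sB[OF i] using A(1) c0 by (intro ennreal_mult) auto
 finally show ?thesis .
qed (simp add: f_def)
have low: "s t<=ennreal (A^k) * f t" for t
proof (cases "t >= 1")
 case True
 then obtain i where i: "t:B i" using cover by blast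
 have "s t<=ennreal (A^k * (t^(k - 1) * \<psi> t^k))" unfolding sB[OF i] using block[OF i] by (intro ennreal_leI) simp
 also have "... = ennreal (A^k) * f t" using True A(1) pos by (simp add: f_def ennreal_mult[symmetric] less_imp_le)
 finally show ?thesis .
next
 case False
 thus ?thesis using s0 by simp
qed
have nonneg: "0<=(2^i * \<psi> (2^i))^k" for i using pos by (simp add: less_imp_le)
show ?thesis
proof
 assume fin: "(\<integral>\<^sup>+t\<in>{1..}. ennreal (t^(k - 1) * \<psi> t^k) \<partial>lebesgue) < \<infinity>"
 have c': "ennreal (1 / A^k) * ennreal (A^k)=1" using A(1) by (simp add: ennreal_mult[symmetric])
 have le: "ennreal (1 / A^k) * s t<=f t" for t
 proof -
 have "ennreal (1 / A^k) * s t<=ennreal (1 / A^k) * (ennreal (A^k) * f t)" by (rule mult_left_mono[OF low]) simp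
 also have "... = f t" by (simp only: mult.assoc[symmetric] c' mult_1)
 finally show ?thesis .
 qed
 have "ennreal (1 / A^k) * (\<integral>\<^sup>+t. s t \<partial>lebesgue)=(\<integral>\<^sup>+t. ennreal (1 / A^k) * s t \<partial>lebesgue)"
 by (rule nn_integral_cmult[OF sm, symmetric])
 also have "... <= (\<integral>\<^sup>+t. f t \<partial>lebesgue)" by (intro nn_integral_mono le)
 also have "... < \<infinity>" using fin unfolding f_def .
 finally have lt: "ennreal (1 / A^k) * (\<integral>\<^sup>+t. s t \<partial>lebesgue) < \<infinity>" .
 have "ennreal (1 / A^k) ~= 0" using A(1) by (simp add: ennreal_eq_0_iff not_le)
 hence "(\<integral>\<^sup>+t. s t \<partial>lebesgue) ~= \<infinity>" using lt by (auto simp: ennreal_mult_top)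
 hence "(\<Sum>i. ennreal ((2^i * \<psi> (2^i))^k)) ~= top" unfolding ints by simp
 thus "summable (%i. (2^i * \<psi> (2^i))^k)" by (intro summable_suminf_not_top nonneg)
next
 assume sum: "summable (%i. (2^i * \<psi> (2^i))^k)"
 have "(\<integral>\<^sup>+t. f t \<partial>lebesgue)<=(\<integral>\<^sup>+t. ennreal (2^(k - 1) * A^k) * s t \<partial>lebesgue)" by (intro nn_integral_mono up)
 also have "... = ennreal (2^(k - 1) * A^k) * (\<Sum>i. ennreal ((2^i * \<psi> (2^i))^k))"
 unfolding ints[symmetric] by (rule nn_integral_cmult[OF sm])
 also have "... < \<infinity>" using ennreal_suminf_neq_top[OF sum nonneg] by (simp add: ennreal_mult_less_top less_top)
 finally show "(\<integral>\<^sup>+t\<in>{1..}. ennreal (t^(k - 1) * \<psi> t^k) \<partial>lebesgue) < \<infinity>" unfolding f_def .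
qed
qed

lemma rational_form_denominator:
assumes "rational_quadratic_form Q"
shows "EX D0::nat. D0 > 0 & (ALL z. intvec z --> real D0 * Q z:\<int>)"
proof -
obtain A :: "real^'a^'a" where A: "!!i j. A$i$j:\<rat>" "!!x. Q x=(SUM i:UNIV. SUM j:UNIV. A$i$j * x$i * x$j)"
 using assms unfolding rational_quadratic_form_def by blast
obtain D :: nat where D: "D > 0" "!!i j. real D * A$i$j:\<int>"
 using common_denominator[of "UNIV :: ('a \<times> 'a) set" "%(i, j). A$i$j"] A(1) by auto
have "real D * Q z:\<int>" if z: "intvec z" for z
proof -
 have "real D * Q z=(SUM i:UNIV. SUM j:UNIV. (real D * A$i$j) * z$i * z$j)" by (simp add: A(2) sum_distrib_left mult.assoc)
 also have "... : \<int>" by (intro Ints_sum Ints_mult[OF Ints_mult[OF D(2)]]) (use z in \<open>auto simp: intvec_def\<close>)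
 finally show ?thesis .
qed
thus ?thesis using D(1) by blast
qed

theorem theorem1p2:
  fixes d :: nat
    and Q :: "real ^ 'n \<Rightarrow> real"
    and m :: real
    and \<psi> :: "real \<Rightarrow> real"
    and \<mu> :: "(real ^ 'n) measure"
  assumes "d \<ge> 3" and "CARD('n) = d + 1"
    and "rational_quadratic_form Q" and "nondegenerate_form Q" and "indefinite_form Q"
    and "m \<in> \<rat>" and "m \<noteq> 0"
    and "integer_points (quadric Q m) \<noteq> {}"
    and "\<forall>t>0. \<psi> t > 0"
    and "\<psi> \<in> borel_measurable (lebesgue_on {0<..})"
    and "quasi_conformal \<psi>"
    and "semi_invariant_probability Q \<mu>"
  shows "((\<integral>\<^sup>+t\<in>{1..}. ennreal (t ^ (d - 2) * \<psi> t ^ (d - 1)) \<partial>lebesgue) = \<infinity> \<longrightarrow>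
            (AE v in \<mu>. approximable (quadric Q m) \<psi> v)) \<and>
         ((\<integral>\<^sup>+t\<in>{1..}. ennreal (t ^ (d - 2) * \<psi> t ^ (d - 1)) \<partial>lebesgue) < \<infinity> \<longrightarrow>
            (AE v in \<mu>. \<not> approximable (quadric Q m) \<psi> v))"
proof -
have c4: "4<=CARD('n)" using assms(1,2) by simp
obtain a b :: 'n where ab: "a ~= b"
proof -
 have "1 < CARD('n)" using c4 by simp
 hence "~ is_singleton (UNIV :: 'n set)" by (metis is_singleton_altdef less_irrefl)
 thus thesis using that by (metis UNIV_I empty_not_UNIV is_singletonI')
qed
have XZne: "EX x. intvec x & Q x=m" using assms(8) by (auto simp: integer_points_intvec quadric_def)
have den: "EX D0::nat. D0 > 0 & (ALL z. intvec z --> real D0 * Q z:\<int>)" by (rule rational_form_denominator[OF assms(3)])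
obtain A :: "real^'n^'n" where A: "!!i j. A$i$j:\<rat>" "!!x. Q x=(SUM i:UNIV. SUM j:UNIV. A$i$j * x$i * x$j)"
 using assms(3) unfolding rational_quadratic_form_def by blast
define rat where "rat=(EX e0. e0 ~= 0 & Q e0=0 & (ALL i. e0$i:\<rat>))"
\<comment> \<open>If no rational isotropic vector exists, rational charts are impossible; a real
  isotropic vector then comes from indefiniteness.\<close>
define F where "F=(if rat then \<rat> else (UNIV :: real set))"
interpret form_over F A Q by unfold_locales (use A assms(4) in \<open>auto simp: F_def\<close>)
obtain e0 where e0: "e0 ~= 0" "Q e0=0" "FV e0"
proof (cases rat)
 case True
 then obtain x where x: "x ~= 0" "Q x=0" "ALL i. x$i:\<rat>" unfolding rat_def by blast
 have "F=\<rat>" using True by (simp add: F_def)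
 hence "FV x" unfolding FV_def using x(3) by simp
 thus thesis by (rule that[OF x(1,2)])
next
 case False
 obtain x where x: "x ~= 0" "Q x=0"
 using indefinite_isotropic[of Q bl, OF Q_add bl_linear(2) bl_linear(4) Q_scale assms(5)] by blast
 have "F=UNIV" using False by (simp add: F_def)
 hence "FV x" unfolding FV_def by simp
 thus thesis by (rule that[OF x])
qed
obtain \<C> where C1: "finite \<C>" and C2: "ALL (\<beta>, L):\<C>. (ALL j. \<beta> j:F) & (ALL i j. L$i$j:F) & invertible L & (ALL j. j ~= a --> j ~= b --> \<beta> j ~= 0) &
 (ALL x. Q (L *v x)=x$a * x$b + (SUM j:- {a, b}. \<beta> j * (x$j)\<^sup>2))"
 and C3: "ALL v. v ~= 0 --> (EX (\<beta>, L):\<C>. (matrix_inv L *v v)$a ~= 0)"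
 using chart_atlas[OF e0 ab] by (elim exE conjE) (rule that)
have \<C>: "(ALL j. \<beta> j:F) & (ALL i j. L$i$j:F) & invertible L & (ALL j. j ~= a --> j ~= b --> \<beta> j ~= 0) &
 (ALL x. Q (L *v x)=x$a * x$b + (SUM j:- {a, b}. \<beta> j * (x$j)\<^sup>2))" if "(\<beta>, L):\<C>" for \<beta> L
 by (rule bspec[OF C2 that, unfolded prod.case])
have ch: "int_chart a b \<beta> L Q m" if "(\<beta>, L):\<C>" for \<beta> L
 by unfold_locales (use \<C>[OF that] ab c4 den assms(7) XZne in auto)
have cJ: "card (chart.J a b)=d - 1" if "(\<beta>, L):\<C>" for \<beta> L
proof -
 interpret int_chart a b \<beta> L Q m by (rule ch[OF that])
 show ?thesis using assms(1,2) by (simp add: card_J)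
qed
\<comment> \<open>Each chart settles the boundary points with nonzero coordinate \<open>a\<close>;
  finitely many charts reach every nonzero vector.\<close>
have cover: "AE v in \<mu>. P v" if "!!\<beta> L. (\<beta>, L):\<C> ==> AE v in \<mu>. (matrix_inv L *v v)$a ~= 0 --> P v" for P
proof -
 have "AE v in \<mu>. ALL q:\<C>. (matrix_inv (snd q) *v v)$a ~= 0 --> P v" using that by (intro AE_finite_allI[OF C1]) auto
 with AE_space show ?thesis
 proof eventually_elim
 fix v assume v: "v:space \<mu>" and q: "ALL q:\<C>. (matrix_inv (snd q) *v v)$a ~= 0 --> P v"
 have "v ~= 0" using v assms(12) by (auto simp: semi_invariant_probability_def boundary_def)
 then obtain r where r: "r:\<C>" "case r of (\<beta>, L) => (matrix_inv L *v v)$a ~= 0" using C3 by blast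
 hence "(matrix_inv (snd r) *v v)$a ~= 0" by (simp add: case_prod_beta)
 thus "P v" using q r(1) by blast
 qed
qed
have d1: "d - 1 >= 1" "d - 1 - 1=d - 2" using assms(1) by auto
note equiv=integral_dyadic[OF assms(9,11) d1(1), unfolded d1(2)]
show ?thesis
proof (intro conjI impI)
 assume "(\<integral>\<^sup>+t\<in>{1..}. ennreal (t^(d - 2) * \<psi> t^(d - 1)) \<partial>lebesgue)=\<infinity>"
 hence ns: "~ summable (%i. (2^i * \<psi> (2^i))^(d - 1))" using equiv by simp
 show "AE v in \<mu>. approximable (quadric Q m) \<psi> v"
 proof (rule cover)
 fix \<beta> L assume c: "(\<beta>, L):\<C>"
 interpret int_chart a b \<beta> L Q m by (rule ch[OF c])
 show "AE v in \<mu>. (matrix_inv L *v v)$a ~= 0 --> approximable (quadric Q m) \<psi> v"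
  by (rule AE_approximable[OF assms(12,9,11)]) (use ns cJ[OF c] in simp)
 qed
next
 assume "(\<integral>\<^sup>+t\<in>{1..}. ennreal (t^(d - 2) * \<psi> t^(d - 1)) \<partial>lebesgue) < \<infinity>"
 hence s: "summable (%i. (2^i * \<psi> (2^i))^(d - 1))" using equiv by simp
 show "AE v in \<mu>. ~ approximable (quadric Q m) \<psi> v"
 proof (rule cover)
 fix \<beta> L assume c: "(\<beta>, L):\<C>"
 interpret int_chart a b \<beta> L Q m by (rule ch[OF c])
 have count: "EX C. ALL T>=1. real (card {x:shell W T. c * T<=abs (la x)})<=C * T^card J" if W: "W > 0" and c0: "c > 0" for W c
 proof (cases rat)
  case True
  hence "!!i j. L$i$j:\<rat>" "!!j. \<beta> j:\<rat>" using \<C>[OF c] by (auto simp: F_def)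
  from count_rational[OF this c4 W] obtain C where C: "!!T. T >= 1 ==> real (card (shell W T))<=C * T^card J" by blast
  have "real (card {x:shell W T. c * T<=abs (la x)})<=C * T^card J" if "T >= 1" for T
  proof -
  have "card {x:shell W T. c * T<=abs (la x)}<=card (shell W T)" using finite_shell[of W T] W by (intro card_mono) auto
  thus ?thesis using C[OF that] by linarith
  qed
  thus ?thesis by blast
 next
  case False
  \<comment> \<open>In the absence of a rational isotropic vector the charts are only real, but the
    packing count does not ask for rationality.\<close>
  have "Q z ~= 0" if "intvec z" "z ~= 0" for z
  proof
  assume "Q z=0"
  moreover have "ALL i. z$i:\<rat>" using that(1) Ints_subset_Rats by (auto simp: intvec_def)
  ultimately show False using False that(2) unfolding rat_def by blast
  qed
  from count_anisotropic[OF this W c0] show ?thesis .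
 qed
 show "AE v in \<mu>. (matrix_inv L *v v)$a ~= 0 --> ~ approximable (quadric Q m) \<psi> v"
  by (rule AE_not_approximable[OF assms(12,9,11) _ count]) (use s cJ[OF c] in auto)
 qed
qed
qed

end
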